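(* Let $\varpi\in\mathcal P(\mathcal B)$ with $\varpi(a)>0$ for all $a\in\mathcal B$, let $\omega\in\tilde{\mathcal P}_*(\mathcal B\times\mathcal B)$, and suppose that the sequence $(\varpi_n,\omega_n)\in\mathcal P_n(\mathcal B)\times\tilde{\mathcal P}_n(\mathcal B\times\mathcal B)$ converges to $(\varpi,\omega)$ as $n\to\infty$. Suppose that $X$ is a typed random geometric graph on $n$ nodes conditioned on the event $\{\mathcal H(\mathcal M_X)=(\varpi_n,\omega_n)\}$, i.e. $X$ has law $\mathbb P_{(\varpi_n,\omega_n)}$. Then, as $n\to\infty$, the empirical locality measure $\mathcal M_X$ satisfies a large deviation principle with speed $n$ in the space $\mathcal P(\mathcal B\times\mathcal Z^{\mathcal B})$ (with the weak topology) with good rate function $$\tilde J_{(\varpi,\omega)}(\ell)=\begin{cases}H(\ell\,\|\,Q_{poi}) & \text{if }(\omega,\ell)\text{ is consistent and }\ell_1=\varpi,\\ \infty & \text{otherwise,}\end{cases}$$ where $$Q_{poi}(a_1,\sigma)=\ell_1(a_1)\prod_{a_2\in\mathcal B}e^{-\frac{\omega(a_1,a_2)}{\ell_1(a_1)}}\,\frac{1}{\sigma(a_2)!}\Big(\frac{\omega(a_1,a_2)}{\ell_1(a_1)}\Big)^{\sigma(a_2)},\qquad a_1\in\mathcal B,\ \sigma\in\mathcal Z^{\mathcal B}.$$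
   Context: Spaces. $\mathcal B$ is a finite alphabet and $\mathcal Z=\{0,1,2,\dots\}$. For a finite or countable set $S$, $\mathcal P(S)$ is the set of probability vectors on $S$ and $\tilde{\mathcal P}(S)$ the set of finite measures on $S$, with the weak topology; $\tilde{\mathcal P}_*(\mathcal B\times\mathcal B)$ is the set of symmetric finite measures on $\mathcal B\times\mathcal B$. Put $\mathcal P_n(\mathcal B)=\{\varpi\in\mathcal P(\mathcal B): n\varpi(a)\in\mathcal Z\ \text{for all }a\in\mathcal B\}$ and $\tilde{\mathcal P}_n(\mathcal B\times\mathcal B)=\{\omega\in\tilde{\mathcal P}_*(\mathcal B\times\mathcal B): \frac{n}{1+\mathbf 1\{a_1=a_2\}}\omega(a_1,a_2)\in\mathcal Z\ \text{for all }a_1,a_2\in\mathcal B\}$. $H(\cdot\|\cdot)$ denotes relative entropy. Typed random geometric graph (TRGG). Fix a dimension $d$, a probability measure $\nu$ on $\mathcal B$ and symmetric functions $r_n:\mathcal B\times\mathcal B\to(0,1]$. Nodes $X_1,\dots,X_n$ are independent and uniform on $[0,1]^d$; each node $X_j$ is given independently a type $Z(X_j)$ with law $\nu$; nodes $X_i,X_j$ ($i\ne j$) are linked by an edge if $\|X_i-X_j\|\le r_n[Z(X_i),Z(X_j)]$. Let $E$ be the edge set. It is assumed throughout that $n\,r_n^d(a_1,a_2)\to\lambda(a_1,a_2)$ for all $a_1,a_2\in\mathcal B$, where $\lambda:\mathcal B^2\to[0,\infty)$ is symmetric and not identically zero. Empirical measures. Empirical type measure: $\mathcal L_X^1(a)=\frac1n\sum_{j=1}^n\delta_{Z(X_j)}(a)$.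 Empirical pair measure: $\mathcal L_X^2(a_1,a_2)=\frac1n\sum_{(i,j)\in E}[\delta_{(Z(X_i),Z(X_j))}+\delta_{(Z(X_j),Z(X_i))}](a_1,a_2)$, each (undirected) edge being counted once in the sum. Empirical locality measure: $\mathcal M_X(a_1,\sigma)=\frac1n\sum_{j=1}^n\delta_{(Z(X_j),\mathcal A(X_j))}(a_1,\sigma)$ for $(a_1,\sigma)\in\mathcal B\times\mathcal Z^{\mathcal B}$, where $\mathcal A(X_j)=(\sigma^j(a_2),\,a_2\in\mathcal B)$ and $\sigma^j(a_2)$ is the number of nodes of type $a_2$ linked to $X_j$. The map $\mathcal H$ and consistency. For $\ell\in\mathcal P(\mathcal B\times\mathcal Z^{\mathcal B})$, $\ell_1$ is its $\mathcal B$-marginal, and for $a_2\in\mathcal B$, $\ell_2(a_1,\sigma(a_2))$ denotes the law of the pair $(a_1,\sigma(a_2))$ under $\ell$. Set $\mathcal H_1(\ell)=\ell_1$, $\mathcal H_2(\ell)(a_2,a_1)=\sum_{\sigma(a_2)\in\mathcal Z}\ell_2(a_1,\sigma(a_2))\,\sigma(a_2)$, and $\mathcal H(\ell)=(\mathcal H_1(\ell),\mathcal H_2(\ell))$; then $\mathcal H(\mathcal M_X)=(\mathcal L_X^1,\mathcal L_X^2)$. The pair $(\omega,\ell)$ is consistent if $\mathcal H_2(\ell)(a_2,a_1)=\omega(a_2,a_1)$ for all $a_1,a_2\in\mathcal B$. Conditional law. $\mathbb P_{(\varpi_n,\omega_n)}=\mathbb P\{\,\cdot\mid\mathcal H(\mathcal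 M_X)=(\varpi_n,\omega_n)\}$. In the paper this conditional law is described as obtained as follows: choose $n$ nodes independently and uniformly on $[0,1]^d$; assign types by sampling without replacement from a collection of $n$ types containing each type $a\in\mathcal B$ exactly $n\varpi_n(a)$ times; for each unordered pair $\{a_1,a_2\}$ of types create exactly $m_n(a_1,a_2)$ edges by sampling uniformly without replacement from the pool of potential edges linking nodes of types $a_1$ and $a_2$, where $m_n(a_1,a_2)=n\omega_n(a_1,a_2)$ if $a_1\neq a_2$ and $m_n(a_1,a_1)=\frac n2\omega_n(a_1,a_1)$.
   Formalization: The conditional law is taken as the sampling construction (types and, per type pair, exactly m_n edges drawn without replacement from all node pairs), not the literal conditioning of the geometric graph, for which the claim fails; positions and radii do not affect the edges. *)

theory Defs
  imports "HOL-Probability.Probability"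
begin

section \<open>Large deviation principles\<close>

text \<open>The weak topology on the probability vectors on a discrete space: the coarsest topology
  for which integration against every bounded function is continuous (on a discrete space every
  function is continuous).\<close>

definition weak_topology :: "'s pmf topology" where
  "weak_topology = topology_generated_by
     {{p. measure_pmf.expectation p f \<in> U} | (f :: 's \<Rightarrow> real) U. bounded (range f) \<and> open U}"

definition borel_of_topology :: "'x topology \<Rightarrow> 'x measure" where
  "borel_of_topology T = sigma (topspace T) {G. openin T G}"

definition ln_ext :: "real \<Rightarrow> ereal" where
  "ln_ext x = (if x = 0 then -\<infinity> else ereal (ln x))"

definition good_rate_function :: "'x topology \<Rightarrow> ('x \<Rightarrow> ereal) \<Rightarrow> bool" where
  "good_rate_function T I \<longleftrightarrow>
     (\<forall>x\<in>topspace T. 0 \<le> I x) \<and>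
     (\<forall>c::real. closedin T {x \<in> topspace T. I x \<le> ereal c}) \<and>
     (\<forall>c::real. compactin T {x \<in> topspace T. I x \<le> ereal c})"

definition satisfies_LDP ::
  "'x topology \<Rightarrow> (nat \<Rightarrow> 'x measure) \<Rightarrow> (nat \<Rightarrow> real) \<Rightarrow> ('x \<Rightarrow> ereal) \<Rightarrow> bool" where
  "satisfies_LDP T \<mu> speed I \<longleftrightarrow>
     (\<forall>G. openin T G \<longrightarrow>
        - (INF x\<in>G. I x) \<le> liminf (\<lambda>n. ln_ext (measure (\<mu> n) G) / ereal (speed n))) \<and>
     (\<forall>F. closedin T F \<longrightarrow>
        limsup (\<lambda>n. ln_ext (measure (\<mu> n) F) / ereal (speed n)) \<le> - (INF x\<in>F. I x))"

text \<open>Relative entropy \<open>H(p \<parallel> q)\<close>. Note the argument order of \<^const>\<open>KL_divergence\<close>, which moreover is a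
  Bochner integral and hence \<open>0\<close> instead of \<open>\<infinity>\<close> when the log-density is not integrable. For
  probability measures the negative part of the log-density is always \<open>p\<close>-integrable, so that failure
  of integrability does mean that the integral is \<open>\<infinity>\<close>.\<close>

definition relative_entropy :: "'s measure \<Rightarrow> 's measure \<Rightarrow> ereal" where
  "relative_entropy p q =
     (if absolutely_continuous q p \<and> integrable p (entropy_density (exp 1) q p)
      then ereal (KL_divergence (exp 1) q p) else \<infinity>)"

section \<open>Types and consistency\<close>

text \<open>The alphabet is the finite type \<open>'b\<close>; a finite measure on \<open>\<B> \<times> \<B>\<close> is given by its weights
  \<open>\<omega> a b\<close>.\<close>

definition sym_measures :: "('b::finite \<Rightarrow> 'b \<Rightarrow> real) set" where
  "sym_measures = {\<omega>. (\<forall>a b. 0 \<le> \<omega> a b) \<and> (\<forall>a b. \<omega> a b = \<omega> b a)}"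

definition lattice_types :: "nat \<Rightarrow> ('b::finite) pmf set" where
  "lattice_types n = {\<rho>. \<forall>a. real n * pmf \<rho> a \<in> \<nat>}"

definition lattice_pairs :: "nat \<Rightarrow> ('b::finite \<Rightarrow> 'b \<Rightarrow> real) set" where
  "lattice_pairs n =
     {\<omega> \<in> sym_measures. \<forall>a b. real n / (1 + (if a = b then 1 else 0)) * \<omega> a b \<in> \<nat>}"

definition H1 :: "('b::finite \<times> ('b \<Rightarrow> nat)) pmf \<Rightarrow> 'b pmf" where
  "H1 l = map_pmf fst l"

text \<open>\<open>H2 l\<close> may be infinite for a general \<open>l\<close>, hence the values in \<^typ>\<open>ennreal\<close>.\<close>

definition H2 :: "('b::finite \<times> ('b \<Rightarrow> nat)) pmf \<Rightarrow> 'b \<Rightarrow> 'b \<Rightarrow> ennreal" where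
  "H2 l b a = (\<Sum>k. ennreal (pmf (map_pmf (\<lambda>(a', \<sigma>). (a', \<sigma> b)) l) (a, k)) * of_nat k)"

definition consistent :: "('b::finite \<Rightarrow> 'b \<Rightarrow> real) \<Rightarrow> ('b \<times> ('b \<Rightarrow> nat)) pmf \<Rightarrow> bool" where
  "consistent \<omega> l \<longleftrightarrow> (\<forall>a b. H2 l b a = ennreal (\<omega> b a))"

section \<open>The conditioned graph\<close>

text \<open>Nodes are \<open>0, \<dots>, n - 1\<close>. A configuration consists of the node positions, the node types and
  the set of edges, each edge being a two-element set of nodes.\<close>

type_synonym ('d, 'b) configuration = "(nat \<Rightarrow> real ^ 'd) \<times> (nat \<Rightarrow> 'b) \<times> nat set set"

definition position_law :: "nat \<Rightarrow> (nat \<Rightarrow> real ^ 'd::finite) measure" where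
  "position_law n = PiM {..<n} (\<lambda>_. uniform_measure lborel (cbox 0 1))"

text \<open>Drawing all \<open>n\<close> types without replacement from a collection containing \<open>a\<close> exactly
  \<open>n * pmf \<rho> a\<close> times yields a uniformly distributed arrangement of that collection.\<close>

definition arrangements :: "nat \<Rightarrow> ('b::finite) pmf \<Rightarrow> (nat \<Rightarrow> 'b) set" where
  "arrangements n \<rho> =
     {\<tau> \<in> {..<n} \<rightarrow>\<^sub>E UNIV. \<forall>a. real (card {j \<in> {..<n}. \<tau> j = a}) = real n * pmf \<rho> a}"

text \<open>An unordered pair \<open>{a, b}\<close> of types, possibly with \<open>a = b\<close>, is represented by that set.
  The pool of \<open>A = {a, b}\<close> consists of all pairs of distinct nodes whose types are \<open>a\<close> and \<open>b\<close>.\<close>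

definition type_pairs :: "('b::finite) set set" where
  "type_pairs = {{a, b} | a b. True}"

definition pool :: "nat \<Rightarrow> (nat \<Rightarrow> 'b::finite) \<Rightarrow> 'b set \<Rightarrow> nat set set" where
  "pool n \<tau> A = {e. e \<subseteq> {..<n} \<and> card e = 2 \<and> \<tau> ` e = A}"

definition edge_choices ::
  "nat \<Rightarrow> ('b::finite \<Rightarrow> 'b \<Rightarrow> real) \<Rightarrow> (nat \<Rightarrow> 'b) \<Rightarrow> 'b set \<Rightarrow> nat set set set" where
  "edge_choices n \<omega> \<tau> A =
     {F. F \<subseteq> pool n \<tau> A \<and>
         (\<forall>a b. A = {a, b} \<longrightarrow> real (card F) = (if a = b then real n / 2 else real n) * \<omega> a b)}"

definition edge_law ::
  "nat \<Rightarrow> ('b::finite \<Rightarrow> 'b \<Rightarrow> real) \<Rightarrow> (nat \<Rightarrow> 'b) \<Rightarrow> nat set set pmf" where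
  "edge_law n \<omega> \<tau> =
     map_pmf (\<lambda>F. \<Union>A\<in>type_pairs. F A)
       (Pi_pmf type_pairs {} (\<lambda>A. pmf_of_set (edge_choices n \<omega> \<tau> A)))"

definition typed_graph_law ::
  "nat \<Rightarrow> ('b::finite) pmf \<Rightarrow> ('b \<Rightarrow> 'b \<Rightarrow> real) \<Rightarrow> ((nat \<Rightarrow> 'b) \<times> nat set set) pmf" where
  "typed_graph_law n \<rho> \<omega> =
     do {\<tau> \<leftarrow> pmf_of_set (arrangements n \<rho>); E \<leftarrow> edge_law n \<omega> \<tau>; return_pmf (\<tau>, E)}"

text \<open>The law \<open>P_(\<rho>,\<omega>)\<close> of the graph conditioned on \<open>H(M_X) = (\<rho>, \<omega>)\<close>, in its constructive
  description: \<open>n\<close> independent uniform nodes in the unit cube, types drawn without replacement, and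
  for each unordered pair of types the prescribed number of edges drawn without replacement from the
  pool. The pool contains all pairs of nodes of the given types, so that neither the positions nor
  the connection radii influence the edges. It is meaningful once the pools are large enough for the prescribed numbers of edges (no
  claim is made for the finitely many other \<open>n\<close>, where \<^const>\<open>edge_choices\<close> may be empty). Under it
  \<open>H(M_X) = (\<rho>, \<omega>)\<close> holds surely, see \<open>H_locality_measure\<close> below.\<close>

definition conditional_law ::
  "nat \<Rightarrow> ('b::finite) pmf \<Rightarrow> ('b \<Rightarrow> 'b \<Rightarrow> real) \<Rightarrow> ('d::finite, 'b) configuration measure" where
  "conditional_law n \<rho> \<omega> = position_law n \<Otimes>\<^sub>M measure_pmf (typed_graph_law n \<rho> \<omega>)"

definition locality_measure ::
  "nat \<Rightarrow> ('d::finite, 'b::finite) configuration \<Rightarrow> ('b \<times> ('b \<Rightarrow> nat)) pmf" where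
  "locality_measure n = (\<lambda>(x, \<tau>, E).
     map_pmf (\<lambda>j. (\<tau> j, \<lambda>b. card {i \<in> {..<n}. \<tau> i = b \<and> {i, j} \<in> E})) (pmf_of_set {..<n}))"

definition conditional_locality_law ::
  "'d::finite itself \<Rightarrow> nat \<Rightarrow> ('b::finite) pmf \<Rightarrow> ('b \<Rightarrow> 'b \<Rightarrow> real) \<Rightarrow>
     ('b \<times> ('b \<Rightarrow> nat)) pmf measure" where
  "conditional_locality_law _ n \<rho> \<omega> =
     distr (conditional_law n \<rho> \<omega> :: ('d, 'b) configuration measure)
       (borel_of_topology weak_topology) (locality_measure n)"

section \<open>The rate function\<close>

definition Q_poi ::
  "('b::finite \<Rightarrow> 'b \<Rightarrow> real) \<Rightarrow> ('b \<times> ('b \<Rightarrow> nat)) pmf \<Rightarrow> ('b \<times> ('b \<Rightarrow> nat)) measure" where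
  "Q_poi \<omega> l = density (count_space UNIV) (\<lambda>(a, \<sigma>). ennreal
     (pmf (H1 l) a *
      (\<Prod>b\<in>UNIV. exp (- (\<omega> a b / pmf (H1 l) a)) * (1 / fact (\<sigma> b)) *
                  (\<omega> a b / pmf (H1 l) a) ^ \<sigma> b)))"

definition rate_J ::
  "('b::finite) pmf \<Rightarrow> ('b \<Rightarrow> 'b \<Rightarrow> real) \<Rightarrow> ('b \<times> ('b \<Rightarrow> nat)) pmf \<Rightarrow> ereal" where
  "rate_J \<rho> \<omega> l =
     (if consistent \<omega> l \<and> H1 l = \<rho> then relative_entropy (measure_pmf l) (Q_poi \<omega> l) else \<infinity>)"

section \<open>Sanity checks\<close>

lemma topspace_weak_topology: "topspace (weak_topology :: 's pmf topology) = UNIV"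
proof -
  have "openin (weak_topology :: 's pmf topology) UNIV"
    unfolding weak_topology_def
    by (rule openin_topology_generated_by_iff[THEN iffD2], rule generate_topology_on.Basis,
        rule CollectI, rule exI[of _ "\<lambda>_. 0"], rule exI[of _ UNIV]) auto
  then show ?thesis
    using openin_subset by blast
qed

lemma measurable_locality_measure:
  "locality_measure n \<in> measurable (conditional_law n \<rho> \<omega>) (borel_of_topology weak_topology)"
proof -
  have eq: "(locality_measure n :: ('d::finite, 'b::finite) configuration \<Rightarrow> _) = (\<lambda>g.
     map_pmf (\<lambda>j. (fst g j, \<lambda>b. card {i \<in> {..<n}. fst g i = b \<and> {i, j} \<in> snd g}))
       (pmf_of_set {..<n})) \<circ> snd"
    by (auto simp: locality_measure_def fun_eq_iff)
  have sp: "space (borel_of_topology weak_topology :: ('b \<times> ('b \<Rightarrow> nat)) pmf measure) = UNIV"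
    using openin_subset[of "weak_topology :: ('b \<times> ('b \<Rightarrow> nat)) pmf topology"]
    by (auto simp: borel_of_topology_def topspace_weak_topology)
  show ?thesis
    unfolding eq conditional_law_def
    by (rule measurable_comp[OF measurable_snd]) (auto simp: measurable_def sp)
qed

lemma prob_space_position_law: "prob_space (position_law n :: (nat \<Rightarrow> real ^ 'd::finite) measure)"
proof -
  have "emeasure lborel (cbox (0::real ^ 'd) 1) = 1"
    by (subst emeasure_lborel_cbox) (auto simp: Basis_vec_def inner_axis intro!: prod.neutral)
  then have "prob_space (uniform_measure lborel (cbox (0::real ^ 'd) 1))"
    by (intro prob_space_uniform_measure) auto
  then show ?thesis
    unfolding position_law_def by (intro prob_space_PiM)
qed

lemma prob_space_conditional_locality_law:
  fixes \<rho> :: "'b::finite pmf"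
  shows "prob_space (conditional_locality_law TYPE('d::finite) n \<rho> \<omega>)"
proof -
  interpret A: prob_space "position_law n :: (nat \<Rightarrow> real ^ 'd) measure"
    by (rule prob_space_position_law)
  interpret P: pair_prob_space "position_law n :: (nat \<Rightarrow> real ^ 'd) measure"
    "measure_pmf (typed_graph_law n \<rho> \<omega>)" ..
  have "prob_space (conditional_law n \<rho> \<omega> :: ('d, 'b) configuration measure)"
    unfolding conditional_law_def by (rule P.prob_space_axioms)
  then show ?thesis
    unfolding conditional_locality_law_def
    by (rule prob_space.prob_space_distr) (rule measurable_locality_measure)
qed

lemma H_locality_measure:
  fixes x :: "nat \<Rightarrow> real ^ 'd::finite" and \<rho> :: "'b::finite pmf"
  assumes n: "1 \<le> n" and \<rho>: "\<rho> \<in> lattice_types n" and \<omega>: "\<omega> \<in> lattice_pairs n"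
    and arr: "arrangements n \<rho> \<noteq> {}"
    and edg: "\<And>\<tau> A. \<tau> \<in> arrangements n \<rho> \<Longrightarrow> A \<in> type_pairs \<Longrightarrow> edge_choices n \<omega> \<tau> A \<noteq> {}"
    and supp: "(\<tau>, E) \<in> set_pmf (typed_graph_law n \<rho> \<omega>)"
  shows "H1 (locality_measure n (x, \<tau>, E)) = \<rho>"
    and "H2 (locality_measure n (x, \<tau>, E)) = (\<lambda>b a. ennreal (\<omega> b a))"
proof -
  have fin_arr: "finite (arrangements n \<rho>)"
    by (rule finite_subset[of _ "{..<n} \<rightarrow>\<^sub>E UNIV"]) (auto simp: arrangements_def intro: finite_PiE)
  have fin_pool: "finite (pool n t A)" for t and A :: "'b set"
    by (rule finite_subset[of _ "Pow {..<n}"]) (auto simp: pool_def)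
  have fin_ch: "finite (edge_choices n \<omega> t A)" for t A
    by (rule finite_subset[of _ "Pow (pool n t A)"]) (auto simp: edge_choices_def fin_pool)
  have fin_tp: "finite (type_pairs :: 'b set set)"
    by simp
  from supp have \<tau>: "\<tau> \<in> arrangements n \<rho>" and E: "E \<in> set_pmf (edge_law n \<omega> \<tau>)"
    using arr fin_arr by (auto simp: typed_graph_law_def)
  from E obtain F where EF: "E = (\<Union>A\<in>type_pairs. F A)"
    and F: "\<And>A. A \<in> type_pairs \<Longrightarrow> F A \<in> edge_choices n \<omega> \<tau> A"
    using edg[OF \<tau>] fin_ch
    by (auto simp: edge_law_def set_Pi_pmf[OF fin_tp] PiE_dflt_def)
  let ?N = "{..<n}"
  have ne: "?N \<noteq> {}"
    using n by (auto simp: lessThan_empty_iff)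
  have cnt: "real (card {j \<in> ?N. \<tau> j = a}) = real n * pmf \<rho> a" for a
    using \<tau> by (auto simp: arrangements_def)
  show "H1 (locality_measure n (x, \<tau>, E)) = \<rho>"
  proof (rule pmf_eqI)
    fix a
    have "pmf (H1 (locality_measure n (x, \<tau>, E))) a = pmf (map_pmf \<tau> (pmf_of_set ?N)) a"
      by (simp add: H1_def locality_measure_def map_pmf_comp)
    also have "\<dots> = measure (measure_pmf (pmf_of_set ?N)) (\<tau> -` {a})"
      by (simp add: pmf_map)
    also have "\<dots> = real (card (?N \<inter> \<tau> -` {a})) / real n"
      using ne by (simp add: measure_pmf_of_set)
    also have "?N \<inter> \<tau> -` {a} = {j \<in> ?N. \<tau> j = a}"
      by auto
    also have "real (card \<dots>) / real n = pmf \<rho> a"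
      using n by (subst cnt) simp
    finally show "pmf (H1 (locality_measure n (x, \<tau>, E))) a = pmf \<rho> a" .
  qed
  have E_sub: "e \<subseteq> ?N \<and> card e = 2" if "e \<in> E" for e
  proof -
    from that obtain A where "A \<in> type_pairs" "e \<in> F A"
      unfolding EF by auto
    then have "e \<in> pool n \<tau> A"
      using F[of A] unfolding edge_choices_def by blast
    then show ?thesis
      by (simp add: pool_def)
  qed
  have blk: "{e \<in> E. \<tau> ` e = {a, b}} = F {a, b}" for a b
  proof -
    have "{a, b} \<in> type_pairs"
      by (auto simp: type_pairs_def)
    moreover have "\<tau> ` e = A" if "A \<in> type_pairs" "e \<in> F A" for A e
    proof -
      have "e \<in> pool n \<tau> A"
        using F[OF that(1)] that(2) unfolding edge_choices_def by blast
      then show ?thesis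
        by (simp add: pool_def)
    qed
    ultimately show ?thesis
      unfolding EF by auto
  qed
  have cF: "real (card (F {a, b})) = (if a = b then real n / 2 else real n) * \<omega> a b" for a b
  proof -
    have "{a, b} \<in> type_pairs"
      by (auto simp: type_pairs_def)
    from F[OF this] show ?thesis
      unfolding edge_choices_def by blast
  qed
  let ?D = "\<lambda>a b. {(j, i). j < n \<and> i < n \<and> \<tau> j = a \<and> \<tau> i = b \<and> {i, j} \<in> E}"
  have fD: "finite (?D a b)" for a b
    by (rule finite_subset[of _ "?N \<times> ?N"]) auto
  have cD: "real (card (?D a b)) = real n * \<omega> a b" for a b
  proof -
    let ?h = "\<lambda>(j, i). {i, j} :: nat set"
    have img: "?h ` ?D a b = F {a, b}"
    proof
      show "?h ` ?D a b \<subseteq> F {a, b}"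
      proof
        fix e assume "e \<in> ?h ` ?D a b"
        then obtain j i where "e = {i, j}" "\<tau> j = a" "\<tau> i = b" "{i, j} \<in> E"
          by (elim imageE) auto
        then show "e \<in> F {a, b}"
          unfolding blk[symmetric] by (simp add: insert_commute)
      qed
      show "F {a, b} \<subseteq> ?h ` ?D a b"
      proof
        fix e assume "e \<in> F {a, b}"
        then have e: "e \<in> E" "\<tau> ` e = {a, b}"
          unfolding blk[symmetric] by auto
        then obtain i j where ij: "e = {i, j}" "i \<noteq> j"
          using E_sub card_2_iff by metis
        have "i < n" "j < n"
          using E_sub[OF e(1)] ij(1) by auto
        moreover have "\<tau> j = a \<and> \<tau> i = b \<or> \<tau> i = a \<and> \<tau> j = b"
          using e(2) ij(1) by (auto simp: doubleton_eq_iff)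
        moreover have "{i, j} \<in> E" "{j, i} \<in> E"
          using e(1) ij(1) by (simp_all add: insert_commute)
        ultimately have D: "(j, i) \<in> ?D a b \<or> (i, j) \<in> ?D a b"
          by auto
        have h: "e = ?h (j, i)" "e = ?h (i, j)"
          using ij(1) by (simp_all add: insert_commute)
        from D show "e \<in> ?h ` ?D a b"
          by (elim disjE) (erule rev_image_eqI, rule h)+
      qed
    qed
    show ?thesis
    proof (cases "a = b")
      case False
      have inj: "inj_on ?h (?D a b)"
        using False by (auto simp: inj_on_def doubleton_eq_iff)
      have "card (?D a b) = card (F {a, b})"
        using card_image[OF inj] unfolding img by (rule sym)
      then show ?thesis
        using cF[of a b] False by simp
    next
      case True
      have fib: "card {p \<in> ?D a b. ?h p = e} = 2" if "e \<in> F {a, b}" for e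
      proof -
        have e: "e \<in> E" "\<tau> ` e = {a, b}"
          using that unfolding blk[symmetric] by auto
        then obtain i j where ij: "e = {i, j}" "i \<noteq> j"
          using E_sub card_2_iff by metis
        have "i < n" "j < n"
          using E_sub[OF e(1)] ij(1) by auto
        moreover have "\<tau> i = a" "\<tau> j = a"
          using e(2) ij(1) True by auto
        moreover have "{i, j} \<in> E" "{j, i} \<in> E"
          using e(1) ij(1) by (simp_all add: insert_commute)
        ultimately have D: "(i, j) \<in> ?D a b" "(j, i) \<in> ?D a b"
          using True by simp_all
        have h: "?h p = e \<longleftrightarrow> p \<in> {(i, j), (j, i)}" for p
          unfolding ij(1) by (cases p) (auto simp: doubleton_eq_iff)
        have "{p \<in> ?D a b. ?h p = e} = {(i, j), (j, i)}"
        proof (intro set_eqI iffI)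
          fix p assume "p \<in> {p \<in> ?D a b. ?h p = e}"
          then show "p \<in> {(i, j), (j, i)}"
            by (subst h[symmetric]) (erule CollectE, erule conjunct2)
        next
          fix p assume p: "p \<in> {(i, j), (j, i)}"
          then have "p \<in> ?D a b"
            using D by (elim insertE emptyE) (simp_all only:)
          then show "p \<in> {p \<in> ?D a b. ?h p = e}"
            using p[folded h] by simp
        qed
        then show ?thesis
          using ij by simp
      qed
      have "card (?D a b) = (\<Sum>e\<in>?h ` ?D a b. card {p \<in> ?D a b. ?h p = e})"
        using sum.image_gen[OF fD, of "\<lambda>_. 1 :: nat" a b ?h] by (simp only: card_eq_sum)
      also have "\<dots> = 2 * card (F {a, b})"
        unfolding img by (subst sum.cong[OF refl fib]) simp_all
      finally show ?thesis
        using cF[of a b] True by simp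
    qed
  qed
  show "H2 (locality_measure n (x, \<tau>, E)) = (\<lambda>b a. ennreal (\<omega> b a))"
  proof (intro ext)
    fix b a
    let ?d = "\<lambda>j. card {i \<in> ?N. \<tau> i = b \<and> {i, j} \<in> E}"
    let ?S = "\<lambda>k. {j \<in> ?N. \<tau> j = a \<and> ?d j = k}"
    have p: "pmf (map_pmf (\<lambda>(a', \<sigma>). (a', \<sigma> b)) (locality_measure n (x, \<tau>, E))) (a, k) =
        real (card (?S k)) / real n" for k
    proof -
      have "map_pmf (\<lambda>(a', \<sigma>). (a', \<sigma> b)) (locality_measure n (x, \<tau>, E)) =
          map_pmf (\<lambda>j. (\<tau> j, ?d j)) (pmf_of_set ?N)"
        by (simp add: locality_measure_def map_pmf_comp)
      moreover have "?N \<inter> (\<lambda>j. (\<tau> j, ?d j)) -` {(a, k)} = ?S k"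
        by auto
      ultimately show ?thesis
        using ne by (simp add: pmf_map measure_pmf_of_set)
    qed
    have dn: "?d j \<le> n" for j
      using card_mono[of ?N "{i \<in> ?N. \<tau> i = b \<and> {i, j} \<in> E}"] by auto
    have "H2 (locality_measure n (x, \<tau>, E)) b a =
        (\<Sum>k. ennreal (real (card (?S k)) / real n) * of_nat k)"
      by (simp only: H2_def p)
    also have "\<dots> = (\<Sum>k\<le>n. ennreal (real (card (?S k)) / real n) * of_nat k)"
    proof (rule suminf_finite)
      show "ennreal (real (card (?S k)) / real n) * of_nat k = 0" if "k \<notin> {..n}" for k
      proof -
        have "?S k = {}"
          using dn that by auto
        then show ?thesis
          by (simp only: card.empty) simp
      qed
    qed simp
    also have "\<dots> = ennreal (\<Sum>k\<le>n. real (card (?S k)) / real n * real k)"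
      by (subst sum_ennreal[symmetric])
         (simp_all only: ennreal_of_nat_eq_real_of_nat ennreal_mult'[symmetric] of_nat_0_le_iff
           mult_nonneg_nonneg divide_nonneg_nonneg)
    also have "(\<Sum>k\<le>n. real (card (?S k)) / real n * real k) =
        real (\<Sum>k\<le>n. card (?S k) * k) / real n"
      by (simp add: sum_divide_distrib)
    also have "(\<Sum>k\<le>n. card (?S k) * k) = (\<Sum>k\<le>n. \<Sum>j | j \<in> {j \<in> ?N. \<tau> j = a} \<and> ?d j = k. ?d j)"
      by (intro sum.cong) (auto simp: conj_assoc)
    also have "\<dots> = (\<Sum>j\<in>{j \<in> ?N. \<tau> j = a}. ?d j)"
      by (rule sum.group) (use dn in auto)
    also have "\<dots> = card (SIGMA j:{j \<in> ?N. \<tau> j = a}. {i \<in> ?N. \<tau> i = b \<and> {i, j} \<in> E})"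
      by (subst card_SigmaI) auto
    also have "(SIGMA j:{j \<in> ?N. \<tau> j = a}. {i \<in> ?N. \<tau> i = b \<and> {i, j} \<in> E}) = ?D a b"
      by auto
    also have "real (card (?D a b)) / real n = \<omega> b a"
      using cD[of a b] \<omega> n by (auto simp: lattice_pairs_def sym_measures_def)
    finally show "H2 (locality_measure n (x, \<tau>, E)) b a = ennreal (\<omega> b a)" .
  qed
qed

end

(* Given the types, the edges between two types form a uniform set of prescribed size, and counting
   matchings of half-edges shows that, up to factors exp(o(n)), the degrees towards each type have the
   law of independent Poisson variables conditioned on their sums. Only one half of this is exact: the
   probability of a degree vector d is at most exp(o(n)) times its Poisson weight, whereas conversely
   only a neighbourhood of d in l^1, of radius epsilon n, is shown to have at least that weight.

   Upper bound: off the compact set of measures with bounded means nothing has mass, so it suffices to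
   bound the probability of small neighbourhoods. The exponential Chebyshev inequality with a finitely
   supported test function gives the entropy by duality; since the edge numbers are prescribed exactly,
   an l violating consistency loses mean degree to infinity, which test functions growing linearly
   beyond a high level make superexponentially unlikely.

   Lower bound: l is approximated by a profile supported on a box, for which a multinomial coefficient
   counts the degree vectors d with that empirical measure. Their neighbourhoods overlap, but only
   exp(o(1) n) times, so their probabilities may be added up. *)
theory Submission
  imports Defs "HOL-Real_Asymp.Real_Asymp"
begin

section \<open>Counting graphs with prescribed degrees\<close>

text \<open>The Poisson form comes from labellings: a graph with degrees d_j arises from matchings
  of half-edges, with d_j! labellings at node j, and 1/d_j! is a Poisson weight up to a factor that
  depends only on the degree sum. As the sum is prescribed, the mean is a free parameter; the
  average degree is the choice for which conditioning on the sum costs only a polynomial factor. The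
  asymmetry of the two bounds is due to loops and double edges. For the upper bound they may be
  counted along. For the lower bound they must be avoided, and a greedy matching may get stuck at
  its end. So only a core with slightly too few edges is matched inside d, and a uniform edge set of
  full size is shown to contain such a core often enough. The other obstacle is that the mean degree
  is only lower semicontinuous in the weak topology, so consistency is not a closed condition. It is
  handled through truncated means, which are continuous, together with exponential moments of the
  Poisson law.\<close>

lemma lists_with_counts_eq:
  assumes "finite B"
  shows "{ws. set ws \<subseteq> B \<and> (\<forall>b\<in>B. count_list ws b = k b)} =
     permutations_of_multiset (\<Sum>b\<in>B. replicate_mset (k b) b)" (is "?L = permutations_of_multiset ?M")
proof -
  have cM: "count ?M b = (if b \<in> B then k b else 0)" for b
    using assms by (simp add: count_sum)
  show ?thesis
  proof (intro set_eqI iffI)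
    fix ws assume ws: "ws \<in> ?L"
    have "mset ws = ?M"
    proof (rule multiset_eqI)
      fix b
      show "count (mset ws) b = count ?M b"
        using ws unfolding cM count_mset by (auto simp: count_list_0_iff)
    qed
    then show "ws \<in> permutations_of_multiset ?M" by (simp add: permutations_of_multiset_def)
  next
    fix ws assume "ws \<in> permutations_of_multiset ?M"
    then have m: "mset ws = ?M" by (simp add: permutations_of_multiset_def)
    have c: "count_list ws b = (if b \<in> B then k b else 0)" for b
      unfolding count_mset[symmetric] m cM ..
    have "set ws \<subseteq> B"
    proof
      fix x assume "x \<in> set ws"
      then have "count_list ws x \<noteq> 0" by (simp add: count_list_0_iff)
      then show "x \<in> B" unfolding c by (auto split: if_splits)
    qed
    then show "ws \<in> ?L" using c by auto
  qed
qed

text \<open>The multinomial formula, multiplied out so that no division of natural numbers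
  occurs.\<close>

lemma card_lists_with_counts:
  assumes "finite B"
  shows "card {ws. set ws \<subseteq> B \<and> (\<forall>b\<in>B. count_list ws b = k b)} * (\<Prod>b\<in>B. fact (k b)) =
    (fact (\<Sum>b\<in>B. k b) :: nat)"
proof -
  let ?M = "\<Sum>b\<in>B. replicate_mset (k b) b"
  have cM: "count ?M b = (if b \<in> B then k b else 0)" for b
    using assms by (simp add: count_sum)
  have sM: "set_mset ?M = {b\<in>B. k b \<noteq> 0}"
    using cM by (auto simp: set_mset_def)
  have "(\<Prod>x\<in>set_mset ?M. fact (count ?M x)) = (\<Prod>b\<in>B. fact (k b) :: nat)"
    unfolding sM by (rule prod.mono_neutral_cong_left) (use assms cM in auto)
  moreover have "size ?M = (\<Sum>b\<in>B. k b)" using assms by (induction) auto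
  ultimately show ?thesis
    using card_permutations_of_multiset[of ?M] unfolding lists_with_counts_eq[OF assms]
    by (metis dvd_div_mult_self)
qed

text \<open>If the counts do not add up to \<open>m\<close> the set is empty, so nothing has to be
  assumed about the sum of \<open>k\<close>; any vector of degrees may be inserted.\<close>

lemma card_lists_length_with_counts_le:
  assumes "finite B"
  shows "card {ws. set ws \<subseteq> B \<and> length ws = m \<and> (\<forall>b\<in>B. count_list ws b = k b)} *
    (\<Prod>b\<in>B. fact (k b)) \<le> (fact m :: nat)"
proof (cases "{ws. set ws \<subseteq> B \<and> length ws = m \<and> (\<forall>b\<in>B. count_list ws b = k b)} = {}")
  case True
  then show ?thesis by (simp only:) simp
next
  case False
  then obtain ws where ws: "set ws \<subseteq> B" "length ws = m" "\<forall>b\<in>B. count_list ws b = k b" by auto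
  have "length ws = (\<Sum>b\<in>B. count_list ws b)"
    using assms ws(1) by (metis sum_count_set)
  then have m: "m = (\<Sum>b\<in>B. k b)" using ws by simp
  have "finite {ws. set ws \<subseteq> B \<and> (\<forall>b\<in>B. count_list ws b = k b)}"
    unfolding lists_with_counts_eq[OF assms] by simp
  then have le: "card {ws. set ws \<subseteq> B \<and> length ws = m \<and> (\<forall>b\<in>B. count_list ws b = k b)} \<le>
     card {ws. set ws \<subseteq> B \<and> (\<forall>b\<in>B. count_list ws b = k b)}" by (rule card_mono) auto
  show ?thesis
    unfolding m card_lists_with_counts[OF assms, symmetric] using le[unfolded m] by (rule mult_le_mono1)
qed

lemma finite_distinct_lists: "finite S \<Longrightarrow> finite {xs. distinct xs \<and> set xs \<subseteq> S}"
  using finite_subset_distinct[of S] by (simp add: conj_commute)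

text \<open>Induction on \<open>w\<close>: the first element is chosen in the fibre of \<open>hd w\<close>, which it leaves.\<close>

lemma card_distinct_lists_over_le:
  assumes "finite S" "finite J" "f ` S \<subseteq> J"
  shows "card {xs. distinct xs \<and> set xs \<subseteq> S \<and> map f xs = w} \<le> (\<Prod>j\<in>J. fact (card {s\<in>S. f s = j}))"
  using assms(1,3)
proof (induction w arbitrary: S)
  case Nil
  have "{xs. distinct xs \<and> set xs \<subseteq> S \<and> map f xs = []} = {[]}" by auto
  then show ?case by (simp add: Suc_le_eq prod_pos)
next
  case (Cons v w)
  let ?L = "\<lambda>S w. {xs. distinct xs \<and> set xs \<subseteq> S \<and> map f xs = w}"
  let ?V = "{s\<in>S. f s = v}"
  have eq: "?L S (v # w) = (\<Union>x\<in>?V. (#) x ` ?L (S - {x}) w)"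
  proof (intro set_eqI iffI)
    fix xs assume "xs \<in> ?L S (v # w)"
    then show "xs \<in> (\<Union>x\<in>?V. (#) x ` ?L (S - {x}) w)" by (cases xs) auto
  next
    fix xs assume "xs \<in> (\<Union>x\<in>?V. (#) x ` ?L (S - {x}) w)"
    then show "xs \<in> ?L S (v # w)" by auto
  qed
  have "card (?L S (v # w)) \<le> (\<Sum>x\<in>?V. card ((#) x ` ?L (S - {x}) w))"
    unfolding eq using Cons.prems by (intro card_UN_le) auto
  also have "\<dots> \<le> (\<Sum>x\<in>?V. card (?L (S - {x}) w))"
    by (intro sum_mono card_image_le finite_subset[OF _ finite_distinct_lists[of S]]) (use Cons.prems in auto)
  also have "\<dots> \<le> (\<Sum>x\<in>?V. \<Prod>j\<in>J. fact (card {s\<in>S - {x}. f s = j}))"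
    by (intro sum_mono Cons.IH) (use Cons.prems in auto)
  also have "\<dots> \<le> (\<Prod>j\<in>J. fact (card {s\<in>S. f s = j}))"
  proof (cases "v \<in> J")
    case True
    have *: "(\<Prod>j\<in>J. fact (card {s\<in>S - {x}. f s = j})) =
        fact (card ?V - 1) * (\<Prod>j\<in>J-{v}. fact (card {s\<in>S. f s = j}) :: nat)" if "x \<in> ?V" for x
    proof -
      have "{s \<in> S - {x}. f s = v} = ?V - {x}" by auto
      then have "card {s\<in>S - {x}. f s = v} = card ?V - 1"
        using that Cons.prems by simp
      moreover have "{s\<in>S - {x}. f s = j} = {s\<in>S. f s = j}" if "j \<noteq> v" for j
        using that \<open>x \<in> ?V\<close> by auto
      ultimately show ?thesis using True assms(2) by (subst prod.remove[of J v]) auto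
    qed
    \<comment> \<open>Each of the \<open>card ?V\<close> possible first elements leaves one element
      fewer in its fibre, which rebuilds the factorial; for an empty fibre the left side is
      0.\<close>
    have "(\<Sum>x\<in>?V. \<Prod>j\<in>J. fact (card {s\<in>S - {x}. f s = j})) =
       (card ?V * fact (card ?V - 1)) * (\<Prod>j\<in>J-{v}. fact (card {s\<in>S. f s = j}))"
      using * by simp
    also have "\<dots> \<le> fact (card ?V) * (\<Prod>j\<in>J-{v}. fact (card {s\<in>S. f s = j}))"
      by (intro mult_right_mono) (cases "card ?V", auto)
    finally show ?thesis using True assms(2) by (subst prod.remove[of J v]) auto
  next
    case False
    then have "?V = {}" using Cons.prems(2) by auto
    then show ?thesis by (simp only:) simp
  qed
  finally show ?case .
qed

section \<open>Edge families and their ordered, oriented enumerations\<close>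

definition ends :: "'v \<times> 'v \<Rightarrow> 'v set" where "ends = (\<lambda>(i, j). {i, j})"

definition distinct_pairs :: "'v set \<Rightarrow> 'v set \<Rightarrow> ('v \<times> 'v) set" where
  "distinct_pairs U V = {(i, j). i \<in> U \<and> j \<in> V \<and> i \<noteq> j}"

text \<open>The degree of \<open>j\<close> in the graph with edge set \<open>F\<close>.\<close>

definition inc :: "'v set set \<Rightarrow> 'v \<Rightarrow> nat" where "inc F j = card {e \<in> F. j \<in> e}"

lemma finite_distinct_pairs: "finite U \<Longrightarrow> finite V \<Longrightarrow> finite (distinct_pairs U V)"
  by (rule finite_subset[of _ "U \<times> V"]) (auto simp: distinct_pairs_def)

text \<open>An edge between disjoint classes has one orientation from \<open>U\<close> to
  \<open>V\<close>, an edge inside a class has two. The multiplicity \<open>c\<close> lets later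
  counts treat both situations at once.\<close>

lemma card_ends_fibre:
  assumes "U \<inter> V = {} \<and> c = 1 \<or> U = V \<and> c = 2" "e \<in> ends ` distinct_pairs U V"
  shows "card {p \<in> distinct_pairs U V. ends p = e} = c"
proof -
  obtain i j where ij: "e = {i, j}" "i \<in> U" "j \<in> V" "i \<noteq> j"
    using assms(2) by (auto simp: distinct_pairs_def ends_def)
  show ?thesis
    using assms(1)
  proof
    assume "U \<inter> V = {} \<and> c = 1"
    moreover from this have "{p \<in> distinct_pairs U V. ends p = e} = {(i, j)}"
      using ij by (auto simp: distinct_pairs_def ends_def doubleton_eq_iff)
    ultimately show ?thesis by simp
  next
    assume "U = V \<and> c = 2"
    moreover from this have "{p \<in> distinct_pairs U V. ends p = e} = {(i, j), (j, i)}"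
      using ij by (auto simp: distinct_pairs_def ends_def doubleton_eq_iff)
    ultimately show ?thesis using ij by simp
  qed
qed

lemma card_lists_fibrewise:
  assumes "finite R" "\<And>e. e \<in> f ` R \<Longrightarrow> card {p \<in> R. f p = e} = c" "set es \<subseteq> f ` R"
  shows "finite {gs. set gs \<subseteq> R \<and> map f gs = es} \<and>
    card {gs. set gs \<subseteq> R \<and> map f gs = es} = c ^ length es"
  using assms(3)
proof (induction es)
  case Nil
  have "{gs. set gs \<subseteq> R \<and> map f gs = []} = {[]}" by auto
  then show ?case by simp
next
  case (Cons e es)
  let ?L = "\<lambda>es. {gs. set gs \<subseteq> R \<and> map f gs = es}"
  have "?L (e # es) = (\<lambda>(p, gs). p # gs) ` ({p \<in> R. f p = e} \<times> ?L es)"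
  proof (intro set_eqI iffI)
    fix xs assume "xs \<in> ?L (e # es)"
    then show "xs \<in> (\<lambda>(p, gs). p # gs) ` ({p \<in> R. f p = e} \<times> ?L es)" by (cases xs) auto
  qed auto
  moreover have "card ((\<lambda>(p, gs). p # gs) ` ({p \<in> R. f p = e} \<times> ?L es)) = c * c ^ length es"
    using Cons assms(2)[of e] by (subst card_image) (auto simp: inj_on_def card_cartesian_product)
  ultimately show ?case using Cons assms(1) by simp
qed

text \<open>The factorial counts the orders of the edges, the power of \<open>c\<close> their
  orientations.\<close>

lemma card_enumerations:
  assumes "finite R" "\<And>e. e \<in> f ` R \<Longrightarrow> card {p \<in> R. f p = e} = c" "F \<subseteq> f ` R"
  shows "finite {gs. set gs \<subseteq> R \<and> distinct (map f gs) \<and> f ` set gs = F}"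
    and "card {gs. set gs \<subseteq> R \<and> distinct (map f gs) \<and> f ` set gs = F} = fact (card F) * c ^ card F"
proof -
  let ?L = "\<lambda>es. {gs. set gs \<subseteq> R \<and> map f gs = es}"
  have F: "finite F" using assms(1,3) finite_subset by blast
  have eq: "{gs. set gs \<subseteq> R \<and> distinct (map f gs) \<and> f ` set gs = F} =
     (\<Union>es\<in>permutations_of_set F. ?L es)"
    by (auto simp: permutations_of_set_def)
  have L: "finite (?L es) \<and> card (?L es) = c ^ card F" if "es \<in> permutations_of_set F" for es
    using card_lists_fibrewise[of R f c es] that assms
    by (auto simp: permutations_of_set_def distinct_card)
  show "finite {gs. set gs \<subseteq> R \<and> distinct (map f gs) \<and> f ` set gs = F}"
    unfolding eq using L F by auto
  have "card (\<Union>es\<in>permutations_of_set F. ?L es) = (\<Sum>es\<in>permutations_of_set F. card (?L es))"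
    by (rule card_UN_disjoint) (use L F in auto)
  also have "\<dots> = fact (card F) * c ^ card F" using L F by simp
  finally show "card {gs. set gs \<subseteq> R \<and> distinct (map f gs) \<and> f ` set gs = F} = fact (card F) * c ^ card F"
    unfolding eq .
qed

text \<open>Degrees become letter counts. Both assumptions matter: a loop would list its node twice,
  and a repeated edge would be listed again but counted only once by \<open>inc\<close>.\<close>

lemma count_list_ends:
  assumes "\<forall>p\<in>set gs. fst p \<noteq> snd p" "distinct (map ends gs)"
  shows "count_list (map fst gs @ map snd gs) j = inc (ends ` set gs) j"
  using assms
proof (induction gs)
  case Nil
  then show ?case by (simp add: inc_def)
next
  case (Cons p gs)
  obtain u v where p: "p = (u, v)" by (cases p)
  have "{e \<in> ends ` set (p # gs). j \<in> e} =
     (if j \<in> {u, v} then insert (ends p) {e \<in> ends ` set gs. j \<in> e} else {e \<in> ends ` set gs. j \<in> e})"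
    by (auto simp: p ends_def)
  moreover have "ends p \<notin> {e \<in> ends ` set gs. j \<in> e}" using Cons.prems by auto
  ultimately have "inc (ends ` set (p # gs)) j = inc (ends ` set gs) j + (if j \<in> {u, v} then 1 else 0)"
    by (simp add: inc_def)
  then show ?case using Cons by (auto simp: p)
qed

text \<open>Coupling: a uniform \<open>m\<close>-subset contains a uniform \<open>k\<close>-subset.\<close>

lemma card_supersets_ge:
  assumes P: "finite P" and C: "\<And>C. C \<in> \<C> \<Longrightarrow> C \<subseteq> P \<and> card C = k" and km: "k \<le> m" "m \<le> card P"
  shows "card \<C> * (card P choose m) \<le>
    card {F. F \<subseteq> P \<and> card F = m \<and> (\<exists>C\<in>\<C>. C \<subseteq> F)} * (card P choose k)"
proof -
  let ?G = "{F. F \<subseteq> P \<and> card F = m \<and> (\<exists>C\<in>\<C>. C \<subseteq> F)}"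
  have finC: "finite \<C>" by (rule finite_subset[of _ "Pow P"]) (use C P in auto)
  have finG: "finite ?G" by (rule finite_subset[of _ "Pow P"]) (use P in auto)
  have up: "card {F \<in> ?G. C \<subseteq> F} = (card P - k) choose (m - k)" if "C \<in> \<C>" for C
  proof -
    have finc: "finite C" using C[OF that] P finite_subset by blast
    have "bij_betw (\<lambda>D. C \<union> D) {D. D \<subseteq> P - C \<and> card D = m - k} {F \<in> ?G. C \<subseteq> F}"
    proof (rule bij_betwI[where g = "\<lambda>F. F - C"])
      show "(\<lambda>D. C \<union> D) \<in> {D. D \<subseteq> P - C \<and> card D = m - k} \<rightarrow> {F \<in> ?G. C \<subseteq> F}"
      proof
        fix D assume D: "D \<in> {D. D \<subseteq> P - C \<and> card D = m - k}"
        then have "card (C \<union> D) = k + (m - k)"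
          using C[OF that] finc finite_subset[of D P] P by (subst card_Un_disjoint) auto
        then show "C \<union> D \<in> {F \<in> ?G. C \<subseteq> F}" using D C[OF that] that km by auto
      qed
      show "(\<lambda>F. F - C) \<in> {F \<in> ?G. C \<subseteq> F} \<rightarrow> {D. D \<subseteq> P - C \<and> card D = m - k}"
        using C[OF that] finc by (auto simp: card_Diff_subset)
    qed auto
    from bij_betw_same_card[OF this]
    have "card {F \<in> ?G. C \<subseteq> F} = card {D. D \<subseteq> P - C \<and> card D = m - k}" by (rule sym)
    also have "\<dots> = (card P - k) choose (m - k)"
      using n_subsets[of "P - C" "m - k"] P C[OF that] finc by (simp add: card_Diff_subset)
    finally show ?thesis .
  qed
  have down: "card {C \<in> \<C>. C \<subseteq> F} \<le> m choose k" if "F \<in> ?G" for F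
  proof -
    have "finite F" using that P finite_subset by blast
    then have "card {C \<in> \<C>. C \<subseteq> F} \<le> card {C. C \<subseteq> F \<and> card C = k}"
      using C by (intro card_mono) auto
    also have "\<dots> = m choose k" using n_subsets[OF \<open>finite F\<close>] that by simp
    finally show ?thesis .
  qed
  \<comment> \<open>Double counting of the pairs \<open>C \<subseteq> F\<close>.\<close>
  have "card \<C> * ((card P - k) choose (m - k)) = (\<Sum>C\<in>\<C>. card {F \<in> ?G. C \<subseteq> F})"
    using up by simp
  also have "\<dots> = (\<Sum>F\<in>?G. card {C \<in> \<C>. C \<subseteq> F})"
    using sum.swap_restrict[OF finC finG, of "\<lambda>_ _. 1 :: nat" "\<lambda>C F. C \<subseteq> F"] by simp
  also have "\<dots> \<le> card ?G * (m choose k)"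
    using sum_bounded_above[of ?G "\<lambda>F. card {C \<in> \<C>. C \<subseteq> F}" "m choose k", OF down] by simp
  finally have le: "card \<C> * ((card P - k) choose (m - k)) \<le> card ?G * (m choose k)" .
  \<comment> \<open>\<open>choose_mult\<close> exchanges the binomials, so that the factor
    \<open>m choose k\<close> occurs on both sides and cancels.\<close>
  have "card \<C> * (card P choose m) * (m choose k) =
      card \<C> * ((card P - k) choose (m - k)) * (card P choose k)"
    using choose_mult[OF km] by (simp add: ac_simps)
  also have "\<dots> \<le> card ?G * (m choose k) * (card P choose k)" using le by (rule mult_le_mono1)
  finally have "(card \<C> * (card P choose m)) * (m choose k) \<le> (card ?G * (card P choose k)) * (m choose k)"
    by (simp only: ac_simps)
  moreover have "0 < m choose k" using km by simp
  ultimately show ?thesis by (simp only: mult_le_cancel2)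
qed

text \<open>Passes from sets of edges to lists of oriented edges, which are easier to count.
  \<open>P\<close> is left open because exact degrees as well as degree bounds are imposed
  later.\<close>

lemma card_families_enumerations:
  assumes "finite R" "\<And>e. e \<in> f ` R \<Longrightarrow> card {p \<in> R. f p = e} = c"
  shows "finite {gs. set gs \<subseteq> R \<and> length gs = m \<and> distinct (map f gs) \<and> P (f ` set gs)}"
    and "card {F. F \<subseteq> f ` R \<and> card F = m \<and> P F} * (fact m * c ^ m) =
     card {gs. set gs \<subseteq> R \<and> length gs = m \<and> distinct (map f gs) \<and> P (f ` set gs)}"
proof -
  let ?F = "{F. F \<subseteq> f ` R \<and> card F = m \<and> P F}"
  let ?E = "\<lambda>F. {gs. set gs \<subseteq> R \<and> distinct (map f gs) \<and> f ` set gs = F}"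
  have finF: "finite ?F" by (rule finite_subset[of _ "Pow (f ` R)"]) (use assms(1) in auto)
  have card_eq: "card (f ` set gs) = length gs" if "distinct (map f gs)" for gs
    using distinct_card[OF that] by simp
  have eq: "{gs. set gs \<subseteq> R \<and> length gs = m \<and> distinct (map f gs) \<and> P (f ` set gs)} = (\<Union>F\<in>?F. ?E F)"
  proof (intro set_eqI iffI)
    fix gs assume gs: "gs \<in> {gs. set gs \<subseteq> R \<and> length gs = m \<and> distinct (map f gs) \<and> P (f ` set gs)}"
    then have "f ` set gs \<in> ?F" using card_eq[of gs] by (simp add: image_mono)
    moreover have "gs \<in> ?E (f ` set gs)" using gs by simp
    ultimately show "gs \<in> (\<Union>F\<in>?F. ?E F)" by blast
  next
    fix gs assume "gs \<in> (\<Union>F\<in>?F. ?E F)"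
    then show "gs \<in> {gs. set gs \<subseteq> R \<and> length gs = m \<and> distinct (map f gs) \<and> P (f ` set gs)}"
      using card_eq[of gs] by auto
  qed
  have E: "finite (?E F)" "card (?E F) = fact m * c ^ m" if "F \<in> ?F" for F
    using card_enumerations[OF assms, of F] that by auto
  show "finite {gs. set gs \<subseteq> R \<and> length gs = m \<and> distinct (map f gs) \<and> P (f ` set gs)}"
    unfolding eq using finF E(1) by blast
  have "card (\<Union>F\<in>?F. ?E F) = (\<Sum>F\<in>?F. card (?E F))"
    by (rule card_UN_disjoint) (use finF E(1) in blast)+
  also have "\<dots> = (\<Sum>F\<in>?F. fact m * c ^ m)" by (rule sum.cong[OF refl E(2)])
  finally show "card ?F * (fact m * c ^ m) =
     card {gs. set gs \<subseteq> R \<and> length gs = m \<and> distinct (map f gs) \<and> P (f ` set gs)}"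
    unfolding eq by simp
qed

lemma finite_lists_subset_length: "finite B \<Longrightarrow> finite {ws. set ws \<subseteq> B \<and> length ws = m \<and> P ws}"
  by (rule finite_subset[OF _ finite_lists_length_eq[of B m]]) auto

lemma map_fst_snd_eqD: "map fst xs = map fst ys \<Longrightarrow> map snd xs = map snd ys \<Longrightarrow> xs = ys"
  by (metis zip_map_fst_snd)

section \<open>Upper bounds for the number of graphs with given degrees\<close>

text \<open>Reading first and second end points separately turns an enumeration into two words of
  length \<open>m\<close>, whose letter counts are the degrees on \<open>U\<close> and on
  \<open>V\<close>. The words determine the enumeration, and the multinomial bound applies to each
  of them.\<close>

lemma card_degree_families_disjoint:
  assumes fin: "finite U" "finite V" and disj: "U \<inter> V = {}"
  shows "card {F. F \<subseteq> ends ` distinct_pairs U V \<and> card F = m \<and> (\<forall>j\<in>U\<union>V. inc F j = d j)} * fact m *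
    (\<Prod>j\<in>U\<union>V. fact (d j)) \<le> (fact m * fact m :: nat)"
proof -
  let ?R = "distinct_pairs U V"
  let ?W = "\<lambda>B. {ws. set ws \<subseteq> B \<and> length ws = m \<and> (\<forall>b\<in>B. count_list ws b = d b)}"
  let ?G = "{gs. set gs \<subseteq> ?R \<and> length gs = m \<and> distinct (map ends gs) \<and> (\<forall>j\<in>U\<union>V. inc (ends ` set gs) j = d j)}"
  have "card ?G \<le> card (?W U \<times> ?W V)"
  proof (rule card_inj_on_le[where f = "\<lambda>gs. (map fst gs, map snd gs)"])
    show "inj_on (\<lambda>gs. (map fst gs, map snd gs)) ?G"
      by (intro inj_onI) (auto intro: map_fst_snd_eqD)
    show "(\<lambda>gs. (map fst gs, map snd gs)) ` ?G \<subseteq> ?W U \<times> ?W V"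
    proof (rule image_subsetI)
      fix gs assume gs: "gs \<in> ?G"
      then have R: "set gs \<subseteq> ?R" and dist: "distinct (map ends gs)"
        and deg: "\<forall>j\<in>U\<union>V. inc (ends ` set gs) j = d j" and m: "m = length gs" by auto
      have sub: "set (map fst gs) \<subseteq> U" "set (map snd gs) \<subseteq> V"
        using R by (auto simp: distinct_pairs_def)
      have "count_list (map fst gs) j + count_list (map snd gs) j = inc (ends ` set gs) j" for j
      proof -
        have "\<forall>p\<in>set gs. fst p \<noteq> snd p" using R by (auto simp: distinct_pairs_def)
        from count_list_ends[OF this dist, of j] show ?thesis by simp
      qed
      \<comment> \<open>Disjointness separates the two words: a node of \<open>U\<close> never is a
        second end point, so its whole degree is seen by the first word.\<close>
      moreover have "count_list (map snd gs) j = 0" if "j \<in> U" for j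
        using sub disj that unfolding count_list_0_iff by blast
      moreover have "count_list (map fst gs) j = 0" if "j \<in> V" for j
        using sub disj that unfolding count_list_0_iff by blast
      ultimately have "\<forall>j\<in>U. count_list (map fst gs) j = d j" "\<forall>j\<in>V. count_list (map snd gs) j = d j"
        using deg by (metis UnI1 add.right_neutral, metis UnI2 add.left_neutral)
      then show "(map fst gs, map snd gs) \<in> ?W U \<times> ?W V" using sub m by simp
    qed
    show "finite (?W U \<times> ?W V)" using fin by (intro finite_cartesian_product finite_lists_subset_length)
  qed
  then have G: "card ?G \<le> card (?W U) * card (?W V)" by (simp only: card_cartesian_product)
  have eq: "card {F. F \<subseteq> ends ` ?R \<and> card F = m \<and> (\<forall>j\<in>U\<union>V. inc F j = d j)} * fact m = card ?G"
    using card_families_enumerations(2)[of ?R ends 1 m "\<lambda>F. \<forall>j\<in>U\<union>V. inc F j = d j"]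
      card_ends_fibre[of U V 1] disj finite_distinct_pairs[OF fin] by simp
  have "card ?G * (\<Prod>j\<in>U\<union>V. fact (d j)) \<le>
      (card (?W U) * (\<Prod>j\<in>U. fact (d j))) * (card (?W V) * (\<Prod>j\<in>V. fact (d j)))"
    unfolding prod.union_disjoint[OF fin disj] using mult_le_mono1[OF G, of "(\<Prod>j\<in>U. fact (d j)) * (\<Prod>j\<in>V. fact (d j))"]
    by (simp only: ac_simps)
  also have "\<dots> \<le> fact m * fact m"
    by (intro mult_le_mono card_lists_length_with_counts_le fin)
  finally show ?thesis unfolding eq .
qed

text \<open>Within one class a node may be first or second end point, so only the concatenated word
  of length \<open>2 * m\<close> has prescribed counts.\<close>

lemma card_degree_families_same:
  assumes fin: "finite U"
  shows "card {F. F \<subseteq> ends ` distinct_pairs U U \<and> card F = m \<and> (\<forall>j\<in>U. inc F j = d j)} * (fact m * 2 ^ m) *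
    (\<Prod>j\<in>U. fact (d j)) \<le> (fact (2 * m) :: nat)"
proof -
  let ?R = "distinct_pairs U U"
  let ?W = "{ws. set ws \<subseteq> U \<and> length ws = 2 * m \<and> (\<forall>b\<in>U. count_list ws b = d b)}"
  let ?G = "{gs. set gs \<subseteq> ?R \<and> length gs = m \<and> distinct (map ends gs) \<and> (\<forall>j\<in>U. inc (ends ` set gs) j = d j)}"
  have "card ?G \<le> card ?W"
  proof (rule card_inj_on_le[where f = "\<lambda>gs. map fst gs @ map snd gs"])
    show "inj_on (\<lambda>gs. map fst gs @ map snd gs) ?G"
      by (intro inj_onI) (auto intro: map_fst_snd_eqD)
    show "(\<lambda>gs. map fst gs @ map snd gs) ` ?G \<subseteq> ?W"
    proof clarify
      fix gs assume R: "set gs \<subseteq> ?R" and dist: "distinct (map ends gs)"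
        and deg: "\<forall>j\<in>U. inc (ends ` set gs) j = d j" and m: "m = length gs"
      have "count_list (map fst gs @ map snd gs) j = inc (ends ` set gs) j" for j
        using R by (intro count_list_ends[OF _ dist]) (auto simp: distinct_pairs_def)
      moreover have "set (map fst gs @ map snd gs) \<subseteq> U" using R by (auto simp: distinct_pairs_def)
      ultimately show "set (map fst gs @ map snd gs) \<subseteq> U \<and> length (map fst gs @ map snd gs) = 2 * length gs \<and>
         (\<forall>b\<in>U. count_list (map fst gs @ map snd gs) b = d b)" using deg by (simp del: set_append)
    qed
    show "finite ?W" using fin by (rule finite_lists_subset_length)
  qed
  moreover have "card {F. F \<subseteq> ends ` ?R \<and> card F = m \<and> (\<forall>j\<in>U. inc F j = d j)} * (fact m * 2 ^ m) = card ?G"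
    using card_families_enumerations(2)[of ?R ends 2 m "\<lambda>F. \<forall>j\<in>U. inc F j = d j"]
      card_ends_fibre[of U U 2] finite_distinct_pairs[OF fin fin] by simp
  ultimately show ?thesis
    using card_lists_length_with_counts_le[OF fin, of "2 * m" d]
    by (metis (no_types, lifting) le_trans mult_le_mono1)
qed

section \<open>Lower bounds by greedy matching of half-edges\<close>

text \<open>Passing from length \<open>k\<close> to \<open>Suc k\<close> multiplies the number of
  lists by at least \<open>e k\<close>, because different lists or different heads give different
  extensions.\<close>

lemma card_lists_greedy:
  assumes "P []" "\<And>x xs. P (x # xs) \<Longrightarrow> P xs" "\<And>xs. P xs \<Longrightarrow> set xs \<subseteq> X" "finite X"
    and "\<And>xs. P xs \<Longrightarrow> length xs < m \<Longrightarrow> e (length xs) \<le> card {x. P (x # xs)}"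
  shows "(\<Prod>k<m. e k) \<le> card {xs. P xs \<and> length xs = m}"
proof -
  let ?L = "\<lambda>k. {xs. P xs \<and> length xs = k}"
  have fin: "finite (?L k)" for k
    by (rule finite_subset[OF _ finite_lists_length_eq[of X k]]) (use assms(3,4) in auto)
  have "(\<Prod>i<k. e i) \<le> card (?L k)" if "k \<le> m" for k
    using that
  proof (induction k)
    case 0
    have "?L 0 = {[]}" using assms(1) by auto
    then show ?case by simp
  next
    case (Suc k)
    have eq: "?L (Suc k) = (\<Union>xs\<in>?L k. (\<lambda>x. x # xs) ` {x. P (x # xs)})"
    proof (intro set_eqI iffI)
      fix ys assume "ys \<in> ?L (Suc k)"
      then show "ys \<in> (\<Union>xs\<in>?L k. (\<lambda>x. x # xs) ` {x. P (x # xs)})" using assms(2) by (cases ys) auto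
    qed auto
    have finx: "finite {x. P (x # xs)}" for xs
      by (rule finite_subset[OF _ assms(4)]) (use assms(3) in fastforce)
    have "card (?L (Suc k)) = (\<Sum>xs\<in>?L k. card ((\<lambda>x. x # xs) ` {x. P (x # xs)}))"
      unfolding eq by (rule card_UN_disjoint) (use fin finx in auto)
    also have "\<dots> = (\<Sum>xs\<in>?L k. card {x. P (x # xs)})"
      by (intro sum.cong card_image) (auto simp: inj_on_def)
    finally have a: "card (?L (Suc k)) = (\<Sum>xs\<in>?L k. card {x. P (x # xs)})" .
    have "e k \<le> card {x. P (x # xs)}" if "xs \<in> ?L k" for xs
      using assms(5)[of xs] that Suc.prems by auto
    from sum_bounded_below[of "?L k", OF this]
    have b: "card (?L k) * e k \<le> card (?L (Suc k))" unfolding a by simp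
    have c: "(\<Prod>i<k. e i) * e k \<le> card (?L k) * e k" using Suc by (intro mult_le_mono1) simp
    show ?case unfolding prod.lessThan_Suc using c b by (rule le_trans)
  qed
  then show ?thesis by simp
qed

definition half_ends :: "('v \<times> nat) \<times> ('v \<times> nat) \<Rightarrow> 'v set" where
  "half_ends x = ends (map_prod fst fst x)"

text \<open>Partial matchings of half-edges, node \<open>j\<close> having the half-edges \<open>(j, 0), \<dots>, (j, d j - 1)\<close>,
  that induce a simple graph.\<close>

definition half_edge_list ::
  "'v set \<Rightarrow> 'v set \<Rightarrow> ('v \<Rightarrow> nat) \<Rightarrow> (('v \<times> nat) \<times> ('v \<times> nat)) list \<Rightarrow> bool" where
  "half_edge_list U V d xs \<longleftrightarrow> distinct (map fst xs @ map snd xs) \<and>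
     fst ` set xs \<subseteq> Sigma U (\<lambda>j. {..<d j}) \<and> snd ` set xs \<subseteq> Sigma V (\<lambda>j. {..<d j}) \<and>
     (\<forall>x\<in>set xs. fst (fst x) \<noteq> fst (snd x)) \<and> distinct (map half_ends xs)"

lemma half_edge_list_Cons: "half_edge_list U V d (x # xs) \<Longrightarrow> half_edge_list U V d xs"
  by (auto simp: half_edge_list_def)

lemma half_edge_list_subset:
  "half_edge_list U V d xs \<Longrightarrow> set xs \<subseteq> Sigma U (\<lambda>j. {..<d j}) \<times> Sigma V (\<lambda>j. {..<d j})"
  by (fastforce simp: half_edge_list_def)

lemma half_edge_list_Nil: "half_edge_list U V d []"
  by (simp add: half_edge_list_def)

text \<open>Every edge at \<open>j\<close> uses up a half-edge of \<open>j\<close>, and no half-edge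
  is used twice.\<close>

lemma half_edge_list_degree:
  assumes "half_edge_list U V d xs" "j \<in> U \<union> V"
  shows "card {x \<in> set xs. j \<in> half_ends x} \<le> d j"
proof -
  let ?g = "\<lambda>x. if fst (fst x) = j then fst x else snd x"
  have inj: "inj_on fst (set xs)" "inj_on snd (set xs)" "fst ` set xs \<inter> snd ` set xs = {}"
    using assms(1) by (auto simp: half_edge_list_def distinct_map)
  have "card {x \<in> set xs. j \<in> half_ends x} \<le> card ({j} \<times> {..<d j})"
  proof (rule card_inj_on_le[where f = ?g])
    show "inj_on ?g {x \<in> set xs. j \<in> half_ends x}"
    proof (rule inj_onI)
      fix x y assume x: "x \<in> {x \<in> set xs. j \<in> half_ends x}" and y: "y \<in> {x \<in> set xs. j \<in> half_ends x}"
        and eq: "?g x = ?g y"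
      have "fst x \<noteq> snd y" "fst y \<noteq> snd x" using inj(3) x y by force+
      then show "x = y" using eq x y inj(1,2) by (auto simp: inj_on_def split: if_splits)
    qed
    show "?g ` {x \<in> set xs. j \<in> half_ends x} \<subseteq> {j} \<times> {..<d j}"
      using assms(1) by (force simp: half_edge_list_def half_ends_def ends_def split: if_splits)
  qed simp
  then show ?thesis by (simp add: card_cartesian_product)
qed

lemma card_half_edge_extensions:
  assumes xs: "half_edge_list U V d xs" and fin: "finite U" "finite V"
    and bound: "\<And>j. j \<in> U \<union> V \<Longrightarrow> d j \<le> \<Delta>"
    and SU: "SU = Sigma U (\<lambda>j. {..<d j})" and SV: "SV = Sigma V (\<lambda>j. {..<d j})"
    and used: "used = set (map fst xs @ map snd xs)"
  shows "card (SU - used) * (card (SV - used) - (\<Delta> + 1) * \<Delta>) \<le> card {x. half_edge_list U V d (x # xs)}"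
proof -
  let ?bad = "\<lambda>p. {q \<in> SV. fst q = fst p \<or> {fst p, fst q} \<in> half_ends ` set xs}"
  have finS: "finite SU" "finite SV" unfolding SU SV using fin by auto
  have bad: "card (?bad p) \<le> (\<Delta> + 1) * \<Delta>" if p: "p \<in> SU" for p
  proof -
    let ?N = "{v \<in> V. {fst p, v} \<in> half_ends ` set xs \<and> v \<noteq> fst p}"
    have jU: "fst p \<in> U" using p SU by auto
    have sub: "(\<lambda>v. {fst p, v}) ` ?N \<subseteq> half_ends ` {x \<in> set xs. fst p \<in> half_ends x}" by force
    have inj: "inj_on (\<lambda>v. {fst p, v}) ?N" by (auto simp: inj_on_def doubleton_eq_iff)
    have "card ?N = card ((\<lambda>v. {fst p, v}) ` ?N)" using inj by (rule card_image[symmetric])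
    also have "\<dots> \<le> card (half_ends ` {x \<in> set xs. fst p \<in> half_ends x})" by (rule card_mono[OF _ sub]) simp
    also have "\<dots> \<le> card {x \<in> set xs. fst p \<in> half_ends x}" by (rule card_image_le) simp
    also have "\<dots> \<le> \<Delta>" using half_edge_list_degree[OF xs, of "fst p"] jU bound[of "fst p"] by auto
    finally have N: "card ?N \<le> \<Delta>" .
    have "?bad p \<subseteq> ({fst p} \<union> ?N) \<times> {..<\<Delta>}"
      using bound unfolding SV by fastforce
    then have "card (?bad p) \<le> card (({fst p} \<union> ?N) \<times> {..<\<Delta>})"
      by (rule card_mono[rotated]) (use fin in auto)
    also have "\<dots> \<le> (\<Delta> + 1) * \<Delta>"
      using N fin card_insert_le_m1[of "\<Delta> + 1" ?N "fst p"] unfolding card_cartesian_product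
      by (intro mult_le_mono) auto
    finally show ?thesis .
  qed
  have "card (SU - used) * (card (SV - used) - (\<Delta> + 1) * \<Delta>) \<le>
      (\<Sum>p\<in>SU - used. card (SV - used - ?bad p))"
  proof -
    have "card (SV - used) - (\<Delta> + 1) * \<Delta> \<le> card (SV - used - ?bad p)" if "p \<in> SU - used" for p
    proof -
      have "finite (?bad p)" using finS(2) by simp
      then have "card (SV - used) - card (?bad p) \<le> card (SV - used - ?bad p)" by (rule diff_card_le_card_Diff)
      then show ?thesis using bad[of p] that by (meson DiffD1 diff_le_mono2 le_trans)
    qed
    from sum_bounded_below[of "SU - used", OF this] show ?thesis by simp
  qed
  also have "\<dots> = card (Sigma (SU - used) (\<lambda>p. SV - used - ?bad p))"
    using finS by (subst card_SigmaI) auto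
  also have "\<dots> \<le> card {x. half_edge_list U V d (x # xs)}"
  proof (rule card_mono)
    show "finite {x. half_edge_list U V d (x # xs)}"
      by (rule finite_subset[of _ "SU \<times> SV"]) (use finS in \<open>auto simp: half_edge_list_def SU SV\<close>)
    show "Sigma (SU - used) (\<lambda>p. SV - used - ?bad p) \<subseteq> {x. half_edge_list U V d (x # xs)}"
    proof (rule subsetI)
      fix x assume x: "x \<in> Sigma (SU - used) (\<lambda>p. SV - used - ?bad p)"
      obtain v i w k where x_eq: "x = ((v, i), (w, k))" by (metis prod.exhaust)
      have "(v, i) \<in> SU" "(v, i) \<notin> used" "(w, k) \<in> SV" "(w, k) \<notin> used" "w \<noteq> v"
        "ends (v, w) \<notin> half_ends ` set xs"
        using x by (auto simp: x_eq ends_def)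
      moreover from this have "half_ends x \<notin> half_ends ` set xs" by (simp add: x_eq half_ends_def)
      ultimately show "x \<in> {x. half_edge_list U V d (x # xs)}"
        using xs unfolding x_eq by (auto simp: half_edge_list_def used SU SV)
    qed
  qed
  finally show ?thesis .
qed

text \<open>Forgetting which half-edge was used maps half-edge lists to enumerations of simple
  graphs. A fibre consists of injective labellings of the end points, at most
  \<open>fact (d j)\<close> of them at node \<open>j\<close>.\<close>

lemma card_half_edge_lists_le:
  assumes fin: "finite U" "finite V" and c: "U \<inter> V = {} \<and> c = 1 \<or> U = V \<and> c = 2"
  shows "card {xs. half_edge_list U V d xs \<and> length xs = m} \<le>
    card {F. F \<subseteq> ends ` distinct_pairs U V \<and> card F = m \<and> (\<forall>j\<in>U\<union>V. inc F j \<le> d j)} * (fact m * c ^ m) *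
      (\<Prod>j\<in>U\<union>V. fact (d j))"
proof -
  let ?R = "distinct_pairs U V"
  let ?P = "\<lambda>F. \<forall>j\<in>U\<union>V. inc F j \<le> d j"
  let ?H = "{xs. half_edge_list U V d xs \<and> length xs = m}"
  let ?G = "{gs. set gs \<subseteq> ?R \<and> length gs = m \<and> distinct (map ends gs) \<and> ?P (ends ` set gs)}"
  let ?pr = "map (map_prod fst fst) :: (('a \<times> nat) \<times> ('a \<times> nat)) list \<Rightarrow> _"
  let ?S = "Sigma (U \<union> V) (\<lambda>j. {..<d j})"
  note fam = card_families_enumerations[of ?R ends c m ?P, OF finite_distinct_pairs[OF fin] card_ends_fibre[OF c]]
  have finS: "finite ?S" using fin by auto
  have finH: "finite ?H"
  proof (rule finite_subset[OF _ finite_lists_length_eq[of "?S \<times> ?S" m]])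
    have "set xs \<subseteq> ?S \<times> ?S" if "half_edge_list U V d xs" for xs
      using half_edge_list_subset[OF that] by fastforce
    then show "?H \<subseteq> {xs. set xs \<subseteq> ?S \<times> ?S \<and> length xs = m}" by blast
  qed (use finS in auto)
  have sub: "?pr ` ?H \<subseteq> ?G"
  proof (rule image_subsetI)
    fix xs assume "xs \<in> ?H"
    then have xs: "half_edge_list U V d xs" and m: "length xs = m" by auto
    have "?P (ends ` set (?pr xs))"
    proof
      fix j assume j: "j \<in> U \<union> V"
      have "{e \<in> ends ` set (?pr xs). j \<in> e} = half_ends ` {x \<in> set xs. j \<in> half_ends x}"
        by (force simp: half_ends_def)
      then have "inc (ends ` set (?pr xs)) j \<le> card {x \<in> set xs. j \<in> half_ends x}"
        unfolding inc_def by (simp add: card_image_le)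
      then show "inc (ends ` set (?pr xs)) j \<le> d j" using half_edge_list_degree[OF xs j] by simp
    qed
    moreover have "set (?pr xs) \<subseteq> ?R" using xs by (fastforce simp: half_edge_list_def distinct_pairs_def)
    moreover have "map ends (?pr xs) = map half_ends xs" by (simp add: half_ends_def)
    then have "distinct (map ends (?pr xs))" using xs by (simp only: half_edge_list_def)
    ultimately show "?pr xs \<in> ?G" using m by simp
  qed
  have fib: "card {xs \<in> ?H. ?pr xs = gs} \<le> (\<Prod>j\<in>U\<union>V. fact (d j))" if "gs \<in> ?G" for gs
  proof -
    let ?T = "{zs. distinct zs \<and> set zs \<subseteq> ?S \<and> map fst zs = map fst gs @ map snd gs}"
    have "card {xs \<in> ?H. ?pr xs = gs} \<le> card ?T"
    proof (rule card_inj_on_le[where f = "\<lambda>xs. map fst xs @ map snd xs"])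
      show "inj_on (\<lambda>xs. map fst xs @ map snd xs) {xs \<in> ?H. ?pr xs = gs}"
        by (intro inj_onI) (auto intro: map_fst_snd_eqD)
      show "(\<lambda>xs. map fst xs @ map snd xs) ` {xs \<in> ?H. ?pr xs = gs} \<subseteq> ?T"
        by (auto simp: half_edge_list_def image_subset_iff)
      show "finite ?T" using finite_distinct_lists[OF finS] by (rule finite_subset[rotated]) auto
    qed
    also have "\<dots> \<le> (\<Prod>j\<in>U\<union>V. fact (card {s\<in>?S. fst s = j}))"
      by (rule card_distinct_lists_over_le) (use finS fin in auto)
    also have "\<dots> = (\<Prod>j\<in>U\<union>V. fact (d j))"
    proof (rule prod.cong[OF refl])
      fix j assume "j \<in> U \<union> V"
      then have "{s\<in>?S. fst s = j} = {j} \<times> {..<d j}" by auto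
      then show "fact (card {s\<in>?S. fst s = j}) = fact (d j)" by (simp add: card_cartesian_product)
    qed
    finally show ?thesis .
  qed
  have "?H = (\<Union>gs\<in>?G. {xs \<in> ?H. ?pr xs = gs})" using sub by blast
  then have "card ?H = card (\<Union>gs\<in>?G. {xs \<in> ?H. ?pr xs = gs})" by (rule arg_cong)
  also have "\<dots> \<le> (\<Sum>gs\<in>?G. card {xs \<in> ?H. ?pr xs = gs})" by (rule card_UN_le[OF fam(1)])
  also have "\<dots> \<le> card ?G * (\<Prod>j\<in>U\<union>V. fact (d j))"
    using sum_bounded_above[of ?G, OF fib] by simp
  finally show ?thesis using fam(2) by simp
qed

text \<open>The surplus of \<open>(\<Delta> + 1) * \<Delta>\<close> half-edges over \<open>m\<close>
  pays for the forbidden ones. Hence \<open>m - length xs\<close> choices remain on either side, and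
  the product of these numbers is the square of \<open>fact m\<close>.\<close>

lemma card_subdegree_families_disjoint:
  assumes fin: "finite U" "finite V" and disj: "U \<inter> V = {}"
    and bound: "\<And>j. j \<in> U \<union> V \<Longrightarrow> d j \<le> \<Delta>"
    and m: "m + (\<Delta> + 1) * \<Delta> \<le> (\<Sum>j\<in>U. d j)" "m + (\<Delta> + 1) * \<Delta> \<le> (\<Sum>j\<in>V. d j)"
  shows "fact m * fact m \<le>
    card {F. F \<subseteq> ends ` distinct_pairs U V \<and> card F = m \<and> (\<forall>j\<in>U\<union>V. inc F j \<le> d j)} * fact m *
      (\<Prod>j\<in>U\<union>V. fact (d j))"
proof -
  let ?SU = "Sigma U (\<lambda>j. {..<d j})" and ?SV = "Sigma V (\<lambda>j. {..<d j})"
  have cS: "card ?SU = (\<Sum>j\<in>U. d j)" "card ?SV = (\<Sum>j\<in>V. d j)" using fin by (simp_all add: card_SigmaI)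
  have "(\<Prod>k<m. (m - k) * (m - k)) \<le> card {xs. half_edge_list U V d xs \<and> length xs = m}"
  proof (rule card_lists_greedy[where P = "half_edge_list U V d",
        OF half_edge_list_Nil half_edge_list_Cons half_edge_list_subset])
    show "finite (?SU \<times> ?SV)" using fin by auto
    fix xs assume xs: "half_edge_list U V d xs" "length xs < m"
    let ?used = "set (map fst xs @ map snd xs)"
    have le: "card (fst ` set xs) \<le> length xs" "card (snd ` set xs) \<le> length xs"
      using card_length[of "map fst xs"] card_length[of "map snd xs"] by simp_all
    have "fst ` set xs \<subseteq> ?SU" "snd ` set xs \<subseteq> ?SV" using xs(1) by (simp_all add: half_edge_list_def)
    \<comment> \<open>Each earlier step has taken only one half-edge from either side.\<close>
    moreover have "?SU \<inter> ?SV = {}" using disj by auto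
    ultimately have "?SU - ?used = ?SU - fst ` set xs" "?SV - ?used = ?SV - snd ` set xs"
      by auto
    then have "card ?SU - length xs \<le> card (?SU - ?used)" "card ?SV - length xs \<le> card (?SV - ?used)"
      using le diff_card_le_card_Diff[of "fst ` set xs" ?SU] diff_card_le_card_Diff[of "snd ` set xs" ?SV]
      by simp_all
    then have "m - length xs \<le> card (?SU - ?used)" "m - length xs \<le> card (?SV - ?used) - (\<Delta> + 1) * \<Delta>"
      using m cS by linarith+
    then show "(m - length xs) * (m - length xs) \<le> card {x. half_edge_list U V d (x # xs)}"
      using card_half_edge_extensions[OF xs(1) fin bound refl refl refl] by (meson le_trans mult_le_mono)
  qed
  moreover have "(\<Prod>k<m. m - k) = fact m"
    by (simp add: fact_prod_rev atLeast0LessThan)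
  ultimately have "fact m * fact m \<le> card {xs. half_edge_list U V d xs \<and> length xs = m}"
    by (simp add: prod.distrib)
  moreover have "U \<inter> V = {} \<and> (1 :: nat) = 1 \<or> U = V \<and> (1 :: nat) = 2" using disj by simp
  note card_half_edge_lists_le[OF fin this, of d m, unfolded power_one mult_1_right]
  ultimately show ?thesis by (rule le_trans)
qed

text \<open>A matching inside one class removes two half-edges per step; consecutive factors of the
  factorial are grouped accordingly.\<close>

lemma prod_falling_pairs: "(\<Prod>k<m. (2 * m - 2 * k) * (2 * m - 2 * k - 1)) = (fact (2 * m) :: nat)"
proof (induction m)
  case (Suc m)
  show ?case
    by (subst prod.lessThan_Suc_shift) (use Suc in \<open>simp add: algebra_simps fact_reduce\<close>)
qed simp

lemma card_subdegree_families_same: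
  assumes fin: "finite U" and bound: "\<And>j. j \<in> U \<Longrightarrow> d j \<le> \<Delta>"
    and m: "2 * m + (\<Delta> + 1) * \<Delta> \<le> (\<Sum>j\<in>U. d j)"
  shows "fact (2 * m) \<le>
    card {F. F \<subseteq> ends ` distinct_pairs U U \<and> card F = m \<and> (\<forall>j\<in>U. inc F j \<le> d j)} * (fact m * 2 ^ m) *
      (\<Prod>j\<in>U. fact (d j))"
proof -
  let ?SU = "Sigma U (\<lambda>j. {..<d j})"
  have cS: "card ?SU = (\<Sum>j\<in>U. d j)" using fin by (simp add: card_SigmaI)
  have "(\<Prod>k<m. (2 * m - 2 * k) * (2 * m - 2 * k - 1)) \<le> card {xs. half_edge_list U U d xs \<and> length xs = m}"
  proof (rule card_lists_greedy[where P = "half_edge_list U U d",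
        OF half_edge_list_Nil half_edge_list_Cons half_edge_list_subset])
    show "finite (?SU \<times> ?SU)" using fin by auto
    fix xs assume xs: "half_edge_list U U d xs" "length xs < m"
    let ?used = "set (map fst xs @ map snd xs)"
    have "card ?used \<le> 2 * length xs"
      using card_length[of "map fst xs @ map snd xs"] by simp
    then have "card ?SU - 2 * length xs \<le> card (?SU - ?used)"
      using diff_card_le_card_Diff[of ?used ?SU] by simp
    \<comment> \<open>Both half-edges come from the same supply. The \<open>- 1\<close> is given
      away to obtain the factors of a factorial; the chosen half-edge itself is already among the
      forbidden ones.\<close>
    then have "2 * m - 2 * length xs \<le> card (?SU - ?used)"
      "2 * m - 2 * length xs - 1 \<le> card (?SU - ?used) - (\<Delta> + 1) * \<Delta>"
      using m cS by linarith+
    then show "(2 * m - 2 * length xs) * (2 * m - 2 * length xs - 1) \<le> card {x. half_edge_list U U d (x # xs)}"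
      using card_half_edge_extensions[OF xs(1) fin fin _ refl refl refl, of \<Delta>] bound
      by (meson Un_iff le_trans mult_le_mono)
  qed
  then show ?thesis
    unfolding prod_falling_pairs using card_half_edge_lists_le[OF fin fin, of 2 d m] by simp
qed

section \<open>Degree probabilities for a single pair of types\<close>

text \<open>A plain function of the mean, so that mean 0 is included, where it is the point mass at
  0.\<close>

definition poisson_weight :: "real \<Rightarrow> nat \<Rightarrow> real" where
  "poisson_weight \<mu> k = exp (- \<mu>) * \<mu> ^ k / fact k"

lemma poisson_weight_nonneg: "0 \<le> \<mu> \<Longrightarrow> 0 \<le> poisson_weight \<mu> k"
  by (simp add: poisson_weight_def)

text \<open>Apart from the factorials the product depends on the degrees only through their sum,
  which the edge number fixes. This is what makes counts of matchings comparable with Poisson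
  weights.\<close>

lemma prod_poisson_weight:
  assumes "finite U"
  shows "(\<Prod>j\<in>U. poisson_weight \<mu> (d j)) =
    exp (- \<mu> * real (card U)) * \<mu> ^ (\<Sum>j\<in>U. d j) / (\<Prod>j\<in>U. fact (d j))"
  using assms by (induction) (simp_all add: poisson_weight_def exp_add[symmetric] power_add algebra_simps)

section \<open>Stirling-type bounds\<close>

text \<open>The factorial is compared with a single term of the series of
  \<open>exp (real m)\<close>.\<close>

lemma power_le_fact_exp: "(real m / exp 1) ^ m \<le> fact m"
proof -
  have "real m ^ m / fact m \<le> exp (real m)"
  proof -
    have "summable (\<lambda>k. real m ^ k / fact k)" using summable_exp[of "real m"] by (simp add: field_simps)
    then have "(\<Sum>k\<in>{m}. real m ^ k / fact k) \<le> (\<Sum>k. real m ^ k / fact k)"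
      by (rule sum_le_suminf) auto
    then show ?thesis by (simp add: exp_def field_simps)
  qed
  then show ?thesis by (simp add: power_divide exp_of_nat_mult[symmetric] field_simps)
qed

text \<open>The polynomial prefactor is harmless on the exponential scale; having
  \<open>real m + 1\<close> in it instead of \<open>real m\<close> covers
  \<open>m = 0\<close>.\<close>

lemma fact_le_power_exp: "fact m \<le> exp 1 * (real m + 1) * (real m / exp 1) ^ m"
proof (cases "m = 0")
  case False
  have "fact (Suc k) \<le> exp 1 * real (Suc k) * (real (Suc k) / exp 1) ^ Suc k" for k
  proof (induction k)
    case (Suc k)
    let ?x = "real (Suc k)"
    have x: "?x > 0" by simp
    \<comment> \<open>The induction step rests on (1 + 1/x)^(x+1) >= e, which is ln y <= y - 1 at y
      = x/(x+1).\<close>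
    have "1 / (?x + 1) \<le> ln ((?x + 1) / ?x)"
      using ln_le_minus_one[of "?x / (?x + 1)"] by (simp add: ln_div field_simps)
    then have "1 \<le> (?x + 1) * ln ((?x + 1) / ?x)" using x by (simp add: field_simps)
    also have "\<dots> = real (Suc (Suc k)) * ln ((?x + 1) / ?x)" by simp
    also have "\<dots> = ln (((?x + 1) / ?x) ^ Suc (Suc k))" by (rule ln_realpow[symmetric])
    finally have "exp 1 \<le> ((?x + 1) / ?x) ^ Suc (Suc k)"
      by (subst (asm) ln_ge_iff) (auto intro!: divide_pos_pos)
    then have *: "exp 1 * ?x ^ Suc (Suc k) \<le> (?x + 1) ^ Suc (Suc k)"
      unfolding power_divide by (subst (asm) pos_le_divide_eq) (use x in simp_all)
    have "fact (Suc (Suc k)) = (?x + 1) * fact (Suc k)" by (simp add: algebra_simps)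
    also have "\<dots> \<le> (?x + 1) * (exp 1 * ?x * (?x / exp 1) ^ Suc k)"
      by (intro mult_left_mono Suc.IH) simp
    also have "\<dots> = (?x + 1) * (exp 1 * ?x ^ Suc (Suc k)) / exp 1 ^ Suc k"
      by (simp add: power_divide)
    also have "\<dots> \<le> (?x + 1) * (?x + 1) ^ Suc (Suc k) / exp 1 ^ Suc k"
      by (intro divide_right_mono mult_left_mono *) auto
    also have "\<dots> = exp 1 * real (Suc (Suc k)) * (real (Suc (Suc k)) / exp 1) ^ Suc (Suc k)"
    proof -
      have gen: "y * y ^ Suc n / E ^ n = E * y * (y / E) ^ Suc n" if "E > 0" for y E :: real and n
        using that by (simp add: power_divide)
      have y: "?x + 1 = real (Suc (Suc k))" by simp
      show ?thesis unfolding y by (rule gen) simp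
    qed
    finally show ?case .
  qed simp
  from this[of "m - 1"] False have "fact m \<le> exp 1 * real m * (real m / exp 1) ^ m" by simp
  also have "\<dots> \<le> exp 1 * (real m + 1) * (real m / exp 1) ^ m"
    by (intro mult_right_mono mult_left_mono) auto
  finally show ?thesis .
qed simp

lemma power_le_fact_binomial: "m \<le> N \<Longrightarrow> real (N - m) ^ m \<le> fact m * real (N choose m)"
proof -
  assume mN: "m \<le> N"
  have "real (N - m) ^ m = (\<Prod>i<m. real (N - m))" by simp
  also have "\<dots> \<le> (\<Prod>i = 0..<m. real (N - i))"
    unfolding atLeast0LessThan by (rule prod_mono) auto
  also have "\<dots> = (\<Prod>i = 0..<m. real N - real i)" using mN by (intro prod.cong) auto
  also have "\<dots> = fact m * real (N choose m)"
    by (simp add: binomial_gbinomial gbinomial_prod_rev)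
  finally show ?thesis .
qed

lemma fact_binomial_le_power: "fact m * real (N choose m) \<le> real N ^ m"
proof -
  have "real ((N choose m) * fact m) \<le> real (N ^ m)"
    using binomial_fact_pow[of N m] by (simp only: of_nat_le_iff)
  then show ?thesis by (simp add: mult.commute)
qed

text \<open>The handshake argument: incidences of nodes and edges are counted in two ways.\<close>

lemma sum_inc:
  assumes "finite U" "finite F"
  shows "(\<Sum>j\<in>U. inc F j) = (\<Sum>e\<in>F. card (e \<inter> U))"
proof -
  have "(\<Sum>j\<in>U. inc F j) = (\<Sum>j\<in>U. \<Sum>e\<in>{e\<in>F. j \<in> e}. 1)" by (simp add: inc_def)
  also have "\<dots> = (\<Sum>e\<in>F. \<Sum>j\<in>{j\<in>U. j \<in> e}. 1)" using assms by (rule sum.swap_restrict)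
  also have "\<dots> = (\<Sum>e\<in>F. card (e \<inter> U))"
    by (intro sum.cong) (auto intro: arg_cong[where f = card])
  finally show ?thesis .
qed

lemma sum_inc_disjoint:
  assumes "finite U" "finite V" "U \<inter> V = {}" "F \<subseteq> ends ` distinct_pairs U V"
  shows "(\<Sum>j\<in>U. inc F j) = card F" "(\<Sum>j\<in>V. inc F j) = card F"
proof -
  have F: "finite F" using assms by (meson finite_distinct_pairs finite_imageI finite_subset)
  have "card (e \<inter> U) = 1 \<and> card (e \<inter> V) = 1" if eF: "e \<in> F" for e
  proof -
    obtain i j where ij: "e = {i, j}" "i \<in> U" "j \<in> V"
      using subsetD[OF assms(4) eF] by (auto simp: ends_def distinct_pairs_def)
    then have "e \<inter> U = {i}" "e \<inter> V = {j}" using assms(3) by auto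
    then show ?thesis by simp
  qed
  then show "(\<Sum>j\<in>U. inc F j) = card F" "(\<Sum>j\<in>V. inc F j) = card F"
    using assms F by (simp_all add: sum_inc)
qed

lemma sum_inc_same:
  assumes "finite U" "F \<subseteq> ends ` distinct_pairs U U"
  shows "(\<Sum>j\<in>U. inc F j) = 2 * card F"
proof -
  have F: "finite F" using assms by (meson finite_distinct_pairs finite_imageI finite_subset)
  have "card (e \<inter> U) = 2" if eF: "e \<in> F" for e
  proof -
    obtain i j where ij: "e = {i, j}" "i \<in> U" "j \<in> U" "i \<noteq> j"
      using subsetD[OF assms(2) eF] by (auto simp: ends_def distinct_pairs_def)
    then have "e \<inter> U = {i, j}" by auto
    then show ?thesis using ij by simp
  qed
  then show ?thesis using assms F by (simp add: sum_inc)
qed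

lemma card_ends_disjoint:
  assumes "U \<inter> V = {}"
  shows "card (ends ` distinct_pairs U V) = card U * card V"
proof -
  have "distinct_pairs U V = U \<times> V" using assms by (auto simp: distinct_pairs_def)
  moreover have "inj_on ends (U \<times> V)" using assms by (auto simp: inj_on_def ends_def doubleton_eq_iff)
  ultimately show ?thesis by (simp add: card_image card_cartesian_product)
qed

lemma card_ends_same:
  assumes "finite U"
  shows "2 * card (ends ` distinct_pairs U U) = card U * (card U - 1)"
proof -
  have "ends ` distinct_pairs U U = {K. K \<subseteq> U \<and> card K = 2}"
    by (auto simp: ends_def distinct_pairs_def card_2_iff image_iff)
  then have "card (ends ` distinct_pairs U U) = card U choose 2" using n_subsets[OF assms, of 2] by simp
  moreover have "even (card U * (card U - 1))" by (cases "card U") auto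
  ultimately show ?thesis by (simp add: choose_two)
qed

section \<open>Probability of exact degrees: upper bounds\<close>

text \<open>Let N be the size of the pool. There are at most m!/prod d_j! favourable sets, and at
  least (N-m)^m/m! sets in all. Stirling's bound turns the square of m! into (m/e)^(2m), and e^(-2m)
  is just what the exponentials of the two Poisson products contribute, their means being the
  average degrees. What remains is the prefactor and the power of N/(N-m).\<close>

lemma degree_probability_le_disjoint:
  assumes fin: "finite U" "finite V" and disj: "U \<inter> V = {}" and m: "m < card U * card V"
  shows "real (card {F. F \<subseteq> ends ` distinct_pairs U V \<and> card F = m \<and> (\<forall>j\<in>U\<union>V. inc F j = d j)}) /
      real (card U * card V choose m) \<le>
    (exp 1 * (real m + 1))\<^sup>2 * (real (card U * card V) / (real (card U * card V) - real m)) ^ m *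
     ((\<Prod>j\<in>U. poisson_weight (real m / card U) (d j)) * (\<Prod>j\<in>V. poisson_weight (real m / card V) (d j)))"
    (is "real (card ?F) / _ \<le> ?R")
proof (cases "?F = {}")
  case True
  have "0 \<le> ?R" using m by (intro mult_nonneg_nonneg prod_nonneg zero_le_power divide_nonneg_nonneg)
      (auto intro!: poisson_weight_nonneg simp del: of_nat_mult)
  then show ?thesis unfolding True by simp
next
  case False
  let ?N = "card U * card V" and ?P = "\<Prod>j\<in>U\<union>V. fact (d j) :: real"
  \<comment> \<open>One favourable set is enough to force the degree sums; without any the left side
    is 0.\<close>
  obtain F where F: "F \<subseteq> ends ` distinct_pairs U V" "card F = m" "\<forall>j\<in>U\<union>V. inc F j = d j"
    using False by auto
  have sums: "(\<Sum>j\<in>U. d j) = m" "(\<Sum>j\<in>V. d j) = m"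
    using sum_inc_disjoint[OF fin disj F(1)] F(2,3) by auto
  have U0: "card U > 0" "card V > 0" using m by (auto intro: ccontr)
  have P: "?P > 0" by (intro prod_pos) auto
  have P_split: "?P = (\<Prod>j\<in>U. fact (d j)) * (\<Prod>j\<in>V. fact (d j))"
    by (rule prod.union_disjoint[OF fin disj])
  have "real (card ?F * fact m * (\<Prod>j\<in>U\<union>V. fact (d j))) \<le> real (fact m * fact m)"
    using card_degree_families_disjoint[OF fin disj, of m d] by (simp only: of_nat_le_iff)
  then have "real (card ?F) * ?P * fact m \<le> fact m * fact m" by (simp add: ac_simps)
  then have 1: "real (card ?F) * ?P \<le> fact m" by simp
  have 2: "(real ?N - real m) ^ m \<le> fact m * real (?N choose m)"
    using power_le_fact_binomial[of m ?N] m by (simp add: of_nat_diff)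
  have Nm: "real ?N - real m > 0" using m by (simp only: of_nat_less_iff diff_gt_0_iff_gt)
  have C: "real (?N choose m) > 0" using m by simp
  have "real (card ?F) / real (?N choose m) \<le> (fact m / ?P) / ((real ?N - real m) ^ m / fact m)"
    using 1 2 P C Nm by (intro frac_le) (auto simp: field_simps)
  also have "\<dots> = (fact m)\<^sup>2 / ((real ?N - real m) ^ m * ?P)"
    by (simp add: power2_eq_square field_simps)
  also have "\<dots> \<le> (exp 1 * (real m + 1) * (real m / exp 1) ^ m)\<^sup>2 / ((real ?N - real m) ^ m * ?P)"
    by (intro divide_right_mono power_mono fact_le_power_exp mult_nonneg_nonneg) (use Nm P in auto)
  also have "\<dots> = ?R"
  proof -
    define D where "D = real ?N - real m"
    have e: "exp (- (real m / real c) * real c) = 1 / exp 1 ^ m" if "c > 0" for c :: nat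
      using that by (simp add: exp_minus exp_of_nat_mult[symmetric] inverse_eq_divide)
    show ?thesis
      unfolding prod_poisson_weight[OF fin(1)] prod_poisson_weight[OF fin(2)] sums P_split
        e[OF U0(1)] e[OF U0(2)] D_def[symmetric]
      using U0 by (simp add: power2_eq_square power_divide power_mult_distrib ac_simps)
  qed
  finally show ?thesis .
qed

text \<open>Twice the pool size is now \<open>card U * card U - card U\<close>. The power of 2 from
  the orientations merges with the falling factors, since twice the number of pairs left over after
  \<open>m\<close> edges is \<open>card U * card U - (card U + 2 * m)\<close>.\<close>

lemma degree_probability_le_same:
  assumes fin: "finite U" and m: "card U + 2 * m < card U * card U"
  shows "real (card {F. F \<subseteq> ends ` distinct_pairs U U \<and> card F = m \<and> (\<forall>j\<in>U. inc F j = d j)}) /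
      real (card (ends ` distinct_pairs U U) choose m) \<le>
    (exp 1 * (real (2 * m) + 1)) *
      (real (card U * card U) / (real (card U * card U) - real (card U + 2 * m))) ^ m *
     (\<Prod>j\<in>U. poisson_weight (real (2 * m) / card U) (d j))"
    (is "real (card ?F) / _ \<le> ?R")
proof (cases "?F = {}")
  case True
  have "0 \<le> ?R" using m by (intro mult_nonneg_nonneg prod_nonneg zero_le_power divide_nonneg_nonneg)
      (auto intro!: poisson_weight_nonneg simp del: of_nat_mult of_nat_add)
  then show ?thesis unfolding True by simp
next
  case False
  let ?u = "real (card U)" and ?N = "card (ends ` distinct_pairs U U)" and ?P = "\<Prod>j\<in>U. fact (d j) :: real"
  obtain F where F: "F \<subseteq> ends ` distinct_pairs U U" "card F = m" "\<forall>j\<in>U. inc F j = d j"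
    using False by auto
  have sums: "(\<Sum>j\<in>U. d j) = 2 * m" using sum_inc_same[OF fin F(1)] F(2,3) by auto
  have U0: "card U > 0" using m by (auto intro: ccontr)
  have "real (2 * ?N) = real (card U * (card U - 1))" using card_ends_same[OF fin] by simp
  then have N2: "2 * real ?N = ?u * ?u - ?u" using U0 by (simp add: of_nat_diff algebra_simps)
  have "real (card U + 2 * m) < real (card U * card U)" using m by (simp only: of_nat_less_iff)
  then have D: "0 < ?u * ?u - ?u - 2 * real m" by simp
  then have mN: "m < ?N" using N2 by linarith
  have P: "?P > 0" by (intro prod_pos) auto
  have "real (card ?F * (fact m * 2 ^ m) * (\<Prod>j\<in>U. fact (d j))) \<le> real (fact (2 * m))"
    using card_degree_families_same[OF fin, of m d] by (simp only: of_nat_le_iff)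
  then have 1: "real (card ?F) * (fact m * 2 ^ m * ?P) \<le> fact (2 * m)" by (simp add: ac_simps)
  have 2: "(real ?N - real m) ^ m \<le> fact m * real (?N choose m)"
    using power_le_fact_binomial[of m ?N] mN by (simp add: of_nat_diff)
  have Nm: "real ?N - real m > 0" using mN by (simp only: of_nat_less_iff diff_gt_0_iff_gt)
  have C: "real (?N choose m) > 0" using mN by simp
  have fac: "2 ^ m * (real ?N - real m) ^ m = (?u * ?u - (?u + 2 * real m)) ^ m"
  proof -
    have "2 * (real ?N - real m) = ?u * ?u - (?u + 2 * real m)" using N2 by simp
    then show ?thesis by (simp only: power_mult_distrib[symmetric])
  qed
  have "real (card ?F) / real (?N choose m) \<le>
     (fact (2 * m) / (fact m * 2 ^ m * ?P)) / ((real ?N - real m) ^ m / fact m)"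
    using 1 2 P C Nm by (intro frac_le) (auto simp: field_simps)
  also have "\<dots> = fact (2 * m) / (2 ^ m * (real ?N - real m) ^ m * ?P)"
    by (simp add: field_simps)
  also have "\<dots> \<le> (exp 1 * (real (2 * m) + 1) * (real (2 * m) / exp 1) ^ (2 * m)) / (2 ^ m * (real ?N - real m) ^ m * ?P)"
    by (intro divide_right_mono fact_le_power_exp mult_nonneg_nonneg) (use Nm P in auto)
  also have "\<dots> = ?R"
  proof -
    define D' where "D' = ?u * ?u - (?u + 2 * real m)"
    have D'_eq: "real (card U * card U) - real (card U + 2 * m) = D'" by (simp add: D'_def)
    have e: "exp (- (real (2 * m) / ?u) * ?u) = 1 / exp 1 ^ (2 * m)"
      using U0 exp_of_nat_mult[of "2 * m" "1 :: real"] by (simp add: exp_minus inverse_eq_divide)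
    have u: "real (card U * card U) ^ m = ?u ^ (2 * m)" by (simp add: power_mult power2_eq_square)
    show ?thesis
      unfolding prod_poisson_weight[OF fin(1)] sums fac e D'_def[symmetric] D'_eq power_divide u
      using U0 by (simp add: ac_simps)
  qed
  finally show ?thesis .
qed

section \<open>Probability of containing a core: lower bounds\<close>

text \<open>By the coupling of uniform sets, an \<open>m\<close>-set contains a member of
  \<open>\<C>\<close> at least as often as a \<open>k\<close>-set is one.\<close>

lemma cover_probability_ge:
  assumes fin: "finite P" and C: "\<And>C. C \<in> \<C> \<Longrightarrow> C \<subseteq> P \<and> card C = k" and km: "k \<le> m" "m \<le> card P"
  shows "real (card \<C>) * fact k / real (card P) ^ k \<le>
    real (card {F. F \<subseteq> P \<and> card F = m \<and> (\<exists>C\<in>\<C>. C \<subseteq> F)}) / real (card P choose m)"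
proof -
  have "real (card \<C> * (card P choose m)) \<le>
    real (card {F. F \<subseteq> P \<and> card F = m \<and> (\<exists>C\<in>\<C>. C \<subseteq> F)} * (card P choose k))"
    using card_supersets_ge[OF assms] by (simp only: of_nat_le_iff)
  moreover have "real (card P choose m) > 0" "real (card P choose k) > 0" using km by auto
  ultimately have "real (card \<C>) / real (card P choose k) \<le>
    real (card {F. F \<subseteq> P \<and> card F = m \<and> (\<exists>C\<in>\<C>. C \<subseteq> F)}) / real (card P choose m)"
    by (simp add: field_simps)
  moreover have "real (card \<C>) * fact k / real (card P) ^ k \<le> real (card \<C>) / real (card P choose k)"
  proof -
    have "real (card \<C>) / (real (card P) ^ k / fact k) \<le> real (card \<C>) / real (card P choose k)"
    proof (intro divide_left_mono mult_pos_pos)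
      show "real (card P choose k) \<le> real (card P) ^ k / fact k"
        using fact_binomial_le_power[of k "card P"] by (simp add: field_simps)
      show "0 < real (card P choose k)" using km by simp
      show "0 < real (card P) ^ k / fact k" using km by (cases "k = 0") auto
    qed simp
    then show ?thesis by simp
  qed
  ultimately show ?thesis by linarith
qed

text \<open>The left side is the Poisson product of \<open>d\<close> with means
  \<open>k / card U\<close> and \<open>k / card V\<close>, but with the degree sums in the exponents
  replaced by the core size \<open>k\<close>.\<close>

lemma core_probability_ge_disjoint:
  assumes fin: "finite U" "finite V" and disj: "U \<inter> V = {}" and mN: "m \<le> card U * card V" and km: "k \<le> m"
    and bound: "\<And>j. j \<in> U \<union> V \<Longrightarrow> d j \<le> \<Delta>"
    and k: "k + (\<Delta> + 1) * \<Delta> \<le> (\<Sum>j\<in>U. d j)" "k + (\<Delta> + 1) * \<Delta> \<le> (\<Sum>j\<in>V. d j)"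
  shows "(real k / (exp 1 * card U)) ^ k * (real k / (exp 1 * card V)) ^ k /
      ((\<Prod>j\<in>U. fact (d j)) * (\<Prod>j\<in>V. fact (d j))) \<le>
    real (card {F. F \<subseteq> ends ` distinct_pairs U V \<and> card F = m \<and>
        (\<exists>C. C \<subseteq> F \<and> card C = k \<and> (\<forall>j\<in>U\<union>V. inc C j \<le> d j))}) /
      real (card U * card V choose m)"
proof -
  let ?R = "ends ` distinct_pairs U V" and ?P = "\<Prod>j\<in>U\<union>V. fact (d j) :: real"
  let ?C = "{F. F \<subseteq> ?R \<and> card F = k \<and> (\<forall>j\<in>U\<union>V. inc F j \<le> d j)}"
  have cR: "card ?R = card U * card V" by (rule card_ends_disjoint[OF disj])
  have finR: "finite ?R" using fin finite_distinct_pairs by blast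
  have P: "?P > 0" by (intro prod_pos) auto
  have "real (fact k * fact k) \<le> real (card ?C * fact k * (\<Prod>j\<in>U\<union>V. fact (d j)))"
    using card_subdegree_families_disjoint[OF fin disj bound k] by (simp only: of_nat_le_iff)
  then have "fact k * fact k \<le> real (card ?C) * ?P * fact k" by (simp add: ac_simps)
  then have "fact k / ?P \<le> real (card ?C)" using P by (simp add: field_simps)
  then have "fact k / ?P * fact k / real (card ?R) ^ k \<le> real (card ?C) * fact k / real (card ?R) ^ k"
    by (intro divide_right_mono mult_right_mono) auto
  also have "\<dots> \<le> real (card {F. F \<subseteq> ?R \<and> card F = m \<and> (\<exists>C\<in>?C. C \<subseteq> F)}) / real (card ?R choose m)"
    by (rule cover_probability_ge[OF finR]) (use km mN cR in auto)
  also have "{F. F \<subseteq> ?R \<and> card F = m \<and> (\<exists>C\<in>?C. C \<subseteq> F)} =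
      {F. F \<subseteq> ?R \<and> card F = m \<and> (\<exists>C. C \<subseteq> F \<and> card C = k \<and> (\<forall>j\<in>U\<union>V. inc C j \<le> d j))}"
    by blast
  finally have *: "fact k / ?P * fact k / real (card ?R) ^ k \<le>
     real (card {F. F \<subseteq> ?R \<and> card F = m \<and> (\<exists>C. C \<subseteq> F \<and> card C = k \<and> (\<forall>j\<in>U\<union>V. inc C j \<le> d j))}) /
      real (card ?R choose m)" .
  have "(real k / (exp 1 * card U)) ^ k * (real k / (exp 1 * card V)) ^ k / ?P =
     (real k / exp 1) ^ k / ?P * (real k / exp 1) ^ k / real (card ?R) ^ k"
    by (simp add: cR power_divide power_mult_distrib)
  also have "\<dots> \<le> fact k / ?P * fact k / real (card ?R) ^ k"
    by (intro divide_right_mono mult_mono power_le_fact_exp) (use P in auto)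
  finally show ?thesis using * unfolding cR prod.union_disjoint[OF fin disj] by linarith
qed

lemma core_probability_ge_same:
  assumes fin: "finite U" and mN: "m \<le> card (ends ` distinct_pairs U U)" and km: "k \<le> m"
    and bound: "\<And>j. j \<in> U \<Longrightarrow> d j \<le> \<Delta>"
    and k: "2 * k + (\<Delta> + 1) * \<Delta> \<le> (\<Sum>j\<in>U. d j)"
  shows "(real (2 * k) / (exp 1 * card U)) ^ (2 * k) / (\<Prod>j\<in>U. fact (d j)) \<le>
    real (card {F. F \<subseteq> ends ` distinct_pairs U U \<and> card F = m \<and>
        (\<exists>C. C \<subseteq> F \<and> card C = k \<and> (\<forall>j\<in>U. inc C j \<le> d j))}) /
      real (card (ends ` distinct_pairs U U) choose m)"
proof -
  let ?R = "ends ` distinct_pairs U U" and ?P = "\<Prod>j\<in>U. fact (d j) :: real"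
  let ?C = "{F. F \<subseteq> ?R \<and> card F = k \<and> (\<forall>j\<in>U. inc F j \<le> d j)}"
  have finR: "finite ?R" using fin finite_distinct_pairs by blast
  have P: "?P > 0" by (intro prod_pos) auto
  have "real (fact (2 * k)) \<le> real (card ?C * (fact k * 2 ^ k) * (\<Prod>j\<in>U. fact (d j)))"
    using card_subdegree_families_same[OF fin bound k] by (simp only: of_nat_le_iff)
  then have "fact (2 * k) / (2 ^ k * ?P) \<le> real (card ?C) * fact k" using P by (simp add: field_simps)
  then have "fact (2 * k) / (2 ^ k * ?P) / real (card ?R) ^ k \<le> real (card ?C) * fact k / real (card ?R) ^ k"
    by (intro divide_right_mono) auto
  also have "\<dots> \<le> real (card {F. F \<subseteq> ?R \<and> card F = m \<and> (\<exists>C\<in>?C. C \<subseteq> F)}) / real (card ?R choose m)"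
    by (rule cover_probability_ge[OF finR]) (use km mN in auto)
  also have "{F. F \<subseteq> ?R \<and> card F = m \<and> (\<exists>C\<in>?C. C \<subseteq> F)} =
      {F. F \<subseteq> ?R \<and> card F = m \<and> (\<exists>C. C \<subseteq> F \<and> card C = k \<and> (\<forall>j\<in>U. inc C j \<le> d j))}"
    by blast
  finally have *: "fact (2 * k) / (2 ^ k * ?P) / real (card ?R) ^ k \<le>
     real (card {F. F \<subseteq> ?R \<and> card F = m \<and> (\<exists>C. C \<subseteq> F \<and> card C = k \<and> (\<forall>j\<in>U. inc C j \<le> d j))}) /
      real (card ?R choose m)" .
  show ?thesis
  proof (cases "k = 0")
    case True
    then show ?thesis using * by simp
  next
    case False
    then have "card ?R > 0" using km mN by linarith
    then have R0: "real (card ?R) > 0" by simp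
    \<comment> \<open>A pool holds at most half of the ordered pairs; this factor 2 offsets the
      \<open>2 ^ k\<close> orientations of the core.\<close>
    have "real (2 * card ?R) \<le> real (card U * card U)"
      unfolding card_ends_same[OF fin] of_nat_le_iff by simp
    then have R: "2 * real (card ?R) \<le> (real (card U))\<^sup>2" by (simp add: power2_eq_square)
    have "(real (2 * k) / (exp 1 * card U)) ^ (2 * k) / ?P =
       (real (2 * k) / exp 1) ^ (2 * k) / ?P / ((real (card U))\<^sup>2) ^ k"
      by (simp add: power_divide power_mult_distrib power_mult)
    also have "\<dots> \<le> fact (2 * k) / ?P / (2 * real (card ?R)) ^ k"
      by (intro frac_le divide_right_mono power_le_fact_exp power_mono R) (use P R0 in auto)
    also have "\<dots> = fact (2 * k) / (2 ^ k * ?P) / real (card ?R) ^ k"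
      by (simp add: power_mult_distrib)
    finally show ?thesis using * by linarith
  qed
qed

section \<open>The corrections are subexponential\<close>

lemma power_ratio_le_exp:
  fixes N s :: real
  assumes "0 \<le> s" "s < N"
  shows "(N / (N - s)) ^ m \<le> exp (real m * (s / (N - s)))"
proof -
  have "N / (N - s) = 1 + s / (N - s)" using assms by (simp add: field_simps)
  also have "\<dots> \<le> exp (s / (N - s))" by (rule exp_ge_add_one_self)
  finally have "(N / (N - s)) ^ m \<le> exp (s / (N - s)) ^ m" using assms by (intro power_mono) auto
  then show ?thesis by (simp only: exp_of_nat_mult)
qed

text \<open>Pools grow quadratically while edge numbers and shifts grow linearly, so the power stays
  below the constant \<open>exp (2 * M\<^sup>2 / c)\<close> and only the polynomial prefactor grows.
  The latter is squared and taken at \<open>2 * m n\<close> so as to dominate the prefactors for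
  both kinds of pools.\<close>

lemma correction_subexponential:
  fixes m :: "nat \<Rightarrow> nat" and s N :: "nat \<Rightarrow> real"
  assumes c: "c > 0" and M: "M > 0" and \<epsilon>: "\<epsilon> > 0"
    and m: "\<forall>\<^sub>F n in sequentially. real (m n) \<le> M * real n"
    and s: "\<forall>\<^sub>F n in sequentially. 0 \<le> s n \<and> s n \<le> M * real n"
    and N: "\<forall>\<^sub>F n in sequentially. c * (real n)\<^sup>2 \<le> N n"
  shows "\<forall>\<^sub>F n in sequentially. s n < N n \<and>
    (exp 1 * (real (2 * m n) + 1))\<^sup>2 * (N n / (N n - s n)) ^ m n \<le> exp (\<epsilon> * real n)"
proof -
  have 1: "\<forall>\<^sub>F n in sequentially. M * real n < c / 2 * (real n)\<^sup>2" using c M by real_asymp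
  have 2: "\<forall>\<^sub>F n in sequentially. 2 + 2 * ln (2 * M * real n + 1) + 2 * M\<^sup>2 / c \<le> \<epsilon> * real n"
    using c M \<epsilon> by real_asymp
  show ?thesis
    using m s N 1 2 eventually_gt_at_top[of 0]
  proof eventually_elim
    case (elim n)
    have n: "real n > 0" using elim by simp
    have Ns: "c / 2 * (real n)\<^sup>2 \<le> N n - s n" using elim by (simp add: field_simps)
    have pos: "0 < c / 2 * (real n)\<^sup>2" using n c by simp
    have "real (m n) * (s n / (N n - s n)) \<le> (M * real n) * (M * real n / (c / 2 * (real n)\<^sup>2))"
      using elim Ns pos M n by (intro mult_mono frac_le) auto
    also have "\<dots> = 2 * M\<^sup>2 / c" using n c by (simp add: power2_eq_square field_simps)
    finally have a: "real (m n) * (s n / (N n - s n)) \<le> 2 * M\<^sup>2 / c" .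
    have "(N n / (N n - s n)) ^ m n \<le> exp (real (m n) * (s n / (N n - s n)))"
      using elim Ns pos by (intro power_ratio_le_exp) auto
    also have "\<dots> \<le> exp (2 * M\<^sup>2 / c)" using a by simp
    finally have b: "(N n / (N n - s n)) ^ m n \<le> exp (2 * M\<^sup>2 / c)" .
    have p: "2 * M * real n + 1 > 0" using n M by (simp add: add_pos_pos)
    have "(exp 1 * (real (2 * m n) + 1))\<^sup>2 \<le> (exp 1 * (2 * M * real n + 1))\<^sup>2"
      using elim by (intro power_mono mult_left_mono) auto
    also have "\<dots> = exp (1 + ln (2 * M * real n + 1)) ^ 2" using p by (simp add: exp_add)
    also have "\<dots> = exp (2 + 2 * ln (2 * M * real n + 1))"
      by (simp add: exp_of_nat_mult[symmetric] power2_eq_square exp_add[symmetric])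
    finally have d: "(exp 1 * (real (2 * m n) + 1))\<^sup>2 \<le> exp (2 + 2 * ln (2 * M * real n + 1))" .
    have "(exp 1 * (real (2 * m n) + 1))\<^sup>2 * (N n / (N n - s n)) ^ m n \<le>
        exp (2 + 2 * ln (2 * M * real n + 1)) * exp (2 * M\<^sup>2 / c)"
      using b d Ns pos elim by (intro mult_mono zero_le_power divide_nonneg_nonneg) auto
    also have "\<dots> \<le> exp (\<epsilon> * real n)" using elim by (simp add: exp_add[symmetric])
    finally show ?case using Ns pos by auto
  qed
qed

section \<open>Degrees of the typed graph\<close>

definition nodes_of :: "nat \<Rightarrow> (nat \<Rightarrow> 'b) \<Rightarrow> 'b \<Rightarrow> nat set" where
  "nodes_of n t a = {j. j < n \<and> t j = a}"

text \<open>The coordinates \<open>(j, b)\<close> of a degree vector to which the edges of the pool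
  \<open>A\<close> contribute. The slots of the different type pairs partition all
  coordinates.\<close>

definition slots :: "nat \<Rightarrow> (nat \<Rightarrow> 'b::finite) \<Rightarrow> 'b set \<Rightarrow> (nat \<times> 'b) set" where
  "slots n t A = {(j, b). j < n \<and> {t j, b} = A}"

definition degree_vector :: "nat \<Rightarrow> (nat \<Rightarrow> 'b) \<Rightarrow> nat set set \<Rightarrow> nat \<Rightarrow> 'b \<Rightarrow> nat" where
  "degree_vector n t E j b = card {i \<in> {..<n}. t i = b \<and> {i, j} \<in> E}"

lemma finite_nodes_of [simp]: "finite (nodes_of n t a)"
  by (simp add: nodes_of_def)

lemma nodes_of_disjoint: "a \<noteq> b \<Longrightarrow> nodes_of n t a \<inter> nodes_of n t b = {}"
  by (auto simp: nodes_of_def)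

lemma finite_slots [simp]: "finite (slots n t A)"
  by (rule finite_subset[of _ "{..<n} \<times> UNIV"]) (auto simp: slots_def)

lemma type_pairs_cases:
  assumes "A \<in> type_pairs" obtains a b where "A = {a, b}"
  using assms by (auto simp: type_pairs_def)

lemma doubleton_in_type_pairs [simp]: "{a, b} \<in> type_pairs" "{a} \<in> type_pairs"
  by (auto simp: type_pairs_def)

lemma slots_eq:
  "slots n t {a, b} = (\<lambda>j. (j, b)) ` nodes_of n t a \<union> (\<lambda>j. (j, a)) ` nodes_of n t b"
  by (auto simp: slots_def nodes_of_def doubleton_eq_iff)

lemma sum_slots_disjoint:
  assumes "a \<noteq> b"
  shows "(\<Sum>x\<in>slots n t {a, b}. f x) = (\<Sum>j\<in>nodes_of n t a. f (j, b)) + (\<Sum>j\<in>nodes_of n t b. f (j, a))"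
  unfolding slots_eq
  by (subst sum.union_disjoint) (use assms in \<open>auto simp: sum.reindex inj_on_def\<close>)

lemma prod_slots_disjoint:
  assumes "a \<noteq> b"
  shows "(\<Prod>x\<in>slots n t {a, b}. f x) = (\<Prod>j\<in>nodes_of n t a. f (j, b)) * (\<Prod>j\<in>nodes_of n t b. f (j, a))"
  unfolding slots_eq
  by (subst prod.union_disjoint) (use assms in \<open>auto simp: prod.reindex inj_on_def\<close>)

lemma slots_same: "slots n t {a} = (\<lambda>j. (j, a)) ` nodes_of n t a"
  using slots_eq[of n t a a] by simp

lemma sum_slots_same: "(\<Sum>x\<in>slots n t {a}. f x) = (\<Sum>j\<in>nodes_of n t a. f (j, a))"
  unfolding slots_same by (auto simp: sum.reindex inj_on_def)

lemma prod_slots_same: "(\<Prod>x\<in>slots n t {a}. f x) = (\<Prod>j\<in>nodes_of n t a. f (j, a))"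
  unfolding slots_same by (auto simp: prod.reindex inj_on_def)

text \<open>As the slots partition the coordinates, bounds for the independent pools multiply to a
  bound for the whole degree vector.\<close>

lemma prod_type_pairs_slots:
  "(\<Prod>A\<in>type_pairs. \<Prod>x\<in>slots n t A. f x) = (\<Prod>j<n. \<Prod>b\<in>UNIV. f (j, b))"
proof -
  have "(\<Prod>A\<in>type_pairs. \<Prod>x\<in>slots n t A. f x) =
      (\<Prod>A\<in>type_pairs. \<Prod>x\<in>{x \<in> {..<n} \<times> UNIV. {t (fst x), snd x} = A}. f x)"
    by (intro prod.cong) (auto simp: slots_def)
  also have "\<dots> = (\<Prod>x\<in>{..<n} \<times> UNIV. f x)" by (rule prod.group) auto
  finally show ?thesis by (simp add: prod.cartesian_product)
qed

lemma sum_type_pairs_slots: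
  "(\<Sum>A\<in>type_pairs. \<Sum>x\<in>slots n t A. f x) = (\<Sum>j<n. \<Sum>b\<in>UNIV. f (j, b))"
proof -
  have "(\<Sum>A\<in>type_pairs. \<Sum>x\<in>slots n t A. f x) =
      (\<Sum>A\<in>type_pairs. \<Sum>x\<in>{x \<in> {..<n} \<times> UNIV. {t (fst x), snd x} = A}. f x)"
    by (intro sum.cong) (auto simp: slots_def)
  also have "\<dots> = (\<Sum>x\<in>{..<n} \<times> UNIV. f x)" by (rule sum.group) auto
  finally show ?thesis by (simp add: sum.cartesian_product)
qed

lemma pool_eq: "pool n t {a, b} = ends ` distinct_pairs (nodes_of n t a) (nodes_of n t b)"
proof (intro set_eqI iffI)
  fix e assume e: "e \<in> pool n t {a, b}"
  then obtain i j where ij: "e = {i, j}" "i \<noteq> j" by (auto simp: pool_def card_2_iff)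
  then have "t i = a \<and> t j = b \<or> t i = b \<and> t j = a" "i < n" "j < n"
    using e by (auto simp: pool_def doubleton_eq_iff)
  then have "(i, j) \<in> distinct_pairs (nodes_of n t a) (nodes_of n t b) \<or>
      (j, i) \<in> distinct_pairs (nodes_of n t a) (nodes_of n t b)"
    using ij by (auto simp: distinct_pairs_def nodes_of_def)
  then show "e \<in> ends ` distinct_pairs (nodes_of n t a) (nodes_of n t b)"
    using ij by (force simp: ends_def insert_commute)
next
  fix e assume "e \<in> ends ` distinct_pairs (nodes_of n t a) (nodes_of n t b)"
  then show "e \<in> pool n t {a, b}" by (auto simp: pool_def ends_def distinct_pairs_def nodes_of_def)
qed

lemma finite_pool [simp]: "finite (pool n t A)"
  by (rule finite_subset[of _ "Pow {..<n}"]) (auto simp: pool_def)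

lemma finite_edge_choices [simp]: "finite (edge_choices n \<omega> t A)"
  by (rule finite_subset[of _ "Pow (pool n t A)"]) (auto simp: edge_choices_def)

text \<open>An edge in another pool joins other types, hence only \<open>F {t j, b}\<close> can link
  \<open>j\<close> to nodes of type \<open>b\<close>.\<close>

lemma degree_vector_eq_inc:
  assumes F: "\<And>A. A \<in> type_pairs \<Longrightarrow> F A \<subseteq> pool n t A" and j: "j < n"
  shows "degree_vector n t (\<Union>A\<in>type_pairs. F A) j b = inc (F {t j, b}) j"
proof -
  let ?E = "\<Union>A\<in>type_pairs. F A"
  have "bij_betw (\<lambda>i. {i, j}) {i \<in> {..<n}. t i = b \<and> {i, j} \<in> ?E} {e \<in> F {t j, b}. j \<in> e}"
  proof (rule bij_betw_imageI)
    show "inj_on (\<lambda>i. {i, j}) {i \<in> {..<n}. t i = b \<and> {i, j} \<in> ?E}"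
      by (auto simp: inj_on_def doubleton_eq_iff)
    show "(\<lambda>i. {i, j}) ` {i \<in> {..<n}. t i = b \<and> {i, j} \<in> ?E} = {e \<in> F {t j, b}. j \<in> e}"
    proof (intro set_eqI iffI)
      fix e assume "e \<in> (\<lambda>i. {i, j}) ` {i \<in> {..<n}. t i = b \<and> {i, j} \<in> ?E}"
      then obtain i A where i: "e = {i, j}" "t i = b" "A \<in> type_pairs" "{i, j} \<in> F A" by blast
      then have "t ` {i, j} = A" using F[of A] by (auto simp: pool_def)
      then have "A = {t j, b}" using i by auto
      then show "e \<in> {e \<in> F {t j, b}. j \<in> e}" using i by simp
    next
      fix e assume e: "e \<in> {e \<in> F {t j, b}. j \<in> e}"
      then have p: "e \<in> pool n t {t j, b}" using F[of "{t j, b}"] by auto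
      then obtain i where i: "e = {i, j}" "i \<noteq> j"
        using e by (auto simp: pool_def card_2_iff insert_commute)
      then have "t i = b" "i < n" using p by (auto simp: pool_def doubleton_eq_iff)
      moreover have "{i, j} \<in> ?E" using e i doubleton_in_type_pairs(1)[of "t j" b] by blast
      ultimately show "e \<in> (\<lambda>i. {i, j}) ` {i \<in> {..<n}. t i = b \<and> {i, j} \<in> ?E}" using i by blast
    qed
  qed
  then show ?thesis unfolding degree_vector_def inc_def by (rule bij_betw_same_card)
qed

section \<open>Independence of the pools\<close>

text \<open>The pools are drawn independently, so an event that forces \<open>F A \<in> Y A\<close>
  for every \<open>A\<close> costs at most the product of the uniform probabilities. The implication
  is required only for admissible choices, which carry all the mass.\<close>

lemma prob_edge_law_le:
  assumes ne: "\<And>A. A \<in> type_pairs \<Longrightarrow> edge_choices n \<omega> t A \<noteq> {}"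
    and sub: "\<And>F. (\<And>A. A \<in> type_pairs \<Longrightarrow> F A \<in> edge_choices n \<omega> t A) \<Longrightarrow> (\<Union>A\<in>type_pairs. F A) \<in> X \<Longrightarrow>
        (\<forall>A\<in>type_pairs. F A \<in> Y A)"
  shows "measure_pmf.prob (edge_law n \<omega> t) X \<le>
    (\<Prod>A\<in>type_pairs. real (card (edge_choices n \<omega> t A \<inter> Y A)) / real (card (edge_choices n \<omega> t A)))"
proof -
  let ?P = "Pi_pmf type_pairs {} (\<lambda>A. pmf_of_set (edge_choices n \<omega> t A))"
  have "measure_pmf.prob (edge_law n \<omega> t) X = measure_pmf.prob ?P ((\<lambda>F. \<Union>A\<in>type_pairs. F A) -` X)"
    by (simp add: edge_law_def)
  also have "\<dots> \<le> measure_pmf.prob ?P (Pi type_pairs Y)"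
  proof (rule measure_pmf.finite_measure_mono_AE)
    show "AE F in measure_pmf ?P. F \<in> (\<lambda>F. \<Union>A\<in>type_pairs. F A) -` X \<longrightarrow> F \<in> Pi type_pairs Y"
    proof (rule AE_pmfI, rule impI)
      fix F assume F: "F \<in> set_pmf ?P" "F \<in> (\<lambda>F. \<Union>A\<in>type_pairs. F A) -` X"
      then have "F A \<in> edge_choices n \<omega> t A" if "A \<in> type_pairs" for A
        using that ne by (auto simp: set_Pi_pmf PiE_dflt_def)
      then show "F \<in> Pi type_pairs Y" using sub[of F] F(2) by auto
    qed
  qed simp
  also have "\<dots> = (\<Prod>A\<in>type_pairs. measure_pmf.prob (pmf_of_set (edge_choices n \<omega> t A)) (Y A))"
    by (rule measure_Pi_pmf_Pi) simp
  also have "\<dots> = (\<Prod>A\<in>type_pairs. real (card (edge_choices n \<omega> t A \<inter> Y A)) / real (card (edge_choices n \<omega> t A)))"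
    by (intro prod.cong refl measure_pmf_of_set ne) auto
  finally show ?thesis .
qed

lemma prob_edge_law_ge:
  assumes ne: "\<And>A. A \<in> type_pairs \<Longrightarrow> edge_choices n \<omega> t A \<noteq> {}"
    and sub: "\<And>F. (\<And>A. A \<in> type_pairs \<Longrightarrow> F A \<in> edge_choices n \<omega> t A \<inter> Y A) \<Longrightarrow> (\<Union>A\<in>type_pairs. F A) \<in> X"
  shows "(\<Prod>A\<in>type_pairs. real (card (edge_choices n \<omega> t A \<inter> Y A)) / real (card (edge_choices n \<omega> t A))) \<le>
    measure_pmf.prob (edge_law n \<omega> t) X"
proof -
  let ?P = "Pi_pmf type_pairs {} (\<lambda>A. pmf_of_set (edge_choices n \<omega> t A))"
  have "(\<Prod>A\<in>type_pairs. real (card (edge_choices n \<omega> t A \<inter> Y A)) / real (card (edge_choices n \<omega> t A))) =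
      (\<Prod>A\<in>type_pairs. measure_pmf.prob (pmf_of_set (edge_choices n \<omega> t A)) (Y A))"
    by (intro prod.cong refl measure_pmf_of_set[symmetric] ne) auto
  also have "\<dots> = measure_pmf.prob ?P (Pi type_pairs Y)"
    by (rule measure_Pi_pmf_Pi[symmetric]) simp
  also have "\<dots> \<le> measure_pmf.prob ?P ((\<lambda>F. \<Union>A\<in>type_pairs. F A) -` X)"
  proof (rule measure_pmf.finite_measure_mono_AE)
    show "AE F in measure_pmf ?P. F \<in> Pi type_pairs Y \<longrightarrow> F \<in> (\<lambda>F. \<Union>A\<in>type_pairs. F A) -` X"
    proof (rule AE_pmfI, rule impI)
      fix F assume F: "F \<in> set_pmf ?P" "F \<in> Pi type_pairs Y"
      then have "F A \<in> edge_choices n \<omega> t A \<inter> Y A" if "A \<in> type_pairs" for A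
        using that ne by (auto simp: set_Pi_pmf PiE_dflt_def)
      then show "F \<in> (\<lambda>F. \<Union>A\<in>type_pairs. F A) -` X" using sub[of F] by auto
    qed
  qed simp
  also have "\<dots> = measure_pmf.prob (edge_law n \<omega> t) X"
    by (simp add: edge_law_def)
  finally show ?thesis .
qed

text \<open>The floor serves to have a natural number for every \<open>\<omega>\<close>; on lattice
  pairs nothing is rounded.\<close>

definition edge_number :: "nat \<Rightarrow> ('b::finite \<Rightarrow> 'b \<Rightarrow> real) \<Rightarrow> 'b \<Rightarrow> 'b \<Rightarrow> nat" where
  "edge_number n \<omega> a b = nat \<lfloor>(if a = b then real n / 2 else real n) * \<omega> a b\<rfloor>"

lemma real_edge_number:
  assumes "\<omega> \<in> lattice_pairs n"
  shows "real (edge_number n \<omega> a b) = (if a = b then real n / 2 else real n) * \<omega> a b"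
proof -
  have "real n / (1 + (if a = b then 1 else 0)) * \<omega> a b \<in> \<nat>" using assms by (auto simp: lattice_pairs_def)
  then have "(if a = b then real n / 2 else real n) * \<omega> a b \<in> \<nat>" by (auto split: if_splits)
  then obtain k where "(if a = b then real n / 2 else real n) * \<omega> a b = real k" by (rule Nats_cases)
  then show ?thesis by (simp add: edge_number_def)
qed

text \<open>A type pair has several representations \<open>{a', b'}\<close>; by the symmetry of
  \<open>\<omega>\<close> they all impose the same edge number.\<close>

lemma edge_choices_eq:
  assumes \<omega>: "\<omega> \<in> lattice_pairs n"
  shows "edge_choices n \<omega> t {a, b} = {F. F \<subseteq> pool n t {a, b} \<and> card F = edge_number n \<omega> a b}"
proof -
  have sym: "\<omega> a b = \<omega> b a" using \<omega> by (auto simp: lattice_pairs_def sym_measures_def)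
  have "(\<forall>a' b'. {a, b} = {a', b'} \<longrightarrow> real (card F) = (if a' = b' then real n / 2 else real n) * \<omega> a' b') \<longleftrightarrow>
      real (card F) = (if a = b then real n / 2 else real n) * \<omega> a b" for F :: "nat set set"
    using sym by (auto simp: doubleton_eq_iff)
  then show ?thesis
    unfolding edge_choices_def real_edge_number[OF \<omega>, symmetric] by auto
qed

lemma arrangement_card:
  assumes "t \<in> arrangements n \<rho>"
  shows "real (card (nodes_of n t a)) = real n * pmf \<rho> a"
proof -
  have "nodes_of n t a = {j \<in> {..<n}. t j = a}" by (auto simp: nodes_of_def)
  then show ?thesis using assms by (simp add: arrangements_def)
qed

lemma ball_slots:
  "(\<forall>x\<in>slots n t {a, b}. P x) \<longleftrightarrow> (\<forall>j\<in>nodes_of n t a. P (j, b)) \<and> (\<forall>j\<in>nodes_of n t b. P (j, a))"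
  unfolding slots_eq by blast

section \<open>Bounds uniform in the arrangement, along a convergent sequence\<close>

text \<open>Convergence of the type laws is assumed weight by weight, the form in which every
  estimate uses it.\<close>

locale type_sequence =
  fixes \<rho> :: "'b::finite pmf" and \<rho>n :: "nat \<Rightarrow> 'b pmf"
    and \<omega> :: "'b \<Rightarrow> 'b \<Rightarrow> real" and \<omega>n :: "nat \<Rightarrow> 'b \<Rightarrow> 'b \<Rightarrow> real"
  assumes pmf_pos: "\<And>a. 0 < pmf \<rho> a"
    and \<omega>: "\<omega> \<in> sym_measures"
    and lattice_\<rho>: "\<And>n. 1 \<le> n \<Longrightarrow> \<rho>n n \<in> lattice_types n"
    and lattice_\<omega>: "\<And>n. 1 \<le> n \<Longrightarrow> \<omega>n n \<in> lattice_pairs n"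
    and tendsto_\<rho>: "\<And>a. (\<lambda>n. pmf (\<rho>n n) a) \<longlonglongrightarrow> pmf \<rho> a"
    and tendsto_\<omega>: "\<And>a b. (\<lambda>n. \<omega>n n a b) \<longlonglongrightarrow> \<omega> a b"
begin

lemma \<omega>_nonneg: "0 \<le> \<omega> a b" and \<omega>_commute: "\<omega> a b = \<omega> b a"
  using \<omega> by (auto simp: sym_measures_def)

lemma \<omega>n_nonneg: "1 \<le> n \<Longrightarrow> 0 \<le> \<omega>n n a b" and \<omega>n_commute: "1 \<le> n \<Longrightarrow> \<omega>n n a b = \<omega>n n b a"
  using lattice_\<omega>[of n] by (auto simp: lattice_pairs_def sym_measures_def)

lemma eventually_\<omega>n_le: "\<forall>\<^sub>F n in sequentially. \<omega>n n a b \<le> \<omega> a b + 1"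
  using order_tendstoD(2)[OF tendsto_\<omega>[of a b], of "\<omega> a b + 1"] by (auto elim!: eventually_mono)

lemma eventually_\<rho>n_ge: "\<forall>\<^sub>F n in sequentially. pmf \<rho> a / 2 \<le> pmf (\<rho>n n) a"
  using order_tendstoD(1)[OF tendsto_\<rho>[of a], of "pmf \<rho> a / 2"] pmf_pos[of a]
  by (auto elim!: eventually_mono)

abbreviation "choices n t A \<equiv> edge_choices n (\<omega>n n) t A"

text \<open>The mean is the average degree at size \<open>n\<close> itself, which the prescribed
  edge number realises exactly. So the convergence of \<open>\<omega>n\<close> and
  \<open>\<rho>n\<close> contributes no error to the comparison of degree probabilities.\<close>

abbreviation "weight n t d x \<equiv>
  poisson_weight (\<omega>n n (t (fst x)) (snd x) / pmf (\<rho>n n) (t (fst x))) (d (fst x) (snd x))"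

text \<open>The bound for fixed node sets involves the arrangement only through the class sizes,
  which are prescribed; hence uniformity in \<open>t\<close> and \<open>d\<close>.\<close>

lemma degree_probability_disjoint:
  assumes ab: "a \<noteq> b" and \<epsilon>: "0 < \<epsilon>"
  shows "\<forall>\<^sub>F n in sequentially. \<forall>t\<in>arrangements n (\<rho>n n). \<forall>d. choices n t {a, b} \<noteq> {} \<and>
    real (card (choices n t {a, b} \<inter> {F. \<forall>x\<in>slots n t {a, b}. inc F (fst x) = d (fst x) (snd x)})) /
      real (card (choices n t {a, b})) \<le>
    exp (\<epsilon> * real n) * (\<Prod>x\<in>slots n t {a, b}. weight n t d x)"
proof -
  let ?m = "\<lambda>n. edge_number n (\<omega>n n) a b"
  let ?N = "\<lambda>n. (real n * pmf (\<rho>n n) a) * (real n * pmf (\<rho>n n) b)"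
  define c where "c = (pmf \<rho> a / 2) * (pmf \<rho> b / 2)"
  define M where "M = \<omega> a b + 1"
  have c: "c > 0" and M: "M > 0" using pmf_pos \<omega>_nonneg[of a b] by (auto simp: c_def M_def)
  have m: "\<forall>\<^sub>F n in sequentially. real (?m n) \<le> M * real n"
    using eventually_\<omega>n_le[of a b] eventually_ge_at_top[of 1]
    by eventually_elim (use ab lattice_\<omega> in \<open>auto simp: real_edge_number M_def mult.commute mult_left_mono\<close>)
  have N: "\<forall>\<^sub>F n in sequentially. c * (real n)\<^sup>2 \<le> ?N n"
    using eventually_\<rho>n_ge[of a] eventually_\<rho>n_ge[of b]
  proof eventually_elim
    case (elim n)
    then have "c * (real n * real n) \<le> (pmf (\<rho>n n) a * pmf (\<rho>n n) b) * (real n * real n)"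
      unfolding c_def using pmf_pos by (intro mult_right_mono mult_mono) (auto simp: less_imp_le)
    then show ?case by (simp add: power2_eq_square ac_simps)
  qed
  have "\<forall>\<^sub>F n in sequentially. real (?m n) < ?N n \<and>
    (exp 1 * (real (2 * ?m n) + 1))\<^sup>2 * (?N n / (?N n - real (?m n))) ^ ?m n \<le> exp (\<epsilon> * real n)"
    by (rule correction_subexponential[OF c M \<epsilon> m _ N]) (use m in \<open>auto elim!: eventually_mono\<close>)
  then show ?thesis
    using eventually_ge_at_top[of 1]
  proof eventually_elim
    case (elim n)
    note lat = lattice_\<omega>[OF elim(2)]
    show ?case
    proof (intro ballI allI)
      fix t and d :: "nat \<Rightarrow> 'b \<Rightarrow> nat" assume t: "t \<in> arrangements n (\<rho>n n)"
      let ?U = "nodes_of n t a" and ?V = "nodes_of n t b"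
      \<comment> \<open>An edge of this pool raises coordinate \<open>b\<close> at its node of type
        \<open>a\<close> and coordinate \<open>a\<close> at its node of type \<open>b\<close>;
        \<open>d'\<close> selects the relevant coordinate.\<close>
      define d' where "d' j = d j (if t j = a then b else a)" for j
      have U: "real (card ?U) = real n * pmf (\<rho>n n) a" "real (card ?V) = real n * pmf (\<rho>n n) b"
        using arrangement_card[OF t] by auto
      then have N_eq: "real (card ?U * card ?V) = ?N n" by simp
      have mN: "?m n < card ?U * card ?V" using elim(1) unfolding N_eq[symmetric] of_nat_less_iff by simp
      have disj: "?U \<inter> ?V = {}" using ab by (rule nodes_of_disjoint)
      have ch: "choices n t {a, b} = {F. F \<subseteq> ends ` distinct_pairs ?U ?V \<and> card F = ?m n}"
        unfolding edge_choices_eq[OF lat] pool_eq ..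
      have cch: "card (choices n t {a, b}) = card ?U * card ?V choose ?m n"
        unfolding ch by (subst n_subsets) (auto simp: card_ends_disjoint[OF disj] finite_distinct_pairs)
      then have "0 < card (choices n t {a, b})" using mN by simp
      then have ne: "choices n t {a, b} \<noteq> {}" by (rule card_gt_0_iff[THEN iffD1, THEN conjunct1])
      have ev: "choices n t {a, b} \<inter> {F. \<forall>x\<in>slots n t {a, b}. inc F (fst x) = d (fst x) (snd x)} =
          {F. F \<subseteq> ends ` distinct_pairs ?U ?V \<and> card F = ?m n \<and> (\<forall>j\<in>?U\<union>?V. inc F j = d' j)}"
        unfolding ch ball_slots using ab by (auto simp: d'_def nodes_of_def)
      have U0: "card ?U \<noteq> 0" "card ?V \<noteq> 0" using mN by auto
      have "real (card (choices n t {a, b} \<inter> {F. \<forall>x\<in>slots n t {a, b}. inc F (fst x) = d (fst x) (snd x)})) /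
          real (card (choices n t {a, b})) \<le>
        (exp 1 * (real (?m n) + 1))\<^sup>2 * (real (card ?U * card ?V) / (real (card ?U * card ?V) - real (?m n))) ^ ?m n *
         ((\<Prod>j\<in>?U. poisson_weight (real (?m n) / card ?U) (d' j)) * (\<Prod>j\<in>?V. poisson_weight (real (?m n) / card ?V) (d' j)))"
        unfolding ev cch by (rule degree_probability_le_disjoint[OF _ _ disj mN]) auto
      also have "(\<Prod>j\<in>?U. poisson_weight (real (?m n) / card ?U) (d' j)) * (\<Prod>j\<in>?V. poisson_weight (real (?m n) / card ?V) (d' j)) =
          (\<Prod>x\<in>slots n t {a, b}. weight n t d x)"
      proof -
        have "real (?m n) / card ?U = \<omega>n n a b / pmf (\<rho>n n) a" "real (?m n) / card ?V = \<omega>n n b a / pmf (\<rho>n n) b"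
          using elim(2) ab \<omega>n_commute[OF elim(2), of a b] unfolding real_edge_number[OF lat] U by auto
        then show ?thesis
          unfolding prod_slots_disjoint[OF ab] using ab
          by (intro arg_cong2[where f = "(*)"] prod.cong) (auto simp: d'_def nodes_of_def)
      qed
      also have "(exp 1 * (real (?m n) + 1))\<^sup>2 * (real (card ?U * card ?V) / (real (card ?U * card ?V) - real (?m n))) ^ ?m n * \<dots> \<le>
          exp (\<epsilon> * real n) * (\<Prod>x\<in>slots n t {a, b}. weight n t d x)"
      proof (rule mult_right_mono)
        have "(exp 1 * (real (?m n) + 1))\<^sup>2 * (real (card ?U * card ?V) / (real (card ?U * card ?V) - real (?m n))) ^ ?m n \<le>
            (exp 1 * (real (2 * ?m n) + 1))\<^sup>2 * (?N n / (?N n - real (?m n))) ^ ?m n"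
          unfolding N_eq using elim(1) pmf_nonneg
          by (intro mult_right_mono power_mono mult_left_mono zero_le_power divide_nonneg_nonneg) auto
        then show "(exp 1 * (real (?m n) + 1))\<^sup>2 * (real (card ?U * card ?V) / (real (card ?U * card ?V) - real (?m n))) ^ ?m n \<le> exp (\<epsilon> * real n)"
          using elim(1) by linarith
        show "0 \<le> (\<Prod>x\<in>slots n t {a, b}. weight n t d x)"
          using \<omega>n_nonneg[OF elim(2)] by (intro prod_nonneg poisson_weight_nonneg divide_nonneg_nonneg) auto
      qed
      finally show "choices n t {a, b} \<noteq> {} \<and>
        real (card (choices n t {a, b} \<inter> {F. \<forall>x\<in>slots n t {a, b}. inc F (fst x) = d (fst x) (snd x)})) /
          real (card (choices n t {a, b})) \<le>
        exp (\<epsilon> * real n) * (\<Prod>x\<in>slots n t {a, b}. weight n t d x)" using ne by simp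
    qed
  qed
qed

lemma degree_probability_same:
  assumes \<epsilon>: "0 < \<epsilon>"
  shows "\<forall>\<^sub>F n in sequentially. \<forall>t\<in>arrangements n (\<rho>n n). \<forall>d. choices n t {a} \<noteq> {} \<and>
    real (card (choices n t {a} \<inter> {F. \<forall>x\<in>slots n t {a}. inc F (fst x) = d (fst x) (snd x)})) /
      real (card (choices n t {a})) \<le>
    exp (\<epsilon> * real n) * (\<Prod>x\<in>slots n t {a}. weight n t d x)"
proof -
  let ?m = "\<lambda>n. edge_number n (\<omega>n n) a a"
  let ?N = "\<lambda>n. (real n * pmf (\<rho>n n) a) * (real n * pmf (\<rho>n n) a)"
  \<comment> \<open>The shift is class size plus twice the edge number, because the pairs inside a
    class lack the diagonal.\<close>
  let ?s = "\<lambda>n. real n * pmf (\<rho>n n) a + 2 * real (?m n)"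
  define c where "c = (pmf \<rho> a / 2) * (pmf \<rho> a / 2)"
  define M where "M = \<omega> a a + 2"
  have c: "c > 0" and M: "M > 0" using pmf_pos \<omega>_nonneg[of a a] by (auto simp: c_def M_def)
  have s: "\<forall>\<^sub>F n in sequentially. 0 \<le> ?s n \<and> ?s n \<le> M * real n"
    using eventually_\<omega>n_le[of a a] eventually_ge_at_top[of 1]
  proof eventually_elim
    case (elim n)
    have "?s n = real n * (pmf (\<rho>n n) a + \<omega>n n a a)"
      using real_edge_number[OF lattice_\<omega>[OF elim(2)], of a a] by (simp add: algebra_simps)
    also have "\<dots> \<le> real n * M" using elim(1) pmf_le_1[of "\<rho>n n" a] unfolding M_def by (intro mult_left_mono) auto
    finally show ?case by (simp add: mult.commute)
  qed
  have m: "\<forall>\<^sub>F n in sequentially. real (?m n) \<le> M * real n"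
    using s
  proof eventually_elim
    case (elim n)
    have "0 \<le> real n * pmf (\<rho>n n) a" by simp
    then show ?case using elim by linarith
  qed
  have N: "\<forall>\<^sub>F n in sequentially. c * (real n)\<^sup>2 \<le> ?N n"
    using eventually_\<rho>n_ge[of a]
  proof eventually_elim
    case (elim n)
    then have "c * (real n * real n) \<le> (pmf (\<rho>n n) a * pmf (\<rho>n n) a) * (real n * real n)"
      unfolding c_def using pmf_pos by (intro mult_right_mono mult_mono) (auto simp: less_imp_le)
    then show ?case by (simp add: power2_eq_square ac_simps)
  qed
  have "\<forall>\<^sub>F n in sequentially. ?s n < ?N n \<and>
    (exp 1 * (real (2 * ?m n) + 1))\<^sup>2 * (?N n / (?N n - ?s n)) ^ ?m n \<le> exp (\<epsilon> * real n)"
    by (rule correction_subexponential[OF c M \<epsilon> m s N])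
  then show ?thesis
    using eventually_ge_at_top[of 1]
  proof eventually_elim
    case (elim n)
    note lat = lattice_\<omega>[OF elim(2)]
    show ?case
    proof (intro ballI allI)
      fix t and d :: "nat \<Rightarrow> 'b \<Rightarrow> nat" assume t: "t \<in> arrangements n (\<rho>n n)"
      let ?U = "nodes_of n t a"
      let ?R = "ends ` distinct_pairs ?U ?U"
      have U: "real (card ?U) = real n * pmf (\<rho>n n) a"
        using arrangement_card[OF t] by auto
      then have N_eq: "real (card ?U * card ?U) = ?N n" by simp
      have s_eq: "real (card ?U + 2 * ?m n) = ?s n" using U by simp
      have mN: "card ?U + 2 * ?m n < card ?U * card ?U"
        using elim(1) unfolding N_eq[symmetric] s_eq[symmetric] of_nat_less_iff by simp
      have "2 * card ?R = card ?U * card ?U - card ?U"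
        by (simp add: card_ends_same diff_mult_distrib2)
      then have mR: "?m n \<le> card ?R" using mN by linarith
      have ch: "choices n t {a} = {F. F \<subseteq> ?R \<and> card F = ?m n}"
        using edge_choices_eq[OF lat, of t a a] pool_eq[of n t a a] by simp
      have cch: "card (choices n t {a}) = card ?R choose ?m n"
        unfolding ch by (subst n_subsets) (auto simp: finite_distinct_pairs)
      then have "0 < card (choices n t {a})" using mR by simp
      then have ne: "choices n t {a} \<noteq> {}" by (rule card_gt_0_iff[THEN iffD1, THEN conjunct1])
      have ev: "choices n t {a} \<inter> {F. \<forall>x\<in>slots n t {a}. inc F (fst x) = d (fst x) (snd x)} =
          {F. F \<subseteq> ?R \<and> card F = ?m n \<and> (\<forall>j\<in>?U. inc F j = d j a)}"
        unfolding ch slots_same by auto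
      have U0: "card ?U \<noteq> 0" using mN by auto
      have "real (card (choices n t {a} \<inter> {F. \<forall>x\<in>slots n t {a}. inc F (fst x) = d (fst x) (snd x)})) /
          real (card (choices n t {a})) \<le>
        (exp 1 * (real (2 * ?m n) + 1)) * (real (card ?U * card ?U) / (real (card ?U * card ?U) - real (card ?U + 2 * ?m n))) ^ ?m n *
         (\<Prod>j\<in>?U. poisson_weight (real (2 * ?m n) / card ?U) (d j a))"
        unfolding ev cch by (rule degree_probability_le_same[OF _ mN]) auto
      also have "(\<Prod>j\<in>?U. poisson_weight (real (2 * ?m n) / card ?U) (d j a)) =
          (\<Prod>x\<in>slots n t {a}. weight n t d x)"
      proof -
        have "real (2 * ?m n) / card ?U = \<omega>n n a a / pmf (\<rho>n n) a"
        proof -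
          have "real (2 * ?m n) = real n * \<omega>n n a a" using real_edge_number[OF lat, of a a] by simp
          then show ?thesis unfolding U using elim(2) by simp
        qed
        then show ?thesis
          unfolding prod_slots_same by (intro prod.cong) (auto simp: nodes_of_def)
      qed
      also have "(exp 1 * (real (2 * ?m n) + 1)) * (real (card ?U * card ?U) / (real (card ?U * card ?U) - real (card ?U + 2 * ?m n))) ^ ?m n * \<dots> \<le>
          exp (\<epsilon> * real n) * (\<Prod>x\<in>slots n t {a}. weight n t d x)"
      proof (rule mult_right_mono)
        \<comment> \<open>A prefactor of at least 1 only grows by squaring, which brings it into the
          form of the asymptotic estimate.\<close>
        have "1 \<le> exp 1 * (real (2 * ?m n) + 1)"
          using mult_mono[of 1 "exp 1" 1 "real (2 * ?m n) + 1"] by simp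
        then have "exp 1 * (real (2 * ?m n) + 1) \<le> (exp 1 * (real (2 * ?m n) + 1))\<^sup>2"
          by (rule self_le_power) simp
        then have "(exp 1 * (real (2 * ?m n) + 1)) * (real (card ?U * card ?U) / (real (card ?U * card ?U) - real (card ?U + 2 * ?m n))) ^ ?m n \<le>
            (exp 1 * (real (2 * ?m n) + 1))\<^sup>2 * (?N n / (?N n - ?s n)) ^ ?m n"
          unfolding N_eq s_eq using elim(1) by (intro mult_right_mono zero_le_power divide_nonneg_nonneg) auto
        then show "(exp 1 * (real (2 * ?m n) + 1)) * (real (card ?U * card ?U) / (real (card ?U * card ?U) - real (card ?U + 2 * ?m n))) ^ ?m n \<le> exp (\<epsilon> * real n)"
          using elim(1) by linarith
        show "0 \<le> (\<Prod>x\<in>slots n t {a}. weight n t d x)"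
          using \<omega>n_nonneg[OF elim(2)] by (intro prod_nonneg poisson_weight_nonneg divide_nonneg_nonneg) auto
      qed
      finally show "choices n t {a} \<noteq> {} \<and>
        real (card (choices n t {a} \<inter> {F. \<forall>x\<in>slots n t {a}. inc F (fst x) = d (fst x) (snd x)})) /
          real (card (choices n t {a})) \<le>
        exp (\<epsilon> * real n) * (\<Prod>x\<in>slots n t {a}. weight n t d x)" using ne by simp
    qed
  qed
qed

lemma degree_probability_pair:
  assumes "A \<in> type_pairs" "0 < \<epsilon>"
  shows "\<forall>\<^sub>F n in sequentially. \<forall>t\<in>arrangements n (\<rho>n n). \<forall>d. choices n t A \<noteq> {} \<and>
    real (card (choices n t A \<inter> {F. \<forall>x\<in>slots n t A. inc F (fst x) = d (fst x) (snd x)})) /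
      real (card (choices n t A)) \<le> exp (\<epsilon> * real n) * (\<Prod>x\<in>slots n t A. weight n t d x)"
proof -
  obtain a b where "A = {a, b}" using type_pairs_cases[OF assms(1)] .
  then show ?thesis
    using degree_probability_disjoint[of a b \<epsilon>] degree_probability_same[of \<epsilon> a] assms(2)
    by (cases "a = b") simp_all
qed

text \<open>A by-product of the probability bounds, with an arbitrary exponent: pools grow
  quadratically and edge numbers only linearly.\<close>

lemma eventually_choices_nonempty:
  "\<forall>\<^sub>F n in sequentially. \<forall>t\<in>arrangements n (\<rho>n n). \<forall>A\<in>type_pairs. choices n t A \<noteq> {}"
proof -
  have "\<forall>\<^sub>F n in sequentially. \<forall>A\<in>type_pairs. \<forall>t\<in>arrangements n (\<rho>n n). \<forall>d :: nat \<Rightarrow> 'b \<Rightarrow> nat. choices n t A \<noteq> {} \<and>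
    real (card (choices n t A \<inter> {F. \<forall>x\<in>slots n t A. inc F (fst x) = d (fst x) (snd x)})) /
      real (card (choices n t A)) \<le> exp (1 * real n) * (\<Prod>x\<in>slots n t A. weight n t d x)"
    by (subst eventually_ball_finite_distrib, simp, rule ballI, rule degree_probability_pair[OF _ zero_less_one])
  then show ?thesis by (rule eventually_mono) blast
qed

text \<open>Each of the finitely many pools gets an equal share \<open>\<delta>\<close> of the
  admissible exponent.\<close>

lemma degree_probability:
  assumes \<epsilon>: "0 < \<epsilon>"
  shows "\<forall>\<^sub>F n in sequentially. \<forall>t\<in>arrangements n (\<rho>n n). \<forall>d.
    measure_pmf.prob (edge_law n (\<omega>n n) t) {E. \<forall>j<n. \<forall>b. degree_vector n t E j b = d j b} \<le>
      exp (\<epsilon> * real n) * (\<Prod>j<n. \<Prod>b\<in>UNIV. weight n t d (j, b))"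
proof -
  let ?T = "type_pairs :: 'b set set"
  define \<delta> where "\<delta> = \<epsilon> / real (card ?T)"
  have ne: "?T \<noteq> {}" by (auto simp: type_pairs_def)
  then have T: "real (card ?T) > 0" by (simp add: card_gt_0_iff)
  then have \<delta>: "\<delta> > 0" using \<epsilon> by (simp add: \<delta>_def)
  have "\<forall>\<^sub>F n in sequentially. \<forall>A\<in>?T. \<forall>t\<in>arrangements n (\<rho>n n). \<forall>d. choices n t A \<noteq> {} \<and>
    real (card (choices n t A \<inter> {F. \<forall>x\<in>slots n t A. inc F (fst x) = d (fst x) (snd x)})) /
      real (card (choices n t A)) \<le> exp (\<delta> * real n) * (\<Prod>x\<in>slots n t A. weight n t d x)"
    by (subst eventually_ball_finite_distrib, simp, rule ballI, rule degree_probability_pair[OF _ \<delta>])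
  then show ?thesis
  proof (rule eventually_mono, intro ballI allI)
    fix n t and d :: "nat \<Rightarrow> 'b \<Rightarrow> nat"
    assume *: "\<forall>A\<in>?T. \<forall>t\<in>arrangements n (\<rho>n n). \<forall>d. choices n t A \<noteq> {} \<and>
      real (card (choices n t A \<inter> {F. \<forall>x\<in>slots n t A. inc F (fst x) = d (fst x) (snd x)})) /
      real (card (choices n t A)) \<le> exp (\<delta> * real n) * (\<Prod>x\<in>slots n t A. weight n t d x)"
      and t: "t \<in> arrangements n (\<rho>n n)"
    let ?Y = "\<lambda>A. {F. \<forall>x\<in>slots n t A. inc F (fst x) = d (fst x) (snd x)}"
    have "measure_pmf.prob (edge_law n (\<omega>n n) t) {E. \<forall>j<n. \<forall>b. degree_vector n t E j b = d j b} \<le>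
      (\<Prod>A\<in>?T. real (card (choices n t A \<inter> ?Y A)) / real (card (choices n t A)))"
    proof (rule prob_edge_law_le)
      show "choices n t A \<noteq> {}" if "A \<in> ?T" for A using * t that by blast
      fix F assume F: "\<And>A. A \<in> ?T \<Longrightarrow> F A \<in> choices n t A"
        and E: "(\<Union>A\<in>?T. F A) \<in> {E. \<forall>j<n. \<forall>b. degree_vector n t E j b = d j b}"
      have "F A \<subseteq> pool n t A" if "A \<in> ?T" for A using F[OF that] by (simp add: edge_choices_def)
      from degree_vector_eq_inc[OF this] E
      have "inc (F {t j, b}) j = d j b" if "j < n" for j b using that by auto
      then show "\<forall>A\<in>?T. F A \<in> ?Y A" by (auto simp: slots_def)
    qed
    also have "\<dots> \<le> (\<Prod>A\<in>?T. exp (\<delta> * real n) * (\<Prod>x\<in>slots n t A. weight n t d x))"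
      using * t by (intro prod_mono) auto
    also have "\<dots> = exp (\<delta> * real n) ^ card ?T * (\<Prod>A\<in>?T. \<Prod>x\<in>slots n t A. weight n t d x)"
      by (simp add: prod.distrib)
    also have "exp (\<delta> * real n) ^ card ?T = exp (\<epsilon> * real n)"
      using T ne by (simp add: exp_of_nat_mult[symmetric] \<delta>_def)
    finally show "measure_pmf.prob (edge_law n (\<omega>n n) t) {E. \<forall>j<n. \<forall>b. degree_vector n t E j b = d j b} \<le>
      exp (\<epsilon> * real n) * (\<Prod>j<n. \<Prod>b\<in>UNIV. weight n t d (j, b))"
      unfolding prod_type_pairs_slots .
  qed
qed

end

section \<open>Degree vectors close to a given one\<close>

lemma nat_floor_bounds:
  fixes x :: real
  assumes "x \<ge> 0"
  shows "x - 1 \<le> real (nat \<lfloor>x\<rfloor>)" "real (nat \<lfloor>x\<rfloor>) \<le> x"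
  using assms by (auto simp: of_nat_nat)

lemma tendsto_nat_floor:
  assumes "c > 0"
  shows "(\<lambda>n. real (nat \<lfloor>real n * c\<rfloor>) / real n) \<longlonglongrightarrow> c"
proof (rule tendsto_sandwich[where f = "\<lambda>n. c - 1 / real n" and h = "\<lambda>_. c"])
  show "(\<lambda>n. c - 1 / real n) \<longlonglongrightarrow> c" by real_asymp
  have b: "real n * c - 1 \<le> real (nat \<lfloor>real n * c\<rfloor>) \<and> real (nat \<lfloor>real n * c\<rfloor>) \<le> real n * c" for n
    using assms by (auto simp: of_nat_nat)
  show "\<forall>\<^sub>F n in sequentially. c - 1 / real n \<le> real (nat \<lfloor>real n * c\<rfloor>) / real n"
    using eventually_gt_at_top[of 0]
  proof eventually_elim
    case (elim n)
    then have "c - 1 / real n = (real n * c - 1) / real n" by (simp add: field_simps)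
    then show ?case using b[of n] elim by (simp add: divide_right_mono)
  qed
  show "\<forall>\<^sub>F n in sequentially. real (nat \<lfloor>real n * c\<rfloor>) / real n \<le> c"
    using eventually_gt_at_top[of 0]
    by eventually_elim (use b in \<open>simp add: divide_le_eq mult.commute\<close>)
qed simp

text \<open>Compares one class of the core bound with its Poisson product. At
  \<open>\<delta> = 0\<close> both sides have the same exponential rate, namely
  \<open>w * (ln (w / r) - 1)\<close>, so by continuity a small \<open>\<delta>\<close> costs less
  than \<open>\<epsilon>\<close>, uniformly over degree sums \<open>h\<close> within
  \<open>\<delta> * real n\<close> of the nominal value.\<close>

lemma matching_weight_ge:
  fixes w r :: real
  assumes w: "w > 0" and r: "r > 0" and \<epsilon>: "\<epsilon> > 0"
  shows "\<forall>\<^sub>F \<delta> in at_right 0. \<forall>K U. (\<lambda>n. real (K n) / real n) \<longlonglongrightarrow> w - 2 * \<delta> \<longrightarrow>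
    (\<lambda>n. U n / real n) \<longlonglongrightarrow> r \<longrightarrow>
    (\<forall>\<^sub>F n in sequentially. \<forall>h. \<bar>real h - real n * w\<bar> \<le> \<delta> * real n \<longrightarrow>
      exp (- \<epsilon> * real n) * (exp (- (w / r) * U n) * (w / r) ^ h) \<le> (real (K n) / (exp 1 * U n)) ^ K n)"
proof -
  let ?L = "ln (w / r)"
  \<comment> \<open>The limiting difference of the exponents divided by \<open>n\<close>. The term
    with \<open>\<bar>?L\<bar>\<close> is the worst effect of the deviation of \<open>h\<close>; at
    \<open>\<delta> = 0\<close> everything but \<open>\<epsilon>\<close> cancels.\<close>
  let ?f = "\<lambda>\<delta>. (w - 2 * \<delta>) * (ln ((w - 2 * \<delta>) / r) - 1) + w - w * ?L - \<delta> * \<bar>?L\<bar> + \<epsilon>"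
  have "(?f \<longlongrightarrow> (w - 2 * 0) * (ln ((w - 2 * 0) / r) - 1) + w - w * ?L - 0 * \<bar>?L\<bar> + \<epsilon>) (at_right 0)"
    by (intro tendsto_intros) (use w r in auto)
  then have "(?f \<longlongrightarrow> \<epsilon>) (at_right 0)" by (simp add: algebra_simps)
  then have 1: "\<forall>\<^sub>F \<delta> in at_right 0. 0 < ?f \<delta>" using \<epsilon> by (rule order_tendstoD)
  have "\<forall>\<^sub>F \<delta> in at_right 0. \<delta> < w / 4" by (rule eventually_at_rightI[of 0 "w / 4"]) (use w in auto)
  with 1 show ?thesis
  proof eventually_elim
    case (elim \<delta>)
    show ?case
    proof (intro allI impI)
      fix K :: "nat \<Rightarrow> nat" and U :: "nat \<Rightarrow> real"
      assume K: "(\<lambda>n. real (K n) / real n) \<longlonglongrightarrow> w - 2 * \<delta>" and U: "(\<lambda>n. U n / real n) \<longlonglongrightarrow> r"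
      have w\<delta>: "w - 2 * \<delta> > 0" using elim(2) w by simp
      let ?g = "\<lambda>n. (real (K n) / real n) * (ln ((real (K n) / real n) / (U n / real n)) - 1) + (w / r) * (U n / real n)
         - w * ?L - \<delta> * \<bar>?L\<bar> + \<epsilon>"
      have "?g \<longlonglongrightarrow> (w - 2 * \<delta>) * (ln ((w - 2 * \<delta>) / r) - 1) + (w / r) * r - w * ?L - \<delta> * \<bar>?L\<bar> + \<epsilon>"
        by (intro tendsto_intros K U) (use w r w\<delta> in auto)
      moreover have "(w / r) * r = w" using r by simp
      ultimately have "?g \<longlonglongrightarrow> ?f \<delta>" by (simp only:)
      then have g: "\<forall>\<^sub>F n in sequentially. 0 < ?g n" using elim(1) by (rule order_tendstoD)
      show "\<forall>\<^sub>F n in sequentially. \<forall>h. \<bar>real h - real n * w\<bar> \<le> \<delta> * real n \<longrightarrow>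
          exp (- \<epsilon> * real n) * (exp (- (w / r) * U n) * (w / r) ^ h) \<le> (real (K n) / (exp 1 * U n)) ^ K n"
        using g order_tendstoD(1)[OF K w\<delta>] order_tendstoD(1)[OF U r] eventually_gt_at_top[of 0]
      proof eventually_elim
        case (elim n)
        have n: "real n > 0" using elim by simp
        have Kp: "real (K n) > 0" and Up: "U n > 0" using elim n by (auto simp: zero_less_divide_iff)
        have gn: "real n * ?g n = real (K n) * (ln (real (K n) / U n) - 1) + (w / r) * U n
            - real n * w * ?L - real n * \<delta> * \<bar>?L\<bar> + \<epsilon> * real n"
          using n by (simp add: algebra_simps)
        have pos: "0 < real (K n) * (ln (real (K n) / U n) - 1) + (w / r) * U n
            - real n * w * ?L - real n * \<delta> * \<bar>?L\<bar> + \<epsilon> * real n"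
          unfolding gn[symmetric] using elim n by simp
        show ?case
        proof (intro allI impI)
          fix h :: nat assume h: "\<bar>real h - real n * w\<bar> \<le> \<delta> * real n"
          have "(real h - real n * w) * ?L \<le> \<bar>real h - real n * w\<bar> * \<bar>?L\<bar>"
            by (metis abs_ge_self abs_mult)
          also have "\<dots> \<le> \<delta> * real n * \<bar>?L\<bar>" using h by (intro mult_right_mono) auto
          finally have hL: "real h * ?L \<le> real n * w * ?L + real n * \<delta> * \<bar>?L\<bar>" by (simp add: algebra_simps)
          have "exp (- \<epsilon> * real n) * (exp (- (w / r) * U n) * (w / r) ^ h) =
              exp (- \<epsilon> * real n - (w / r) * U n + real h * ?L)"
          proof -
            have "(w / r) ^ h = exp (real h * ?L)" using w r by (simp add: exp_of_nat_mult)
            then show ?thesis by (simp add: exp_add[symmetric] exp_diff[symmetric])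
          qed
          also have "\<dots> \<le> exp (real (K n) * (ln (real (K n) / U n) - 1))"
            using pos hL by simp
          also have "\<dots> = (real (K n) / (exp 1 * U n)) ^ K n"
            using Kp Up by (simp only: exp_of_nat_mult exp_diff) (simp add: ac_simps)
          finally show "exp (- \<epsilon> * real n) * (exp (- (w / r) * U n) * (w / r) ^ h) \<le> (real (K n) / (exp 1 * U n)) ^ K n" .
        qed
      qed
    qed
  qed
qed

section \<open>Probability of a neighbourhood of a degree vector\<close>

context type_sequence
begin

text \<open>A tolerance is needed since rounded profiles meet the prescribed means only
  approximately. Where \<open>\<omega>\<close> vanishes the degrees must be 0, in accordance with
  the limiting Poisson law, which is then a point mass.\<close>

definition nearly_balanced :: "real \<Rightarrow> nat \<Rightarrow> (nat \<Rightarrow> 'b) \<Rightarrow> (nat \<Rightarrow> 'b \<Rightarrow> nat) \<Rightarrow> bool" where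
  "nearly_balanced \<delta> n t d \<longleftrightarrow> (\<forall>a b. \<bar>real (\<Sum>j\<in>nodes_of n t a. d j b) - real n * \<omega> a b\<bar> \<le> \<delta> * real n \<and>
     (\<omega> a b = 0 \<longrightarrow> (\<Sum>j\<in>nodes_of n t a. d j b) = 0))"

text \<open>Limiting means this time: the lower bound is to be compared with the entropy relative to
  the limiting Poisson law.\<close>

abbreviation "limit_weight t d x \<equiv>
  poisson_weight (\<omega> (t (fst x)) (snd x) / pmf \<rho> (t (fst x))) (d (fst x) (snd x))"

abbreviation "deviation n t d A F \<equiv> (\<Sum>x\<in>slots n t A. \<bar>real (inc F (fst x)) - real (d (fst x) (snd x))\<bar>)"

lemma eventually_\<omega>n_close: "\<delta> > 0 \<Longrightarrow> \<forall>\<^sub>F n in sequentially. \<omega> a b - \<delta> \<le> \<omega>n n a b \<and> \<omega>n n a b \<le> \<omega> a b + \<delta>"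
proof -
  assume \<delta>: "\<delta> > 0"
  then have "\<forall>\<^sub>F n in sequentially. \<omega>n n a b < \<omega> a b + \<delta>" "\<forall>\<^sub>F n in sequentially. \<omega> a b - \<delta> < \<omega>n n a b"
    by (intro order_tendstoD[OF tendsto_\<omega>[of a b]]; simp)+
  then show ?thesis by eventually_elim auto
qed

text \<open>Every edge contributes to exactly two slots, whether its types agree or not.\<close>

lemma sum_inc_slots:
  assumes F: "F \<subseteq> pool n t A" and A: "A \<in> type_pairs"
  shows "(\<Sum>x\<in>slots n t A. inc F (fst x)) = 2 * card F"
proof -
  obtain a b where ab: "A = {a, b}" using type_pairs_cases[OF A] .
  show ?thesis
  proof (cases "a = b")
    case True
    then show ?thesis using F sum_inc_same[of "nodes_of n t a" F] pool_eq[of n t a a]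
      by (simp add: ab sum_slots_same)
  next
    case False
    show ?thesis
      using F sum_inc_disjoint[OF _ _ nodes_of_disjoint[OF False], of n t F] pool_eq[of n t a b]
      by (simp add: ab sum_slots_disjoint[OF False])
  qed
qed

text \<open>If \<open>c\<close> is at most \<open>x\<close> and \<open>y\<close> then
  \<open>\<bar>x - y\<bar> \<le> x + y - 2 * c\<close>. Summed over the slots, each edge of
  \<open>F\<close> and of \<open>C\<close> is counted twice.\<close>

lemma deviation_le_core:
  assumes F: "F \<subseteq> pool n t A" and A: "A \<in> type_pairs" and C: "C \<subseteq> F"
    and le: "\<forall>x\<in>slots n t A. inc C (fst x) \<le> d (fst x) (snd x)"
  shows "deviation n t d A F \<le> 2 * real (card F) + real (\<Sum>x\<in>slots n t A. d (fst x) (snd x)) - 4 * real (card C)"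
proof -
  have finF: "finite F" using F finite_subset by fastforce
  have "deviation n t d A F \<le> (\<Sum>x\<in>slots n t A. real (inc F (fst x)) + real (d (fst x) (snd x)) - 2 * real (inc C (fst x)))"
  proof (rule sum_mono)
    fix x assume x: "x \<in> slots n t A"
    have "inc C (fst x) \<le> inc F (fst x)" unfolding inc_def by (rule card_mono) (use finF C in auto)
    then show "\<bar>real (inc F (fst x)) - real (d (fst x) (snd x))\<bar> \<le>
        real (inc F (fst x)) + real (d (fst x) (snd x)) - 2 * real (inc C (fst x))"
      using bspec[OF le x] by linarith
  qed
  also have "\<dots> = real (\<Sum>x\<in>slots n t A. inc F (fst x)) + real (\<Sum>x\<in>slots n t A. d (fst x) (snd x))
      - 2 * real (\<Sum>x\<in>slots n t A. inc C (fst x))"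
    by (simp add: sum.distrib sum_subtractf sum_distrib_left)
  also have "\<dots> = 2 * real (card F) + real (\<Sum>x\<in>slots n t A. d (fst x) (snd x)) - 4 * real (card C)"
    using sum_inc_slots[OF F A] sum_inc_slots[of C n t A] C F A by simp
  finally show ?thesis .
qed

text \<open>Such a pool receives only o(n) edges, so every choice is close to the zero degrees which
  \<open>d\<close> must have here, and the limit weight of those is 1.\<close>

lemma near_probability_zero:
  assumes w: "\<omega> a b = 0" and \<epsilon>: "0 < \<epsilon>"
  shows "\<forall>\<^sub>F n in sequentially. \<forall>t\<in>arrangements n (\<rho>n n). \<forall>d. nearly_balanced \<delta> n t d \<longrightarrow>
    exp (- \<epsilon> * real n) * (\<Prod>x\<in>slots n t {a, b}. limit_weight t d x) \<le>
    real (card (choices n t {a, b} \<inter> {F. deviation n t d {a, b} F \<le> \<epsilon> * real n})) / real (card (choices n t {a, b}))"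
  using eventually_choices_nonempty eventually_\<omega>n_close[OF half_gt_zero[OF \<epsilon>], of a b] eventually_ge_at_top[of 1]
proof eventually_elim
  case (elim n)
  have m: "2 * real (edge_number n (\<omega>n n) a b) \<le> \<epsilon> * real n"
  proof -
    have "real n * \<omega>n n a b \<le> real n * (\<epsilon> / 2)" using elim w \<epsilon> by (intro mult_left_mono) auto
    moreover have "0 \<le> real n * \<omega>n n a b" using \<omega>n_nonneg[OF elim(3)] by simp
    ultimately show ?thesis
      using elim unfolding real_edge_number[OF lattice_\<omega>[OF elim(3)]] by (auto simp: mult.commute)
  qed
  show ?case
  proof (intro ballI allI impI)
    fix t d assume t: "t \<in> arrangements n (\<rho>n n)" and bal: "nearly_balanced \<delta> n t d"
    have "(\<Sum>j\<in>nodes_of n t a. d j b) = 0" "(\<Sum>j\<in>nodes_of n t b. d j a) = 0"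
      using bal w \<omega>_commute[of a b] unfolding nearly_balanced_def by metis+
    then have d0: "\<forall>x\<in>slots n t {a, b}. d (fst x) (snd x) = 0"
      unfolding ball_slots by simp
    have "limit_weight t d x = 1" if "x \<in> slots n t {a, b}" for x
    proof -
      have "{t (fst x), snd x} = {a, b}" using that by (simp add: slots_def case_prod_beta)
      moreover have "\<omega> b a = 0" using w \<omega>_commute[of a b] by simp
      ultimately have "\<omega> (t (fst x)) (snd x) = 0" using w by (auto simp: doubleton_eq_iff)
      then show ?thesis using d0 that by (simp add: poisson_weight_def)
    qed
    then have 1: "(\<Prod>x\<in>slots n t {a, b}. limit_weight t d x) = 1" by simp
    have "deviation n t d {a, b} F \<le> \<epsilon> * real n" if "F \<in> choices n t {a, b}" for F
    proof -
      have "F \<subseteq> pool n t {a, b}" "card F = edge_number n (\<omega>n n) a b"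
        using that unfolding edge_choices_eq[OF lattice_\<omega>[OF elim(3)]] by auto
      moreover have "deviation n t d {a, b} F = real (\<Sum>x\<in>slots n t {a, b}. inc F (fst x))"
        using d0 by simp
      ultimately show ?thesis using m sum_inc_slots[of F n t "{a, b}"] by simp
    qed
    then have eq: "choices n t {a, b} \<inter> {F. deviation n t d {a, b} F \<le> \<epsilon> * real n} = choices n t {a, b}" by auto
    have "choices n t {a, b} \<noteq> {}" using elim(1) t by simp
    then show "exp (- \<epsilon> * real n) * (\<Prod>x\<in>slots n t {a, b}. limit_weight t d x) \<le>
      real (card (choices n t {a, b} \<inter> {F. deviation n t d {a, b} F \<le> \<epsilon> * real n})) / real (card (choices n t {a, b}))"
      unfolding 1 eq using \<epsilon> by simp
  qed
qed

text \<open>Exact degree probabilities cannot be bounded from below uniformly, since \<open>d\<close> need not be the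
  degree vector of any graph. Instead all but about \<open>2 * \<delta> * n\<close> of the edges are required to form a
  core whose degrees are at most \<open>d\<close>; the remaining edges move the degrees only slightly.\<close>

lemma near_probability_disjoint:
  assumes ab: "a \<noteq> b" and w: "\<omega> a b > 0" and \<epsilon>: "0 < \<epsilon>"
  shows "\<forall>\<^sub>F \<delta> in at_right 0. \<forall>\<Delta>. \<forall>\<^sub>F n in sequentially. \<forall>t\<in>arrangements n (\<rho>n n). \<forall>d.
    nearly_balanced \<delta> n t d \<longrightarrow> (\<forall>j b. d j b \<le> \<Delta>) \<longrightarrow>
    exp (- \<epsilon> * real n) * (\<Prod>x\<in>slots n t {a, b}. limit_weight t d x) \<le>
    real (card (choices n t {a, b} \<inter> {F. deviation n t d {a, b} F \<le> \<epsilon> * real n})) / real (card (choices n t {a, b}))"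
proof -
  let ?w = "\<omega> a b"
  have \<epsilon>2: "\<epsilon> / 2 > 0" using \<epsilon> by simp
  \<comment> \<open>The bound \<open>?w / 4\<close> keeps the core size positive;
    \<open>\<epsilon> / 20\<close> makes the final estimate of the deviation,
    \<open>20 * (\<delta> * real n)\<close>, small enough.\<close>
  have "\<forall>\<^sub>F \<delta> in at_right 0. \<delta> < min (?w / 4) (\<epsilon> / 20)"
    by (rule eventually_at_rightI[of 0 "min (?w / 4) (\<epsilon> / 20)"]) (use w \<epsilon> in auto)
  moreover have "\<forall>\<^sub>F \<delta> in at_right (0 :: real). 0 < \<delta>" by (rule eventually_at_right_less)
  ultimately show ?thesis
    using matching_weight_ge[OF w pmf_pos[of a] \<epsilon>2] matching_weight_ge[OF w pmf_pos[of b] \<epsilon>2]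
  proof eventually_elim
    case (elim \<delta>)
    show ?case
    proof
      fix \<Delta> :: nat
      let ?m = "\<lambda>n. edge_number n (\<omega>n n) a b"
      \<comment> \<open>The core size. One \<open>\<delta>\<close> allows for degree sums or edge
        numbers below the nominal value, the other reserves half-edges against loops and double
        edges.\<close>
      define K where "K n = nat \<lfloor>real n * (?w - 2 * \<delta>)\<rfloor>" for n
      have w\<delta>: "?w - 2 * \<delta> > 0" using elim(1) w by simp
      have K: "(\<lambda>n. real (K n) / real n) \<longlonglongrightarrow> ?w - 2 * \<delta>" unfolding K_def by (rule tendsto_nat_floor[OF w\<delta>])
      have U: "(\<lambda>n. (real n * pmf (\<rho>n n) a) / real n) \<longlonglongrightarrow> pmf \<rho> a" for a
        by (rule Lim_transform_eventually[OF tendsto_\<rho>[of a]])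
          (rule eventually_mono[OF eventually_gt_at_top[of 0]], simp)
      have big: "\<forall>\<^sub>F n in sequentially. real ((\<Delta> + 1) * \<Delta>) + 4 \<le> \<delta> * real n"
        using elim(2) by real_asymp
      show "\<forall>\<^sub>F n in sequentially. \<forall>t\<in>arrangements n (\<rho>n n). \<forall>d.
        nearly_balanced \<delta> n t d \<longrightarrow> (\<forall>j b. d j b \<le> \<Delta>) \<longrightarrow>
        exp (- \<epsilon> * real n) * (\<Prod>x\<in>slots n t {a, b}. limit_weight t d x) \<le>
        real (card (choices n t {a, b} \<inter> {F. deviation n t d {a, b} F \<le> \<epsilon> * real n})) / real (card (choices n t {a, b}))"
        using elim(3)[rule_format, OF K U[of a]] elim(4)[rule_format, OF K U[of b]] big
          eventually_choices_nonempty eventually_\<omega>n_close[OF elim(2), of a b] eventually_ge_at_top[of 1]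
      proof eventually_elim
        case (elim n)
        note side_a = elim(1) and side_b = elim(2) and big = elim(3) and ne = elim(4) and close = elim(5) and n = elim(6)
        note lat = lattice_\<omega>[OF n]
        have Kb: "real n * (?w - 2 * \<delta>) - 1 \<le> real (K n)" "real (K n) \<le> real n * (?w - 2 * \<delta>)"
          using w\<delta> unfolding K_def by (auto simp: of_nat_nat)
        have m_eq: "real (?m n) = real n * \<omega>n n a b" using real_edge_number[OF lat, of a b] ab by simp
        have mb: "real n * (?w - \<delta>) \<le> real (?m n)" "real (?m n) \<le> real n * (?w + \<delta>)"
          unfolding m_eq using close by (auto intro!: mult_left_mono)
        have Km: "K n \<le> ?m n"
        proof -
          have "real (K n) \<le> real (?m n)" using Kb mb big by (simp add: algebra_simps)
          then show ?thesis by simp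
        qed
        show ?case
        proof (intro ballI allI impI)
          fix t d assume t: "t \<in> arrangements n (\<rho>n n)" and bal: "nearly_balanced \<delta> n t d"
            and \<Delta>: "\<forall>j b. d j b \<le> \<Delta>"
          let ?U = "nodes_of n t a" and ?V = "nodes_of n t b"
          let ?R = "ends ` distinct_pairs ?U ?V"
          define d' where "d' j = d j (if t j = a then b else a)" for j
          have card_U: "real (card ?U) = real n * pmf (\<rho>n n) a" "real (card ?V) = real n * pmf (\<rho>n n) b"
            using arrangement_card[OF t] by auto
          have disj: "?U \<inter> ?V = {}" using ab by (rule nodes_of_disjoint)
          have ch: "choices n t {a, b} = {F. F \<subseteq> ?R \<and> card F = ?m n}"
            unfolding edge_choices_eq[OF lat] pool_eq ..
          have cch: "card (choices n t {a, b}) = card ?U * card ?V choose ?m n"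
            unfolding ch by (subst n_subsets) (auto simp: card_ends_disjoint[OF disj] finite_distinct_pairs)
          moreover have "card (choices n t {a, b}) \<noteq> 0" using ne t by simp
          ultimately have mN: "?m n \<le> card ?U * card ?V" by (metis binomial_eq_0 not_le_imp_less)
          have sums: "(\<Sum>j\<in>?U. d' j) = (\<Sum>j\<in>?U. d j b)" "(\<Sum>j\<in>?V. d' j) = (\<Sum>j\<in>?V. d j a)"
            using ab by (auto intro!: sum.cong simp: d'_def nodes_of_def)
          have hU: "\<bar>real (\<Sum>j\<in>?U. d' j) - real n * ?w\<bar> \<le> \<delta> * real n"
            using bal unfolding sums nearly_balanced_def by blast
          have hV: "\<bar>real (\<Sum>j\<in>?V. d' j) - real n * ?w\<bar> \<le> \<delta> * real n"
            using bal \<omega>_commute[of a b] unfolding sums nearly_balanced_def by metis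
          have kU: "K n + (\<Delta> + 1) * \<Delta> \<le> (\<Sum>j\<in>?U. d' j)" "K n + (\<Delta> + 1) * \<Delta> \<le> (\<Sum>j\<in>?V. d' j)"
          proof -
            have "real (K n) + real ((\<Delta> + 1) * \<Delta>) \<le> real n * ?w - \<delta> * real n" using Kb big by (simp add: algebra_simps)
            then have "real (K n + (\<Delta> + 1) * \<Delta>) \<le> real (\<Sum>j\<in>?U. d' j)" "real (K n + (\<Delta> + 1) * \<Delta>) \<le> real (\<Sum>j\<in>?V. d' j)"
              unfolding of_nat_add[of "K n"] using hU hV by linarith+
            then show "K n + (\<Delta> + 1) * \<Delta> \<le> (\<Sum>j\<in>?U. d' j)" "K n + (\<Delta> + 1) * \<Delta> \<le> (\<Sum>j\<in>?V. d' j)"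
              by (simp_all only: of_nat_le_iff)
          qed
          let ?P = "(\<Prod>j\<in>?U. fact (d' j)) * (\<Prod>j\<in>?V. fact (d' j)) :: real"
          have "(\<Prod>x\<in>slots n t {a, b}. limit_weight t d x) =
              (\<Prod>j\<in>?U. poisson_weight (?w / pmf \<rho> a) (d' j)) * (\<Prod>j\<in>?V. poisson_weight (?w / pmf \<rho> b) (d' j))"
            unfolding prod_slots_disjoint[OF ab] using ab \<omega>_commute[of a b]
            by (intro arg_cong2[where f = "(*)"] prod.cong) (auto simp: d'_def nodes_of_def)
          then have "exp (- \<epsilon> * real n) * (\<Prod>x\<in>slots n t {a, b}. limit_weight t d x) =
              (exp (- (\<epsilon> / 2) * real n) * (exp (- (?w / pmf \<rho> a) * (real n * pmf (\<rho>n n) a)) * (?w / pmf \<rho> a) ^ (\<Sum>j\<in>?U. d' j))) *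
              (exp (- (\<epsilon> / 2) * real n) * (exp (- (?w / pmf \<rho> b) * (real n * pmf (\<rho>n n) b)) * (?w / pmf \<rho> b) ^ (\<Sum>j\<in>?V. d' j))) / ?P"
            unfolding prod_poisson_weight[OF finite_nodes_of] card_U
            by (simp add: exp_add[symmetric] mult_exp_exp)
          also have "\<dots> \<le> (real (K n) / (exp 1 * (real n * pmf (\<rho>n n) a))) ^ K n *
              (real (K n) / (exp 1 * (real n * pmf (\<rho>n n) b))) ^ K n / ?P"
            using side_a[rule_format, OF hU] side_b[rule_format, OF hV] w pmf_pos
            by (intro divide_right_mono mult_mono mult_nonneg_nonneg prod_nonneg zero_le_power divide_nonneg_nonneg)
              (auto simp: less_imp_le)
          also have "\<dots> \<le> real (card {F. F \<subseteq> ?R \<and> card F = ?m n \<and>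
              (\<exists>C. C \<subseteq> F \<and> card C = K n \<and> (\<forall>j\<in>?U\<union>?V. inc C j \<le> d' j))}) / real (card ?U * card ?V choose ?m n)"
            unfolding card_U[symmetric]
            by (rule core_probability_ge_disjoint[OF _ _ disj mN Km _ kU]) (use \<Delta> in \<open>auto simp: d'_def\<close>)
          also have "\<dots> \<le> real (card (choices n t {a, b} \<inter> {F. deviation n t d {a, b} F \<le> \<epsilon> * real n})) / real (card (choices n t {a, b}))"
            unfolding cch
          proof (intro divide_right_mono of_nat_mono card_mono subsetI)
            fix F assume "F \<in> {F. F \<subseteq> ?R \<and> card F = ?m n \<and> (\<exists>C. C \<subseteq> F \<and> card C = K n \<and> (\<forall>j\<in>?U\<union>?V. inc C j \<le> d' j))}"
            then obtain C where F: "F \<subseteq> ?R" "card F = ?m n" and C: "C \<subseteq> F" "card C = K n" "\<forall>j\<in>?U\<union>?V. inc C j \<le> d' j"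
              by auto
            have "\<forall>x\<in>slots n t {a, b}. inc C (fst x) \<le> d (fst x) (snd x)"
              unfolding ball_slots using C(3) ab by (auto simp: ball_Un d'_def nodes_of_def)
            from deviation_le_core[OF F(1)[folded pool_eq] _ C(1) this]
            have "deviation n t d {a, b} F \<le> 2 * real (?m n) + real (\<Sum>x\<in>slots n t {a, b}. d (fst x) (snd x)) - 4 * real (K n)"
              using F C by simp
            also have "real (\<Sum>x\<in>slots n t {a, b}. d (fst x) (snd x)) = real (\<Sum>j\<in>?U. d' j) + real (\<Sum>j\<in>?V. d' j)"
              unfolding sum_slots_disjoint[OF ab] sums by simp
            \<comment> \<open>Edge number and degree sums account for \<open>2 * \<delta>\<close>
              each, the reduced core for \<open>8 * \<delta>\<close>, and the rounding of
              \<open>K n\<close> for the 4.\<close>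
            also have "2 * real (?m n) + \<dots> - 4 * real (K n) \<le> 12 * (\<delta> * real n) + 4"
              using mb Kb hU hV unfolding abs_le_iff by (simp add: algebra_simps)
            also have "\<dots> \<le> 20 * (\<delta> * real n)"
              using big of_nat_0_le_iff[of "(\<Delta> + 1) * \<Delta>", where 'a = real] by linarith
            also have "\<dots> \<le> \<epsilon> * real n" 
              using mult_right_mono[of "20 * \<delta>" \<epsilon> "real n"] \<open>\<delta> < min (?w / 4) (\<epsilon> / 20)\<close> by simp
            finally show "F \<in> choices n t {a, b} \<inter> {F. deviation n t d {a, b} F \<le> \<epsilon> * real n}"
              using F ch by auto
          qed auto
          finally show "exp (- \<epsilon> * real n) * (\<Prod>x\<in>slots n t {a, b}. limit_weight t d x) \<le>
            real (card (choices n t {a, b} \<inter> {F. deviation n t d {a, b} F \<le> \<epsilon> * real n})) / real (card (choices n t {a, b}))" .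
        qed
      qed
    qed
  qed
qed

text \<open>The same argument with a single supply of half-edges: every core edge takes two of them,
  so \<open>2 * K n\<close> plays the role of the core size.\<close>

lemma near_probability_same:
  assumes w: "\<omega> a a > 0" and \<epsilon>: "0 < \<epsilon>"
  shows "\<forall>\<^sub>F \<delta> in at_right 0. \<forall>\<Delta>. \<forall>\<^sub>F n in sequentially. \<forall>t\<in>arrangements n (\<rho>n n). \<forall>d.
    nearly_balanced \<delta> n t d \<longrightarrow> (\<forall>j b. d j b \<le> \<Delta>) \<longrightarrow>
    exp (- \<epsilon> * real n) * (\<Prod>x\<in>slots n t {a}. limit_weight t d x) \<le>
    real (card (choices n t {a} \<inter> {F. deviation n t d {a} F \<le> \<epsilon> * real n})) / real (card (choices n t {a}))"
proof -
  let ?w = "\<omega> a a"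
  have "\<forall>\<^sub>F \<delta> in at_right 0. \<delta> < min (?w / 4) (\<epsilon> / 20)"
    by (rule eventually_at_rightI[of 0 "min (?w / 4) (\<epsilon> / 20)"]) (use w \<epsilon> in auto)
  moreover have "\<forall>\<^sub>F \<delta> in at_right (0 :: real). 0 < \<delta>" by (rule eventually_at_right_less)
  ultimately show ?thesis
    using matching_weight_ge[OF w pmf_pos[of a] \<epsilon>]
  proof eventually_elim
    case (elim \<delta>)
    show ?case
    proof
      fix \<Delta> :: nat
      let ?m = "\<lambda>n. edge_number n (\<omega>n n) a a"
      define K where "K n = nat \<lfloor>real n * ((?w - 2 * \<delta>) / 2)\<rfloor>" for n
      have w\<delta>: "(?w - 2 * \<delta>) / 2 > 0" using elim(1) w by simp
      have "(\<lambda>n. 2 * (real (K n) / real n)) \<longlonglongrightarrow> 2 * ((?w - 2 * \<delta>) / 2)"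
        unfolding K_def by (intro tendsto_mult tendsto_const tendsto_nat_floor[OF w\<delta>])
      moreover have "2 * ((?w - 2 * \<delta>) / 2) = ?w - 2 * \<delta>" by simp
      ultimately have K: "(\<lambda>n. real (2 * K n) / real n) \<longlonglongrightarrow> ?w - 2 * \<delta>"
        by (simp only: of_nat_mult of_nat_numeral times_divide_eq_right)
      have U: "(\<lambda>n. (real n * pmf (\<rho>n n) a) / real n) \<longlonglongrightarrow> pmf \<rho> a"
        by (rule Lim_transform_eventually[OF tendsto_\<rho>[of a]])
          (rule eventually_mono[OF eventually_gt_at_top[of 0]], simp)
      have big: "\<forall>\<^sub>F n in sequentially. real ((\<Delta> + 1) * \<Delta>) + 4 \<le> \<delta> * real n"
        using elim(2) by real_asymp
      show "\<forall>\<^sub>F n in sequentially. \<forall>t\<in>arrangements n (\<rho>n n). \<forall>d.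
        nearly_balanced \<delta> n t d \<longrightarrow> (\<forall>j b. d j b \<le> \<Delta>) \<longrightarrow>
        exp (- \<epsilon> * real n) * (\<Prod>x\<in>slots n t {a}. limit_weight t d x) \<le>
        real (card (choices n t {a} \<inter> {F. deviation n t d {a} F \<le> \<epsilon> * real n})) / real (card (choices n t {a}))"
        using elim(3)[rule_format, OF K U] big
          eventually_choices_nonempty eventually_\<omega>n_close[OF elim(2), of a a] eventually_ge_at_top[of 1]
      proof eventually_elim
        case (elim n)
        note side = elim(1) and big = elim(2) and ne = elim(3) and close = elim(4) and n = elim(5)
        note lat = lattice_\<omega>[OF n]
        have Kb: "real n * (?w - 2 * \<delta>) - 2 \<le> 2 * real (K n)" "2 * real (K n) \<le> real n * (?w - 2 * \<delta>)"
        proof -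
          have "real n * ((?w - 2 * \<delta>) / 2) - 1 \<le> real (K n)" "real (K n) \<le> real n * ((?w - 2 * \<delta>) / 2)"
            unfolding K_def using w\<delta> by (intro nat_floor_bounds mult_nonneg_nonneg; simp)+
          then show "real n * (?w - 2 * \<delta>) - 2 \<le> 2 * real (K n)" "2 * real (K n) \<le> real n * (?w - 2 * \<delta>)"
            by linarith+
        qed
        have m_eq: "2 * real (?m n) = real n * \<omega>n n a a" using real_edge_number[OF lat, of a a] by simp
        have mb: "real n * (?w - \<delta>) \<le> 2 * real (?m n)" "2 * real (?m n) \<le> real n * (?w + \<delta>)"
          unfolding m_eq using close by (auto intro!: mult_left_mono)
        have Km: "K n \<le> ?m n"
        proof -
          have "2 * real (K n) \<le> 2 * real (?m n)" using Kb mb big by (simp add: algebra_simps)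
          then show ?thesis by simp
        qed
        show ?case
        proof (intro ballI allI impI)
          fix t d assume t: "t \<in> arrangements n (\<rho>n n)" and bal: "nearly_balanced \<delta> n t d"
            and \<Delta>: "\<forall>j b. d j b \<le> \<Delta>"
          let ?U = "nodes_of n t a"
          let ?R = "ends ` distinct_pairs ?U ?U"
          have card_U: "real (card ?U) = real n * pmf (\<rho>n n) a" using arrangement_card[OF t] by auto
          have pool: "pool n t {a} = ?R" using pool_eq[of n t a a] by simp
          have ch: "choices n t {a} = {F. F \<subseteq> ?R \<and> card F = ?m n}"
            using edge_choices_eq[OF lat, of t a a] pool by simp
          have cch: "card (choices n t {a}) = card ?R choose ?m n"
            unfolding ch by (subst n_subsets) (auto simp: finite_distinct_pairs)
          moreover have "card (choices n t {a}) \<noteq> 0" using ne t by simp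
          ultimately have mN: "?m n \<le> card ?R" by (metis binomial_eq_0 not_le_imp_less)
          have h: "\<bar>real (\<Sum>j\<in>?U. d j a) - real n * ?w\<bar> \<le> \<delta> * real n"
            using bal unfolding nearly_balanced_def by blast
          have kU: "2 * K n + (\<Delta> + 1) * \<Delta> \<le> (\<Sum>j\<in>?U. d j a)"
          proof -
            have "2 * real (K n) + real ((\<Delta> + 1) * \<Delta>) \<le> real n * ?w - \<delta> * real n"
              using Kb big by (simp add: algebra_simps)
            then have "real (2 * K n + (\<Delta> + 1) * \<Delta>) \<le> real (\<Sum>j\<in>?U. d j a)"
              using h by simp
            then show ?thesis by (simp only: of_nat_le_iff)
          qed
          let ?P = "(\<Prod>j\<in>?U. fact (d j a)) :: real"
          have "(\<Prod>x\<in>slots n t {a}. limit_weight t d x) = (\<Prod>j\<in>?U. poisson_weight (?w / pmf \<rho> a) (d j a))"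
            unfolding prod_slots_same by (intro prod.cong) (auto simp: nodes_of_def)
          then have "exp (- \<epsilon> * real n) * (\<Prod>x\<in>slots n t {a}. limit_weight t d x) =
              (exp (- \<epsilon> * real n) * (exp (- (?w / pmf \<rho> a) * (real n * pmf (\<rho>n n) a)) * (?w / pmf \<rho> a) ^ (\<Sum>j\<in>?U. d j a))) / ?P"
            unfolding prod_poisson_weight[OF finite_nodes_of] card_U by simp
          also have "\<dots> \<le> (real (2 * K n) / (exp 1 * (real n * pmf (\<rho>n n) a))) ^ (2 * K n) / ?P"
            using side[rule_format, OF h] by (intro divide_right_mono prod_nonneg) auto
          also have "\<dots> \<le> real (card {F. F \<subseteq> ?R \<and> card F = ?m n \<and>
              (\<exists>C. C \<subseteq> F \<and> card C = K n \<and> (\<forall>j\<in>?U. inc C j \<le> d j a))}) / real (card ?R choose ?m n)"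
            unfolding card_U[symmetric]
            by (rule core_probability_ge_same[OF _ mN Km _ kU]) (use \<Delta> in auto)
          also have "\<dots> \<le> real (card (choices n t {a} \<inter> {F. deviation n t d {a} F \<le> \<epsilon> * real n})) / real (card (choices n t {a}))"
            unfolding cch
          proof (intro divide_right_mono of_nat_mono card_mono subsetI)
            fix F assume "F \<in> {F. F \<subseteq> ?R \<and> card F = ?m n \<and> (\<exists>C. C \<subseteq> F \<and> card C = K n \<and> (\<forall>j\<in>?U. inc C j \<le> d j a))}"
            then obtain C where F: "F \<subseteq> ?R" "card F = ?m n" and C: "C \<subseteq> F" "card C = K n" "\<forall>j\<in>?U. inc C j \<le> d j a"
              by auto
            have "\<forall>x\<in>slots n t {a}. inc C (fst x) \<le> d (fst x) (snd x)"
              unfolding slots_same using C(3) by auto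
            from deviation_le_core[OF F(1)[folded pool] _ C(1) this]
            have "deviation n t d {a} F \<le> 2 * real (?m n) + real (\<Sum>x\<in>slots n t {a}. d (fst x) (snd x)) - 4 * real (K n)"
              using F C by simp
            also have "real (\<Sum>x\<in>slots n t {a}. d (fst x) (snd x)) = real (\<Sum>j\<in>?U. d j a)"
              unfolding sum_slots_same by simp
            also have "2 * real (?m n) + \<dots> - 4 * real (K n) \<le> 12 * (\<delta> * real n) + 4"
              using mb Kb h big unfolding abs_le_iff by (simp add: algebra_simps)
            also have "\<dots> \<le> 20 * (\<delta> * real n)"
              using big of_nat_0_le_iff[of "(\<Delta> + 1) * \<Delta>", where 'a = real] by linarith
            also have "\<dots> \<le> \<epsilon> * real n" 
              using mult_right_mono[of "20 * \<delta>" \<epsilon> "real n"] \<open>\<delta> < min (?w / 4) (\<epsilon> / 20)\<close> by simp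
            finally show "F \<in> choices n t {a} \<inter> {F. deviation n t d {a} F \<le> \<epsilon> * real n}"
              using F ch by auto
          qed auto
          finally show "exp (- \<epsilon> * real n) * (\<Prod>x\<in>slots n t {a}. limit_weight t d x) \<le>
            real (card (choices n t {a} \<inter> {F. deviation n t d {a} F \<le> \<epsilon> * real n})) / real (card (choices n t {a}))" .
        qed
      qed
    qed
  qed
qed

lemma near_probability_pair:
  assumes A: "A \<in> type_pairs" and \<epsilon>: "0 < \<epsilon>"
  shows "\<forall>\<^sub>F \<delta> in at_right 0. \<forall>\<Delta>. \<forall>\<^sub>F n in sequentially. \<forall>t\<in>arrangements n (\<rho>n n). \<forall>d.
    nearly_balanced \<delta> n t d \<longrightarrow> (\<forall>j b. d j b \<le> \<Delta>) \<longrightarrow>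
    exp (- \<epsilon> * real n) * (\<Prod>x\<in>slots n t A. limit_weight t d x) \<le>
    real (card (choices n t A \<inter> {F. deviation n t d A F \<le> \<epsilon> * real n})) / real (card (choices n t A))"
proof -
  obtain a b where ab: "A = {a, b}" using type_pairs_cases[OF A] .
  consider "\<omega> a b = 0" | "\<omega> a b > 0" "a \<noteq> b" | "\<omega> a b > 0" "a = b" using \<omega>_nonneg[of a b] by fastforce
  then show ?thesis
  proof cases
    case 1
    show ?thesis unfolding ab
      by (intro always_eventually allI eventually_mono[OF near_probability_zero[OF 1 \<epsilon>]]) blast
  next
    case 2
    then show ?thesis unfolding ab by (intro near_probability_disjoint \<epsilon>)
  next
    case 3
    then show ?thesis unfolding ab using near_probability_same[of b \<epsilon>] \<epsilon> by simp
  qed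
qed

text \<open>The order of the quantifiers matters: \<open>\<delta>\<close> is found before the degree
  bound \<open>\<Delta>\<close>. When a profile is approximated later, its box, and with it
  \<open>\<Delta>\<close>, depends on \<open>\<delta>\<close>.\<close>

lemma near_probability:
  assumes \<epsilon>: "0 < \<epsilon>"
  shows "\<forall>\<^sub>F \<delta> in at_right 0. \<forall>\<Delta>. \<forall>\<^sub>F n in sequentially. \<forall>t\<in>arrangements n (\<rho>n n). \<forall>d.
    nearly_balanced \<delta> n t d \<longrightarrow> (\<forall>j b. d j b \<le> \<Delta>) \<longrightarrow>
    exp (- \<epsilon> * real n) * (\<Prod>j<n. \<Prod>b\<in>UNIV. limit_weight t d (j, b)) \<le>
    measure_pmf.prob (edge_law n (\<omega>n n) t)
      {E. (\<Sum>j<n. \<Sum>b\<in>UNIV. \<bar>real (degree_vector n t E j b) - real (d j b)\<bar>) \<le> \<epsilon> * real n}"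
proof -
  let ?T = "type_pairs :: 'b set set"
  define \<epsilon>' where "\<epsilon>' = \<epsilon> / real (card ?T)"
  have ne: "?T \<noteq> {}" by (auto simp: type_pairs_def)
  then have T: "real (card ?T) > 0" by (simp add: card_gt_0_iff)
  then have \<epsilon>': "\<epsilon>' > 0" using \<epsilon> by (simp add: \<epsilon>'_def)
  have "\<forall>\<^sub>F \<delta> in at_right 0. \<forall>A\<in>?T. \<forall>\<Delta>. \<forall>\<^sub>F n in sequentially. \<forall>t\<in>arrangements n (\<rho>n n). \<forall>d.
    nearly_balanced \<delta> n t d \<longrightarrow> (\<forall>j b. d j b \<le> \<Delta>) \<longrightarrow>
    exp (- \<epsilon>' * real n) * (\<Prod>x\<in>slots n t A. limit_weight t d x) \<le>
    real (card (choices n t A \<inter> {F. deviation n t d A F \<le> \<epsilon>' * real n})) / real (card (choices n t A))"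
    by (subst eventually_ball_finite_distrib, simp, rule ballI, rule near_probability_pair[OF _ \<epsilon>'])
  then show ?thesis
  proof (rule eventually_mono, intro allI)
    fix \<delta> and \<Delta> :: nat
    assume *: "\<forall>A\<in>?T. \<forall>\<Delta>. \<forall>\<^sub>F n in sequentially. \<forall>t\<in>arrangements n (\<rho>n n). \<forall>d.
      nearly_balanced \<delta> n t d \<longrightarrow> (\<forall>j b. d j b \<le> \<Delta>) \<longrightarrow>
      exp (- \<epsilon>' * real n) * (\<Prod>x\<in>slots n t A. limit_weight t d x) \<le>
      real (card (choices n t A \<inter> {F. deviation n t d A F \<le> \<epsilon>' * real n})) / real (card (choices n t A))"
    have "\<forall>\<^sub>F n in sequentially. \<forall>A\<in>?T. \<forall>t\<in>arrangements n (\<rho>n n). \<forall>d.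
      nearly_balanced \<delta> n t d \<longrightarrow> (\<forall>j b. d j b \<le> \<Delta>) \<longrightarrow>
      exp (- \<epsilon>' * real n) * (\<Prod>x\<in>slots n t A. limit_weight t d x) \<le>
      real (card (choices n t A \<inter> {F. deviation n t d A F \<le> \<epsilon>' * real n})) / real (card (choices n t A))"
      by (subst eventually_ball_finite_distrib, simp) (use * in blast)
    then show "\<forall>\<^sub>F n in sequentially. \<forall>t\<in>arrangements n (\<rho>n n). \<forall>d.
      nearly_balanced \<delta> n t d \<longrightarrow> (\<forall>j b. d j b \<le> \<Delta>) \<longrightarrow>
      exp (- \<epsilon> * real n) * (\<Prod>j<n. \<Prod>b\<in>UNIV. limit_weight t d (j, b)) \<le>
      measure_pmf.prob (edge_law n (\<omega>n n) t)
        {E. (\<Sum>j<n. \<Sum>b\<in>UNIV. \<bar>real (degree_vector n t E j b) - real (d j b)\<bar>) \<le> \<epsilon> * real n}"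
      using eventually_choices_nonempty
    proof eventually_elim
      case (elim n)
      show ?case
      proof (intro ballI allI impI)
        fix t d assume t: "t \<in> arrangements n (\<rho>n n)" and bal: "nearly_balanced \<delta> n t d" and \<Delta>: "\<forall>j b. d j b \<le> \<Delta>"
        let ?Y = "\<lambda>A. {F. deviation n t d A F \<le> \<epsilon>' * real n}"
        have "exp (- \<epsilon> * real n) = exp (- \<epsilon>' * real n) ^ card ?T"
          using T ne by (simp add: exp_of_nat_mult[symmetric] \<epsilon>'_def)
        then have "exp (- \<epsilon> * real n) * (\<Prod>j<n. \<Prod>b\<in>UNIV. limit_weight t d (j, b)) =
            (\<Prod>A\<in>?T. exp (- \<epsilon>' * real n) * (\<Prod>x\<in>slots n t A. limit_weight t d x))"
          by (simp only: prod_type_pairs_slots[where f = "limit_weight t d" and n = n and t = t, symmetric]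
              prod.distrib prod_constant)
        also have "\<dots> \<le> (\<Prod>A\<in>?T. real (card (choices n t A \<inter> ?Y A)) / real (card (choices n t A)))"
        proof (rule prod_mono, intro conjI)
          fix A assume A: "A \<in> ?T"
          show "exp (- \<epsilon>' * real n) * (\<Prod>x\<in>slots n t A. limit_weight t d x) \<le>
              real (card (choices n t A \<inter> ?Y A)) / real (card (choices n t A))"
            using elim(1) A t bal \<Delta> by blast
          show "0 \<le> exp (- \<epsilon>' * real n) * (\<Prod>x\<in>slots n t A. limit_weight t d x)"
            using \<omega>_nonneg by (intro mult_nonneg_nonneg prod_nonneg poisson_weight_nonneg divide_nonneg_nonneg) auto
        qed
        also have "\<dots> \<le> measure_pmf.prob (edge_law n (\<omega>n n) t)
          {E. (\<Sum>j<n. \<Sum>b\<in>UNIV. \<bar>real (degree_vector n t E j b) - real (d j b)\<bar>) \<le> \<epsilon> * real n}"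
        proof (rule prob_edge_law_ge)
          show "choices n t A \<noteq> {}" if "A \<in> ?T" for A using elim(2) t that by blast
          fix F assume F: "\<And>A. A \<in> ?T \<Longrightarrow> F A \<in> choices n t A \<inter> ?Y A"
          have "F A \<subseteq> pool n t A" if "A \<in> ?T" for A using F[OF that] by (simp add: edge_choices_def)
          note deg = degree_vector_eq_inc[OF this]
          have "(\<Sum>j<n. \<Sum>b\<in>UNIV. \<bar>real (degree_vector n t (\<Union>A\<in>?T. F A) j b) - real (d j b)\<bar>) =
              (\<Sum>j<n. \<Sum>b\<in>UNIV. \<bar>real (inc (F {t (fst (j, b)), snd (j, b)}) (fst (j, b))) - real (d (fst (j, b)) (snd (j, b)))\<bar>)"
            using deg by (intro sum.cong) auto
          also have "\<dots> = (\<Sum>A\<in>?T. \<Sum>x\<in>slots n t A. \<bar>real (inc (F {t (fst x), snd x}) (fst x)) - real (d (fst x) (snd x))\<bar>)"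
            by (rule sum_type_pairs_slots[symmetric])
          also have "\<dots> = (\<Sum>A\<in>?T. deviation n t d A (F A))"
            by (intro sum.cong refl) (auto simp: slots_def)
          also have "\<dots> \<le> (\<Sum>A\<in>?T. \<epsilon>' * real n)" using F by (intro sum_mono) auto
          also have "\<dots> = \<epsilon> * real n" using T ne by (simp add: \<epsilon>'_def)
          finally show "(\<Union>A\<in>?T. F A) \<in>
            {E. (\<Sum>j<n. \<Sum>b\<in>UNIV. \<bar>real (degree_vector n t E j b) - real (d j b)\<bar>) \<le> \<epsilon> * real n}" by simp
        qed
        finally show "exp (- \<epsilon> * real n) * (\<Prod>j<n. \<Prod>b\<in>UNIV. limit_weight t d (j, b)) \<le>
          measure_pmf.prob (edge_law n (\<omega>n n) t)
            {E. (\<Sum>j<n. \<Sum>b\<in>UNIV. \<bar>real (degree_vector n t E j b) - real (d j b)\<bar>) \<le> \<epsilon> * real n}" .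
      qed
    qed
  qed
qed

end

section \<open>The weak topology\<close>

lemma openin_weak_expectation:
  fixes f :: "'s \<Rightarrow> real"
  assumes "bounded (range f)" "open U"
  shows "openin weak_topology {p. measure_pmf.expectation p f \<in> U}"
  unfolding weak_topology_def 
  by (rule topology_generated_by_Basis, rule CollectI, rule exI[of _ f], rule exI[of _ U]) (simp add: assms)

lemma continuous_map_expectation:
  assumes "bounded (range f)"
  shows "continuous_map weak_topology euclideanreal (\<lambda>p. measure_pmf.expectation p f)"
  using openin_weak_expectation[OF assms] by (auto simp: continuous_map_def topspace_weak_topology)

lemma continuous_map_prob:
  "continuous_map weak_topology euclideanreal (\<lambda>p. measure_pmf.prob p A)"
proof -
  have "bounded (range (indicat_real A))"
    by (rule boundedI[of _ 1]) (auto simp: indicator_def)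
  from continuous_map_expectation[OF this] show ?thesis by simp
qed

lemma continuous_map_pmf: "continuous_map weak_topology euclideanreal (\<lambda>p. pmf p x)"
  using continuous_map_prob[of "{x}"] by (simp add: measure_pmf_single)

lemma openin_weak_Collect_less:
  assumes "continuous_map weak_topology euclideanreal f" "continuous_map weak_topology euclideanreal g"
  shows "openin weak_topology {p. f p < g p}"
proof -
  have "openin weak_topology {p \<in> topspace weak_topology. g p - f p \<in> {0<..}}"
    by (rule openin_continuous_map_preimage[of _ euclideanreal]) (auto intro!: continuous_map_diff assms)
  then show ?thesis by (simp add: topspace_weak_topology)
qed

lemma closedin_weak_Collect_le:
  assumes "continuous_map weak_topology euclideanreal f" "continuous_map weak_topology euclideanreal g"
  shows "closedin weak_topology {p. f p \<le> g p}"
proof -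
  have "topspace weak_topology - {p. f p \<le> g p} = {p. g p < f p}" by (auto simp: topspace_weak_topology)
  then show ?thesis
    using openin_weak_Collect_less[OF assms(2,1)] by (simp add: closedin_def topspace_weak_topology)
qed

section \<open>Neighbourhoods and compact sets of probability vectors\<close>

text \<open>The support is countable, and the initial pieces of an enumeration exhaust the
  mass.\<close>

lemma finite_pmf_mass:
  assumes "\<eta> > 0"
  obtains F where "finite F" "measure_pmf.prob p (- F) < \<eta>"
proof -
  define A where "A n = from_nat_into (set_pmf p) ` {..<n}" for n :: nat
  have A_un: "(\<Union>n. A n) = set_pmf p"
    unfolding A_def image_UN[symmetric] UN_lessThan_UNIV
    by (rule range_from_nat_into[OF set_pmf_not_empty countable_set_pmf])
  have "(\<lambda>n. measure_pmf.prob p (A n)) \<longlonglongrightarrow> measure_pmf.prob p (\<Union>n. A n)"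
    by (rule measure_pmf.finite_Lim_measure_incseq) (auto simp: incseq_def A_def)
  also have "measure_pmf.prob p (\<Union>n. A n) = 1" unfolding A_un by (simp add: measure_pmf.prob_eq_1 AE_measure_pmf)
  finally have "\<forall>\<^sub>F n in sequentially. 1 - \<eta> < measure_pmf.prob p (A n)"
    by (rule order_tendstoD) (use assms in auto)
  then obtain n where n: "1 - \<eta> < measure_pmf.prob p (A n)" by (auto simp: eventually_sequentially)
  have "measure_pmf.prob p (- A n) = 1 - measure_pmf.prob p (A n)"
    using measure_pmf.prob_compl[of "A n" p] by (simp add: Compl_eq_Diff_UNIV)
  then show ?thesis using n by (intro that[of "A n"]) (auto simp: A_def)
qed

lemma expectation_split:
  fixes f :: "'s \<Rightarrow> real"
  assumes F: "finite F" and B: "\<And>x. \<bar>f x\<bar> \<le> B"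
  shows "\<bar>measure_pmf.expectation p f - (\<Sum>x\<in>F. pmf p x * f x)\<bar> \<le> B * (1 - (\<Sum>x\<in>F. pmf p x))"
proof -
  have int: "integrable (measure_pmf p) f"
    by (rule measure_pmf.integrable_const_bound[of _ B]) (auto simp: B)
  have intF: "integrable (measure_pmf p) (\<lambda>x. indicator A x * f x)" for A
    by (rule measure_pmf.integrable_const_bound[of _ B]) (use B in \<open>auto simp: indicator_def intro: order_trans[OF abs_ge_zero]\<close>)
  have "measure_pmf.expectation p (\<lambda>x. indicator F x * f x) = (\<Sum>x\<in>F. pmf p x *\<^sub>R (indicator F x * f x))"
    by (rule integral_measure_pmf[OF F]) (auto simp: indicator_def)
  then have 1: "measure_pmf.expectation p (\<lambda>x. indicator F x * f x) = (\<Sum>x\<in>F. pmf p x * f x)"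
    by (simp add: indicator_def)
  have "measure_pmf.expectation p f = measure_pmf.expectation p (\<lambda>x. indicator F x * f x + indicator (- F) x * f x)"
    by (intro Bochner_Integration.integral_cong) (auto simp: indicator_def)
  also have "\<dots> = (\<Sum>x\<in>F. pmf p x * f x) + measure_pmf.expectation p (\<lambda>x. indicator (- F) x * f x)"
    using intF by (simp add: 1)
  finally have "\<bar>measure_pmf.expectation p f - (\<Sum>x\<in>F. pmf p x * f x)\<bar> =
      \<bar>measure_pmf.expectation p (\<lambda>x. indicator (- F) x * f x)\<bar>" by simp
  also have "\<dots> \<le> measure_pmf.expectation p (\<lambda>x. \<bar>indicator (- F) x * f x\<bar>)" by (rule integral_abs_bound)
  also have "\<dots> \<le> measure_pmf.expectation p (\<lambda>x. B * indicator (- F) x)"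
  proof (intro integral_mono integrable_abs intF)
    show "integrable (measure_pmf p) (\<lambda>x. B * indicator (- F) x)"
      by (rule measure_pmf.integrable_const_bound[of _ "\<bar>B\<bar>"]) (auto simp: indicator_def)
  qed (use B in \<open>auto simp: indicator_def\<close>)
  also have "\<dots> = B * measure_pmf.prob p (- F)" by simp
  also have "measure_pmf.prob p (- F) = 1 - (\<Sum>x\<in>F. pmf p x)"
    using measure_pmf.prob_compl[of F p] F by (simp add: Compl_eq_Diff_UNIV measure_measure_pmf_finite)
  finally show ?thesis .
qed

text \<open>The weak topology is the topology of pointwise convergence of the weights (Scheffe).\<close>

lemma weak_neighbourhood:
  assumes "openin weak_topology G" "l \<in> G"
  obtains F \<delta> where "finite F" "\<delta> > 0" "\<And>p. (\<forall>x\<in>F. \<bar>pmf p x - pmf l x\<bar> < \<delta>) \<Longrightarrow> p \<in> G"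
proof -
  have "\<exists>F \<delta>. finite F \<and> \<delta> > 0 \<and> (\<forall>p. (\<forall>x\<in>F. \<bar>pmf p x - pmf l x\<bar> < \<delta>) \<longrightarrow> p \<in> G)"
    using assms unfolding weak_topology_def openin_topology_generated_by_iff
  proof (induction rule: generate_topology_on.induct)
    case (Int a b)
    then obtain F1 d1 F2 d2 where "finite F1" "d1 > 0" "\<forall>p. (\<forall>x\<in>F1. \<bar>pmf p x - pmf l x\<bar> < d1) \<longrightarrow> p \<in> a"
      "finite F2" "d2 > 0" "\<forall>p. (\<forall>x\<in>F2. \<bar>pmf p x - pmf l x\<bar> < d2) \<longrightarrow> p \<in> b" by auto
    then show ?case by (intro exI[of _ "F1 \<union> F2"] exI[of _ "min d1 d2"]) auto
  next
    case (UN K)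
    then obtain k where k: "k \<in> K" "l \<in> k" by auto
    from UN.IH[OF this] obtain F \<delta> where "finite F" "\<delta> > 0" "\<forall>p. (\<forall>x\<in>F. \<bar>pmf p x - pmf l x\<bar> < \<delta>) \<longrightarrow> p \<in> k"
      by auto
    with k(1)
    show ?case by (intro exI[of _ F] exI[of _ \<delta>]) blast
  next
    case (Basis s)
    then obtain f :: "'a \<Rightarrow> real" and U where s: "s = {p. measure_pmf.expectation p f \<in> U}" "bounded (range f)" "open U"
      by auto
    obtain B where B: "B > 0" "\<And>x. \<bar>f x\<bar> \<le> B"
      using s(2) unfolding bounded_pos by auto
    have "measure_pmf.expectation l f \<in> U" using Basis s by simp
    then obtain e where e: "e > 0" "\<And>y. \<bar>y - measure_pmf.expectation l f\<bar> < e \<Longrightarrow> y \<in> U"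
      using s(3) unfolding open_dist dist_real_def by blast
    \<comment> \<open>If the weights on \<open>F\<close> change by at most \<open>\<eta>\<close> in
      total, \<open>p\<close> has mass less than \<open>2 * \<eta>\<close> off \<open>F\<close>. The
      errors are then \<open>\<eta> * B\<close> on \<open>F\<close> and, off \<open>F\<close>,
      \<open>2 * \<eta> * B\<close> for \<open>p\<close> and \<open>\<eta> * B\<close> for
      \<open>l\<close>, together \<open>e\<close>.\<close>
    define \<eta> where "\<eta> = e / (4 * B)"
    have \<eta>: "\<eta> > 0" using e B by (simp add: \<eta>_def)
    obtain F where F: "finite F" "measure_pmf.prob l (- F) < \<eta>" by (rule finite_pmf_mass[OF \<eta>])
    then have lF: "1 - (\<Sum>x\<in>F. pmf l x) < \<eta>"
      using measure_pmf.prob_compl[of F l] by (simp add: Compl_eq_Diff_UNIV measure_measure_pmf_finite)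
    define \<delta> where "\<delta> = \<eta> / (card F + 1)"
    have \<delta>: "\<delta> > 0" using \<eta> by (simp add: \<delta>_def)
    have \<delta>F: "card F * \<delta> \<le> \<eta>" using \<eta> by (simp add: \<delta>_def field_simps)
    have "p \<in> s" if p: "\<forall>x\<in>F. \<bar>pmf p x - pmf l x\<bar> < \<delta>" for p
    proof -
      have 1: "(\<Sum>x\<in>F. \<bar>pmf p x - pmf l x\<bar>) \<le> \<eta>"
        using sum_bounded_above[of F "\<lambda>x. \<bar>pmf p x - pmf l x\<bar>" \<delta>] p \<delta>F by fastforce
      have "\<bar>(\<Sum>x\<in>F. pmf p x) - (\<Sum>x\<in>F. pmf l x)\<bar> \<le> (\<Sum>x\<in>F. \<bar>pmf p x - pmf l x\<bar>)"
        unfolding sum_subtractf[symmetric] by (rule sum_abs)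
      then have pF: "1 - (\<Sum>x\<in>F. pmf p x) < 2 * \<eta>" using 1 lF by linarith
      have "\<bar>(\<Sum>x\<in>F. pmf p x * f x) - (\<Sum>x\<in>F. pmf l x * f x)\<bar> = \<bar>\<Sum>x\<in>F. (pmf p x - pmf l x) * f x\<bar>"
        by (simp add: sum_subtractf left_diff_distrib)
      also have "\<dots> \<le> (\<Sum>x\<in>F. \<bar>pmf p x - pmf l x\<bar> * B)"
        by (rule order_trans[OF sum_abs]) (auto simp: abs_mult intro!: sum_mono mult_left_mono B)
      also have "\<dots> \<le> \<eta> * B" using 1 B by (simp add: sum_distrib_right[symmetric])
      finally have 2: "\<bar>(\<Sum>x\<in>F. pmf p x * f x) - (\<Sum>x\<in>F. pmf l x * f x)\<bar> \<le> \<eta> * B" .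
      have 3: "\<bar>measure_pmf.expectation p f - (\<Sum>x\<in>F. pmf p x * f x)\<bar> < 2 * \<eta> * B"
        using expectation_split[of F f B p, OF F(1) B(2)] mult_strict_left_mono[OF pF B(1)] by (simp add: ac_simps)
      have 4: "\<bar>measure_pmf.expectation l f - (\<Sum>x\<in>F. pmf l x * f x)\<bar> < \<eta> * B"
        using expectation_split[of F f B l, OF F(1) B(2)] mult_strict_left_mono[OF lF B(1)] by (simp add: ac_simps)
      have "4 * (\<eta> * B) = e" using B by (simp add: \<eta>_def)
      then have "\<bar>measure_pmf.expectation p f - measure_pmf.expectation l f\<bar> < e"
        using 2 3 4 by linarith
      then show ?thesis using e(2) s(1) by simp
    qed
    then show ?case using F(1) \<delta> by blast
  qed auto
  then show ?thesis using that by blast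
qed

lemma openin_weak_pmf_ball:
  assumes "finite F"
  shows "openin weak_topology {p. \<forall>x\<in>F. \<bar>pmf p x - c x\<bar> < \<delta>}"
proof -
  have "openin weak_topology {p. \<bar>pmf p x - c x\<bar> < \<delta>}" for x
    by (rule openin_weak_Collect_less) (intro continuous_map_real_abs continuous_map_diff continuous_map_pmf continuous_map_canonical_const; simp)+
  then have "openin weak_topology (topspace weak_topology \<inter> (\<Inter>x\<in>F. {p. \<bar>pmf p x - c x\<bar> < \<delta>}))"
    using assms by (cases "F = {}") (auto intro!: openin_INT)
  moreover have "topspace weak_topology \<inter> (\<Inter>x\<in>F. {p. \<bar>pmf p x - c x\<bar> < \<delta>}) = {p. \<forall>x\<in>F. \<bar>pmf p x - c x\<bar> < \<delta>}"
    by (auto simp: topspace_weak_topology)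
  ultimately show ?thesis by simp
qed

text \<open>Tychonoff's theorem gives compactness of a set of functions with values in the unit
  interval. The lower bounds on \<open>F m\<close> are closed conditions that prevent mass from
  escaping in pointwise limits, so all these functions are weights of probability vectors, and by
  the description of weak neighbourhoods \<open>embed_pmf\<close> is continuous on them.\<close>

lemma compactin_tight:
  fixes F :: "nat \<Rightarrow> 's set"
  assumes F: "\<And>m. finite (F m)"
  shows "compactin weak_topology {p. \<forall>m. 1 - 1 / real (Suc m) \<le> (\<Sum>x\<in>F m. pmf p x)}"
proof -
  define Z where "Z = {f :: 's \<Rightarrow> real. (\<forall>x. f x \<in> {0..1}) \<and> (\<forall>A. finite A \<longrightarrow> sum f A \<le> 1) \<and>
     (\<forall>m. 1 - 1 / real (Suc m) \<le> sum f (F m))}"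
  have cont: "continuous_on UNIV (\<lambda>f :: 's \<Rightarrow> real. sum f A)" for A
    by (intro continuous_intros continuous_on_product_coordinates)
  have "compactin (product_topology (\<lambda>_ :: 's. euclideanreal) UNIV) (PiE UNIV (\<lambda>_. {0..1}))"
    unfolding compactin_PiE by (simp add: compactin_euclidean_iff)
  then have "compact (PiE (UNIV :: 's set) (\<lambda>_. {0..1 :: real}))"
    unfolding euclidean_product_topology compactin_euclidean_iff .
  moreover have "closed ((\<Inter>A\<in>{A. finite A}. {f :: 's \<Rightarrow> real. sum f A \<le> 1}) \<inter>
      (\<Inter>m. {f. 1 - 1 / real (Suc m) \<le> sum f (F m)}))"
    by (intro closed_Int closed_INT ballI closed_Collect_le cont continuous_on_const)
  ultimately have "compact (PiE (UNIV :: 's set) (\<lambda>_. {0..1 :: real}) \<inter> ((\<Inter>A\<in>{A. finite A}. {f. sum f A \<le> 1}) \<inter>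
      (\<Inter>m. {f. 1 - 1 / real (Suc m) \<le> sum f (F m)})))"
    by (rule compact_Int_closed)
  also have "PiE (UNIV :: 's set) (\<lambda>_. {0..1 :: real}) \<inter> ((\<Inter>A\<in>{A. finite A}. {f. sum f A \<le> 1}) \<inter>
      (\<Inter>m. {f. 1 - 1 / real (Suc m) \<le> sum f (F m)})) = Z"
    by (auto simp: Z_def PiE_def)
  finally have Z: "compact Z" .
  have emb: "pmf (embed_pmf f) x = f x" if f: "f \<in> Z" for f x
  proof (rule pmf_embed_pmf)
    show "0 \<le> f x" for x using f by (auto simp: Z_def)
    have le: "(\<integral>\<^sup>+x. ennreal (f x) * indicator A x \<partial>count_space UNIV) = ennreal (sum f A)" if "finite A" for A
    proof -
      have "(\<integral>\<^sup>+x. ennreal (f x) * indicator A x \<partial>count_space UNIV) = (\<Sum>x\<in>A. ennreal (f x))"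
        using that by (simp add: nn_integral_count_space_indicator[symmetric] nn_integral_count_space_finite)
      also have "\<dots> = ennreal (sum f A)" using f by (intro sum_ennreal) (auto simp: Z_def)
      finally show ?thesis .
    qed
    have "(\<integral>\<^sup>+x. ennreal (f x) \<partial>count_space UNIV) \<le> 1"
    proof -
      have "f summable_on UNIV"
        by (rule nonneg_bdd_above_summable_on) (use f in \<open>auto simp: Z_def intro!: bdd_aboveI[of _ 1]\<close>)
      moreover have "infsum f UNIV \<le> 1"
        by (rule infsum_le_finite_sums[OF calculation]) (use f in \<open>auto simp: Z_def\<close>)
      moreover have "Infinite_Set_Sum.abs_summable_on f UNIV"
        using calculation(1) abs_summable_equivalent[of f UNIV] summable_on_iff_abs_summable_on_real by blast
      ultimately show ?thesis
        using nn_integral_conv_infsetsum[of f UNIV] f infsetsum_infsum[of f UNIV] by (auto simp: Z_def)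
    qed
    \<comment> \<open>The bounds on the finite sets \<open>F m\<close> tend to 1; this is where
      tightness enters.\<close>
    moreover have "1 \<le> (\<integral>\<^sup>+x. ennreal (f x) \<partial>count_space UNIV)"
    proof -
      have "ennreal (1 - 1 / real (Suc m)) \<le> (\<integral>\<^sup>+x. ennreal (f x) \<partial>count_space UNIV)" for m
      proof -
        have "ennreal (1 - 1 / real (Suc m)) \<le> ennreal (sum f (F m))"
          using f by (intro ennreal_leI) (auto simp: Z_def)
        also have "\<dots> = (\<integral>\<^sup>+x. ennreal (f x) * indicator (F m) x \<partial>count_space UNIV)" using le[OF F] by simp
        also have "\<dots> \<le> (\<integral>\<^sup>+x. ennreal (f x) \<partial>count_space UNIV)"
          by (intro nn_integral_mono) (auto simp: indicator_def)
        finally show ?thesis .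
      qed
      moreover have "(\<lambda>m. ennreal (1 - 1 / real (Suc m))) \<longlonglongrightarrow> ennreal (1 - 0)"
        by (intro tendsto_ennrealI tendsto_diff tendsto_const) (rule LIMSEQ_inverse_real_of_nat[unfolded inverse_eq_divide])
      ultimately show ?thesis by (intro LIMSEQ_le_const2[of _ 1]) auto
    qed
    ultimately show "(\<integral>\<^sup>+x. ennreal (f x) \<partial>count_space UNIV) = 1" by (rule antisym)
  qed
  have "continuous_map (subtopology euclidean Z) weak_topology embed_pmf"
    unfolding continuous_map_def
  proof (intro conjI allI impI)
    show "embed_pmf \<in> topspace (subtopology euclidean Z) \<rightarrow> topspace weak_topology"
      by (simp add: topspace_weak_topology)
    fix G :: "'s pmf set" assume G: "openin weak_topology G"
    show "openin (subtopology euclidean Z) {f \<in> topspace (subtopology euclidean Z). embed_pmf f \<in> G}"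
    proof (subst openin_subopen, intro ballI)
      fix f assume f: "f \<in> {f \<in> topspace (subtopology euclidean Z). embed_pmf f \<in> G}"
      then have fZ: "f \<in> Z" and fG: "embed_pmf f \<in> G" by auto
      obtain A \<delta> where A: "finite A" "\<delta> > 0" "\<And>p. (\<forall>x\<in>A. \<bar>pmf p x - pmf (embed_pmf f) x\<bar> < \<delta>) \<Longrightarrow> p \<in> G"
        using weak_neighbourhood[OF G fG] by blast
      let ?T = "\<Inter>x\<in>A. {g :: 's \<Rightarrow> real. \<bar>g x - f x\<bar> < \<delta>}"
      have "open ?T" using A(1)
        by (intro open_INT ballI open_Collect_less continuous_intros continuous_on_product_coordinates) auto
      then have "openin (subtopology euclidean Z) (Z \<inter> ?T)" by (simp add: openin_subtopology_Int2)
      moreover have "f \<in> Z \<inter> ?T" using fZ A(2) by simp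
      moreover have "Z \<inter> ?T \<subseteq> {f \<in> topspace (subtopology euclidean Z). embed_pmf f \<in> G}"
        using A(3) emb fZ by auto
      ultimately show "\<exists>T. openin (subtopology euclidean Z) T \<and> f \<in> T \<and>
          T \<subseteq> {f \<in> topspace (subtopology euclidean Z). embed_pmf f \<in> G}" by blast
    qed
  qed
  moreover have "compactin (subtopology euclidean Z) Z"
    using Z by (simp add: compactin_subtopology compactin_euclidean_iff)
  ultimately have "compactin weak_topology (embed_pmf ` Z)" by (rule image_compactin[rotated])
  also have "embed_pmf ` Z = {p. \<forall>m. 1 - 1 / real (Suc m) \<le> (\<Sum>x\<in>F m. pmf p x)}"
  proof (intro set_eqI iffI)
    fix p assume "p \<in> embed_pmf ` Z"
    then obtain f where "f \<in> Z" "p = embed_pmf f" by blast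
    then show "p \<in> {p. \<forall>m. 1 - 1 / real (Suc m) \<le> (\<Sum>x\<in>F m. pmf p x)}" using emb by (simp add: Z_def)
  next
    fix p assume p: "p \<in> {p. \<forall>m. 1 - 1 / real (Suc m) \<le> (\<Sum>x\<in>F m. pmf p x)}"
    have "sum (pmf p) A \<le> 1" if "finite A" for A
      using that by (simp add: measure_measure_pmf_finite[symmetric])
    then have pZ: "pmf p \<in> Z" using p by (simp add: Z_def pmf_le_1)
    have "embed_pmf (pmf p) = p" by (rule pmf_eqI) (simp add: emb[OF pZ])
    then show "p \<in> embed_pmf ` Z" using pZ by (metis imageI)
  qed
  finally show ?thesis .
qed

section \<open>A criterion for large deviation principles\<close>

lemma ln_ext_ge:
  assumes "exp y \<le> x" "n > 0"
  shows "ereal (y / n) \<le> ln_ext x / ereal n"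
proof -
  have "x > 0" using assms(1) exp_gt_zero[of y] by linarith
  then have "y \<le> ln x" using assms(1) by (simp add: ln_ge_iff)
  then show ?thesis using \<open>x > 0\<close> assms(2) by (simp add: ln_ext_def divide_right_mono)
qed

lemma ln_ext_le:
  assumes "x \<le> exp y" "n > 0" "0 \<le> x"
  shows "ln_ext x / ereal n \<le> ereal (y / n)"
proof (cases "x = 0")
  case False
  then have "ln x \<le> y" using assms by (metis exp_gt_zero ln_exp ln_le_cancel_iff order_less_le)
  then show ?thesis using False assms(2) by (simp add: ln_ext_def divide_right_mono)
qed (use assms(2) in \<open>simp add: ln_ext_def\<close>)

text \<open>Local estimates suffice because one compact set eventually carries all the mass: inside
  it a closed set is covered by finitely many of the neighbourhoods from \<open>upper\<close>, and a
  union bound over a fixed number of sets costs nothing on the exponential scale.\<close>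

lemma satisfies_LDP_compactI:
  fixes \<mu> :: "nat \<Rightarrow> 'x measure"
  assumes prob: "\<And>n. prob_space (\<mu> n)" and sets: "\<And>n. sets (\<mu> n) = sets (borel_of_topology T)"
    and nonneg: "\<And>x. x \<in> topspace T \<Longrightarrow> 0 \<le> I x"
    and lower: "\<And>G x v \<epsilon>. openin T G \<Longrightarrow> x \<in> G \<Longrightarrow> I x = ereal v \<Longrightarrow> \<epsilon> > 0 \<Longrightarrow>
      \<forall>\<^sub>F n in sequentially. exp (- real n * (v + \<epsilon>)) \<le> measure (\<mu> n) G"
    and upper: "\<And>x c. x \<in> topspace T \<Longrightarrow> ereal c < I x \<Longrightarrow>
      \<exists>U. openin T U \<and> x \<in> U \<and> (\<forall>\<^sub>F n in sequentially. measure (\<mu> n) U \<le> exp (- real n * c))"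
    and K: "compactin T K" and tight: "\<forall>\<^sub>F n in sequentially. AE x in \<mu> n. x \<in> K"
  shows "satisfies_LDP T \<mu> real I"
  unfolding satisfies_LDP_def
proof (intro conjI allI impI)
  have opens: "G \<in> sets (\<mu> n)" if "openin T G" for G n
    using that openin_subset unfolding sets by (auto simp: borel_of_topology_def)
  fix G assume G: "openin T G"
  show "- (INF x\<in>G. I x) \<le> liminf (\<lambda>n. ln_ext (measure (\<mu> n) G) / ereal (real n))" (is "_ \<le> ?L")
  proof -
    have "- ?L \<le> I x" if x: "x \<in> G" for x
    proof (cases "I x")
      case (real v)
      have "- ereal v \<le> ?L"
      proof (rule ereal_le_epsilon2)
        fix \<epsilon> :: real assume \<epsilon>: "0 < \<epsilon>"
        have "\<forall>\<^sub>F n in sequentially. ereal (- (v + \<epsilon>)) \<le> ln_ext (measure (\<mu> n) G) / ereal (real n)"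
          using lower[OF G x real \<epsilon>] eventually_gt_at_top[of 0]
        proof eventually_elim
          case (elim n)
          then show ?case using ln_ext_ge[of "- real n * (v + \<epsilon>)" "measure (\<mu> n) G" "real n"] by simp
        qed
        then have "ereal (- (v + \<epsilon>)) \<le> ?L" by (rule Liminf_bounded)
        then have "ereal (- (v + \<epsilon>)) + ereal \<epsilon> \<le> ?L + ereal \<epsilon>" by (rule add_right_mono)
        then show "- ereal v \<le> ?L + ereal \<epsilon>" by simp
      qed
      then show ?thesis using real by (simp add: ereal_uminus_le_reorder)
    next
      case MInf
      then show ?thesis using nonneg[of x] x openin_subset[OF G] by auto
    qed simp
    then have "- ?L \<le> (INF x\<in>G. I x)" by (rule INF_greatest)
    then show ?thesis by (simp add: ereal_uminus_le_reorder)
  qed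
next
  have opens: "G \<in> sets (\<mu> n)" if "openin T G" for G n
    using that openin_subset unfolding sets by (auto simp: borel_of_topology_def)
  have space: "space (\<mu> n) = topspace T" for n
    using sets_eq_imp_space_eq[OF sets[of n]] openin_subset
    by (auto simp: borel_of_topology_def space_measure_of_conv)
  fix F assume F: "closedin T F"
  let ?L = "limsup (\<lambda>n. ln_ext (measure (\<mu> n) F) / ereal (real n))"
  have "z \<le> - ?L" if z: "z < (INF x\<in>F. I x)" for z
  proof (cases z)
    case (real c)
    have "\<exists>U. openin T U \<and> x \<in> U \<and> (\<forall>\<^sub>F n in sequentially. measure (\<mu> n) U \<le> exp (- real n * c))"
      if "x \<in> F" for x
      using upper[of x c] that z real closedin_subset[OF F] by (auto dest: less_INF_D)
    then obtain U where U: "\<And>x. x \<in> F \<Longrightarrow> openin T (U x) \<and> x \<in> U x \<and>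
        (\<forall>\<^sub>F n in sequentially. measure (\<mu> n) (U x) \<le> exp (- real n * c))" by metis
    have "compactin T (F \<inter> K)" by (rule closed_Int_compactin[OF F K])
    then obtain \<F> where \<F>: "finite \<F>" "\<F> \<subseteq> U ` F" "F \<inter> K \<subseteq> \<Union>\<F>"
      unfolding compactin_def by (auto elim!: allE[of _ "U ` F"] simp: U)
    from finite_subset_image[OF \<F>(1,2)] obtain A where A_sub: "A \<subseteq> F" "finite A" "\<F> = U ` A" by auto
    with \<F>(3) have A: "finite A" "A \<subseteq> F" "F \<inter> K \<subseteq> (\<Union>x\<in>A. U x)" by auto
    have ev: "\<forall>\<^sub>F n in sequentially. \<forall>x\<in>A. measure (\<mu> n) (U x) \<le> exp (- real n * c)"
      using A U by (subst eventually_ball_finite_distrib) auto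
    \<comment> \<open>The \<open>+ 1\<close> keeps the argument of the logarithm positive when the
      cover is empty.\<close>
    have "?L \<le> limsup (\<lambda>n. ereal (ln (real (card A) + 1) / real n - c))"
    proof (rule Limsup_mono)
      show "\<forall>\<^sub>F n in sequentially. ln_ext (measure (\<mu> n) F) / ereal (real n) \<le> ereal (ln (real (card A) + 1) / real n - c)"
        using ev tight eventually_gt_at_top[of 0]
      proof eventually_elim
        case (elim n)
        interpret prob_space "\<mu> n" by (rule prob)
        have "measure (\<mu> n) F \<le> measure (\<mu> n) (\<Union>x\<in>A. U x)"
        proof (rule finite_measure_mono_AE)
          show "(\<Union>x\<in>A. U x) \<in> sets (\<mu> n)" using A opens U by (intro sets.finite_UN) auto
        qed (use elim(2) A in \<open>auto elim!: eventually_mono\<close>)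
        also have "\<dots> \<le> (\<Sum>x\<in>A. measure (\<mu> n) (U x))"
          using A opens U by (intro finite_measure_subadditive_finite) auto
        also have "\<dots> \<le> real (card A) * exp (- real n * c)"
          using elim(1) sum_bounded_above[of A "\<lambda>x. measure (\<mu> n) (U x)" "exp (- real n * c)"] by simp
        also have "\<dots> \<le> (real (card A) + 1) * exp (- real n * c)" by (simp add: distrib_right)
        also have "\<dots> = exp (ln (real (card A) + 1) - real n * c)"
          by (simp add: exp_diff exp_minus field_simps)
        finally have "ln_ext (measure (\<mu> n) F) / ereal (real n) \<le> ereal ((ln (real (card A) + 1) - real n * c) / real n)"
          using elim by (intro ln_ext_le) auto
        then show ?case using elim by (simp add: diff_divide_distrib)
      qed
    qed
    also have "\<dots> = ereal (0 - c)"
    proof (intro lim_imp_Limsup)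
      show "(\<lambda>n. ereal (ln (real (card A) + 1) / real n - c)) \<longlonglongrightarrow> ereal (0 - c)"
        by (intro tendsto_ereal tendsto_diff tendsto_const) (rule lim_const_over_n)
    qed simp
    finally have "?L \<le> - z" using real by simp
    then show ?thesis by (metis ereal_minus_le_minus ereal_uminus_uminus)
  qed (use z in auto)
  then have "(INF x\<in>F. I x) \<le> - ?L" by (rule dense_le)
  then show "?L \<le> - (INF x\<in>F. I x)" by (metis ereal_minus_le_minus ereal_uminus_uminus)
qed

section \<open>Relative entropy and the Poisson reference measure\<close>

text \<open>The correction \<open>q - p\<close> makes the summand non-negative and sums to 0 over
  two probability vectors. For \<open>q = 0 < p\<close> the formula stays finite instead of becoming
  infinite, which is why absolute continuity is always carried along separately.\<close>

definition kl_term :: "real \<Rightarrow> real \<Rightarrow> real" where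
  "kl_term p q = (if p = 0 then q else p * ln (p / q) - p + q)"

text \<open>\<open>q * (exp y - 1)\<close> is the convex conjugate of \<open>kl_term\<close> in its
  first argument; the inequality is \<open>ln z \<le> z - 1\<close> at
  \<open>z = q * exp y / p\<close>.\<close>

lemma fenchel_young:
  assumes "0 \<le> p" "0 \<le> q" "q = 0 \<Longrightarrow> p = 0"
  shows "p * y \<le> kl_term p q + q * (exp y - 1)"
proof (cases "p = 0")
  case False
  then have p: "p > 0" and "q \<noteq> 0" using assms by auto
  then have q: "q > 0" using assms(2) by simp
  let ?z = "q * exp y / p"
  have "ln ?z \<le> ?z - 1" using p q by (intro ln_le_minus_one) auto
  moreover have "ln ?z = y - ln (p / q)" using p q by (simp add: ln_div ln_mult)
  ultimately have "p * (y - ln (p / q)) \<le> p * (?z - 1)" using p by (intro mult_left_mono) auto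
  moreover have "p * ?z = q * exp y" using p by simp
  ultimately show ?thesis using False by (simp add: kl_term_def right_diff_distrib)
qed (use assms in \<open>simp add: kl_term_def algebra_simps\<close>)

lemma kl_term_nonneg: "0 \<le> p \<Longrightarrow> 0 \<le> q \<Longrightarrow> (q = 0 \<Longrightarrow> p = 0) \<Longrightarrow> 0 \<le> kl_term p q"
  using fenchel_young[of p q 0] by simp

lemma kl_term_eq: "kl_term p q = p * ln (p / q) - p + q"
  by (simp add: kl_term_def)

lemma absolutely_continuous_pmf_iff:
  "absolutely_continuous (measure_pmf q) (measure_pmf p) \<longleftrightarrow> (\<forall>x. pmf q x = 0 \<longrightarrow> pmf p x = 0)"
proof
  assume ac: "absolutely_continuous (measure_pmf q) (measure_pmf p)"
  show "\<forall>x. pmf q x = 0 \<longrightarrow> pmf p x = 0"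
  proof (intro allI impI)
    fix x assume "pmf q x = 0"
    then have "{x} \<in> null_sets (measure_pmf q)" by (intro null_setsI) (auto simp: emeasure_pmf_single)
    then have "{x} \<in> null_sets (measure_pmf p)" using ac by (auto simp: absolutely_continuous_def)
    then show "pmf p x = 0" by (auto simp: null_sets_def emeasure_pmf_single)
  qed
next
  assume *: "\<forall>x. pmf q x = 0 \<longrightarrow> pmf p x = 0"
  show "absolutely_continuous (measure_pmf q) (measure_pmf p)"
    unfolding absolutely_continuous_def
  proof
    fix A assume "A \<in> null_sets (measure_pmf q)"
    then have "measure_pmf.prob q A = 0" by (auto simp: null_sets_def measure_def)
    then have "set_pmf q \<inter> A = {}" by (simp add: measure_pmf_zero_iff)
    then have "set_pmf p \<inter> A = {}" using * by (auto simp: set_pmf_iff disjoint_iff)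
    then have "measure_pmf.prob p A = 0" by (simp add: measure_pmf_zero_iff)
    then show "A \<in> null_sets (measure_pmf p)" by (intro null_setsI) (auto simp: measure_pmf.emeasure_eq_measure)
  qed
qed

lemma pmf_has_sum: "(pmf p has_sum 1) UNIV"
proof -
  have "Infinite_Set_Sum.abs_summable_on (pmf p) UNIV" by (rule pmf_abs_summable)
  then have "pmf p summable_on UNIV"
    using abs_summable_equivalent summable_on_iff_abs_summable_on_real by blast
  moreover have "infsum (pmf p) UNIV = 1"
    using infsetsum_infsum[OF pmf_abs_summable[of p UNIV]] infsetsum_pmf_eq_1[of p UNIV] by simp
  ultimately show ?thesis by (metis has_sum_infsum)
qed

text \<open>For real functions unconditional summability is absolute, hence the same as Bochner
  integrability.\<close>

lemma integrable_pmf_iff: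
  fixes f :: "'a \<Rightarrow> real"
  shows "integrable (measure_pmf p) f \<longleftrightarrow> (\<lambda>x. pmf p x * f x) summable_on UNIV"
    and "integrable (measure_pmf p) f \<Longrightarrow> ((\<lambda>x. pmf p x * f x) has_sum measure_pmf.expectation p f) UNIV"
proof -
  have 1: "integrable (measure_pmf p) f \<longleftrightarrow> integrable (count_space UNIV) (\<lambda>x. pmf p x * f x)"
    unfolding measure_pmf_eq_density by (subst integrable_density) auto
  also have "\<dots> \<longleftrightarrow> Infinite_Set_Sum.abs_summable_on (\<lambda>x. pmf p x * f x) UNIV"
    by (simp add: Infinite_Set_Sum.abs_summable_on_def)
  finally have 2: "integrable (measure_pmf p) f \<longleftrightarrow> Infinite_Set_Sum.abs_summable_on (\<lambda>x. pmf p x * f x) UNIV" .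
  then show 3: "integrable (measure_pmf p) f \<longleftrightarrow> (\<lambda>x. pmf p x * f x) summable_on UNIV"
    using abs_summable_equivalent[of "\<lambda>x. pmf p x * f x" UNIV]
      summable_on_iff_abs_summable_on_real[of "\<lambda>x. pmf p x * f x" UNIV] by blast
  assume int: "integrable (measure_pmf p) f"
  have "measure_pmf.expectation p f = integral\<^sup>L (count_space UNIV) (\<lambda>x. pmf p x * f x)"
    unfolding measure_pmf_eq_density by (subst integral_density) auto
  also have "\<dots> = infsum (\<lambda>x. pmf p x * f x) UNIV"
    using infsetsum_infsum[of "\<lambda>x. pmf p x * f x" UNIV] int 2 by (simp add: infsetsum_def)
  finally show "((\<lambda>x. pmf p x * f x) has_sum measure_pmf.expectation p f) UNIV"
    using int 3 by (simp add: has_sum_infsum)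
qed

text \<open>The Radon-Nikodym derivative is the quotient of the weights; adding the differences
  \<open>pmf q x - pmf p x\<close>, which sum to 0, changes neither summability nor value.\<close>

lemma relative_entropy_pmf:
  "relative_entropy (measure_pmf p) (measure_pmf q) =
    (if (\<forall>x. pmf q x = 0 \<longrightarrow> pmf p x = 0) \<and> (\<lambda>x. kl_term (pmf p x) (pmf q x)) summable_on UNIV
     then ereal (infsum (\<lambda>x. kl_term (pmf p x) (pmf q x)) UNIV) else \<infinity>)"
proof (cases "\<forall>x. pmf q x = 0 \<longrightarrow> pmf p x = 0")
  case False
  show ?thesis unfolding relative_entropy_def absolutely_continuous_pmf_iff
    by (simp only: False simp_thms if_False)
next
  case True
  let ?r = "\<lambda>x. pmf p x / pmf q x" and ?k = "\<lambda>x. kl_term (pmf p x) (pmf q x)"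
  have "density (measure_pmf q) (\<lambda>x. ennreal (?r x)) = measure_pmf p"
  proof -
    have "density (measure_pmf q) (\<lambda>x. ennreal (?r x)) =
        density (count_space UNIV) (\<lambda>x. ennreal (pmf q x) * ennreal (?r x))"
      unfolding measure_pmf_eq_density[of q] by (subst density_density_eq) auto
    also have "(\<lambda>x. ennreal (pmf q x) * ennreal (?r x)) = (\<lambda>x. ennreal (pmf p x))"
      using True by (auto simp: ennreal_mult'[symmetric] fun_eq_iff)
    finally show ?thesis unfolding measure_pmf_eq_density[of p] .
  qed
  then have RN: "AE x in measure_pmf q. ennreal (?r x) = RN_deriv (measure_pmf q) (measure_pmf p) x"
    by (intro measure_pmf.RN_deriv_unique) auto
  have ed: "AE x in measure_pmf p. entropy_density (exp 1) (measure_pmf q) (measure_pmf p) x = ln (?r x)"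
  proof (rule AE_pmfI)
    fix x assume "x \<in> set_pmf p"
    then have x: "pmf p x \<noteq> 0" by (simp add: set_pmf_iff)
    then have "x \<in> set_pmf q" using True by (auto simp: set_pmf_iff)
    then have "RN_deriv (measure_pmf q) (measure_pmf p) x = ennreal (?r x)"
      using RN by (auto simp: AE_measure_pmf_iff)
    then show "entropy_density (exp 1) (measure_pmf q) (measure_pmf p) x = ln (?r x)"
      by (simp add: entropy_density_def log_def)
  qed
  have int: "integrable (measure_pmf p) (entropy_density (exp 1) (measure_pmf q) (measure_pmf p)) \<longleftrightarrow>
      integrable (measure_pmf p) (\<lambda>x. ln (?r x))"
    using ed by (intro integrable_cong_AE) auto
  have val: "KL_divergence (exp 1) (measure_pmf q) (measure_pmf p) = measure_pmf.expectation p (\<lambda>x. ln (?r x))"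
    unfolding KL_divergence_def using ed by (intro integral_cong_AE) auto
  have pq: "((\<lambda>x. pmf q x - pmf p x) has_sum 0) UNIV"
    using has_sum_add[OF pmf_has_sum[of q] has_sum_uminusI[OF pmf_has_sum[of p]]] by simp
  have qp: "((\<lambda>x. pmf p x - pmf q x) has_sum 0) UNIV"
    using has_sum_add[OF pmf_has_sum[of p] has_sum_uminusI[OF pmf_has_sum[of q]]] by simp
  have k_eq: "?k x = pmf p x * ln (?r x) + (pmf q x - pmf p x)" for x by (simp add: kl_term_eq)
  have l_eq: "pmf p x * ln (?r x) = ?k x + (pmf p x - pmf q x)" for x by (simp add: kl_term_eq)
  have "(\<lambda>x. pmf p x * ln (?r x)) summable_on UNIV \<longleftrightarrow> ?k summable_on UNIV"
    using summable_on_add[of "\<lambda>x. pmf p x * ln (?r x)" UNIV "\<lambda>x. pmf q x - pmf p x"]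
      summable_on_add[of ?k UNIV "\<lambda>x. pmf p x - pmf q x"] has_sum_imp_summable[OF pq] has_sum_imp_summable[OF qp]
    unfolding k_eq[symmetric] l_eq[symmetric] by blast
  then have iff: "integrable (measure_pmf p) (\<lambda>x. ln (?r x)) \<longleftrightarrow> ?k summable_on UNIV"
    by (simp add: integrable_pmf_iff(1))
  have "infsum ?k UNIV = measure_pmf.expectation p (\<lambda>x. ln (?r x))" if "integrable (measure_pmf p) (\<lambda>x. ln (?r x))"
    using has_sum_add[OF integrable_pmf_iff(2)[OF that] pq] unfolding k_eq[symmetric] by (simp add: infsumI)
  then show ?thesis
    using True int val iff by (simp add: relative_entropy_def absolutely_continuous_pmf_iff)
qed

text \<open>By non-negativity the entropy is the supremum of its finite partial sums. Each of them
  involves finitely many weights, which is what lower semicontinuity and duality need.\<close>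

lemma relative_entropy_pmf_le_iff:
  "relative_entropy (measure_pmf p) (measure_pmf q) \<le> ereal c \<longleftrightarrow>
    (\<forall>x. pmf q x = 0 \<longrightarrow> pmf p x = 0) \<and> (\<forall>F. finite F \<longrightarrow> (\<Sum>x\<in>F. kl_term (pmf p x) (pmf q x)) \<le> c)"
proof (cases "\<forall>x. pmf q x = 0 \<longrightarrow> pmf p x = 0")
  case True
  let ?k = "\<lambda>x. kl_term (pmf p x) (pmf q x)"
  have k: "0 \<le> ?k x" for x using True by (intro kl_term_nonneg) auto
  show ?thesis
  proof
    assume *: "relative_entropy (measure_pmf p) (measure_pmf q) \<le> ereal c"
    then have s: "?k summable_on UNIV" and le: "infsum ?k UNIV \<le> c"
      using True by (auto simp: relative_entropy_pmf split: if_splits)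
    have "sum ?k F \<le> c" if "finite F" for F
      using finite_sum_le_infsum[OF s that] k le by fastforce
    then show "(\<forall>x. pmf q x = 0 \<longrightarrow> pmf p x = 0) \<and> (\<forall>F. finite F \<longrightarrow> sum ?k F \<le> c)" using True by blast
  next
    assume *: "(\<forall>x. pmf q x = 0 \<longrightarrow> pmf p x = 0) \<and> (\<forall>F. finite F \<longrightarrow> sum ?k F \<le> c)"
    have s: "?k summable_on UNIV"
      by (rule nonneg_bdd_above_summable_on) (use k * in \<open>auto intro!: bdd_aboveI[of _ c]\<close>)
    moreover have "infsum ?k UNIV \<le> c" by (rule infsum_le_finite_sums[OF s]) (use * in auto)
    ultimately show "relative_entropy (measure_pmf p) (measure_pmf q) \<le> ereal c"
      using True by (simp add: relative_entropy_pmf)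
  qed
next
  case False
  show ?thesis by (simp only: relative_entropy_pmf False simp_thms if_False) simp
qed

lemma relative_entropy_pmf_nonneg: "0 \<le> relative_entropy (measure_pmf p) (measure_pmf q)"
  by (auto simp: relative_entropy_pmf intro!: infsum_nonneg kl_term_nonneg)

section \<open>The Poisson reference law\<close>

text \<open>Mean 0 occurs wherever \<open>\<omega>\<close> vanishes; the law then degenerates to
  having no neighbours.\<close>

definition poisson_law :: "real \<Rightarrow> nat pmf" where
  "poisson_law \<mu> = (if \<mu> = 0 then return_pmf 0 else poisson_pmf \<mu>)"

lemma pmf_poisson_law: "0 \<le> \<mu> \<Longrightarrow> pmf (poisson_law \<mu>) k = poisson_weight \<mu> k"
  by (auto simp: poisson_law_def poisson_weight_def indicator_def)

text \<open>The measure \<open>Q_poi\<close> as a probability mass function, built so that its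
  marginals can be read off; see \<open>Q_poi_eq\<close>.\<close>

definition poisson_locality :: "('b::finite \<Rightarrow> 'b \<Rightarrow> real) \<Rightarrow> 'b pmf \<Rightarrow> ('b \<times> ('b \<Rightarrow> nat)) pmf" where
  "poisson_locality \<omega> \<rho> = bind_pmf \<rho> (\<lambda>a. map_pmf (Pair a) (Pi_pmf UNIV 0 (\<lambda>b. poisson_law (\<omega> a b / pmf \<rho> a))))"

lemma pmf_bind_Pair:
  fixes \<rho> :: "'b::finite pmf"
  shows "pmf (bind_pmf \<rho> (\<lambda>a. map_pmf (Pair a) (M a))) (a, y) = pmf \<rho> a * pmf (M a) y"
proof -
  have "pmf (map_pmf (Pair a') (M a')) (a, y) = (if a' = a then pmf (M a) y else 0)" for a'
  proof (cases "a' = a")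
    case True
    then show ?thesis using pmf_map_inj'[of "Pair a" "M a" y] by (simp add: inj_on_def)
  qed (auto simp: pmf_eq_0_set_pmf)
  then show ?thesis
    by (simp add: pmf_bind integral_measure_pmf_real[of UNIV] if_distrib[of "\<lambda>x. x * _"] cong: if_cong)
qed

lemma pmf_poisson_locality:
  assumes "\<And>a b. 0 \<le> \<omega> a b"
  shows "pmf (poisson_locality \<omega> \<rho>) (a, \<sigma>) = pmf \<rho> a * (\<Prod>b\<in>UNIV. poisson_weight (\<omega> a b / pmf \<rho> a) (\<sigma> b))"
  using assms by (simp add: poisson_locality_def pmf_bind_Pair pmf_Pi pmf_poisson_law)

lemma pmf_poisson_locality_component:
  assumes "\<And>a b. 0 \<le> \<omega> a b"
  shows "pmf (map_pmf (\<lambda>(a', \<sigma>). (a', \<sigma> b)) (poisson_locality \<omega> \<rho>)) (a, k) =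
    pmf \<rho> a * poisson_weight (\<omega> a b / pmf \<rho> a) k"
proof -
  have "map_pmf (\<lambda>(a', \<sigma>). (a', \<sigma> b)) (poisson_locality \<omega> \<rho>) =
      bind_pmf \<rho> (\<lambda>a. map_pmf (Pair a) (map_pmf (\<lambda>\<sigma>. \<sigma> b) (Pi_pmf UNIV 0 (\<lambda>b. poisson_law (\<omega> a b / pmf \<rho> a)))))"
    by (simp add: poisson_locality_def map_bind_pmf map_pmf_comp)
  also have "\<dots> = bind_pmf \<rho> (\<lambda>a. map_pmf (Pair a) (poisson_law (\<omega> a b / pmf \<rho> a)))"
    by (simp add: Pi_pmf_component)
  finally show ?thesis using assms by (simp add: pmf_bind_Pair pmf_poisson_law)
qed

lemma Q_poi_eq:
  assumes "\<And>a b. 0 \<le> \<omega> a b"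
  shows "Q_poi \<omega> l = measure_pmf (poisson_locality \<omega> (H1 l))"
  unfolding Q_poi_def measure_pmf_eq_density
  by (intro arg_cong2[where f = density] refl ext)
    (auto simp: pmf_poisson_locality[OF assms] poisson_weight_def)

text \<open>Where the entropy is evaluated the type marginal is \<open>\<rho>\<close>, so the
  reference measure no longer depends on \<open>l\<close>.\<close>

lemma rate_J_eq:
  assumes "\<And>a b. 0 \<le> \<omega> a b"
  shows "rate_J \<rho> \<omega> l = (if consistent \<omega> l \<and> H1 l = \<rho> then
    relative_entropy (measure_pmf l) (measure_pmf (poisson_locality \<omega> \<rho>)) else \<infinity>)"
  by (simp add: rate_J_def Q_poi_eq[OF assms])

section \<open>Goodness of the rate function\<close>

text \<open>Mean number of neighbours of type \<open>b\<close>, cut off above \<open>K\<close>.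
  Unlike the full mean in \<open>H2\<close> it is weakly continuous.\<close>

definition trunc_mean :: "nat \<Rightarrow> ('b::finite \<times> ('b \<Rightarrow> nat)) pmf \<Rightarrow> 'b \<Rightarrow> 'b \<Rightarrow> real" where
  "trunc_mean K l a b = (\<Sum>k\<le>K. pmf (map_pmf (\<lambda>(a', \<sigma>). (a', \<sigma> b)) l) (a, k) * real k)"

lemma continuous_map_pmf_map: "continuous_map weak_topology euclideanreal (\<lambda>l. pmf (map_pmf f l) y)"
  using continuous_map_prob[of "f -` {y}"] by (simp add: pmf_map)

lemma continuous_map_trunc_mean: "continuous_map weak_topology euclideanreal (\<lambda>l. trunc_mean K l a b)"
  unfolding trunc_mean_def
  by (intro continuous_map_sum continuous_map_real_mult continuous_map_pmf_map continuous_map_canonical_const) auto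

lemma trunc_mean_mono: "K \<le> K' \<Longrightarrow> trunc_mean K l a b \<le> trunc_mean K' l a b"
  unfolding trunc_mean_def by (rule sum_mono2) auto

lemma trunc_mean_diff:
  assumes "K \<le> K'"
  shows "trunc_mean K' l a b - trunc_mean K l a b =
    (\<Sum>k\<in>{K<..K'}. pmf (map_pmf (\<lambda>(a', \<sigma>). (a', \<sigma> b)) l) (a, k) * real k)"
proof -
  have "{..K'} = {..K} \<union> {K<..K'}" using assms by auto
  moreover have "sum f ({..K} \<union> {K<..K'}) = sum f {..K} + sum f {K<..K'}" for f :: "nat \<Rightarrow> real"
    by (rule sum.union_disjoint) auto
  ultimately show ?thesis unfolding trunc_mean_def by (simp only: add_diff_cancel_left')
qed

text \<open>Truncated means increase to the full mean; convergence to a real number also excludes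
  the value infinity.\<close>

lemma consistent_iff:
  assumes "\<And>a b. 0 \<le> \<omega> a b"
  shows "consistent \<omega> l \<longleftrightarrow> (\<forall>a b. (\<lambda>K. trunc_mean K l a b) \<longlonglongrightarrow> \<omega> b a)"
proof -
  have "H2 l b a = ennreal (\<omega> b a) \<longleftrightarrow> (\<lambda>K. trunc_mean K l a b) \<longlonglongrightarrow> \<omega> b a" for a b
  proof -
    let ?f = "\<lambda>k. pmf (map_pmf (\<lambda>(a', \<sigma>). (a', \<sigma> b)) l) (a, k) * real k"
    have H2: "H2 l b a = (\<Sum>k. ennreal (?f k))"
      by (simp add: H2_def ennreal_of_nat_eq_real_of_nat ennreal_mult')
    have nn: "0 \<le> ?f k" for k by simp
    have sums: "(\<lambda>K. trunc_mean K l a b) \<longlonglongrightarrow> \<omega> b a \<longleftrightarrow> ?f sums \<omega> b a"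
      by (simp add: sums_def_le trunc_mean_def)
    show ?thesis
    proof
      assume *: "H2 l b a = ennreal (\<omega> b a)"
      then have "(\<Sum>k. ennreal (?f k)) \<noteq> top" unfolding H2 by simp
      then have s: "summable ?f" using summable_suminf_not_top[of ?f] nn by blast
      then have "ennreal (suminf ?f) = ennreal (\<omega> b a)" using * nn unfolding H2 by (simp add: suminf_ennreal2)
      then have eq: "suminf ?f = \<omega> b a" using assms suminf_nonneg[OF s nn] by (simp add: ennreal_inj)
      show "(\<lambda>K. trunc_mean K l a b) \<longlonglongrightarrow> \<omega> b a" unfolding sums using summable_sums[OF s, unfolded eq] .
    next
      assume "(\<lambda>K. trunc_mean K l a b) \<longlonglongrightarrow> \<omega> b a"
      then show "H2 l b a = ennreal (\<omega> b a)" unfolding sums H2 using nn by (intro suminf_ennreal_eq) auto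
    qed
  qed
  then show ?thesis unfolding consistent_def by blast
qed

lemma trunc_mean_le:
  assumes "\<And>a b. 0 \<le> \<omega> a b" "consistent \<omega> l"
  shows "trunc_mean K l a b \<le> \<omega> b a"
proof (rule LIMSEQ_le_const[where X = "\<lambda>K. trunc_mean K l a b"])
  show "(\<lambda>K. trunc_mean K l a b) \<longlonglongrightarrow> \<omega> b a" using assms consistent_iff[of \<omega> l] by blast
  show "\<exists>N. \<forall>n\<ge>N. trunc_mean K l a b \<le> trunc_mean n l a b" using trunc_mean_mono by blast
qed

lemma sum_slices:
  assumes "finite F" "finite I"
  shows "(\<Sum>x\<in>F. pmf w x * (if fst x = a \<and> snd x b \<in> I then \<phi> (snd x b) else 0)) =
    (\<Sum>k\<in>I. \<phi> k * measure_pmf.prob w (F \<inter> (\<lambda>(a', \<sigma>). (a', \<sigma> b)) -` {(a, k)}))"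
proof -
  have "(\<Sum>k\<in>I. \<phi> k * measure_pmf.prob w (F \<inter> (\<lambda>(a', \<sigma>). (a', \<sigma> b)) -` {(a, k)})) =
      (\<Sum>k\<in>I. \<Sum>x\<in>F. if fst x = a \<and> snd x b = k then pmf w x * \<phi> k else 0)"
  proof (rule sum.cong[OF refl])
    fix k
    have "F \<inter> (\<lambda>(a', \<sigma>). (a', \<sigma> b)) -` {(a, k)} = {x \<in> F. fst x = a \<and> snd x b = k}" by auto
    then show "\<phi> k * measure_pmf.prob w (F \<inter> (\<lambda>(a', \<sigma>). (a', \<sigma> b)) -` {(a, k)}) =
        (\<Sum>x\<in>F. if fst x = a \<and> snd x b = k then pmf w x * \<phi> k else 0)"
      using assms by (simp add: measure_measure_pmf_finite sum.inter_filter sum_distrib_left mult.commute)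
        (auto intro!: sum.cong)
  qed
  also have "\<dots> = (\<Sum>x\<in>F. \<Sum>k\<in>I. if fst x = a \<and> snd x b = k then pmf w x * \<phi> k else 0)"
    by (rule sum.swap)
  also have "\<dots> = (\<Sum>x\<in>F. pmf w x * (if fst x = a \<and> snd x b \<in> I then \<phi> (snd x b) else 0))"
  proof (rule sum.cong[OF refl])
    fix x
    show "(\<Sum>k\<in>I. if fst x = a \<and> snd x b = k then pmf w x * \<phi> k else 0) =
        pmf w x * (if fst x = a \<and> snd x b \<in> I then \<phi> (snd x b) else 0)"
      using assms by (cases "fst x = a") (auto simp: sum.delta)
  qed
  finally show ?thesis ..
qed

text \<open>The entropy controls exponential moments, hence no degree mass escapes on its level sets.\<close>

lemma trunc_mean_tail:
  fixes l :: "('b::finite \<times> ('b \<Rightarrow> nat)) pmf"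
  assumes \<omega>: "\<And>a b. 0 \<le> \<omega> a b" and t: "0 < t" and K: "K \<le> K'"
    and ac: "\<And>x. pmf (poisson_locality \<omega> \<rho>) x = 0 \<Longrightarrow> pmf l x = 0"
    and c: "\<And>F. finite F \<Longrightarrow> (\<Sum>x\<in>F. kl_term (pmf l x) (pmf (poisson_locality \<omega> \<rho>) x)) \<le> c"
  shows "t * (trunc_mean K' l a b - trunc_mean K l a b) \<le>
    c + (\<Sum>k\<in>{K<..K'}. poisson_weight (\<omega> a b / pmf \<rho> a) k * exp (t * real k))"
proof -
  let ?q = "poisson_locality \<omega> \<rho>" and ?I = "{K<..K'}"
  let ?S = "\<lambda>k. (\<lambda>(a' :: 'b, \<sigma> :: 'b \<Rightarrow> nat). (a', \<sigma> b)) -` {(a, k)}"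
  let ?g = "\<lambda>x :: 'b \<times> ('b \<Rightarrow> nat). if fst x = a \<and> snd x b \<in> ?I then t * real (snd x b) else 0"
  let ?R = "\<Sum>k\<in>?I. poisson_weight (\<omega> a b / pmf \<rho> a) k * exp (t * real k)"
  have fin_bound: "(\<Sum>k\<in>?I. (t * real k) * measure_pmf.prob l (F \<inter> ?S k)) \<le> c + ?R" if F: "finite F" for F
  proof -
    have "(\<Sum>k\<in>?I. (t * real k) * measure_pmf.prob l (F \<inter> ?S k)) = (\<Sum>x\<in>F. pmf l x * ?g x)"
      using sum_slices[OF F, of ?I l a b "\<lambda>k. t * real k"] by simp
    \<comment> \<open>The entropy inequality, summand by summand, for a test function that is linear
      with slope \<open>t\<close> in the degrees between \<open>K\<close> and
      \<open>K'\<close>.\<close>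
    also have "\<dots> \<le> (\<Sum>x\<in>F. kl_term (pmf l x) (pmf ?q x) + pmf ?q x * (exp (?g x) - 1))"
      by (intro sum_mono fenchel_young ac) auto
    also have "\<dots> \<le> c + (\<Sum>x\<in>F. pmf ?q x * (exp (?g x) - 1))"
      using c[OF F] by (simp add: sum.distrib)
    also have "(\<Sum>x\<in>F. pmf ?q x * (exp (?g x) - 1)) =
        (\<Sum>x\<in>F. pmf ?q x * (if fst x = a \<and> snd x b \<in> ?I then exp (t * real (snd x b)) - 1 else 0))"
      by (intro sum.cong) auto
    also have "\<dots> = (\<Sum>k\<in>?I. (exp (t * real k) - 1) * measure_pmf.prob ?q (F \<inter> ?S k))"
      by (rule sum_slices[OF F, of ?I ?q a b "\<lambda>k. exp (t * real k) - 1"]) simp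
    also have "\<dots> \<le> ?R"
    proof (rule sum_mono)
      fix k
      have "measure_pmf.prob ?q (F \<inter> ?S k) \<le> measure_pmf.prob ?q (?S k)"
        by (rule measure_pmf.finite_measure_mono) auto
      also have "\<dots> = pmf \<rho> a * poisson_weight (\<omega> a b / pmf \<rho> a) k"
        using pmf_poisson_locality_component[OF \<omega>, where b = b and a = a and k = k and \<rho> = \<rho>] by (simp add: pmf_map)
      also have "\<dots> \<le> 1 * poisson_weight (\<omega> a b / pmf \<rho> a) k"
        by (intro mult_right_mono pmf_le_1 poisson_weight_nonneg) (simp add: \<omega>)
      finally have "measure_pmf.prob ?q (F \<inter> ?S k) \<le> poisson_weight (\<omega> a b / pmf \<rho> a) k" by simp
      then have "(exp (t * real k) - 1) * measure_pmf.prob ?q (F \<inter> ?S k) \<le>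
          exp (t * real k) * poisson_weight (\<omega> a b / pmf \<rho> a) k"
        using t by (intro mult_mono) auto
      then show "(exp (t * real k) - 1) * measure_pmf.prob ?q (F \<inter> ?S k) \<le>
          poisson_weight (\<omega> a b / pmf \<rho> a) k * exp (t * real k)" by (simp add: mult.commute)
    qed
    finally show ?thesis by simp
  qed
  have "(\<Sum>k\<in>?I. (t * real k) * measure_pmf.prob l (?S k)) \<le> c + ?R"
  proof (rule field_le_epsilon)
    fix e :: real assume e: "e > 0"
    \<comment> \<open>For the passage from finite \<open>F\<close> to the whole space: the missed
      mass is below \<open>e / B\<close>, and the coefficients it meets add up to
      \<open>B - 1\<close>.\<close>
    define B where "B = (\<Sum>k\<in>?I. t * real k) + 1"
    have B: "B > 0" using t unfolding B_def by (intro add_nonneg_pos sum_nonneg) auto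
    obtain F where F: "finite F" "measure_pmf.prob l (- F) < e / B"
      using finite_pmf_mass[of "e / B" l] e B by auto
    have "measure_pmf.prob l (?S k) \<le> measure_pmf.prob l (F \<inter> ?S k) + e / B" for k
    proof -
      have "measure_pmf.prob l (?S k) \<le> measure_pmf.prob l ((F \<inter> ?S k) \<union> - F)"
        by (rule measure_pmf.finite_measure_mono) auto
      also have "\<dots> \<le> measure_pmf.prob l (F \<inter> ?S k) + measure_pmf.prob l (- F)"
        by (rule measure_Un_le) auto
      finally show ?thesis using F(2) by simp
    qed
    then have "(\<Sum>k\<in>?I. (t * real k) * measure_pmf.prob l (?S k)) \<le>
        (\<Sum>k\<in>?I. (t * real k) * (measure_pmf.prob l (F \<inter> ?S k) + e / B))"
      using t by (intro sum_mono mult_left_mono) auto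
    also have "\<dots> = (\<Sum>k\<in>?I. (t * real k) * measure_pmf.prob l (F \<inter> ?S k)) + (B - 1) * (e / B)"
    proof -
      have S: "(\<Sum>k\<in>?I. t * real k) = B - 1" by (simp add: B_def)
      show ?thesis unfolding S[symmetric] by (simp only: distrib_left sum.distrib sum_distrib_right)
    qed
    also have "(B - 1) * (e / B) \<le> e" using B e by (simp add: field_simps)
    finally show "(\<Sum>k\<in>?I. (t * real k) * measure_pmf.prob l (?S k)) \<le> c + ?R + e"
      using fin_bound[OF F(1)] by simp
  qed
  also have "(\<Sum>k\<in>?I. (t * real k) * measure_pmf.prob l (?S k)) = t * (trunc_mean K' l a b - trunc_mean K l a b)"
    unfolding trunc_mean_diff[OF K] by (simp add: sum_distrib_left pmf_map ac_simps)
  finally show ?thesis .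
qed

lemma summable_poisson_exp: "summable (\<lambda>k. poisson_weight \<mu> k * exp (t * real k))"
proof -
  have "poisson_weight \<mu> k * exp (t * real k) = exp (- \<mu>) * ((\<mu> * exp t) ^ k / fact k)" for k
    by (simp add: poisson_weight_def power_mult_distrib exp_of_nat_mult[symmetric] mult.commute)
  moreover have "summable (\<lambda>k. (\<mu> * exp t) ^ k / fact k)"
    using summable_exp[of "\<mu> * exp t"] by (simp add: field_simps)
  ultimately show ?thesis by (simp only: summable_mult)
qed

text \<open>Cauchy criterion for the exponential moments; \<open>K0\<close> allows the level to be
  pushed beyond any given one.\<close>

lemma poisson_tail:
  assumes "\<eta> > 0"
  shows
  "\<exists>K\<ge>K0. \<forall>K'. (\<Sum>k\<in>{K<..K'}. poisson_weight \<mu> k * exp (t * real k)) \<le> \<eta>"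
proof -
  obtain N where N: "\<And>m n. m \<ge> N \<Longrightarrow> norm (\<Sum>k\<in>{m..<n}. poisson_weight \<mu> k * exp (t * real k)) < \<eta>"
    using summable_poisson_exp[of \<mu> t] unfolding summable_Cauchy using assms by meson
  have "(\<Sum>k\<in>{max K0 N<..K'}. poisson_weight \<mu> k * exp (t * real k)) \<le> \<eta>" for K'
  proof -
    have eq: "{max K0 N<..K'} = {Suc (max K0 N)..<Suc K'}" by auto
    have "N \<le> Suc (max K0 N)" by simp
    from N[OF this, of "Suc K'"] show ?thesis unfolding eq real_norm_def by linarith
  qed
  then show ?thesis by (intro exI[of _ "max K0 N"]) auto
qed

text \<open>Markov's inequality for a mean known only through its truncations: up to mass
  \<open>e\<close> the degree is bounded, and there a truncation suffices.\<close>

lemma prob_large_le: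
  fixes l :: "('b::finite \<times> ('b \<Rightarrow> nat)) pmf"
  assumes "\<And>K. trunc_mean K l a b \<le> C"
  shows "measure_pmf.prob l {x. fst x = a \<and> N < snd x b} \<le> C / (real N + 1)"
proof (rule field_le_epsilon)
  fix e :: real assume e: "e > 0"
  let ?f = "\<lambda>(a' :: 'b, \<sigma> :: 'b \<Rightarrow> nat). (a', \<sigma> b)"
  let ?M = "map_pmf ?f l"
  obtain F where F: "finite F" "measure_pmf.prob ?M (- F) < e" using finite_pmf_mass[OF e] by blast
  define K' where "K' = Max (insert N (snd ` F))"
  have NK: "N \<le> K'" and FK: "\<And>x. x \<in> F \<Longrightarrow> snd x \<le> K'" using F(1) by (auto simp: K'_def)
  have "{x. fst x = a \<and> N < snd x b} = ?f -` {y. fst y = a \<and> N < snd y}" by auto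
  then have "measure_pmf.prob l {x. fst x = a \<and> N < snd x b} = measure_pmf.prob ?M {y. fst y = a \<and> N < snd y}"
    by simp
  also have "\<dots> \<le> measure_pmf.prob ?M (Pair a ` {N<..K'} \<union> - F)"
    by (rule measure_pmf.finite_measure_mono) (use FK in \<open>force simp: image_iff\<close>)+
  also have "\<dots> \<le> measure_pmf.prob ?M (Pair a ` {N<..K'}) + measure_pmf.prob ?M (- F)"
    by (rule measure_Un_le) auto
  also have "measure_pmf.prob ?M (Pair a ` {N<..K'}) = (\<Sum>k\<in>{N<..K'}. pmf ?M (a, k))"
    by (subst measure_measure_pmf_finite) (simp_all add: sum.reindex inj_on_def)
  also have "\<dots> \<le> C / (real N + 1)"
  proof -
    have "(\<Sum>k\<in>{N<..K'}. pmf ?M (a, k)) * (real N + 1) \<le> (\<Sum>k\<in>{N<..K'}. pmf ?M (a, k) * real k)"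
      unfolding sum_distrib_right by (intro sum_mono mult_left_mono) auto
    also have "\<dots> = trunc_mean K' l a b - trunc_mean N l a b" by (rule trunc_mean_diff[OF NK, symmetric])
    also have "\<dots> \<le> C"
    proof -
      have "0 \<le> trunc_mean N l a b" unfolding trunc_mean_def by (intro sum_nonneg) auto
      then show ?thesis using assms[of K'] by linarith
    qed
    finally show ?thesis by (simp add: field_simps)
  qed
  finally show "measure_pmf.prob l {x. fst x = a \<and> N < snd x b} \<le> C / (real N + 1) + e"
    using F(2) by simp
qed

lemma finite_box: "finite {x :: 'b::finite \<times> ('b \<Rightarrow> nat). \<forall>b. snd x b \<le> N}"
proof -
  have "{x :: 'b \<times> ('b \<Rightarrow> nat). \<forall>b. snd x b \<le> N} = UNIV \<times> PiE UNIV (\<lambda>_. {..N})" by (auto simp: PiE_def Pi_def)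
  then show ?thesis by (auto intro!: finite_PiE)
qed

text \<open>Markov's inequality and a union bound over pairs of types give tightness, and the set is
  closed because each truncated mean is continuous.\<close>

lemma compactin_bounded_mean:
  "compactin weak_topology {l :: ('b::finite \<times> ('b \<Rightarrow> nat)) pmf. \<forall>a b K. trunc_mean K l a b \<le> C}"
proof -
  define B where "B = real (CARD('b) * CARD('b)) * \<bar>C\<bar>"
  \<comment> \<open>The size of the box outside of which at most \<open>1 / Suc m\<close> of the
    mass remains; \<open>B\<close> counts the pairs of types, each contributing
    \<open>\<bar>C\<bar> / (N m + 1)\<close>.\<close>
  define N where "N m = nat \<lceil>B * real (Suc m)\<rceil>" for m
  let ?F = "\<lambda>m. {x :: 'b \<times> ('b \<Rightarrow> nat). \<forall>b. snd x b \<le> N m}"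
  have N: "B * real (Suc m) \<le> real (N m)" for m unfolding N_def by linarith
  have "closedin weak_topology (\<Inter>(a, b, K)\<in>UNIV. {l :: ('b \<times> ('b \<Rightarrow> nat)) pmf. trunc_mean K l a b \<le> C})"
    by (intro closedin_INT) (auto intro!: closedin_weak_Collect_le continuous_map_trunc_mean)
  also have "(\<Inter>(a, b, K)\<in>UNIV. {l :: ('b \<times> ('b \<Rightarrow> nat)) pmf. trunc_mean K l a b \<le> C}) =
      {l. \<forall>a b K. trunc_mean K l a b \<le> C}" by auto
  finally have cl: "closedin weak_topology {l :: ('b \<times> ('b \<Rightarrow> nat)) pmf. \<forall>a b K. trunc_mean K l a b \<le> C}" .
  have sub: "{l :: ('b \<times> ('b \<Rightarrow> nat)) pmf. \<forall>a b K. trunc_mean K l a b \<le> C} \<subseteq>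
      {l. \<forall>m. 1 - 1 / real (Suc m) \<le> (\<Sum>x\<in>?F m. pmf l x)}"
  proof (clarify)
    fix l :: "('b \<times> ('b \<Rightarrow> nat)) pmf" and m assume l: "\<forall>a b K. trunc_mean K l a b \<le> C"
    have "measure_pmf.prob l (- ?F m) \<le> measure_pmf.prob l (\<Union>p\<in>UNIV. {x. fst x = fst p \<and> N m < snd x (snd p)})"
      by (rule measure_pmf.finite_measure_mono) (auto simp: not_less)
    also have "\<dots> \<le> (\<Sum>p\<in>UNIV. measure_pmf.prob l {x. fst x = fst p \<and> N m < snd x (snd p)})"
      by (rule measure_pmf.finite_measure_subadditive_finite) auto
    also have "\<dots> \<le> (\<Sum>p\<in>(UNIV :: ('b \<times> 'b) set). \<bar>C\<bar> / (real (N m) + 1))"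
    proof (rule sum_mono)
      fix p :: "'b \<times> 'b"
      let ?a = "fst p" and ?b = "snd p"
      have "measure_pmf.prob l {x. fst x = ?a \<and> N m < snd x ?b} \<le> C / (real (N m) + 1)"
        using l by (intro prob_large_le) auto
      also have "\<dots> \<le> \<bar>C\<bar> / (real (N m) + 1)" by (intro divide_right_mono) auto
      finally show "measure_pmf.prob l {x. fst x = ?a \<and> N m < snd x ?b} \<le> \<bar>C\<bar> / (real (N m) + 1)" .
    qed
    also have "\<dots> = B / (real (N m) + 1)" by (simp add: B_def)
    also have "\<dots> \<le> 1 / real (Suc m)" using N[of m] by (simp add: field_simps)
    finally have "measure_pmf.prob l (- ?F m) \<le> 1 / real (Suc m)" .
    moreover have "measure_pmf.prob l (- ?F m) = 1 - (\<Sum>x\<in>?F m. pmf l x)"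
      using measure_pmf.prob_compl[of "?F m" l] by (simp add: Compl_eq_Diff_UNIV measure_measure_pmf_finite finite_box)
    ultimately show "1 - 1 / real (Suc m) \<le> (\<Sum>x\<in>?F m. pmf l x)" by linarith
  qed
  show ?thesis by (rule closed_compactin[OF compactin_tight[of ?F] sub cl]) (rule finite_box)
qed

lemma closedin_weak_Collect_eq:
  assumes "continuous_map weak_topology euclideanreal f"
  shows "closedin weak_topology {p. f p = c}"
proof -
  have "{p. f p = c} = {p. f p \<le> c} \<inter> {p. c \<le> f p}" by auto
  then show ?thesis
    using closedin_weak_Collect_le[OF assms, of "\<lambda>_. c"] closedin_weak_Collect_le[OF _ assms, of "\<lambda>_. c"] by auto
qed

text \<open>The only critical point is 0, where \<open>y * ln (y / q)\<close> tends to its value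
  0.\<close>

lemma continuous_on_mult_ln:
  fixes q :: real
  assumes q: "q > 0"
  shows "continuous_on {0..} (\<lambda>y. y * ln (y / q))"
  unfolding continuous_on_def
proof
  fix y :: real assume y: "y \<in> {0..}"
  show "((\<lambda>y. y * ln (y / q)) \<longlongrightarrow> y * ln (y / q)) (at y within {0..})"
  proof (cases "y = 0")
    case True
    have "((\<lambda>y. y * ln (y / q)) \<longlongrightarrow> 0) (at_right 0)" using q by real_asymp
    then show ?thesis unfolding True by (simp add: at_within_Ici_at_right)
  next
    case False
    then show ?thesis using y q by (intro tendsto_intros) auto
  qed
qed

lemma continuous_map_kl_term:
  assumes "0 \<le> q"
  shows "continuous_map weak_topology euclideanreal (\<lambda>p. kl_term (pmf p x) q)"
proof -
  have "continuous_on {0..} (\<lambda>y. kl_term y q)"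
  proof (cases "q = 0")
    case True
    then show ?thesis by (auto simp: kl_term_eq intro!: continuous_intros)
  next
    case False
    then have q: "q > 0" using assms by simp
    have "continuous_on {0..} (\<lambda>y :: real. y * ln (y / q))" by (rule continuous_on_mult_ln[OF q])
    then show ?thesis unfolding kl_term_eq
      by (intro continuous_on_add continuous_on_diff continuous_on_id continuous_on_const)
  qed
  then have "continuous_map (top_of_set {0..}) euclideanreal (\<lambda>y. kl_term y q)" by simp
  moreover have "continuous_map weak_topology (top_of_set {0..}) (\<lambda>p. pmf p x)"
    by (auto simp: continuous_map_in_subtopology continuous_map_pmf)
  ultimately have "continuous_map weak_topology euclideanreal ((\<lambda>y. kl_term y q) \<circ> (\<lambda>p. pmf p x))"
    by (rule continuous_map_compose[rotated])
  then show ?thesis by (simp add: o_def)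
qed

text \<open>Marginals and partial entropy sums are continuous, so the difficulty lies in
  consistency: in a weak limit some mean degree could be lost. Bounded entropy makes the tails of
  the means uniformly small and rules this out. Compactness follows, since consistency bounds the
  means.\<close>

lemma good_rate_function_rate_J:
  fixes \<omega> :: "'b::finite \<Rightarrow> 'b \<Rightarrow> real"
  assumes \<omega>: "\<And>a b. 0 \<le> \<omega> a b"
  shows "good_rate_function weak_topology (rate_J \<rho> \<omega>)"
proof -
  let ?q = "poisson_locality \<omega> \<rho>"
  have J: "rate_J \<rho> \<omega> l \<le> ereal c \<longleftrightarrow> consistent \<omega> l \<and> H1 l = \<rho> \<and>
      (\<forall>x. pmf ?q x = 0 \<longrightarrow> pmf l x = 0) \<and> (\<forall>F. finite F \<longrightarrow> (\<Sum>x\<in>F. kl_term (pmf l x) (pmf ?q x)) \<le> c)" for l c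
    by (auto simp: rate_J_eq[OF \<omega>] relative_entropy_pmf_le_iff)
  have closed: "closedin weak_topology {l. rate_J \<rho> \<omega> l \<le> ereal c}" for c
  proof -
    \<comment> \<open>With slope \<open>Suc m\<close> and a Poisson tail of at most 1,
      \<open>trunc_mean_tail\<close> bounds the mean degree beyond this level by
      \<open>(c + 1) / Suc m\<close> for every \<open>l\<close> of entropy at most
      \<open>c\<close>.\<close>
    have "\<forall>a b. \<forall>m::nat. \<exists>K\<ge>m. \<forall>K'. (\<Sum>k\<in>{K<..K'}. poisson_weight (\<omega> a b / pmf \<rho> a) k * exp (real (Suc m) * real k)) \<le> 1"
      using poisson_tail[OF zero_less_one] by blast
    then obtain Kf where Kf: "\<And>a b m. m \<le> Kf a b m"
      "\<And>a b m K'. (\<Sum>k\<in>{Kf a b m<..K'}. poisson_weight (\<omega> a b / pmf \<rho> a) k * exp (real (Suc m) * real k)) \<le> 1"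
      by metis
    let ?E = "{l. (\<forall>x. pmf ?q x = 0 \<longrightarrow> pmf l x = 0) \<and> (\<forall>F. finite F \<longrightarrow> (\<Sum>x\<in>F. kl_term (pmf l x) (pmf ?q x)) \<le> c)}"
    \<comment> \<open>On the entropy ball consistency is equivalent to countably many closed
      conditions on truncated means.\<close>
    have cons: "consistent \<omega> l \<longleftrightarrow> (\<forall>a b m. \<bar>trunc_mean (Kf a b m) l a b - \<omega> b a\<bar> \<le> (c + 1) / real (Suc m))"
      if l: "l \<in> ?E" for l
    proof
      assume con: "consistent \<omega> l"
      show "\<forall>a b m. \<bar>trunc_mean (Kf a b m) l a b - \<omega> b a\<bar> \<le> (c + 1) / real (Suc m)"
      proof (intro allI)
        fix a b m
        have "trunc_mean K' l a b \<le> trunc_mean (Kf a b m) l a b + (c + 1) / real (Suc m)" if "Kf a b m \<le> K'" for K'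
        proof -
          have "real (Suc m) * (trunc_mean K' l a b - trunc_mean (Kf a b m) l a b) \<le> c +
              (\<Sum>k\<in>{Kf a b m<..K'}. poisson_weight (\<omega> a b / pmf \<rho> a) k * exp (real (Suc m) * real k))"
            by (rule trunc_mean_tail[where \<rho> = \<rho>, OF \<omega> _ that]) (use l in auto)
          also have "\<dots> \<le> c + 1" using Kf(2)[of a b m K'] by simp
          finally have "real (Suc m) * (trunc_mean K' l a b - trunc_mean (Kf a b m) l a b) \<le> c + 1" .
          then show ?thesis by (simp add: field_simps)
        qed
        then have "\<omega> b a \<le> trunc_mean (Kf a b m) l a b + (c + 1) / real (Suc m)"
          using con consistent_iff[of \<omega> l] \<omega> by (intro LIMSEQ_le_const2[where X = "\<lambda>K. trunc_mean K l a b"]) auto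
        then show "\<bar>trunc_mean (Kf a b m) l a b - \<omega> b a\<bar> \<le> (c + 1) / real (Suc m)"
          using trunc_mean_le[OF \<omega> con, of "Kf a b m" a b] by linarith
      qed
    next
      assume *: "\<forall>a b m. \<bar>trunc_mean (Kf a b m) l a b - \<omega> b a\<bar> \<le> (c + 1) / real (Suc m)"
      have "(\<lambda>K. trunc_mean K l a b) \<longlonglongrightarrow> \<omega> b a" for a b
      proof -
        have lim: "(\<lambda>m. (c + 1) / real (Suc m)) \<longlonglongrightarrow> 0" by real_asymp
        have T: "(\<lambda>m. trunc_mean (Kf a b m) l a b) \<longlonglongrightarrow> \<omega> b a"
        proof (rule LIM_zero_cancel, rule Lim_null_comparison[OF _ lim])
          show "\<forall>\<^sub>F m in sequentially. norm (trunc_mean (Kf a b m) l a b - \<omega> b a) \<le> (c + 1) / real (Suc m)"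
            using * by (auto simp del: of_nat_Suc)
        qed
        \<comment> \<open>The levels satisfy \<open>m \<le> Kf a b m\<close>, so monotonicity
          carries the limit along them over to all truncations.\<close>
        have le: "trunc_mean K l a b \<le> \<omega> b a" for K
        proof (rule LIMSEQ_le_const[OF T])
          have "trunc_mean K l a b \<le> trunc_mean (Kf a b m) l a b" if "m \<ge> K" for m
            using Kf(1)[where a = a and b = b and m = m] that by (intro trunc_mean_mono) linarith
          then show "\<exists>N. \<forall>n\<ge>N. trunc_mean K l a b \<le> trunc_mean (Kf a b n) l a b" by blast
        qed
        show ?thesis
        proof (rule LIMSEQ_I)
          fix e :: real assume "e > 0"
          then obtain m where "norm (trunc_mean (Kf a b m) l a b - \<omega> b a) < e" using LIMSEQ_D[OF T] by blast
          then have "norm (trunc_mean K l a b - \<omega> b a) < e" if "K \<ge> Kf a b m" for K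
            using le[of K] trunc_mean_mono[OF that, of l a b] by auto
          then show "\<exists>no. \<forall>n\<ge>no. norm (trunc_mean n l a b - \<omega> b a) < e" by blast
        qed
      qed
      then show "consistent \<omega> l" using consistent_iff[of \<omega> l] \<omega> by blast
    qed
    have H1: "H1 l = \<rho> \<longleftrightarrow> (\<forall>a. pmf (map_pmf fst l) a = pmf \<rho> a)" for l :: "('b \<times> ('b \<Rightarrow> nat)) pmf"
      by (auto simp: H1_def pmf_eq_iff)
    have "{l. rate_J \<rho> \<omega> l \<le> ereal c} =
        (\<Inter>a. {l. pmf (map_pmf fst l) a = pmf \<rho> a}) \<inter>
        (\<Inter>x\<in>{x. pmf ?q x = 0}. {l. pmf l x = 0}) \<inter>
        (\<Inter>F\<in>{F. finite F}. {l. (\<Sum>x\<in>F. kl_term (pmf l x) (pmf ?q x)) \<le> c}) \<inter>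
        (\<Inter>(a, b, m)\<in>UNIV. {l. \<bar>trunc_mean (Kf a b m) l a b - \<omega> b a\<bar> \<le> (c + 1) / real (Suc m)})"
      unfolding J H1 using cons by auto
    also have "closedin weak_topology \<dots>"
    proof (intro closedin_Int)
      show "closedin weak_topology (\<Inter>a. {l. pmf (map_pmf fst l) a = pmf \<rho> a})"
        by (intro closedin_INT closedin_weak_Collect_eq continuous_map_pmf_map) auto
      show "closedin weak_topology (\<Inter>F\<in>{F. finite F}. {l. (\<Sum>x\<in>F. kl_term (pmf l x) (pmf ?q x)) \<le> c})"
        by (intro closedin_INT closedin_weak_Collect_le continuous_map_sum continuous_map_kl_term continuous_map_canonical_const) auto
      show "closedin weak_topology (\<Inter>(a, b, m)\<in>UNIV. {l. \<bar>trunc_mean (Kf a b m) l a b - \<omega> b a\<bar> \<le> (c + 1) / real (Suc m)})"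
        by (intro closedin_INT) (auto intro!: closedin_weak_Collect_le continuous_map_real_abs continuous_map_diff continuous_map_trunc_mean)
      show "closedin weak_topology (\<Inter>x\<in>{x. pmf ?q x = 0}. {l. pmf l x = 0})"
      proof (cases "{x. pmf ?q x = 0} = {}")
        case True
        then show ?thesis using closedin_topspace[of weak_topology] by (simp only: True) (simp add: topspace_weak_topology)
      next
        case False
        then show ?thesis by (intro closedin_INT closedin_weak_Collect_eq continuous_map_pmf) auto
      qed
    qed
    finally show ?thesis .
  qed
  have compact: "compactin weak_topology {l. rate_J \<rho> \<omega> l \<le> ereal c}" for c
  proof (rule closed_compactin[OF compactin_bounded_mean _ closed])
    let ?C = "\<Sum>(a, b)\<in>UNIV. \<omega> b a"
    show "{l. rate_J \<rho> \<omega> l \<le> ereal c} \<subseteq> {l. \<forall>a b K. trunc_mean K l a b \<le> ?C}"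
    proof clarify
      fix l a b K assume "rate_J \<rho> \<omega> l \<le> ereal c"
      then have con: "consistent \<omega> l" by (simp only: J)
      have "trunc_mean K l a b \<le> \<omega> b a" by (rule trunc_mean_le[OF \<omega> con])
      also have "\<dots> = (\<lambda>(a, b). \<omega> b a) (a, b)" by simp
      also have "\<dots> \<le> ?C" by (rule member_le_sum) (use \<omega> in auto)
      finally show "trunc_mean K l a b \<le> ?C" .
    qed
  qed
  have "0 \<le> rate_J \<rho> \<omega> l" for l by (simp add: rate_J_eq[OF \<omega>] relative_entropy_pmf_nonneg)
  then show ?thesis using closed compact by (simp add: good_rate_function_def topspace_weak_topology)
qed

section \<open>The upper bound\<close>

text \<open>The locality measure sees the graph only through types and degrees, so it is expressed
  by an arbitrary degree vector \<open>d\<close>, which need not belong to a graph.\<close>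

definition empirical_locality :: "nat \<Rightarrow> (nat \<Rightarrow> 'b) \<Rightarrow> (nat \<Rightarrow> 'b::finite \<Rightarrow> nat) \<Rightarrow> ('b \<times> ('b \<Rightarrow> nat)) pmf" where
  "empirical_locality n t d = map_pmf (\<lambda>j. (t j, d j)) (pmf_of_set {..<n})"

lemma locality_measure_eq:
  "locality_measure n (x, t, E) = empirical_locality n t (degree_vector n t E)"
  by (simp add: locality_measure_def empirical_locality_def degree_vector_def[abs_def])

lemma prob_map_empirical:
  assumes "1 \<le> n"
  shows "pmf (map_pmf f (empirical_locality n t d)) y = real (card {j \<in> {..<n}. f (t j, d j) = y}) / real n"
proof -
  have ne: "{..<n} \<noteq> {}" using assms by (auto simp: lessThan_empty_iff)
  have "{..<n} \<inter> (\<lambda>j. f (t j, d j)) -` {y} = {j \<in> {..<n}. f (t j, d j) = y}" by auto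
  then show ?thesis
    using ne by (simp add: empirical_locality_def map_pmf_comp pmf_map measure_pmf_of_set)
qed

lemma pmf_empirical:
  assumes "1 \<le> n"
  shows "pmf (empirical_locality n t d) x = real (card {j \<in> {..<n}. (t j, d j) = x}) / real n"
  using prob_map_empirical[OF assms, of "\<lambda>x. x" t d x] by simp

lemma sum_empirical:
  assumes n: "1 \<le> n" and F: "finite F"
  shows "(\<Sum>j<n. if (t j, d j) \<in> F then g (t j, d j) else 0) = real n * (\<Sum>x\<in>F. g x * pmf (empirical_locality n t d) x)"
proof -
  have "(\<Sum>j<n. if (t j, d j) \<in> F then g (t j, d j) else 0) = (\<Sum>j\<in>{j \<in> {..<n}. (t j, d j) \<in> F}. g (t j, d j))"
    by (rule sum.inter_filter[symmetric]) simp
  also have "\<dots> = (\<Sum>x\<in>F. \<Sum>j\<in>{j \<in> {j \<in> {..<n}. (t j, d j) \<in> F}. (t j, d j) = x}. g (t j, d j))"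
    by (rule sum.group[symmetric]) (use F in auto)
  also have "\<dots> = (\<Sum>x\<in>F. g x * real (card {j \<in> {..<n}. (t j, d j) = x}))"
  proof (rule sum.cong[OF refl])
    fix x assume "x \<in> F"
    then have "{j \<in> {j \<in> {..<n}. (t j, d j) \<in> F}. (t j, d j) = x} = {j \<in> {..<n}. (t j, d j) = x}" by auto
    then show "(\<Sum>j\<in>{j \<in> {j \<in> {..<n}. (t j, d j) \<in> F}. (t j, d j) = x}. g (t j, d j)) =
        g x * real (card {j \<in> {..<n}. (t j, d j) = x})" by simp
  qed
  also have "\<dots> = real n * (\<Sum>x\<in>F. g x * pmf (empirical_locality n t d) x)"
    using n by (simp add: pmf_empirical sum_distrib_left)
  finally show ?thesis .
qed

lemma trunc_mean_empirical:
  assumes n: "1 \<le> n"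
  shows "real n * trunc_mean K (empirical_locality n t d) a b =
    (\<Sum>j\<in>nodes_of n t a. if d j b \<le> K then real (d j b) else 0)"
proof -
  have "real n * trunc_mean K (empirical_locality n t d) a b =
      (\<Sum>k\<le>K. real (card {j \<in> {..<n}. t j = a \<and> d j b = k}) * real k)"
    using n by (simp add: trunc_mean_def prob_map_empirical sum_distrib_left)
  also have "\<dots> = (\<Sum>k\<le>K. \<Sum>j\<in>{j \<in> {j \<in> nodes_of n t a. d j b \<le> K}. d j b = k}. real (d j b))"
  proof (rule sum.cong[OF refl])
    fix k assume "k \<in> {..K}"
    then have "{j \<in> {j \<in> nodes_of n t a. d j b \<le> K}. d j b = k} = {j \<in> {..<n}. t j = a \<and> d j b = k}"
      by (auto simp: nodes_of_def)
    then show "real (card {j \<in> {..<n}. t j = a \<and> d j b = k}) * real k =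
        (\<Sum>j\<in>{j \<in> {j \<in> nodes_of n t a. d j b \<le> K}. d j b = k}. real (d j b))" by simp
  qed
  also have "\<dots> = (\<Sum>j\<in>{j \<in> nodes_of n t a. d j b \<le> K}. real (d j b))"
    by (rule sum.group) auto
  also have "\<dots> = (\<Sum>j\<in>nodes_of n t a. if d j b \<le> K then real (d j b) else 0)"
    by (simp add: sum.inter_filter)
  finally show ?thesis .
qed

lemma prob_bind_pmf_le:
  assumes "\<And>x. x \<in> set_pmf p \<Longrightarrow> measure_pmf.prob (f x) X \<le> u" "0 \<le> u"
  shows "measure_pmf.prob (bind_pmf p f) X \<le> u"
proof -
  have "ennreal (measure_pmf.prob (bind_pmf p f) X) = (\<integral>\<^sup>+x. ennreal (measure_pmf.prob (f x) X) \<partial>measure_pmf p)"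
    by (simp add: measure_pmf.emeasure_eq_measure[symmetric])
  also have "\<dots> \<le> (\<integral>\<^sup>+x. ennreal u \<partial>measure_pmf p)"
    by (intro nn_integral_mono_AE AE_pmfI ennreal_leI assms)
  finally show ?thesis using assms(2) by simp
qed

lemma prob_bind_pmf_ge:
  assumes "\<And>x. x \<in> set_pmf p \<Longrightarrow> u \<le> measure_pmf.prob (f x) X"
  shows "u \<le> measure_pmf.prob (bind_pmf p f) X"
proof -
  have "ennreal u = (\<integral>\<^sup>+x. ennreal u \<partial>measure_pmf p)" by simp
  also have "\<dots> \<le> (\<integral>\<^sup>+x. ennreal (measure_pmf.prob (f x) X) \<partial>measure_pmf p)"
    by (intro nn_integral_mono_AE AE_pmfI ennreal_leI assms)
  also have "\<dots> = ennreal (measure_pmf.prob (bind_pmf p f) X)"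
    by (simp add: measure_pmf.emeasure_eq_measure[symmetric])
  finally show ?thesis by simp
qed

lemma sets_space_conditional_locality_law:
  "sets (conditional_locality_law TYPE('d::finite) n \<rho> \<omega>) = sets (borel_of_topology weak_topology)"
  by (simp add: conditional_locality_law_def)

text \<open>The positions are independent of types and edges and integrate out with total mass
  1.\<close>

lemma measure_conditional_locality_law:
  fixes \<rho> :: "'b::finite pmf"
  assumes X: "X \<in> sets (borel_of_topology weak_topology)"
  shows "measure (conditional_locality_law TYPE('d::finite) n \<rho> \<omega>) X =
    measure_pmf.prob (typed_graph_law n \<rho> \<omega>) {(t, E). empirical_locality n t (degree_vector n t E) \<in> X}"
proof -
  let ?A = "position_law n :: (nat \<Rightarrow> real ^ 'd) measure" and ?B = "measure_pmf (typed_graph_law n \<rho> \<omega>)"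
  let ?Y = "{(t, E). empirical_locality n t (degree_vector n t E) \<in> X}"
  interpret A: prob_space ?A by (rule prob_space_position_law)
  have vim: "locality_measure n -` X \<inter> space (?A \<Otimes>\<^sub>M ?B) = space ?A \<times> ?Y"
    by (auto simp: space_pair_measure locality_measure_eq)
  have "measure (conditional_locality_law TYPE('d) n \<rho> \<omega>) X = measure (?A \<Otimes>\<^sub>M ?B) (space ?A \<times> ?Y)"
    unfolding conditional_locality_law_def
    by (subst measure_distr[OF measurable_locality_measure X]) (simp add: conditional_law_def vim)
  also have "\<dots> = measure ?B ?Y"
    unfolding measure_def
    by (subst sigma_finite_measure.emeasure_pair_measure_Times)
      (auto simp: measure_pmf.sigma_finite_measure_axioms A.emeasure_space_1)
  finally show ?thesis .
qed

context type_sequence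
begin

text \<open>A multinomial coefficient is not 0, so a word with the prescribed letter counts exists;
  its positions are the nodes.\<close>

lemma arrangements_nonempty:
  assumes n: "1 \<le> n"
  shows "arrangements n (\<rho>n n) \<noteq> {}" "finite (arrangements n (\<rho>n n))"
proof -
  show "finite (arrangements n (\<rho>n n))"
    by (rule finite_subset[of _ "{..<n} \<rightarrow>\<^sub>E UNIV"]) (auto simp: arrangements_def intro: finite_PiE)
  have "\<forall>a. \<exists>k::nat. real n * pmf (\<rho>n n) a = real k"
    using lattice_\<rho>[OF n] by (auto simp: lattice_types_def Nats_def)
  then obtain k :: "'b \<Rightarrow> nat" where k: "\<And>a. real n * pmf (\<rho>n n) a = real (k a)" by metis
  have "real (\<Sum>a\<in>UNIV. k a) = real n * (\<Sum>a\<in>UNIV. pmf (\<rho>n n) a)"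
    by (simp add: k[symmetric] sum_distrib_left)
  then have "real (\<Sum>a\<in>UNIV. k a) = real n" by (simp add: sum_pmf_eq_1 del: of_nat_sum)
  then have kn: "(\<Sum>a\<in>UNIV. k a) = n" by (simp only: of_nat_eq_iff)
  have "card {ws. set ws \<subseteq> UNIV \<and> (\<forall>b\<in>UNIV. count_list ws b = k b)} * (\<Prod>b\<in>UNIV. fact (k b)) = (fact n :: nat)"
    using card_lists_with_counts[of "UNIV :: 'b set" k] kn by simp
  then have "card {ws. set ws \<subseteq> UNIV \<and> (\<forall>b\<in>UNIV. count_list ws b = k b)} \<noteq> 0"
    by (metis fact_nonzero mult_is_0)
  then have "{ws. set ws \<subseteq> UNIV \<and> (\<forall>b\<in>UNIV. count_list ws b = k b)} \<noteq> {}" by (metis card.empty)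
  then obtain ws where ws: "\<And>b. count_list ws b = k b" by auto
  have len: "length ws = n"
    using sum_count_set[of ws "UNIV :: 'b set"] ws kn by simp
  define t where "t = restrict (\<lambda>j. ws ! j) {..<n}"
  have "card {j \<in> {..<n}. t j = a} = k a" for a
  proof -
    have "k a = card {j. j < length ws \<and> a = ws ! j}"
      unfolding ws[symmetric] count_list_eq_length_filter length_filter_conv_card ..
    also have "{j. j < length ws \<and> a = ws ! j} = {j \<in> {..<n}. t j = a}" by (auto simp: t_def len)
    finally show ?thesis by simp
  qed
  then have "t \<in> arrangements n (\<rho>n n)" by (simp add: arrangements_def k t_def)
  then show "arrangements n (\<rho>n n) \<noteq> {}" by blast
qed

text \<open>The law is an average over the arrangements, so bounds uniform in \<open>t\<close> carry
  over. All estimates can therefore be made for a fixed arrangement.\<close>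

lemma measure_law_bounds:
  assumes n: "1 \<le> n" and X: "X \<in> sets (borel_of_topology weak_topology)"
  shows "0 \<le> u \<Longrightarrow> (\<And>t. t \<in> arrangements n (\<rho>n n) \<Longrightarrow>
      measure_pmf.prob (edge_law n (\<omega>n n) t) {E. empirical_locality n t (degree_vector n t E) \<in> X} \<le> u) \<Longrightarrow>
      measure (conditional_locality_law TYPE('d::finite) n (\<rho>n n) (\<omega>n n)) X \<le> u"
    and "(\<And>t. t \<in> arrangements n (\<rho>n n) \<Longrightarrow>
      u \<le> measure_pmf.prob (edge_law n (\<omega>n n) t) {E. empirical_locality n t (degree_vector n t E) \<in> X}) \<Longrightarrow>
      u \<le> measure (conditional_locality_law TYPE('d::finite) n (\<rho>n n) (\<omega>n n)) X"
proof -
  have eq: "measure_pmf.prob (bind_pmf (edge_law n (\<omega>n n) t) (\<lambda>E. return_pmf (t, E))) {(t, E). empirical_locality n t (degree_vector n t E) \<in> X} =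
      measure_pmf.prob (edge_law n (\<omega>n n) t) {E. empirical_locality n t (degree_vector n t E) \<in> X}" for t
    unfolding map_pmf_def[symmetric] by (simp add: vimage_def)
  have set: "set_pmf (pmf_of_set (arrangements n (\<rho>n n))) = arrangements n (\<rho>n n)"
    using arrangements_nonempty[OF n] by (rule set_pmf_of_set)
  {
    assume "0 \<le> u" and *: "\<And>t. t \<in> arrangements n (\<rho>n n) \<Longrightarrow>
      measure_pmf.prob (edge_law n (\<omega>n n) t) {E. empirical_locality n t (degree_vector n t E) \<in> X} \<le> u"
    show "measure (conditional_locality_law TYPE('d::finite) n (\<rho>n n) (\<omega>n n)) X \<le> u"
      unfolding measure_conditional_locality_law[OF X] typed_graph_law_def
      by (rule prob_bind_pmf_le) (simp_all only: eq set * \<open>0 \<le> u\<close>)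
  }
  {
    assume *: "\<And>t. t \<in> arrangements n (\<rho>n n) \<Longrightarrow>
      u \<le> measure_pmf.prob (edge_law n (\<omega>n n) t) {E. empirical_locality n t (degree_vector n t E) \<in> X}"
    show "u \<le> measure (conditional_locality_law TYPE('d::finite) n (\<rho>n n) (\<omega>n n)) X"
      unfolding measure_conditional_locality_law[OF X] typed_graph_law_def
      by (rule prob_bind_pmf_ge) (simp_all only: eq set *)
  }
qed

definition balanced :: "nat \<Rightarrow> (nat \<Rightarrow> 'b) \<Rightarrow> (nat \<Rightarrow> 'b \<Rightarrow> nat) \<Rightarrow> bool" where
  "balanced n t d \<longleftrightarrow> (\<forall>a b. real (\<Sum>j\<in>nodes_of n t a. d j b) = real n * \<omega>n n a b)"

text \<open>The edge numbers fix the degree sums. Within one type the half in the edge number is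
  undone by both ends of an edge being counted.\<close>

lemma balanced_degree_vector:
  assumes n: "1 \<le> n" and ne: "\<And>A. A \<in> type_pairs \<Longrightarrow> choices n t A \<noteq> {}"
    and E: "E \<in> set_pmf (edge_law n (\<omega>n n) t)"
  shows "balanced n t (degree_vector n t E)"
  unfolding balanced_def
proof (intro allI)
  fix a b
  note lat = lattice_\<omega>[OF n]
  obtain F where EF: "E = (\<Union>A\<in>type_pairs. F A)" and F: "\<And>A. A \<in> type_pairs \<Longrightarrow> F A \<in> choices n t A"
    using E ne by (auto simp: edge_law_def set_Pi_pmf PiE_dflt_def)
  have Fp: "F A \<subseteq> pool n t A" if "A \<in> type_pairs" for A using F[OF that] by (simp add: edge_choices_def)
  have deg: "(\<Sum>j\<in>nodes_of n t a. degree_vector n t E j b) = (\<Sum>j\<in>nodes_of n t a. inc (F {a, b}) j)"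
    unfolding EF by (intro sum.cong) (auto simp: nodes_of_def degree_vector_eq_inc[OF Fp])
  have cF: "card (F {a, b}) = edge_number n (\<omega>n n) a b"
    using F[of "{a, b}"] unfolding edge_choices_eq[OF lat] by simp
  show "real (\<Sum>j\<in>nodes_of n t a. degree_vector n t E j b) = real n * \<omega>n n a b"
  proof (cases "a = b")
    case True
    have "F {a} \<subseteq> ends ` distinct_pairs (nodes_of n t a) (nodes_of n t a)"
      using Fp[of "{a, a}"] pool_eq[of n t a a] by simp
    then show ?thesis
      using deg cF True sum_inc_same[of "nodes_of n t a" "F {a}"] real_edge_number[OF lat, of a a] by simp
  next
    case False
    have "F {a, b} \<subseteq> ends ` distinct_pairs (nodes_of n t a) (nodes_of n t b)"
      using Fp[of "{a, b}"] pool_eq[of n t a b] by simp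
    then show ?thesis
      using deg cF False sum_inc_disjoint(1)[OF _ _ nodes_of_disjoint[OF False], of n t "F {a, b}"]
        real_edge_number[OF lat, of a b] by simp
  qed
qed

lemma degree_vector_le: "degree_vector n t E j b \<le> n"
  unfolding degree_vector_def using card_mono[of "{..<n}" "{i \<in> {..<n}. t i = b \<and> {i, j} \<in> E}"] by auto

lemma prod_by_type:
  fixes t :: "nat \<Rightarrow> 'b"
  shows
  "(\<Prod>j<n. f (t j)) = (\<Prod>a\<in>UNIV. f a ^ card (nodes_of n t a))"
proof -
  have "(\<Prod>j<n. f (t j)) = (\<Prod>a\<in>UNIV. \<Prod>j\<in>{j \<in> {..<n}. t j = a}. f (t j))"
    by (rule prod.group[symmetric]) auto
  also have "\<dots> = (\<Prod>a\<in>UNIV. f a ^ card (nodes_of n t a))"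
    by (intro prod.cong) (auto simp: nodes_of_def intro!: arg_cong[where f = "\<lambda>x. _ ^ card x"])
  finally show ?thesis .
qed

section \<open>Exponential Chebyshev inequality and duality\<close>

text \<open>Degree vectors have at most Poisson weight up to
  \<open>exp (\<epsilon> * real n)\<close>; tilting by \<open>exp g\<close> and summing over all
  vectors with entries up to \<open>n\<close> factorises over the nodes, where
  \<open>\<zeta> n a\<close> bounds the logarithmic moment for type \<open>a\<close>. The lower
  bound on the sum of \<open>g\<close> is required only for balanced vectors, which lets prescribed
  edge numbers be exploited.\<close>

lemma exponential_bound:
  fixes g :: "'b \<times> ('b \<Rightarrow> nat) \<Rightarrow> real" and \<zeta> :: "nat \<Rightarrow> 'b \<Rightarrow> real"
  assumes \<epsilon>: "0 < \<epsilon>"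
    and g: "\<forall>\<^sub>F n in sequentially. \<forall>t\<in>arrangements n (\<rho>n n). \<forall>d. balanced n t d \<longrightarrow> (\<forall>j b. d j b \<le> n) \<longrightarrow>
      empirical_locality n t d \<in> X \<longrightarrow> real n * c \<le> (\<Sum>j<n. g (t j, d j))"
    and \<zeta>: "\<forall>\<^sub>F n in sequentially. \<forall>a. (\<Sum>\<sigma>\<in>PiE UNIV (\<lambda>_. {..n}).
      (\<Prod>b\<in>UNIV. poisson_weight (\<omega>n n a b / pmf (\<rho>n n) a) (\<sigma> b)) * exp (g (a, \<sigma>))) \<le> exp (\<zeta> n a)"
  shows "\<forall>\<^sub>F n in sequentially. \<forall>t\<in>arrangements n (\<rho>n n).
    measure_pmf.prob (edge_law n (\<omega>n n) t) {E. empirical_locality n t (degree_vector n t E) \<in> X} \<le>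
      exp (real n * (\<epsilon> - c + (\<Sum>a\<in>UNIV. pmf (\<rho>n n) a * \<zeta> n a)))"
  using degree_probability[OF \<epsilon>] g \<zeta> eventually_choices_nonempty eventually_ge_at_top[of 1]
proof eventually_elim
  case (elim n)
  show ?case
  proof
    fix t assume t: "t \<in> arrangements n (\<rho>n n)"
    let ?P = "measure_pmf.prob (edge_law n (\<omega>n n) t)"
    let ?B = "PiE (UNIV :: 'b set) (\<lambda>_. {..n})"
    define pw where "pw a \<sigma> = (\<Prod>b\<in>UNIV. poisson_weight (\<omega>n n a b / pmf (\<rho>n n) a) (\<sigma> b))" for a \<sigma>
    define D where "D = {d \<in> PiE {..<n} (\<lambda>_. ?B). real n * c \<le> (\<Sum>j<n. g (t j, d j))}"
    have finB: "finite ?B" by (rule finite_PiE) auto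
    have finD: "finite D"
      by (rule finite_subset[of _ "PiE {..<n} (\<lambda>_. ?B)"]) (use finB in \<open>auto simp: D_def intro: finite_PiE\<close>)
    have pw0: "0 \<le> pw a \<sigma>" for a \<sigma>
      unfolding pw_def using \<omega>n_nonneg[OF elim(5)]
      by (intro prod_nonneg poisson_weight_nonneg divide_nonneg_nonneg) auto
    have "?P {E. empirical_locality n t (degree_vector n t E) \<in> X} \<le>
        ?P (\<Union>d\<in>D. {E. \<forall>j<n. \<forall>b. degree_vector n t E j b = d j b})"
    proof (rule measure_pmf.finite_measure_mono_AE)
      show "AE E in edge_law n (\<omega>n n) t. E \<in> {E. empirical_locality n t (degree_vector n t E) \<in> X} \<longrightarrow>
          E \<in> (\<Union>d\<in>D. {E. \<forall>j<n. \<forall>b. degree_vector n t E j b = d j b})"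
      proof (rule AE_pmfI, rule impI)
        fix E assume E: "E \<in> set_pmf (edge_law n (\<omega>n n) t)"
          and X: "E \<in> {E. empirical_locality n t (degree_vector n t E) \<in> X}"
        have bal: "balanced n t (degree_vector n t E)"
          by (rule balanced_degree_vector[OF elim(5) _ E]) (use elim(4) t in blast)
        have "real n * c \<le> (\<Sum>j<n. g (t j, degree_vector n t E j))"
          by (rule elim(2)[rule_format, OF t bal degree_vector_le]) (use X in simp)
        then have "restrict (degree_vector n t E) {..<n} \<in> D"
          by (auto simp: D_def degree_vector_le)
        then show "E \<in> (\<Union>d\<in>D. {E. \<forall>j<n. \<forall>b. degree_vector n t E j b = d j b})"
          by (rule UN_I) simp
      qed
    qed simp
    also have "\<dots> \<le> (\<Sum>d\<in>D. ?P {E. \<forall>j<n. \<forall>b. degree_vector n t E j b = d j b})"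
      by (rule measure_pmf.finite_measure_subadditive_finite[OF finD]) auto
    also have "\<dots> \<le> (\<Sum>d\<in>D. exp (real n * (\<epsilon> - c)) * (\<Prod>j<n. pw (t j) (d j) * exp (g (t j, d j))))"
    proof (rule sum_mono)
      fix d assume d: "d \<in> D"
      have "?P {E. \<forall>j<n. \<forall>b. degree_vector n t E j b = d j b} \<le> exp (\<epsilon> * real n) * (\<Prod>j<n. pw (t j) (d j)) * 1"
        using elim(1) t by (simp add: pw_def)
      \<comment> \<open>The Chebyshev step: on \<open>D\<close> the inserted factor is at least
        1.\<close>
      also have "\<dots> \<le> exp (\<epsilon> * real n) * (\<Prod>j<n. pw (t j) (d j)) * exp ((\<Sum>j<n. g (t j, d j)) - real n * c)"
        using d pw0 by (intro mult_left_mono mult_nonneg_nonneg prod_nonneg) (auto simp: D_def)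
      also have "\<dots> = exp (real n * (\<epsilon> - c)) * (\<Prod>j<n. pw (t j) (d j) * exp (g (t j, d j)))"
        by (simp add: prod.distrib exp_sum exp_diff algebra_simps)
      finally show "?P {E. \<forall>j<n. \<forall>b. degree_vector n t E j b = d j b} \<le>
          exp (real n * (\<epsilon> - c)) * (\<Prod>j<n. pw (t j) (d j) * exp (g (t j, d j)))" .
    qed
    \<comment> \<open>Dropping the constraint that defines \<open>D\<close> leaves a product set,
      over which the sum factorises.\<close>
    also have "\<dots> \<le> (\<Sum>d\<in>PiE {..<n} (\<lambda>_. ?B). exp (real n * (\<epsilon> - c)) * (\<Prod>j<n. pw (t j) (d j) * exp (g (t j, d j))))"
      using pw0 finB
      by (intro sum_mono2 mult_nonneg_nonneg prod_nonneg) (auto simp: D_def intro: finite_PiE)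
    also have "\<dots> = exp (real n * (\<epsilon> - c)) * (\<Prod>j<n. \<Sum>\<sigma>\<in>?B. pw (t j) \<sigma> * exp (g (t j, \<sigma>)))"
      using finB by (simp add: prod_sum_PiE sum_distrib_left)
    also have "\<dots> \<le> exp (real n * (\<epsilon> - c)) * (\<Prod>j<n. exp (\<zeta> n (t j)))"
      using elim(3)[folded pw_def] pw0 by (intro mult_left_mono prod_mono conjI sum_nonneg mult_nonneg_nonneg) auto
    also have "(\<Prod>j<n. exp (\<zeta> n (t j))) = exp (real n * (\<Sum>a\<in>UNIV. pmf (\<rho>n n) a * \<zeta> n a))"
      unfolding prod_by_type[where f = "\<lambda>a. exp (\<zeta> n a)"]
      by (simp add: exp_of_nat_mult[symmetric] exp_sum[symmetric] arrangement_card[OF t] sum_distrib_left mult.assoc)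
    also have "exp (real n * (\<epsilon> - c)) * \<dots> = exp (real n * (\<epsilon> - c + (\<Sum>a\<in>UNIV. pmf (\<rho>n n) a * \<zeta> n a)))"
      by (simp add: exp_add[symmetric] distrib_left)
    finally show "?P {E. empirical_locality n t (degree_vector n t E) \<in> X} \<le>
        exp (real n * (\<epsilon> - c + (\<Sum>a\<in>UNIV. pmf (\<rho>n n) a * \<zeta> n a)))" .
  qed
qed

lemma sum_poisson_weight_le:
  assumes "0 \<le> \<mu>"
  shows "(\<Sum>k\<le>n. poisson_weight \<mu> k) \<le> 1"
proof -
  have "(\<Sum>k\<le>n. poisson_weight \<mu> k) = measure_pmf.prob (poisson_law \<mu>) {..n}"
    using assms by (simp add: measure_measure_pmf_finite pmf_poisson_law)
  then show ?thesis by simp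
qed

lemma sum_box_poisson_le:
  assumes "\<And>b. 0 \<le> \<mu> b"
  shows "(\<Sum>\<sigma>\<in>PiE (UNIV :: 'b set) (\<lambda>_. {..n}). \<Prod>b\<in>UNIV. poisson_weight (\<mu> b) (\<sigma> b)) \<le> 1"
proof -
  have "(\<Sum>\<sigma>\<in>PiE (UNIV :: 'b set) (\<lambda>_. {..n}). \<Prod>b\<in>UNIV. poisson_weight (\<mu> b) (\<sigma> b)) =
      (\<Prod>b\<in>UNIV. \<Sum>k\<le>n. poisson_weight (\<mu> b) k)"
    by (subst prod_sum_PiE) auto
  also have "\<dots> \<le> 1"
    using assms by (intro prod_le_1 conjI sum_nonneg sum_poisson_weight_le poisson_weight_nonneg)
  finally show ?thesis .
qed

end

text \<open>The dual form of the entropy, with finitely supported test functions: the optimal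
  exponent at \<open>x\<close> is \<open>ln (pmf l x / pmf q x)\<close>, approximated where it is
  infinite.\<close>

lemma entropy_test_function:
  assumes "\<not> relative_entropy (measure_pmf l) (measure_pmf q) \<le> ereal c"
  obtains F g where "finite F" "c < (\<Sum>x\<in>F. g x * pmf l x) - (\<Sum>x\<in>F. pmf q x * (exp (g x) - 1))"
proof -
  consider x0 where "pmf q x0 = 0" "pmf l x0 \<noteq> 0"
    | F where "\<forall>x. pmf q x = 0 \<longrightarrow> pmf l x = 0" "finite F" "c < (\<Sum>x\<in>F. kl_term (pmf l x) (pmf q x))"
    using assms unfolding relative_entropy_pmf_le_iff by (auto simp: not_le)
  then show ?thesis
  proof cases
    case (1 x0)
    then have "pmf l x0 > 0" by (simp add: pmf_pos)
    then show ?thesis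
      \<comment> \<open>Where absolute continuity fails, the exponent costs nothing under
        \<open>q\<close>; this value makes the gain \<open>\<bar>c\<bar> + 1\<close>.\<close>
      using 1 by (intro that[of "{x0}" "\<lambda>_. (\<bar>c\<bar> + 1) / pmf l x0"]) auto
  next
    case (2 F)
    \<comment> \<open>Where \<open>pmf l x = 0\<close> the optimal exponent is minus infinity; it is
      approached by \<open>- T\<close> for large \<open>T\<close>.\<close>
    define g where "g T x = (if pmf l x = 0 then - T else ln (pmf l x / pmf q x))" for T :: real and x
    have "((\<lambda>T. (\<Sum>x\<in>F. g T x * pmf l x - pmf q x * (exp (g T x) - 1))) \<longlongrightarrow> (\<Sum>x\<in>F. kl_term (pmf l x) (pmf q x))) at_top"
    proof (rule tendsto_sum)
      fix x
      show "((\<lambda>T. g T x * pmf l x - pmf q x * (exp (g T x) - 1)) \<longlongrightarrow> kl_term (pmf l x) (pmf q x)) at_top"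
      proof (cases "pmf l x = 0")
        case True
        have "((\<lambda>T. pmf q x * (1 - exp (- T))) \<longlongrightarrow> pmf q x * (1 - 0)) at_top"
          by (intro tendsto_intros) real_asymp
        then show ?thesis using True by (simp add: g_def kl_term_def algebra_simps)
      next
        case False
        then have l: "pmf l x > 0" and "pmf q x \<noteq> 0" using 2(1) by (auto simp: pmf_pos)
        then have "pmf q x > 0" by (simp add: pmf_pos)
        then have "g T x * pmf l x - pmf q x * (exp (g T x) - 1) = kl_term (pmf l x) (pmf q x)" for T
          using l by (simp add: g_def kl_term_def algebra_simps)
        then show ?thesis by simp
      qed
    qed
    then have "\<forall>\<^sub>F T in at_top. c < (\<Sum>x\<in>F. g T x * pmf l x - pmf q x * (exp (g T x) - 1))"
      using 2(3) by (rule order_tendstoD)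
    then obtain T where "c < (\<Sum>x\<in>F. g T x * pmf l x - pmf q x * (exp (g T x) - 1))"
      by (meson eventually_at_top_linorder order_refl)
    then show ?thesis using 2(2) by (intro that[of F "g T"]) (simp_all add: sum_subtractf)
  qed
qed

lemma continuous_poisson_weight: "isCont (\<lambda>\<mu>. poisson_weight \<mu> k) x"
  unfolding poisson_weight_def by (intro continuous_intros) auto

context type_sequence
begin

section \<open>Local upper bounds: entropy, type marginal, lost degree\<close>

text \<open>The test function vanishes off a finite set. Hence finitely many weights define the
  neighbourhood, and the exponential moments at size \<open>n\<close> converge to those of the
  limiting Poisson law.\<close>

lemma upper_entropy:
  assumes "\<not> relative_entropy (measure_pmf l) (measure_pmf (poisson_locality \<omega> \<rho>)) \<le> ereal c"
  shows "\<exists>U. openin weak_topology U \<and> l \<in> U \<and>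
    (\<forall>\<^sub>F n in sequentially. measure (conditional_locality_law TYPE('d::finite) n (\<rho>n n) (\<omega>n n)) U \<le> exp (- real n * c))"
proof -
  let ?q = "pmf (poisson_locality \<omega> \<rho>)"
  obtain F g where F: "finite F" and c: "c < (\<Sum>x\<in>F. g x * pmf l x) - (\<Sum>x\<in>F. ?q x * (exp (g x) - 1))"
    using entropy_test_function[OF assms] by blast
  \<comment> \<open>A third of the gap each for the exponent \<open>\<epsilon>\<close> of the
    Chebyshev bound, for the variation over \<open>U\<close>, and for the convergence of the
    moments.\<close>
  define \<eta> where "\<eta> = ((\<Sum>x\<in>F. g x * pmf l x) - (\<Sum>x\<in>F. ?q x * (exp (g x) - 1)) - c) / 3"
  have \<eta>: "\<eta> > 0" using c by (simp add: \<eta>_def)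
  define \<delta> where "\<delta> = \<eta> / ((\<Sum>x\<in>F. \<bar>g x\<bar>) + 1)"
  have S: "(\<Sum>x\<in>F. \<bar>g x\<bar>) + 1 > 0" by (intro add_nonneg_pos sum_nonneg) auto
  have \<delta>: "\<delta> > 0" using \<eta> S by (simp add: \<delta>_def)
  define U where "U = {p. \<forall>x\<in>F. \<bar>pmf p x - pmf l x\<bar> < \<delta>}"
  have U: "openin weak_topology U" unfolding U_def by (rule openin_weak_pmf_ball[OF F])
  have lU: "l \<in> U" using \<delta> by (simp add: U_def)
  define g' where "g' x = (if x \<in> F then g x else 0)" for x
  define qn where "qn n x = (\<Prod>b\<in>UNIV. poisson_weight (\<omega>n n (fst x) b / pmf (\<rho>n n) (fst x)) (snd x b))"
    for n and x :: "'b \<times> ('b \<Rightarrow> nat)"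
  \<comment> \<open>The excess of the exponential moment over total mass: the moment is at most
    \<open>1 + \<zeta> n a\<close>, hence at most \<open>exp (\<zeta> n a)\<close>.\<close>
  define \<zeta> where "\<zeta> n a = (\<Sum>x\<in>F. if fst x = a then qn n x * (exp (g x) - 1) else 0)" for n a
  define c' where "c' = (\<Sum>x\<in>F. g x * pmf l x) - \<eta>"
  have gU: "(\<Sum>x\<in>F. g x * pmf p x) \<ge> c'" if "p \<in> U" for p
  proof -
    have "\<bar>(\<Sum>x\<in>F. g x * pmf p x) - (\<Sum>x\<in>F. g x * pmf l x)\<bar> = \<bar>\<Sum>x\<in>F. g x * (pmf p x - pmf l x)\<bar>"
      by (simp add: sum_subtractf right_diff_distrib)
    also have "\<dots> \<le> (\<Sum>x\<in>F. \<bar>g x * (pmf p x - pmf l x)\<bar>)" by (rule sum_abs)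
    also have "\<dots> \<le> (\<Sum>x\<in>F. \<bar>g x\<bar> * \<delta>)"
      unfolding abs_mult by (intro sum_mono mult_left_mono) (use that in \<open>auto simp: U_def less_imp_le\<close>)
    also have "\<dots> = (\<Sum>x\<in>F. \<bar>g x\<bar>) * \<delta>" by (rule sum_distrib_right[symmetric])
    also have "\<dots> \<le> ((\<Sum>x\<in>F. \<bar>g x\<bar>) + 1) * \<delta>" using \<delta> by (intro mult_right_mono) auto
    also have "\<dots> = \<eta>" using S by (simp add: \<delta>_def)
    finally show ?thesis by (simp add: c'_def)
  qed
  have lim: "(\<lambda>n. \<Sum>a\<in>UNIV. pmf (\<rho>n n) a * \<zeta> n a) \<longlonglongrightarrow> (\<Sum>x\<in>F. ?q x * (exp (g x) - 1))"
  proof -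
    have "(\<Sum>a\<in>UNIV. pmf (\<rho>n n) a * \<zeta> n a) = (\<Sum>x\<in>F. (pmf (\<rho>n n) (fst x) * qn n x) * (exp (g x) - 1))" for n
    proof -
      have "(\<Sum>a\<in>UNIV. pmf (\<rho>n n) a * \<zeta> n a) =
          (\<Sum>a\<in>UNIV. \<Sum>x\<in>F. if fst x = a then pmf (\<rho>n n) a * qn n x * (exp (g x) - 1) else 0)"
        unfolding \<zeta>_def sum_distrib_left by (intro sum.cong) auto
      also have "\<dots> = (\<Sum>x\<in>F. \<Sum>a\<in>UNIV. if fst x = a then pmf (\<rho>n n) a * qn n x * (exp (g x) - 1) else 0)"
        by (rule sum.swap)
      finally show ?thesis by simp
    qed
    moreover have "(\<lambda>n. \<Sum>x\<in>F. (pmf (\<rho>n n) (fst x) * qn n x) * (exp (g x) - 1)) \<longlonglongrightarrow>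
        (\<Sum>x\<in>F. (pmf \<rho> (fst x) * (\<Prod>b\<in>UNIV. poisson_weight (\<omega> (fst x) b / pmf \<rho> (fst x)) (snd x b))) * (exp (g x) - 1))"
      unfolding qn_def
      by (intro tendsto_sum tendsto_mult tendsto_prod tendsto_const tendsto_\<rho> isCont_tendsto_compose[OF continuous_poisson_weight]
          tendsto_divide tendsto_\<omega>) (use pmf_pos in \<open>auto simp: less_imp_neq[THEN not_sym]\<close>)
    moreover have "?q x = pmf \<rho> (fst x) * (\<Prod>b\<in>UNIV. poisson_weight (\<omega> (fst x) b / pmf \<rho> (fst x)) (snd x b))" for x
      using pmf_poisson_locality[OF \<omega>_nonneg, where \<rho> = \<rho> and a = "fst x" and \<sigma> = "snd x"] by simp
    ultimately show ?thesis by simp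
  qed
  have "\<forall>\<^sub>F n in sequentially. \<forall>t\<in>arrangements n (\<rho>n n).
    measure_pmf.prob (edge_law n (\<omega>n n) t) {E. empirical_locality n t (degree_vector n t E) \<in> U} \<le>
      exp (real n * (\<eta> - c' + (\<Sum>a\<in>UNIV. pmf (\<rho>n n) a * \<zeta> n a)))"
  proof (rule exponential_bound[where g = g', OF \<eta>])
    show "\<forall>\<^sub>F n in sequentially. \<forall>t\<in>arrangements n (\<rho>n n). \<forall>d. balanced n t d \<longrightarrow> (\<forall>j b. d j b \<le> n) \<longrightarrow>
      empirical_locality n t d \<in> U \<longrightarrow> real n * c' \<le> (\<Sum>j<n. g' (t j, d j))"
      using eventually_ge_at_top[of 1]
    proof eventually_elim
      case (elim n)
      have "real n * c' \<le> (\<Sum>j<n. g' (t j, d j))" if "empirical_locality n t d \<in> U" for t d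
        unfolding g'_def sum_empirical[OF elim F] using gU[OF that] by (intro mult_left_mono) auto
      then show ?case by blast
    qed
    \<comment> \<open>From \<open>N0\<close> on the box of degrees up to \<open>n\<close> contains
      every neighbourhood occurring in \<open>F\<close>, so no part of \<open>\<zeta>\<close> is cut
      off.\<close>
    obtain N0 where N0: "\<And>x b. x \<in> F \<Longrightarrow> snd x b \<le> N0"
    proof -
      have fin: "finite ((\<lambda>(x, b). snd x b) ` (F \<times> UNIV))" using F by auto
      have "snd x b \<le> Max ((\<lambda>(x, b). snd x b) ` (F \<times> UNIV))" if "x \<in> F" for x b
        using that by (intro Max_ge[OF fin]) force
      then show ?thesis using that by blast
    qed
    show "\<forall>\<^sub>F n in sequentially. \<forall>a. (\<Sum>\<sigma>\<in>PiE UNIV (\<lambda>_. {..n}).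
      (\<Prod>b\<in>UNIV. poisson_weight (\<omega>n n a b / pmf (\<rho>n n) a) (\<sigma> b)) * exp (g' (a, \<sigma>))) \<le> exp (\<zeta> n a)"
      using eventually_ge_at_top[of N0] eventually_ge_at_top[of 1]
    proof eventually_elim
      case (elim n)
      show ?case
      proof
        fix a
        let ?B = "PiE (UNIV :: 'b set) (\<lambda>_. {..n})"
        have finB: "finite ?B" by (rule finite_PiE) auto
        have "(\<Sum>\<sigma>\<in>?B. qn n (a, \<sigma>) * exp (g' (a, \<sigma>))) =
            (\<Sum>\<sigma>\<in>?B. qn n (a, \<sigma>)) + (\<Sum>\<sigma>\<in>?B. qn n (a, \<sigma>) * (exp (g' (a, \<sigma>)) - 1))"
          unfolding sum.distrib[symmetric] by (simp add: algebra_simps)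
        also have "(\<Sum>\<sigma>\<in>?B. qn n (a, \<sigma>)) \<le> 1"
          unfolding qn_def fst_conv snd_conv
          using \<omega>n_nonneg[OF elim(2)] by (intro sum_box_poisson_le divide_nonneg_nonneg) auto
        also have "(\<Sum>\<sigma>\<in>?B. qn n (a, \<sigma>) * (exp (g' (a, \<sigma>)) - 1)) = \<zeta> n a"
        proof -
          have "\<zeta> n a = (\<Sum>x\<in>{x \<in> F. fst x = a}. qn n x * (exp (g x) - 1))"
            unfolding \<zeta>_def by (rule sum.inter_filter[symmetric, OF F])
          also have "\<dots> = (\<Sum>x\<in>Pair a ` ?B. qn n x * (exp (g' x) - 1))"
          proof (rule sum.mono_neutral_cong_left)
            show "{x \<in> F. fst x = a} \<subseteq> Pair a ` ?B"
            proof
              fix x assume x: "x \<in> {x \<in> F. fst x = a}"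
              then have "snd x \<in> ?B" using N0[of x] elim(1) by (auto intro: order_trans)
              then show "x \<in> Pair a ` ?B" using x by (intro image_eqI[of _ _ "snd x"]) auto
            qed
          qed (use finB in \<open>auto simp: g'_def\<close>)
          also have "\<dots> = (\<Sum>\<sigma>\<in>?B. qn n (a, \<sigma>) * (exp (g' (a, \<sigma>)) - 1))"
            by (simp add: sum.reindex inj_on_def)
          finally show ?thesis ..
        qed
        finally have "(\<Sum>\<sigma>\<in>?B. qn n (a, \<sigma>) * exp (g' (a, \<sigma>))) \<le> 1 + \<zeta> n a" by simp
        also have "\<dots> \<le> exp (\<zeta> n a)" by (rule exp_ge_add_one_self)
        finally show "(\<Sum>\<sigma>\<in>?B. (\<Prod>b\<in>UNIV. poisson_weight (\<omega>n n a b / pmf (\<rho>n n) a) (\<sigma> b)) * exp (g' (a, \<sigma>))) \<le> exp (\<zeta> n a)"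
          by (simp add: qn_def)
      qed
    qed
  qed
  moreover have "\<forall>\<^sub>F n in sequentially. (\<Sum>a\<in>UNIV. pmf (\<rho>n n) a * \<zeta> n a) < (\<Sum>x\<in>F. ?q x * (exp (g x) - 1)) + \<eta>"
    by (rule order_tendstoD(2)[OF lim]) (use \<eta> in simp)
  ultimately have "\<forall>\<^sub>F n in sequentially. measure (conditional_locality_law TYPE('d) n (\<rho>n n) (\<omega>n n)) U \<le> exp (- real n * c)"
    using eventually_ge_at_top[of 1]
  proof eventually_elim
    case (elim n)
    have Us: "U \<in> sets (borel_of_topology weak_topology)"
      using U openin_subset by (auto simp: borel_of_topology_def)
    show ?case
    proof (rule measure_law_bounds(1)[OF elim(3) Us])
      fix t assume t: "t \<in> arrangements n (\<rho>n n)"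
      have "\<eta> - c' + (\<Sum>a\<in>UNIV. pmf (\<rho>n n) a * \<zeta> n a) \<le> - c"
        using elim(2) by (simp add: c'_def \<eta>_def field_simps)
      then have "exp (real n * (\<eta> - c' + (\<Sum>a\<in>UNIV. pmf (\<rho>n n) a * \<zeta> n a))) \<le> exp (real n * - c)"
        by (simp only: exp_le_cancel_iff mult_left_mono of_nat_0_le_iff)
      then show "measure_pmf.prob (edge_law n (\<omega>n n) t) {E. empirical_locality n t (degree_vector n t E) \<in> U} \<le> exp (- real n * c)"
        using bspec[OF elim(1) t] by (simp only: mult_minus_right mult_minus_left)
    qed simp
  qed
  then show ?thesis using U lU by blast
qed

text \<open>The type marginal of every drawn graph is exactly \<open>\<rho>n n\<close>, so a
  neighbourhood that separates the marginal of \<open>l\<close> from \<open>\<rho>\<close>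
  eventually has probability 0.\<close>

lemma upper_marginal:
  assumes "H1 l \<noteq> \<rho>"
  shows "\<exists>U. openin weak_topology U \<and> l \<in> U \<and>
    (\<forall>\<^sub>F n in sequentially. measure (conditional_locality_law TYPE('d::finite) n (\<rho>n n) (\<omega>n n)) U \<le> exp (- real n * c))"
proof -
  obtain a where a: "pmf (map_pmf fst l) a \<noteq> pmf \<rho> a"
    using assms by (auto simp: H1_def pmf_eq_iff)
  define \<delta> where "\<delta> = \<bar>pmf (map_pmf fst l) a - pmf \<rho> a\<bar> / 2"
  have \<delta>: "\<delta> > 0" using a by (simp add: \<delta>_def)
  define U where "U = {p :: ('b \<times> ('b \<Rightarrow> nat)) pmf. \<bar>pmf (map_pmf fst p) a - pmf (map_pmf fst l) a\<bar> < \<delta>}"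
  have U: "openin weak_topology U" unfolding U_def
    by (intro openin_weak_Collect_less continuous_map_real_abs continuous_map_diff continuous_map_pmf_map continuous_map_canonical_const)
  have "\<forall>\<^sub>F n in sequentially. \<bar>pmf (\<rho>n n) a - pmf \<rho> a\<bar> < \<delta>"
    using tendstoD[OF tendsto_\<rho> \<delta>] by (simp add: dist_real_def)
  then have "\<forall>\<^sub>F n in sequentially. measure (conditional_locality_law TYPE('d) n (\<rho>n n) (\<omega>n n)) U \<le> exp (- real n * c)"
    using eventually_ge_at_top[of 1]
  proof eventually_elim
    case (elim n)
    have Us: "U \<in> sets (borel_of_topology weak_topology)"
      using U openin_subset by (auto simp: borel_of_topology_def)
    show ?case
    proof (rule measure_law_bounds(1)[OF elim(2) Us])
      fix t assume t: "t \<in> arrangements n (\<rho>n n)"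
      have "pmf (map_pmf fst (empirical_locality n t d)) a = pmf (\<rho>n n) a" for d
      proof -
        have "{j \<in> {..<n}. t j = a} = nodes_of n t a" by (auto simp: nodes_of_def)
        then show ?thesis using arrangement_card[OF t, of a] elim(2) by (simp add: prob_map_empirical)
      qed
      then have "empirical_locality n t d \<notin> U" for d
        using elim(1) unfolding U_def \<delta>_def by (simp add: abs_if split: if_splits)
      then show "measure_pmf.prob (edge_law n (\<omega>n n) t) {E. empirical_locality n t (degree_vector n t E) \<in> U} \<le> exp (- real n * c)"
        by simp
    qed simp
  qed
  moreover have "l \<in> U" using \<delta> by (simp add: U_def)
  ultimately show ?thesis using U by blast
qed

text \<open>At arbitrarily high levels \<open>K\<close> the truncated mean of \<open>l\<close>
  misses \<open>\<omega>\<close> by \<open>\<delta>\<close>. A graph close to \<open>l\<close> has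
  nearly the same truncated mean but the prescribed full mean, so degrees above \<open>K\<close>
  account for at least \<open>\<delta> / 2\<close> per node. With a linear test function above a
  sufficiently high level this becomes as unlikely as desired.\<close>

lemma upper_inconsistent:
  assumes "\<not> consistent \<omega> l"
  shows "\<exists>U. openin weak_topology U \<and> l \<in> U \<and>
    (\<forall>\<^sub>F n in sequentially. measure (conditional_locality_law TYPE('d::finite) n (\<rho>n n) (\<omega>n n)) U \<le> exp (- real n * c))"
proof -
  obtain a b where ab: "\<not> (\<lambda>K. trunc_mean K l a b) \<longlonglongrightarrow> \<omega> b a"
    using assms consistent_iff[of \<omega> l] \<omega>_nonneg by blast
  then obtain \<delta> where \<delta>: "\<delta> > 0" and freq: "\<And>K0. \<exists>K\<ge>K0. \<delta> \<le> \<bar>trunc_mean K l a b - \<omega> b a\<bar>"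
    unfolding LIMSEQ_iff real_norm_def by (meson not_le)
  have \<delta>4: "\<delta> / 4 > 0" using \<delta> by simp
  \<comment> \<open>Eventually an upper bound for the Poisson means at size \<open>n\<close>, so
    that one level \<open>K0\<close> serves for all large \<open>n\<close>.\<close>
  define \<Lambda> where "\<Lambda> = (\<omega> a b + 1) / (pmf \<rho> a / 2)"
  \<comment> \<open>In the slope \<open>s\<close> below,
    \<open>s * \<delta> / 2 = \<bar>c\<bar> + 2\<close>; the 2 covers the exponent 1 of the
    Chebyshev bound and the logarithmic moment, also bounded by 1.\<close>
  have \<Lambda>: "\<Lambda> \<ge> 0" using \<omega>_nonneg[of a b] by (simp add: \<Lambda>_def)
  define s where "s = (\<bar>c\<bar> + 2) * 2 / \<delta>"
  have s: "s > 0" using \<delta> by (simp add: s_def add_nonneg_pos)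
  \<comment> \<open>The bound \<open>exp (- \<Lambda>)\<close> compensates the factor
    \<open>exp \<Lambda>\<close> lost when weights of smaller mean are compared with those of mean
    \<open>\<Lambda>\<close>.\<close>
  obtain K0 where K0: "\<And>K'. (\<Sum>k\<in>{K0<..K'}. poisson_weight \<Lambda> k * exp (s * real k)) \<le> exp (- \<Lambda>)"
    using poisson_tail[of "exp (- \<Lambda>)" 0 \<Lambda> s] by auto
  obtain K where K: "K0 \<le> K" "\<delta> \<le> \<bar>trunc_mean K l a b - \<omega> b a\<bar>" using freq by blast
  define g where "g x = (if fst x = a \<and> K < snd x b then s * real (snd x b) else 0)" for x :: "'b \<times> ('b \<Rightarrow> nat)"
  define U where "U = {p. \<bar>trunc_mean K p a b - trunc_mean K l a b\<bar> < \<delta> / 4}"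
  have U: "openin weak_topology U" unfolding U_def
    by (intro openin_weak_Collect_less continuous_map_real_abs continuous_map_diff continuous_map_trunc_mean continuous_map_canonical_const)
  have "\<forall>\<^sub>F n in sequentially. \<forall>t\<in>arrangements n (\<rho>n n).
    measure_pmf.prob (edge_law n (\<omega>n n) t) {E. empirical_locality n t (degree_vector n t E) \<in> U} \<le>
      exp (real n * (1 - s * \<delta> / 2 + (\<Sum>a\<in>UNIV. pmf (\<rho>n n) a * 1)))"
  proof (rule exponential_bound[where g = g])
    show "\<forall>\<^sub>F n in sequentially. \<forall>t\<in>arrangements n (\<rho>n n). \<forall>d. balanced n t d \<longrightarrow> (\<forall>j b. d j b \<le> n) \<longrightarrow>
      empirical_locality n t d \<in> U \<longrightarrow> real n * (s * \<delta> / 2) \<le> (\<Sum>j<n. g (t j, d j))"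
      using eventually_\<omega>n_close[OF \<delta>4, of a b] eventually_ge_at_top[of 1]
    proof eventually_elim
      case (elim n)
      show ?case
      proof (intro ballI allI impI)
        fix t d assume bal: "balanced n t d" and dU: "empirical_locality n t d \<in> U"
        let ?tr = "trunc_mean K (empirical_locality n t d) a b"
        have full: "(\<Sum>j\<in>nodes_of n t a. real (d j b)) = real n * \<omega>n n a b"
          using bal by (simp add: balanced_def)
        have "(\<Sum>j<n. g (t j, d j)) = (\<Sum>j\<in>nodes_of n t a. g (t j, d j))"
          by (rule sum.mono_neutral_right) (auto simp: nodes_of_def g_def)
        also have "\<dots> = (\<Sum>j\<in>nodes_of n t a. s * (real (d j b) - (if d j b \<le> K then real (d j b) else 0)))"
          by (intro sum.cong) (auto simp: nodes_of_def g_def)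
        also have "\<dots> = s * (real n * \<omega>n n a b - real n * ?tr)"
          unfolding trunc_mean_empirical[OF elim(2)] full[symmetric] by (simp add: sum_distrib_left[symmetric] sum_subtractf)
        finally have g_eq: "(\<Sum>j<n. g (t j, d j)) = s * real n * (\<omega>n n a b - ?tr)" by (simp add: algebra_simps)
        have "0 \<le> \<omega>n n a b - ?tr"
        proof -
          have "real n * ?tr \<le> real n * \<omega>n n a b"
            unfolding trunc_mean_empirical[OF elim(2)] full[symmetric] by (intro sum_mono) auto
          then show ?thesis using elim(2) by simp
        qed
        \<comment> \<open>Of the gap \<open>\<delta>\<close>, the neighbourhood and the convergence
          of \<open>\<omega>n\<close> use up a quarter each. The sign is known because a truncated
          mean cannot exceed the full one.\<close>
        then have "\<delta> / 2 \<le> \<omega>n n a b - ?tr"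
          using dU K(2) elim(1) \<omega>_commute[of a b] unfolding U_def by (auto simp: abs_if split: if_splits)
        then show "real n * (s * \<delta> / 2) \<le> (\<Sum>j<n. g (t j, d j))"
          unfolding g_eq using mult_left_mono[of "\<delta> / 2" "\<omega>n n a b - ?tr" "s * real n"] s by (simp add: ac_simps)
      qed
    qed
    show "\<forall>\<^sub>F n in sequentially. \<forall>a'. (\<Sum>\<sigma>\<in>PiE UNIV (\<lambda>_. {..n}).
      (\<Prod>b\<in>UNIV. poisson_weight (\<omega>n n a' b / pmf (\<rho>n n) a') (\<sigma> b)) * exp (g (a', \<sigma>))) \<le> exp 1"
      using eventually_\<omega>n_le[of a b] eventually_\<rho>n_ge[of a] eventually_ge_at_top[of 1]
    proof eventually_elim
      case (elim n)
      have mu0: "0 \<le> \<omega>n n a' b' / pmf (\<rho>n n) a'" for a' b'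
        using \<omega>n_nonneg[OF elim(3)] by simp
      show ?case
      proof
        fix a'
        let ?B = "PiE (UNIV :: 'b set) (\<lambda>_. {..n})"
        let ?pw = "\<lambda>b'. poisson_weight (\<omega>n n a' b' / pmf (\<rho>n n) a')"
        show "(\<Sum>\<sigma>\<in>?B. (\<Prod>b\<in>UNIV. ?pw b (\<sigma> b)) * exp (g (a', \<sigma>))) \<le> exp 1"
        proof (cases "a' = a")
          case False
          then have "(\<Sum>\<sigma>\<in>?B. (\<Prod>b\<in>UNIV. ?pw b (\<sigma> b)) * exp (g (a', \<sigma>))) = (\<Sum>\<sigma>\<in>?B. \<Prod>b\<in>UNIV. ?pw b (\<sigma> b))"
            by (simp add: g_def)
          also have "\<dots> \<le> 1" by (rule sum_box_poisson_le) (rule mu0)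
          also have "\<dots> \<le> exp 1" by simp
          finally show ?thesis .
        next
          case True
          \<comment> \<open>The tilt acts on coordinate \<open>b\<close> only, so the sum over the
            box still factorises.\<close>
          let ?e = "\<lambda>b' k. if b' = b \<and> K < k then exp (s * real k) else 1 :: real"
          have "exp (g (a', \<sigma>)) = (\<Prod>b'\<in>UNIV. ?e b' (\<sigma> b'))" for \<sigma>
            using True by (subst prod.remove[of _ b]) (auto simp: g_def intro!: prod.neutral)
          then have "(\<Sum>\<sigma>\<in>?B. (\<Prod>b\<in>UNIV. ?pw b (\<sigma> b)) * exp (g (a', \<sigma>))) =
              (\<Sum>\<sigma>\<in>?B. \<Prod>b'\<in>UNIV. ?pw b' (\<sigma> b') * ?e b' (\<sigma> b'))"
            by (simp only: prod.distrib)
          also have "\<dots> = (\<Prod>b'\<in>UNIV. \<Sum>k\<le>n. ?pw b' k * ?e b' k)"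
            by (subst prod_sum_PiE) auto
          also have "\<dots> = (\<Sum>k\<le>n. ?pw b k * ?e b k) * (\<Prod>b'\<in>UNIV - {b}. \<Sum>k\<le>n. ?pw b' k * ?e b' k)"
            by (rule prod.remove) auto
          also have "\<dots> \<le> 2 * 1"
          proof (rule mult_mono)
            have "(\<Prod>b'\<in>UNIV - {b}. \<Sum>k\<le>n. ?pw b' k * ?e b' k) = (\<Prod>b'\<in>UNIV - {b}. \<Sum>k\<le>n. ?pw b' k)"
              by (intro prod.cong sum.cong) auto
            also have "\<dots> \<le> 1"
              by (intro prod_le_1 conjI sum_nonneg sum_poisson_weight_le poisson_weight_nonneg mu0)
            finally show "(\<Prod>b'\<in>UNIV - {b}. \<Sum>k\<le>n. ?pw b' k * ?e b' k) \<le> 1" .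
            have le\<Lambda>: "\<omega>n n a b / pmf (\<rho>n n) a \<le> \<Lambda>"
              unfolding \<Lambda>_def using elim \<omega>n_nonneg[OF elim(3), of a b] pmf_pos[of a] by (intro frac_le) auto
            have pw_le: "?pw b k \<le> exp \<Lambda> * poisson_weight \<Lambda> k" for k
            proof -
              have "(\<omega>n n a b / pmf (\<rho>n n) a) ^ k \<le> \<Lambda> ^ k" using le\<Lambda> mu0 by (intro power_mono) auto
              moreover have "exp (- (\<omega>n n a b / pmf (\<rho>n n) a)) \<le> 1" using mu0[of a b] by simp
              ultimately have "exp (- (\<omega>n n a b / pmf (\<rho>n n) a)) * (\<omega>n n a b / pmf (\<rho>n n) a) ^ k \<le> 1 * \<Lambda> ^ k"
                using mu0 by (intro mult_mono) auto
              then have "?pw b k \<le> \<Lambda> ^ k / fact k" unfolding True poisson_weight_def by (intro divide_right_mono) auto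
              also have "\<dots> = exp \<Lambda> * poisson_weight \<Lambda> k"
                by (simp add: poisson_weight_def exp_minus)
              finally show ?thesis .
            qed
            have pw0: "0 \<le> ?pw b k" for k by (rule poisson_weight_nonneg[OF mu0])
            have "(\<Sum>k\<le>n. ?pw b k * ?e b k) \<le> (\<Sum>k\<le>n. ?pw b k + (if K < k then ?pw b k * exp (s * real k) else 0))"
              using pw0 by (intro sum_mono) auto
            also have "\<dots> = (\<Sum>k\<le>n. ?pw b k) + (\<Sum>k\<in>{k\<in>{..n}. K < k}. ?pw b k * exp (s * real k))"
              unfolding sum.distrib by (intro arg_cong2[where f = "(+)"] refl sum.inter_filter[symmetric]) simp
            also have "\<dots> \<le> 1 + (\<Sum>k\<in>{K0<..n}. exp \<Lambda> * (poisson_weight \<Lambda> k * exp (s * real k)))"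
            proof (intro add_mono sum_poisson_weight_le mu0)
              have "(\<Sum>k\<in>{k\<in>{..n}. K < k}. ?pw b k * exp (s * real k)) \<le> (\<Sum>k\<in>{K0<..n}. ?pw b k * exp (s * real k))"
                by (rule sum_mono2) (use K(1) pw0 in auto)
              also have "\<dots> \<le> (\<Sum>k\<in>{K0<..n}. exp \<Lambda> * poisson_weight \<Lambda> k * exp (s * real k))"
                by (intro sum_mono mult_right_mono pw_le) auto
              finally show "(\<Sum>k\<in>{k\<in>{..n}. K < k}. ?pw b k * exp (s * real k)) \<le>
                  (\<Sum>k\<in>{K0<..n}. exp \<Lambda> * (poisson_weight \<Lambda> k * exp (s * real k)))"
                by (simp add: mult.assoc)
            qed
            also have "\<dots> = 1 + exp \<Lambda> * (\<Sum>k\<in>{K0<..n}. poisson_weight \<Lambda> k * exp (s * real k))"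
              by (simp add: sum_distrib_left)
            also have "\<dots> \<le> 1 + exp \<Lambda> * exp (- \<Lambda>)" by (intro add_left_mono mult_left_mono K0) auto
            also have "\<dots> = 2" by (simp add: exp_minus)
            finally show "(\<Sum>k\<le>n. ?pw b k * ?e b k) \<le> 2" .
            show "0 \<le> (\<Prod>b'\<in>UNIV - {b}. \<Sum>k\<le>n. ?pw b' k * ?e b' k)"
              by (intro prod_nonneg sum_nonneg mult_nonneg_nonneg poisson_weight_nonneg mu0) auto
          qed simp
          also have "\<dots> \<le> exp 1" using exp_ge_add_one_self[of 1] by simp
          finally show ?thesis .
        qed
      qed
    qed
  qed simp
  then have "\<forall>\<^sub>F n in sequentially. measure (conditional_locality_law TYPE('d) n (\<rho>n n) (\<omega>n n)) U \<le> exp (- real n * c)"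
    using eventually_ge_at_top[of 1]
  proof eventually_elim
    case (elim n)
    have Us: "U \<in> sets (borel_of_topology weak_topology)"
      using U openin_subset by (auto simp: borel_of_topology_def)
    show ?case
    proof (rule measure_law_bounds(1)[OF elim(2) Us])
      fix t assume t: "t \<in> arrangements n (\<rho>n n)"
      have "s * \<delta> / 2 = \<bar>c\<bar> + 2" using \<delta> by (simp add: s_def)
      moreover have "(\<Sum>a\<in>UNIV. pmf (\<rho>n n) a * 1) = 1" by (simp add: sum_pmf_eq_1)
      ultimately have "1 - s * \<delta> / 2 + (\<Sum>a\<in>UNIV. pmf (\<rho>n n) a * 1) \<le> - c" by linarith
      then have "exp (real n * (1 - s * \<delta> / 2 + (\<Sum>a\<in>UNIV. pmf (\<rho>n n) a * 1))) \<le> exp (real n * - c)"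
        by (simp only: exp_le_cancel_iff mult_left_mono of_nat_0_le_iff)
      then show "measure_pmf.prob (edge_law n (\<omega>n n) t) {E. empirical_locality n t (degree_vector n t E) \<in> U} \<le> exp (- real n * c)"
        using bspec[OF elim(1) t] by (simp only: mult_minus_right mult_minus_left)
    qed simp
  qed
  moreover have "l \<in> U" using \<delta> by (simp add: U_def)
  ultimately show ?thesis using U by blast
qed

lemma upper_local:
  assumes "ereal c < rate_J \<rho> \<omega> l"
  shows "\<exists>U. openin weak_topology U \<and> l \<in> U \<and>
    (\<forall>\<^sub>F n in sequentially. measure (conditional_locality_law TYPE('d::finite) n (\<rho>n n) (\<omega>n n)) U \<le> exp (- real n * c))"
proof (cases "consistent \<omega> l \<and> H1 l = \<rho>")
  case True
  then show ?thesis using upper_entropy[of l c] assms by (simp add: rate_J_eq[OF \<omega>_nonneg] not_le)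
next
  case False
  then show ?thesis using upper_marginal[of l c] upper_inconsistent[of l c] by blast
qed

text \<open>The full means are prescribed and converge, hence all truncated means are bounded
  surely. This supplies the compact set for the criterion.\<close>

lemma eventually_bounded_mean:
  "\<exists>C. \<forall>\<^sub>F n in sequentially. AE l in conditional_locality_law TYPE('d::finite) n (\<rho>n n) (\<omega>n n).
    l \<in> {l. \<forall>a b K. trunc_mean K l a b \<le> C}"
proof -
  define C where "C = (\<Sum>(a, b)\<in>UNIV. \<omega> a b + 1)"
  have C: "\<omega> a b + 1 \<le> C" for a b
  proof -
    have "\<omega> a b + 1 = (\<lambda>(a, b). \<omega> a b + 1) (a, b)" by simp
    also have "\<dots> \<le> C" unfolding C_def by (rule member_le_sum) (auto simp: \<omega>_nonneg add_nonneg_nonneg)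
    finally show ?thesis .
  qed
  let ?K = "{l :: ('b \<times> ('b \<Rightarrow> nat)) pmf. \<forall>a b K. trunc_mean K l a b \<le> C}"
  have "\<forall>\<^sub>F n in sequentially. \<forall>p\<in>UNIV. \<omega>n n (fst p) (snd p) \<le> \<omega> (fst p) (snd p) + 1"
    by (subst eventually_ball_finite_distrib) (auto simp: eventually_\<omega>n_le)
  then have "\<forall>\<^sub>F n in sequentially. AE l in conditional_locality_law TYPE('d) n (\<rho>n n) (\<omega>n n). l \<in> ?K"
    using eventually_choices_nonempty eventually_ge_at_top[of 1]
  proof eventually_elim
    case (elim n)
    interpret prob_space "conditional_locality_law TYPE('d) n (\<rho>n n) (\<omega>n n)"
      by (rule prob_space_conditional_locality_law)
    have "closedin weak_topology ?K"
    proof -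
      have "?K = (\<Inter>p\<in>UNIV. {l. trunc_mean (snd (snd p)) l (fst p) (fst (snd p)) \<le> C})" by auto
      also have "closedin weak_topology \<dots>"
        by (intro closedin_INT closedin_weak_Collect_le continuous_map_trunc_mean continuous_map_canonical_const) auto
      finally show ?thesis .
    qed
    then have "UNIV - ?K \<in> sets (borel_of_topology weak_topology)"
      by (auto simp: closedin_def topspace_weak_topology borel_of_topology_def intro!: sigma_sets.Basic)
    moreover have "UNIV \<in> sets (borel_of_topology (weak_topology :: ('b \<times> ('b \<Rightarrow> nat)) pmf topology))"
      using openin_topspace[of "weak_topology :: ('b \<times> ('b \<Rightarrow> nat)) pmf topology"]
      by (auto simp: borel_of_topology_def topspace_weak_topology intro!: sigma_sets.Basic)
    ultimately have "UNIV - (UNIV - ?K) \<in> sets (borel_of_topology weak_topology)" by (rule sets.Diff[rotated])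
    then have Ks: "?K \<in> sets (borel_of_topology weak_topology)" by (simp add: double_diff)
    have "1 \<le> measure (conditional_locality_law TYPE('d) n (\<rho>n n) (\<omega>n n)) ?K"
    proof (rule measure_law_bounds(2)[OF elim(3) Ks])
      fix t assume t: "t \<in> arrangements n (\<rho>n n)"
      have "empirical_locality n t (degree_vector n t E) \<in> ?K" if E: "E \<in> set_pmf (edge_law n (\<omega>n n) t)" for E
      proof (intro CollectI allI)
        fix a b K
        have "balanced n t (degree_vector n t E)"
          by (rule balanced_degree_vector[OF elim(3) _ E]) (use elim(2) t in blast)
        then have full: "(\<Sum>j\<in>nodes_of n t a. real (degree_vector n t E j b)) = real n * \<omega>n n a b"
          by (simp add: balanced_def)
        have "real n * trunc_mean K (empirical_locality n t (degree_vector n t E)) a b \<le> real n * \<omega>n n a b"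
          unfolding trunc_mean_empirical[OF elim(3)] full[symmetric] by (intro sum_mono) auto
        then have "trunc_mean K (empirical_locality n t (degree_vector n t E)) a b \<le> \<omega>n n a b" using elim(3) by simp
        also have "\<dots> \<le> C" using elim(1) C[of a b] by (auto intro: order_trans)
        finally show "trunc_mean K (empirical_locality n t (degree_vector n t E)) a b \<le> C" .
      qed
      then have "measure_pmf.prob (edge_law n (\<omega>n n) t) {E. empirical_locality n t (degree_vector n t E) \<in> ?K} = 1"
        by (subst measure_pmf.prob_eq_1) (auto simp: AE_measure_pmf_iff)
      then show "1 \<le> measure_pmf.prob (edge_law n (\<omega>n n) t) {E. empirical_locality n t (degree_vector n t E) \<in> ?K}" by simp
    qed
    then have "prob ?K = 1" using prob_le_1[of ?K] by linarith
    then show ?case using prob_eq_1[of ?K] Ks by (simp add: sets_space_conditional_locality_law)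
  qed
  then show ?thesis by blast
qed

end

section \<open>The lower bound\<close>

lemma sum_geometric_le:
  fixes y :: real
  assumes "0 \<le> y" "y < 1"
  shows "(\<Sum>i<k. y ^ i) \<le> 1 / (1 - y)"
proof -
  have s: "summable (\<lambda>i. y ^ i)" using assms by (intro summable_geometric) auto
  have "(\<Sum>i<k. y ^ i) \<le> (\<Sum>i. y ^ i)" by (rule sum_le_suminf[OF s]) (use assms in auto)
  then show ?thesis using assms suminf_geometric[of y] by simp
qed

text \<open>Two geometric series, one to either side of \<open>e\<close>; the bound tends to 1 as
  \<open>\<theta>\<close> grows.\<close>

lemma sum_two_sided_geometric_le:
  fixes e K :: nat
  assumes \<theta>: "\<theta> > 0"
  shows "(\<Sum>k\<le>K. exp (- \<theta> * \<bar>real e - real k\<bar>)) \<le> (1 + exp (- \<theta>)) / (1 - exp (- \<theta>))"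
proof -
  let ?y = "exp (- \<theta>)"
  have y: "0 \<le> ?y" "?y < 1" using \<theta> by auto
  let ?f = "\<lambda>k. exp (- \<theta> * \<bar>real e - real k\<bar>)"
  have "(\<Sum>k\<le>K. ?f k) \<le> (\<Sum>k\<in>{..e} \<union> (\<lambda>i. e + Suc i) ` {..<K}. ?f k)"
  proof (rule sum_mono2)
    show "{..K} \<subseteq> {..e} \<union> (\<lambda>i. e + Suc i) ` {..<K}"
    proof
      fix k assume "k \<in> {..K}"
      then show "k \<in> {..e} \<union> (\<lambda>i. e + Suc i) ` {..<K}"
        by (cases "k \<le> e") (auto intro!: image_eqI[of _ _ "k - Suc e"])
    qed
  qed auto
  also have "\<dots> = (\<Sum>k\<le>e. ?f k) + (\<Sum>k\<in>(\<lambda>i. e + Suc i) ` {..<K}. ?f k)"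
    by (rule sum.union_disjoint) auto
  also have "(\<Sum>k\<le>e. ?f k) = (\<Sum>i<Suc e. ?y ^ i)"
  proof -
    have "(\<Sum>k\<le>e. ?f k) = (\<Sum>k\<le>e. ?y ^ (e - k))"
      by (intro sum.cong) (auto simp: exp_of_nat_mult[symmetric] of_nat_diff algebra_simps)
    also have "\<dots> = (\<Sum>i\<le>e. ?y ^ i)"
      by (rule sum.reindex_bij_witness[of _ "\<lambda>i. e - i" "\<lambda>i. e - i"]) auto
    finally show ?thesis by (simp add: lessThan_Suc_atMost)
  qed
  also have "(\<Sum>k\<in>(\<lambda>i. e + Suc i) ` {..<K}. ?f k) = (\<Sum>i<K. ?y * ?y ^ i)"
  proof -
    have "(\<Sum>k\<in>(\<lambda>i. e + Suc i) ` {..<K}. ?f k) = (\<Sum>i<K. ?f (e + Suc i))"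
      by (subst sum.reindex) (auto simp: inj_on_def)
    also have "\<dots> = (\<Sum>i<K. ?y * ?y ^ i)"
      by (intro sum.cong) (auto simp: exp_of_nat_mult[symmetric] exp_add[symmetric] algebra_simps)
    finally show ?thesis .
  qed
  also have "(\<Sum>i<Suc e. ?y ^ i) + (\<Sum>i<K. ?y * ?y ^ i) \<le> 1 / (1 - ?y) + ?y * (1 / (1 - ?y))"
    unfolding sum_distrib_left[symmetric] using y by (intro add_mono mult_left_mono sum_geometric_le) auto
  also have "\<dots> = (1 + ?y) / (1 - ?y)" by (simp add: add_divide_distrib)
  finally show ?thesis .
qed

abbreviation boxes :: "nat \<Rightarrow> ('b::finite \<Rightarrow> nat) set" where
  "boxes K \<equiv> PiE UNIV (\<lambda>_. {..K})"

lemma finite_boxes [simp]: "finite (boxes K)"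
  by (intro finite_PiE) simp_all

text \<open>Chebyshev's argument for counting: a vector within distance \<open>s\<close> has
  \<open>exp (\<theta> * (s - dist)) \<ge> 1\<close>, and the sum of these exponentials factorises
  over the coordinates. The growth rate is small if first \<open>\<theta>\<close> is taken large and
  then \<open>s\<close> a small multiple of \<open>n\<close>.\<close>

lemma card_close_le:
  fixes e :: "nat \<Rightarrow> 'b::finite \<Rightarrow> nat"
  assumes \<theta>: "\<theta> > 0"
  shows "real (card {d \<in> PiE {..<n} (\<lambda>_. boxes K). (\<Sum>j<n. \<Sum>b\<in>UNIV. \<bar>real (e j b) - real (d j b)\<bar>) \<le> s}) \<le>
    exp (\<theta> * s) * ((1 + exp (- \<theta>)) / (1 - exp (- \<theta>))) ^ (n * CARD('b))"
proof -
  let ?P = "PiE {..<n} (\<lambda>_. boxes K) :: (nat \<Rightarrow> 'b \<Rightarrow> nat) set"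
  let ?dist = "\<lambda>d :: nat \<Rightarrow> 'b \<Rightarrow> nat. \<Sum>j<n. \<Sum>b\<in>UNIV. \<bar>real (e j b) - real (d j b)\<bar>"
  let ?A = "(1 + exp (- \<theta>)) / (1 - exp (- \<theta>))"
  have finP: "finite ?P" by (intro finite_PiE) auto
  have "real (card {d \<in> ?P. ?dist d \<le> s}) = (\<Sum>d\<in>{d \<in> ?P. ?dist d \<le> s}. 1)" by simp
  also have "\<dots> \<le> (\<Sum>d\<in>{d \<in> ?P. ?dist d \<le> s}. exp (\<theta> * (s - ?dist d)))"
    by (intro sum_mono) (use \<theta> in auto)
  also have "\<dots> \<le> (\<Sum>d\<in>?P. exp (\<theta> * (s - ?dist d)))"
    by (rule sum_mono2) (use finP in auto)
  also have "\<dots> = exp (\<theta> * s) * (\<Sum>d\<in>?P. \<Prod>j<n. \<Prod>b\<in>UNIV. exp (- \<theta> * \<bar>real (e j b) - real (d j b)\<bar>))"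
    by (simp add: sum_distrib_left exp_sum[symmetric] exp_add[symmetric] right_diff_distrib sum_negf)
  also have "(\<Sum>d\<in>?P. \<Prod>j<n. \<Prod>b\<in>UNIV. exp (- \<theta> * \<bar>real (e j b) - real (d j b)\<bar>)) =
      (\<Prod>j<n. \<Sum>\<sigma>\<in>boxes K. \<Prod>b\<in>UNIV. exp (- \<theta> * \<bar>real (e j b) - real (\<sigma> b)\<bar>))"
    by (rule prod_sum_PiE[symmetric]) auto
  also have "\<dots> = (\<Prod>j<n. \<Prod>b\<in>UNIV. \<Sum>k\<le>K. exp (- \<theta> * \<bar>real (e j b) - real k\<bar>))"
    by (intro prod.cong refl prod_sum_PiE[symmetric]) auto
  also have "\<dots> \<le> (\<Prod>j<n. \<Prod>b\<in>(UNIV :: 'b set). ?A)"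
    by (intro prod_mono conjI prod_nonneg sum_nonneg sum_two_sided_geometric_le[OF \<theta>]) auto
  also have "\<dots> = ?A ^ (n * CARD('b))" by (simp add: power_mult[symmetric] mult.commute)
  finally show ?thesis by (simp add: mult_left_mono)
qed

lemma nth_count:
  assumes "bij_betw h V {..<length ws}"
  shows "card {j \<in> V. ws ! h j = \<sigma>} = count_list ws \<sigma>"
proof -
  have "bij_betw h {j \<in> V. ws ! h j = \<sigma>} {i. i < length ws \<and> \<sigma> = ws ! i}"
  proof (rule bij_betw_imageI)
    show "inj_on h {j \<in> V. ws ! h j = \<sigma>}" using assms by (auto simp: bij_betw_def inj_on_def)
    show "h ` {j \<in> V. ws ! h j = \<sigma>} = {i. i < length ws \<and> \<sigma> = ws ! i}"
    proof (intro equalityI subsetI)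
      fix i assume "i \<in> {i. i < length ws \<and> \<sigma> = ws ! i}"
      moreover from this have "i \<in> h ` V" using assms by (simp add: bij_betw_def)
      ultimately show "i \<in> h ` {j \<in> V. ws ! h j = \<sigma>}" by auto
    next
      fix i assume "i \<in> h ` {j \<in> V. ws ! h j = \<sigma>}"
      then obtain j where "j \<in> V" "ws ! h j = \<sigma>" "i = h j" by auto
      then show "i \<in> {i. i < length ws \<and> \<sigma> = ws ! i}" using bij_betwE[OF assms] by auto
    qed
  qed
  then show ?thesis unfolding count_list_eq_length_filter length_filter_conv_card by (rule bij_betw_same_card)
qed

section \<open>Multinomial counting of degree vectors\<close>

text \<open>The degree vectors with a prescribed empirical measure. Values from \<open>n\<close> on
  are set to 0 so that a vector is determined by the nodes and is bounded everywhere.\<close>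

definition typed_degrees :: "nat \<Rightarrow> (nat \<Rightarrow> 'b) \<Rightarrow> ('b \<Rightarrow> nat) set \<Rightarrow> ('b \<Rightarrow> ('b \<Rightarrow> nat) \<Rightarrow> nat) \<Rightarrow> (nat \<Rightarrow> 'b \<Rightarrow> nat) set" where
  "typed_degrees n t S k = {d. (\<forall>j\<ge>n. d j = (\<lambda>_. 0)) \<and> (\<forall>j<n. d j \<in> S) \<and>
     (\<forall>a. \<forall>\<sigma>\<in>S. card {j \<in> nodes_of n t a. d j = \<sigma>} = k a \<sigma>)}"

lemma finite_typed_degrees:
  assumes "finite S"
  shows "finite (typed_degrees n t S k)"
proof -
  have "inj_on (\<lambda>d. restrict d {..<n}) (typed_degrees n t S k)"
  proof (intro inj_onI, rule ext)
    fix d d' j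
    assume d: "d \<in> typed_degrees n t S k" "d' \<in> typed_degrees n t S k" "restrict d {..<n} = restrict d' {..<n}"
    show "d j = d' j"
      using d(1,2) fun_cong[OF d(3), of j] by (cases "j < n") (auto simp: typed_degrees_def)
  qed
  moreover have "(\<lambda>d. restrict d {..<n}) ` typed_degrees n t S k \<subseteq> PiE {..<n} (\<lambda>_. S)"
    by (auto simp: typed_degrees_def)
  ultimately show ?thesis using assms by (meson finite_PiE finite_imageD finite_lessThan finite_subset)
qed

text \<open>Numbering the nodes of each type turns a family of words with prescribed counts into a
  degree vector, injectively; the words of each type are counted by a multinomial
  coefficient.\<close>

lemma card_typed_degrees:
  fixes t :: "nat \<Rightarrow> 'b::finite"
  assumes S: "finite S" and k: "\<And>a. (\<Sum>\<sigma>\<in>S. k a \<sigma>) = card (nodes_of n t a)"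
  shows "(\<Prod>a\<in>UNIV. fact (card (nodes_of n t a))) \<le>
    card (typed_degrees n t S k) * (\<Prod>a\<in>UNIV. \<Prod>\<sigma>\<in>S. fact (k a \<sigma>))"
proof -
  let ?L = "\<lambda>a. {ws. set ws \<subseteq> S \<and> (\<forall>\<sigma>\<in>S. count_list ws \<sigma> = k a \<sigma>)}"
  have finL: "finite (?L a)" for a unfolding lists_with_counts_eq[OF S] by simp
  have len: "length ws = card (nodes_of n t a)" if "ws \<in> ?L a" for ws a
    using that sum_count_set[of ws S] S k[of a] by simp
  have "\<forall>a. \<exists>h. bij_betw h (nodes_of n t a) {0..<card (nodes_of n t a)}"
    by (intro allI ex_bij_betw_finite_nat finite_nodes_of)
  then obtain h where h: "\<And>a. bij_betw (h a) (nodes_of n t a) {..<card (nodes_of n t a)}"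
    unfolding atLeast0LessThan by metis
  define \<Phi> where "\<Phi> W j = (if j < n then W (t j) ! h (t j) j else (\<lambda>_. 0))" for W :: "'b \<Rightarrow> ('b \<Rightarrow> nat) list" and j
  have "card (PiE UNIV ?L) \<le> card (typed_degrees n t S k)"
  proof (rule card_inj_on_le[where f = \<Phi>])
    show "\<Phi> ` PiE UNIV ?L \<subseteq> typed_degrees n t S k"
    proof (rule image_subsetI)
      fix W assume W: "W \<in> PiE UNIV ?L"
      then have Wa: "W a \<in> ?L a" for a by blast
      have hl: "h (t j) j < length (W (t j))" if "j < n" for j
        using bij_betwE[OF h[of "t j"]] that len[OF Wa] by (auto simp: nodes_of_def)
      have "\<Phi> W j \<in> S" if "j < n" for j
        using Wa[of "t j"] hl[OF that] nth_mem[OF hl[OF that]] that by (auto simp: \<Phi>_def)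
      moreover have "card {j \<in> nodes_of n t a. \<Phi> W j = \<sigma>} = k a \<sigma>" if "\<sigma> \<in> S" for a \<sigma>
      proof -
        have "{j \<in> nodes_of n t a. \<Phi> W j = \<sigma>} = {j \<in> nodes_of n t a. W a ! h a j = \<sigma>}"
          by (auto simp: \<Phi>_def nodes_of_def)
        then show ?thesis using nth_count[of "h a" "nodes_of n t a" "W a" \<sigma>] h[of a] len[OF Wa] Wa[of a] that by simp
      qed
      ultimately show "\<Phi> W \<in> typed_degrees n t S k" by (auto simp: typed_degrees_def \<Phi>_def)
    qed
    show "inj_on \<Phi> (PiE UNIV ?L)"
    proof (intro inj_onI ext)
      fix W W' a assume W: "W \<in> PiE UNIV ?L" "W' \<in> PiE UNIV ?L" and eq: "\<Phi> W = \<Phi> W'"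
      have Wa: "W a \<in> ?L a" "W' a \<in> ?L a" using W by blast+
      show "W a = W' a"
      proof (rule nth_equalityI)
        show "length (W a) = length (W' a)" by (simp only: len[OF Wa(1)] len[OF Wa(2)])
        fix i assume "i < length (W a)"
        then have "i \<in> h a ` nodes_of n t a" using h[of a] len[OF Wa(1)] by (auto simp: bij_betw_def)
        then obtain j where "j \<in> nodes_of n t a" "i = h a j" by blast
        then show "W a ! i = W' a ! i" using fun_cong[OF eq, of j] by (auto simp: \<Phi>_def nodes_of_def)
      qed
    qed
    show "finite (typed_degrees n t S k)" by (rule finite_typed_degrees[OF S])
  qed
  then have "(\<Prod>a\<in>UNIV. card (?L a)) \<le> card (typed_degrees n t S k)" by (simp add: card_PiE)
  then have "(\<Prod>a\<in>UNIV. card (?L a)) * (\<Prod>a\<in>UNIV. \<Prod>\<sigma>\<in>S. fact (k a \<sigma>)) \<le>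
      card (typed_degrees n t S k) * (\<Prod>a\<in>UNIV. \<Prod>\<sigma>\<in>S. fact (k a \<sigma>))" by (rule mult_le_mono1)
  moreover have "(\<Prod>a\<in>UNIV. card (?L a)) * (\<Prod>a\<in>UNIV. \<Prod>\<sigma>\<in>S. fact (k a \<sigma>)) = (\<Prod>a\<in>UNIV. fact (card (nodes_of n t a)))"
    unfolding prod.distrib[symmetric] using card_lists_with_counts[OF S] k by simp
  ultimately show ?thesis by simp
qed

text \<open>One factor of a multinomial coefficient times a Poisson weight; its exponential rate is
  the corresponding summand of the entropy.\<close>

lemma multinomial_factor_ge:
  fixes k N :: "nat \<Rightarrow> nat"
  assumes k: "(\<lambda>n. real (k n) / real n) \<longlonglongrightarrow> \<kappa>" and N: "(\<lambda>n. real (N n) / real n) \<longlonglongrightarrow> r"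
    and r: "r > 0" and q: "q \<ge> 0" and kN: "\<And>n. k n \<le> N n" and \<kappa>: "\<kappa> \<ge> 0"
    and q0: "q = 0 \<Longrightarrow> \<kappa> = 0 \<and> (\<forall>n. k n = 0)" and \<epsilon>: "\<epsilon> > 0"
  shows "\<forall>\<^sub>F n in sequentially. exp (- real n * (\<kappa> * ln (\<kappa> / (r * q)) + \<epsilon>)) * fact (k n) \<le>
    (real (N n) / exp 1) ^ k n * q ^ k n"
proof -
  have corr: "\<forall>\<^sub>F n in sequentially. exp 1 * (real (k n) + 1) \<le> exp (\<epsilon> / 2 * real n)"
  proof -
    have "\<forall>\<^sub>F n in sequentially. real (k n) / real n < \<kappa> + 1" by (rule order_tendstoD(2)[OF k]) simp
    moreover have "\<forall>\<^sub>F n in sequentially. exp 1 * ((\<kappa> + 1) * real n + 1) \<le> exp (\<epsilon> / 2 * real n)"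
      using \<kappa> \<epsilon> by real_asymp
    ultimately show ?thesis using eventually_gt_at_top[of 0]
    proof eventually_elim
      case (elim n)
      then have "real (k n) \<le> (\<kappa> + 1) * real n" by (simp add: pos_divide_less_eq)
      then have "exp 1 * (real (k n) + 1) \<le> exp 1 * ((\<kappa> + 1) * real n + 1)" by simp
      then show ?case using elim by linarith
    qed
  qed
  \<comment> \<open>Half of \<open>\<epsilon>\<close> absorbs the polynomial prefactor of Stirling's
    bound for \<open>fact (k n)\<close>.\<close>
  have reduce: "exp (- real n * (\<kappa> * ln (\<kappa> / (r * q)) + \<epsilon>)) * fact (k n) \<le> (real (N n) / exp 1) ^ k n * q ^ k n"
    if main: "exp (- real n * (\<kappa> * ln (\<kappa> / (r * q)) + \<epsilon> / 2)) * real (k n) ^ k n \<le> (real (N n) * q) ^ k n"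
      and c: "exp 1 * (real (k n) + 1) \<le> exp (\<epsilon> / 2 * real n)" for n
  proof -
    let ?R = "\<kappa> * ln (\<kappa> / (r * q))"
    have "exp (- real n * (?R + \<epsilon>)) * fact (k n) \<le>
        exp (- real n * (?R + \<epsilon>)) * (exp 1 * (real (k n) + 1) * (real (k n) / exp 1) ^ k n)"
      by (intro mult_left_mono fact_le_power_exp) auto
    also have "\<dots> \<le> exp (- real n * (?R + \<epsilon>)) * (exp (\<epsilon> / 2 * real n) * (real (k n) / exp 1) ^ k n)"
      by (intro mult_left_mono mult_right_mono c) auto
    also have "\<dots> = exp (- real n * (?R + \<epsilon> / 2)) * real (k n) ^ k n / exp 1 ^ k n"
    proof -
      have "exp (- real n * (?R + \<epsilon>)) * exp (\<epsilon> / 2 * real n) = exp (- real n * (?R + \<epsilon> / 2))"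
        unfolding exp_add[symmetric] by (rule arg_cong[where f = exp]) (simp add: algebra_simps)
      then show ?thesis by (simp add: power_divide mult.assoc[symmetric])
    qed
    also have "\<dots> \<le> (real (N n) * q) ^ k n / exp 1 ^ k n" by (intro divide_right_mono main) auto
    also have "\<dots> = (real (N n) / exp 1) ^ k n * q ^ k n" by (simp add: power_divide power_mult_distrib)
    finally show ?thesis .
  qed
  have "\<forall>\<^sub>F n in sequentially. exp (- real n * (\<kappa> * ln (\<kappa> / (r * q)) + \<epsilon> / 2)) * real (k n) ^ k n \<le> (real (N n) * q) ^ k n"
  proof (cases "\<kappa> = 0")
    \<comment> \<open>The logarithm is singular in this case. For \<open>q > 0\<close> the estimates
      \<open>k n \<le> N n\<close> and \<open>q ^ k n = exp (o(n))\<close> suffice; for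
      \<open>q = 0\<close> all \<open>k n\<close> vanish.\<close>
    case True
    show ?thesis
    proof (cases "q = 0")
      case True
      then show ?thesis using q0 \<epsilon> by simp
    next
      case False
      then have q: "q > 0" using q by simp
      have "(\<lambda>n. (real (k n) / real n) * ln q) \<longlonglongrightarrow> 0 * ln q" using k \<open>\<kappa> = 0\<close> by (intro tendsto_intros) simp
      then have "\<forall>\<^sub>F n in sequentially. - \<epsilon> / 2 < (real (k n) / real n) * ln q"
        by (rule order_tendstoD) (use \<epsilon> in simp)
      then show ?thesis using eventually_gt_at_top[of 0]
      proof eventually_elim
        case (elim n)
        then have "(- \<epsilon> / 2) * real n \<le> ((real (k n) / real n) * ln q) * real n"
          by (intro mult_right_mono) auto
        then have "- real n * (\<epsilon> / 2) \<le> real (k n) * ln q" using elim by (simp add: mult.commute)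
        then have "exp (- real n * (\<epsilon> / 2)) \<le> q ^ k n" using q by (simp add: powr_realpow[symmetric] powr_def)
        then have "exp (- real n * (\<epsilon> / 2)) * real (k n) ^ k n \<le> q ^ k n * real (N n) ^ k n"
          using kN[of n] q by (intro mult_mono power_mono) auto
        then show ?case using True by (simp add: power_mult_distrib mult.commute)
      qed
    qed
  next
    case False
    then have \<kappa>: "\<kappa> > 0" using \<kappa> by simp
    then have q: "q > 0" using q q0 by (cases "q = 0") auto
    let ?g = "\<lambda>n. (real (k n) / real n) * ln ((real (N n) / real n) * q / (real (k n) / real n))"
    have "?g \<longlonglongrightarrow> \<kappa> * ln (r * q / \<kappa>)"
      by (intro tendsto_intros k N) (use \<kappa> r q in auto)
    moreover have "ln (r * q / \<kappa>) = - ln (\<kappa> / (r * q))" using \<kappa> r q by (simp add: ln_div)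
    ultimately have "?g \<longlonglongrightarrow> - (\<kappa> * ln (\<kappa> / (r * q)))" by simp
    then have "\<forall>\<^sub>F n in sequentially. - (\<kappa> * ln (\<kappa> / (r * q))) - \<epsilon> / 2 < ?g n"
      by (rule order_tendstoD) (use \<epsilon> in simp)
    then show ?thesis
      using order_tendstoD(1)[OF k \<kappa>] order_tendstoD(1)[OF N r] eventually_gt_at_top[of 0]
    proof eventually_elim
      case (elim n)
      have n: "real n > 0" using elim by simp
      have kp: "real (k n) > 0" and Np: "real (N n) > 0" using elim n by (auto simp: zero_less_divide_iff)
      have "real n * ?g n = real (k n) * ln (real (N n) * q / real (k n))" using n by simp
      moreover have "real n * (- (\<kappa> * ln (\<kappa> / (r * q))) - \<epsilon> / 2) \<le> real n * ?g n"
        using elim n by (intro mult_left_mono) auto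
      ultimately have "- real n * (\<kappa> * ln (\<kappa> / (r * q)) + \<epsilon> / 2) \<le> real (k n) * ln (real (N n) * q / real (k n))"
        by (simp add: algebra_simps)
      then have "exp (- real n * (\<kappa> * ln (\<kappa> / (r * q)) + \<epsilon> / 2)) \<le> exp (real (k n) * ln (real (N n) * q / real (k n)))"
        by (simp only: exp_le_cancel_iff)
      also have "\<dots> = (real (N n) * q / real (k n)) ^ k n"
        using kp Np q by (simp add: exp_of_nat_mult)
      finally have "exp (- real n * (\<kappa> * ln (\<kappa> / (r * q)) + \<epsilon> / 2)) * real (k n) ^ k n \<le>
          (real (N n) * q / real (k n)) ^ k n * real (k n) ^ k n" by (intro mult_right_mono) auto
      also have "\<dots> = (real (N n) * q) ^ k n" using kp by (simp add: power_mult_distrib[symmetric])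
      finally show ?case .
    qed
  qed
  then show ?thesis using corr by eventually_elim (rule reduce)
qed

section \<open>Exhaustion by boxes, rounding and perturbation\<close>

lemma boxes_iff: "\<sigma> \<in> boxes K \<longleftrightarrow> (\<forall>b. \<sigma> b \<le> K)"
  by (auto simp: PiE_iff)

text \<open>The boxes are cofinal among the finite sets, so unconditional sums can be computed along
  them.\<close>

lemma filterlim_boxes: "filterlim (\<lambda>K. (UNIV :: 'b::finite set) \<times> (boxes K :: ('b \<Rightarrow> nat) set)) (finite_subsets_at_top UNIV) sequentially"
  unfolding filterlim_finite_subsets_at_top
proof (intro allI impI)
  fix X :: "('b \<times> ('b \<Rightarrow> nat)) set" assume X: "finite X \<and> X \<subseteq> UNIV"
  define K where "K = Max (insert 0 ((\<lambda>(x, b). snd x b) ` (X \<times> UNIV)))"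
  have K: "snd x b \<le> K" if "x \<in> X" for x b
    unfolding K_def using X that by (intro Max_ge) (auto intro!: image_eqI[of _ _ "(x, b)"])
  have "x \<in> UNIV \<times> boxes k" if "K \<le> k" "x \<in> X" for k x
  proof -
    have "snd x b \<le> k" for b using K[OF that(2)] that(1) by (rule order_trans)
    then show ?thesis by (cases x) (simp add: boxes_iff)
  qed
  then have "X \<subseteq> UNIV \<times> boxes k" if "K \<le> k" for k using that by blast
  then show "\<forall>\<^sub>F k in sequentially. finite (UNIV \<times> boxes k :: ('b \<times> ('b \<Rightarrow> nat)) set) \<and> X \<subseteq> UNIV \<times> boxes k \<and>
      (UNIV \<times> boxes k :: ('b \<times> ('b \<Rightarrow> nat)) set) \<subseteq> UNIV"
    by (intro eventually_sequentiallyI[of K]) simp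
qed

lemma eventually_subset_boxes:
  fixes X :: "('b::finite \<times> ('b \<Rightarrow> nat)) set"
  assumes "finite X"
  shows "\<forall>\<^sub>F K in sequentially. X \<subseteq> UNIV \<times> boxes K"
proof -
  have "\<forall>\<^sub>F K in sequentially. finite (UNIV \<times> boxes K :: ('b \<times> ('b \<Rightarrow> nat)) set) \<and> X \<subseteq> UNIV \<times> boxes K \<and>
      (UNIV \<times> boxes K :: ('b \<times> ('b \<Rightarrow> nat)) set) \<subseteq> UNIV"
    using filterlim_boxes[where 'b = 'b] assms unfolding filterlim_finite_subsets_at_top by (elim allE[of _ X]) simp
  then show ?thesis by eventually_elim simp
qed

lemma prob_boxes_tendsto:
  fixes l :: "('b::finite \<times> ('b \<Rightarrow> nat)) pmf"
  shows "(\<lambda>K. measure_pmf.prob l ((UNIV \<times> boxes K) \<inter> S)) \<longlonglongrightarrow> measure_pmf.prob l S"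
proof -
  have "(\<lambda>K. measure_pmf.prob l ((UNIV \<times> boxes K) \<inter> S)) \<longlonglongrightarrow> measure_pmf.prob l (\<Union>K. (UNIV \<times> boxes K) \<inter> S)"
    by (rule measure_pmf.finite_Lim_measure_incseq) (auto simp: incseq_def boxes_iff intro: order_trans)
  moreover have "(\<Union>K. (UNIV \<times> boxes K) \<inter> S) = S"
  proof (intro equalityI subsetI)
    fix x assume x: "x \<in> S"
    have "\<forall>\<^sub>F K in sequentially. {x} \<subseteq> UNIV \<times> boxes K" by (rule eventually_subset_boxes) simp
    then obtain K where "{x} \<subseteq> UNIV \<times> boxes K" using eventually_happens'[OF sequentially_bot] by blast
    then show "x \<in> (\<Union>K. (UNIV \<times> boxes K) \<inter> S)" using x by blast
  qed auto
  ultimately show ?thesis by simp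
qed

lemma sum_pair_boxes: "(\<Sum>x\<in>UNIV \<times> boxes K. f x) = (\<Sum>a\<in>(UNIV :: 'b::finite set). \<Sum>\<sigma>\<in>boxes K. f (a, \<sigma>))"
  by (simp add: sum.cartesian_product)

text \<open>Everything but \<open>s0\<close> is rounded down and \<open>s0\<close> takes the
  remainder. Later \<open>s0\<close> is the empty neighbourhood, whose reference weight is positive;
  so entries of reference weight 0 keep count 0 exactly.\<close>

lemma rounding:
  fixes N :: "nat \<Rightarrow> nat" and \<kappa> :: "'s \<Rightarrow> real"
  assumes S: "finite S" "s0 \<in> S" and \<kappa>: "\<And>s. s \<in> S \<Longrightarrow> 0 \<le> \<kappa> s" "(\<Sum>s\<in>S. \<kappa> s) = r" and r: "r > 0"
    and N: "(\<lambda>n. real (N n) / real n) \<longlonglongrightarrow> r"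
  shows "\<exists>k. (\<forall>n. (\<Sum>s\<in>S. k n s) = N n) \<and> (\<forall>s\<in>S. (\<lambda>n. real (k n s) / real n) \<longlonglongrightarrow> \<kappa> s) \<and>
    (\<forall>n. \<forall>s\<in>S - {s0}. \<kappa> s = 0 \<longrightarrow> k n s = 0)"
proof -
  define f where "f n s = nat \<lfloor>real (N n) * (\<kappa> s / r)\<rfloor>" for n s
  define k where "k n s = (if s = s0 then N n - (\<Sum>s\<in>S - {s0}. f n s) else f n s)" for n s
  have f: "real (N n) * (\<kappa> s / r) - 1 \<le> real (f n s)" "real (f n s) \<le> real (N n) * (\<kappa> s / r)" if "s \<in> S" for n s
    unfolding f_def using \<kappa>(1)[OF that] r by (auto intro!: nat_floor_bounds)
  have \<kappa>S: "(\<Sum>s\<in>S - {s0}. \<kappa> s) = r - \<kappa> s0" using S \<kappa>(2) sum.remove[OF S, of \<kappa>] by simp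
  have le: "(\<Sum>s\<in>S - {s0}. f n s) \<le> N n" for n
  proof -
    have "real (\<Sum>s\<in>S - {s0}. f n s) \<le> (\<Sum>s\<in>S - {s0}. real (N n) * (\<kappa> s / r))"
      unfolding of_nat_sum by (intro sum_mono f(2)) auto
    also have "\<dots> = real (N n) * ((r - \<kappa> s0) / r)"
      unfolding \<kappa>S[symmetric] by (simp add: sum_distrib_left sum_divide_distrib)
    also have "\<dots> \<le> real (N n) * 1" using \<kappa>(1)[OF S(2)] r by (intro mult_left_mono) auto
    finally show ?thesis by linarith
  qed
  have lim_f: "(\<lambda>n. real (f n s) / real n) \<longlonglongrightarrow> \<kappa> s" if s: "s \<in> S" for s
  proof (rule tendsto_sandwich)
    show "\<forall>\<^sub>F n in sequentially. real (N n) / real n * (\<kappa> s / r) - 1 / real n \<le> real (f n s) / real n"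
    proof (intro always_eventually allI)
      fix n
      have "(real (N n) * (\<kappa> s / r) - 1) / real n \<le> real (f n s) / real n" using f(1)[OF s] by (intro divide_right_mono) auto
      then show "real (N n) / real n * (\<kappa> s / r) - 1 / real n \<le> real (f n s) / real n"
        by (simp add: diff_divide_distrib mult.commute)
    qed
    show "\<forall>\<^sub>F n in sequentially. real (f n s) / real n \<le> real (N n) / real n * (\<kappa> s / r)"
    proof (intro always_eventually allI)
      fix n
      have "real (f n s) / real n \<le> (real (N n) * (\<kappa> s / r)) / real n" using f(2)[OF s] by (intro divide_right_mono) auto
      then show "real (f n s) / real n \<le> real (N n) / real n * (\<kappa> s / r)" by (simp add: mult.commute)
    qed
    have "(\<lambda>n. real (N n) / real n * (\<kappa> s / r) - 1 / real n) \<longlonglongrightarrow> r * (\<kappa> s / r) - 0"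
      by (intro tendsto_intros N)
    then show "(\<lambda>n. real (N n) / real n * (\<kappa> s / r) - 1 / real n) \<longlonglongrightarrow> \<kappa> s" using r by simp
    have "(\<lambda>n. real (N n) / real n * (\<kappa> s / r)) \<longlonglongrightarrow> r * (\<kappa> s / r)" by (intro tendsto_intros N)
    then show "(\<lambda>n. real (N n) / real n * (\<kappa> s / r)) \<longlonglongrightarrow> \<kappa> s" using r by simp
  qed
  have "(\<Sum>s\<in>S. k n s) = N n" for n
    using le[of n] sum.remove[OF S, of "k n"] by (simp add: k_def)
  moreover have "(\<lambda>n. real (k n s) / real n) \<longlonglongrightarrow> \<kappa> s" if s: "s \<in> S" for s
  proof (cases "s = s0")
    case True
    have "(\<lambda>n. real (N n) / real n - (\<Sum>s\<in>S - {s0}. real (f n s) / real n)) \<longlonglongrightarrow> r - (\<Sum>s\<in>S - {s0}. \<kappa> s)"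
      by (intro tendsto_intros N lim_f) auto
    moreover have "real (k n s) / real n = real (N n) / real n - (\<Sum>s\<in>S - {s0}. real (f n s) / real n)" for n
      using le[of n] True by (simp add: k_def of_nat_diff diff_divide_distrib sum_divide_distrib)
    ultimately show ?thesis using True by (simp add: \<kappa>S)
  next
    case False
    then show ?thesis using lim_f[OF s] by (simp add: k_def)
  qed
  moreover have "k n s = 0" if "s \<in> S - {s0}" "\<kappa> s = 0" for n s
    using that by (simp add: k_def f_def)
  ultimately show ?thesis by (intro exI[of _ k]) blast
qed

text \<open>The sum is the expected number of events that occur, and this number is at most
  \<open>L\<close> and vanishes off the union.\<close>

lemma sum_prob_le_overlap:
  fixes p :: "'e pmf"
  assumes D: "finite D" and L: "\<And>E. real (card {d \<in> D. E \<in> X d}) \<le> L"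
  shows "(\<Sum>d\<in>D. measure_pmf.prob p (X d)) \<le> L * measure_pmf.prob p (\<Union>d\<in>D. X d)"
proof -
  have int: "integrable p (indicator A :: 'e \<Rightarrow> real)" for A
    by (rule measure_pmf.integrable_const_bound[of _ 1]) auto
  have "(\<Sum>d\<in>D. measure_pmf.prob p (X d)) = measure_pmf.expectation p (\<lambda>E. \<Sum>d\<in>D. indicator (X d) E)"
    using int by (subst Bochner_Integration.integral_sum) auto
  also have "\<dots> \<le> measure_pmf.expectation p (\<lambda>E. L * indicator (\<Union>d\<in>D. X d) E)"
  proof (rule integral_mono)
    show "integrable p (\<lambda>E. \<Sum>d\<in>D. indicator (X d) E :: real)" by (intro Bochner_Integration.integrable_sum int)
    show "integrable p (\<lambda>E. L * indicator (\<Union>d\<in>D. X d) E)" by (intro integrable_mult_right int)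
    fix E
    have "(\<Sum>d\<in>D. indicator (X d) E :: real) = real (card {d \<in> D. E \<in> X d})"
      using D by (simp add: indicator_def sum.inter_filter[symmetric] of_bool_def)
    also have "\<dots> \<le> L * indicator (\<Union>d\<in>D. X d) E"
    proof (cases "E \<in> (\<Union>d\<in>D. X d)")
      case False
      then have "{d \<in> D. E \<in> X d} = {}" by blast
      then show ?thesis using False by (simp only: card.empty) simp
    qed (use L in simp)
    finally show "(\<Sum>d\<in>D. indicator (X d) E :: real) \<le> L * indicator (\<Union>d\<in>D. X d) E" .
  qed
  also have "\<dots> = L * measure_pmf.prob p (\<Union>d\<in>D. X d)" by simp
  finally show ?thesis .
qed

text \<open>Degrees are integers, so a node whose neighbourhood differs contributes at least 1 to
  the distance.\<close>

lemma pmf_empirical_diff_le: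
  fixes t :: "nat \<Rightarrow> 'b::finite"
  assumes n: "1 \<le> n"
  shows "real n * \<bar>pmf (empirical_locality n t d) x - pmf (empirical_locality n t d') x\<bar> \<le>
    (\<Sum>j<n. \<Sum>b\<in>UNIV. \<bar>real (d j b) - real (d' j b)\<bar>)"
proof -
  have e: "real n * pmf (empirical_locality n t d) x = (\<Sum>j<n. of_bool ((t j, d j) = x))" for d
    using n by (simp add: pmf_empirical sum.inter_filter[symmetric] of_bool_def)
  have "real n * \<bar>pmf (empirical_locality n t d) x - pmf (empirical_locality n t d') x\<bar> =
      \<bar>(\<Sum>j<n. of_bool ((t j, d j) = x) - of_bool ((t j, d' j) = x))\<bar>"
    unfolding sum_subtractf e[symmetric] using n by (simp add: abs_mult flip: right_diff_distrib)
  also have "\<dots> \<le> (\<Sum>j<n. \<bar>of_bool ((t j, d j) = x) - of_bool ((t j, d' j) = x)\<bar>)" by (rule sum_abs)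
  also have "\<dots> \<le> (\<Sum>j<n. \<Sum>b\<in>UNIV. \<bar>real (d j b) - real (d' j b)\<bar>)"
  proof (rule sum_mono)
    fix j
    show "\<bar>of_bool ((t j, d j) = x) - of_bool ((t j, d' j) = x)\<bar> \<le> (\<Sum>b\<in>UNIV. \<bar>real (d j b) - real (d' j b)\<bar>)"
    proof (cases "d j = d' j")
      case False
      then obtain b where b: "d j b \<noteq> d' j b" by (auto simp: fun_eq_iff)
      have "\<bar>of_bool ((t j, d j) = x) - of_bool ((t j, d' j) = x)\<bar> \<le> (1 :: real)" by (simp add: of_bool_def)
      also have "\<dots> \<le> \<bar>real (d j b) - real (d' j b)\<bar>" using b by linarith
      also have "\<dots> \<le> (\<Sum>b\<in>UNIV. \<bar>real (d j b) - real (d' j b)\<bar>)" by (rule member_le_sum) auto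
      finally show ?thesis .
    qed (simp add: sum_nonneg)
  qed
  finally show ?thesis .
qed

lemma sum_typed_degrees:
  assumes "finite S" "d \<in> typed_degrees n t S k"
  shows "(\<Sum>j\<in>nodes_of n t a. g (d j)) = (\<Sum>\<sigma>\<in>S. of_nat (k a \<sigma>) * g \<sigma>)"
proof -
  have "(\<Sum>j\<in>nodes_of n t a. g (d j)) = (\<Sum>\<sigma>\<in>S. \<Sum>j\<in>{j \<in> nodes_of n t a. d j = \<sigma>}. g (d j))"
    by (rule sum.group[symmetric]) (use assms in \<open>auto simp: typed_degrees_def nodes_of_def\<close>)
  also have "\<dots> = (\<Sum>\<sigma>\<in>S. of_nat (k a \<sigma>) * g \<sigma>)"
    using assms(2) by (intro sum.cong refl) (simp add: typed_degrees_def)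
  finally show ?thesis .
qed

text \<open>Shows that the Poisson weight is constant on \<open>typed_degrees\<close>, which is why
  cardinality times weight is the quantity to estimate.\<close>

lemma prod_typed_degrees:
  fixes t :: "nat \<Rightarrow> 'b::finite"
  assumes "finite S" "d \<in> typed_degrees n t S k"
  shows "(\<Prod>j<n. f (t j) (d j)) = (\<Prod>a\<in>UNIV. \<Prod>\<sigma>\<in>S. f a \<sigma> ^ k a \<sigma>)"
proof -
  have "(\<Prod>j<n. f (t j) (d j)) = (\<Prod>a\<in>UNIV. \<Prod>j\<in>{j \<in> {..<n}. t j = a}. f (t j) (d j))"
    by (rule prod.group[symmetric]) auto
  also have "\<dots> = (\<Prod>a\<in>UNIV. \<Prod>\<sigma>\<in>S. f a \<sigma> ^ k a \<sigma>)"
  proof (rule prod.cong[OF refl])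
    fix a
    have "(\<Prod>j\<in>{j \<in> {..<n}. t j = a}. f (t j) (d j)) = (\<Prod>j\<in>nodes_of n t a. f a (d j))"
      by (intro prod.cong) (auto simp: nodes_of_def)
    also have "\<dots> = (\<Prod>\<sigma>\<in>S. \<Prod>j\<in>{j \<in> nodes_of n t a. d j = \<sigma>}. f a (d j))"
      by (rule prod.group[symmetric]) (use assms in \<open>auto simp: typed_degrees_def nodes_of_def\<close>)
    also have "\<dots> = (\<Prod>\<sigma>\<in>S. f a \<sigma> ^ k a \<sigma>)"
      using assms(2) by (intro prod.cong refl) (simp add: typed_degrees_def)
    finally show "(\<Prod>j\<in>{j \<in> {..<n}. t j = a}. f (t j) (d j)) = (\<Prod>\<sigma>\<in>S. f a \<sigma> ^ k a \<sigma>)" .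
  qed
  finally show ?thesis .
qed

lemma card_typed_degrees_close_le:
  fixes e :: "nat \<Rightarrow> 'b::finite \<Rightarrow> nat"
  assumes "\<theta> > 0"
  shows "real (card {d \<in> typed_degrees n t (boxes K) k. (\<Sum>j<n. \<Sum>b\<in>UNIV. \<bar>real (e j b) - real (d j b)\<bar>) \<le> s}) \<le>
    exp (\<theta> * s) * ((1 + exp (- \<theta>)) / (1 - exp (- \<theta>))) ^ (n * CARD('b))"
proof -
  let ?P = "{d \<in> PiE {..<n} (\<lambda>_. boxes K). (\<Sum>j<n. \<Sum>b\<in>UNIV. \<bar>real (e j b) - real (d j b)\<bar>) \<le> s}"
  let ?T = "{d \<in> typed_degrees n t (boxes K) k. (\<Sum>j<n. \<Sum>b\<in>UNIV. \<bar>real (e j b) - real (d j b)\<bar>) \<le> s}"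
  have "card ?T \<le> card ?P"
  proof (rule card_inj_on_le[where f = "\<lambda>d. restrict d {..<n}"])
    show "inj_on (\<lambda>d. restrict d {..<n}) ?T"
    proof (intro inj_onI, rule ext)
      fix d d' j
      assume d: "d \<in> ?T" "d' \<in> ?T" "restrict d {..<n} = restrict d' {..<n}"
      show "d j = d' j"
        using d(1,2) fun_cong[OF d(3), of j] by (cases "j < n") (auto simp: typed_degrees_def)
    qed
    show "(\<lambda>d. restrict d {..<n}) ` ?T \<subseteq> ?P"
    proof (rule image_subsetI)
      fix d assume d: "d \<in> ?T"
      then have "restrict d {..<n} \<in> PiE {..<n} (\<lambda>_. boxes K)" by (intro restrict_PiE_iff[THEN iffD2]) (simp add: typed_degrees_def)
      then show "restrict d {..<n} \<in> ?P" using d by simp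
    qed
    have "finite (PiE {..<n} (\<lambda>_. boxes K) :: (nat \<Rightarrow> 'b \<Rightarrow> nat) set)" by (intro finite_PiE) simp_all
    then show "finite ?P" by simp
  qed
  then show ?thesis using card_close_le[OF assms, of n K e s] by linarith
qed

section \<open>Approximation by profiles supported on a box\<close>

context type_sequence
begin

text \<open>The conditional reference weight given the type; the joint weight is
  \<open>pmf \<rho> a * poisson_profile a \<sigma>\<close>.\<close>

definition poisson_profile :: "'b \<Rightarrow> ('b \<Rightarrow> nat) \<Rightarrow> real" where
  "poisson_profile a \<sigma> = (\<Prod>b\<in>UNIV. poisson_weight (\<omega> a b / pmf \<rho> a) (\<sigma> b))"

lemma poisson_profile_nonneg: "0 \<le> poisson_profile a \<sigma>"
  unfolding poisson_profile_def using \<omega>_nonneg by (intro prod_nonneg poisson_weight_nonneg divide_nonneg_nonneg) auto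

lemma poisson_profile_0: "poisson_profile a (\<lambda>_. 0) > 0"
  unfolding poisson_profile_def by (intro prod_pos) (simp add: poisson_weight_def)

lemma poisson_profile_eq_0: "\<omega> a b = 0 \<Longrightarrow> \<sigma> b \<noteq> 0 \<Longrightarrow> poisson_profile a \<sigma> = 0"
  unfolding poisson_profile_def by (rule prod_zero) (auto intro!: bexI[of _ b] simp: poisson_weight_def)

text \<open>The mass outside the box is moved to the empty neighbourhood, which preserves the type marginal
  and does not increase the degrees.\<close>

definition truncated_profile :: "nat \<Rightarrow> ('b \<times> ('b \<Rightarrow> nat)) pmf \<Rightarrow> 'b \<Rightarrow> ('b \<Rightarrow> nat) \<Rightarrow> real" where
  "truncated_profile K l a \<sigma> =
    (if \<sigma> = (\<lambda>_. 0) then pmf \<rho> a - (\<Sum>\<sigma>'\<in>boxes K - {\<lambda>_. 0}. pmf l (a, \<sigma>')) else pmf l (a, \<sigma>))"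

lemma zero_in_boxes: "(\<lambda>_. 0) \<in> boxes K"
  by (simp add: boxes_iff)

lemma sum_boxes_prob: "(\<Sum>\<sigma>\<in>boxes K. pmf l (a, \<sigma>)) = measure_pmf.prob l ((UNIV \<times> boxes K) \<inter> {x. fst x = a})"
proof -
  have eq: "(UNIV \<times> boxes K) \<inter> {x. fst x = a} = Pair a ` boxes K" by auto
  show ?thesis
    unfolding eq by (subst measure_measure_pmf_finite) (simp_all add: sum.reindex inj_on_def)
qed

lemma prob_fst: "H1 l = \<rho> \<Longrightarrow> measure_pmf.prob l {x. fst x = a} = pmf \<rho> a"
  by (auto simp: H1_def pmf_map vimage_def)

lemma sum_truncated_profile: "(\<Sum>\<sigma>\<in>boxes K. truncated_profile K l a \<sigma>) = pmf \<rho> a"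
proof -
  have "(\<Sum>\<sigma>\<in>boxes K. truncated_profile K l a \<sigma>) =
      truncated_profile K l a (\<lambda>_. 0) + (\<Sum>\<sigma>\<in>boxes K - {\<lambda>_. 0}. truncated_profile K l a \<sigma>)"
    by (rule sum.remove) (simp_all add: zero_in_boxes)
  also have "(\<Sum>\<sigma>\<in>boxes K - {\<lambda>_. 0}. truncated_profile K l a \<sigma>) = (\<Sum>\<sigma>\<in>boxes K - {\<lambda>_. 0}. pmf l (a, \<sigma>))"
    by (intro sum.cong) (auto simp: truncated_profile_def)
  finally show ?thesis by (simp add: truncated_profile_def)
qed

lemma truncated_profile_0:
  "truncated_profile K l a (\<lambda>_. 0) = pmf l (a, \<lambda>_. 0) + (pmf \<rho> a - measure_pmf.prob l ((UNIV \<times> boxes K) \<inter> {x. fst x = a}))"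
  using sum.remove[of "boxes K" "\<lambda>_. 0" "\<lambda>\<sigma>. pmf l (a, \<sigma>)"]
  by (simp add: truncated_profile_def sum_boxes_prob[symmetric] zero_in_boxes)

text \<open>The surplus at the empty neighbourhood is the mass outside the box.\<close>

lemma pmf_le_truncated_profile:
  assumes "H1 l = \<rho>"
  shows "pmf l (a, \<sigma>) \<le> truncated_profile K l a \<sigma>"
proof (cases "\<sigma> = (\<lambda>_. 0)")
  case True
  have "measure_pmf.prob l ((UNIV \<times> boxes K) \<inter> {x. fst x = a}) \<le> measure_pmf.prob l {x. fst x = a}"
    by (rule measure_pmf.finite_measure_mono) auto
  then show ?thesis unfolding True truncated_profile_0 prob_fst[OF assms] by simp
qed (simp add: truncated_profile_def)

lemma truncated_profile_tendsto:
  assumes "H1 l = \<rho>"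
  shows "(\<lambda>K. truncated_profile K l a \<sigma>) \<longlonglongrightarrow> pmf l (a, \<sigma>)"
proof (cases "\<sigma> = (\<lambda>_. 0)")
  case True
  have "(\<lambda>K. pmf l (a, \<lambda>_. 0) + (pmf \<rho> a - measure_pmf.prob l ((UNIV \<times> boxes K) \<inter> {x. fst x = a}))) \<longlonglongrightarrow>
      pmf l (a, \<lambda>_. 0) + (pmf \<rho> a - measure_pmf.prob l {x. fst x = a})"
    by (intro tendsto_intros prob_boxes_tendsto)
  then show ?thesis unfolding True truncated_profile_0 prob_fst[OF assms] by simp
qed (simp add: truncated_profile_def)

text \<open>Mass moved to the empty neighbourhood carries no degree, so the means are those of
  \<open>l\<close> restricted to the box, and at most \<open>\<omega>\<close>. For the estimate from
  below a truncation level is fixed first and the box grows afterwards.\<close>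

lemma truncated_profile_mean_tendsto:
  assumes c: "consistent \<omega> l"
  shows "(\<lambda>K. \<Sum>\<sigma>\<in>boxes K. truncated_profile K l a \<sigma> * real (\<sigma> b)) \<longlonglongrightarrow> \<omega> a b"
proof -
  define S where "S k = (\<lambda>(a' :: 'b, \<sigma> :: 'b \<Rightarrow> nat). (a', \<sigma> b)) -` {(a, k)}" for k
  define p where "p K k = measure_pmf.prob l ((UNIV \<times> boxes K) \<inter> S k)" for K k
  have tm: "trunc_mean K l a b = (\<Sum>k\<le>K. real k * measure_pmf.prob l (S k))" for K
    by (simp add: trunc_mean_def pmf_map S_def mult.commute)
  have m: "(\<Sum>\<sigma>\<in>boxes K. truncated_profile K l a \<sigma> * real (\<sigma> b)) = (\<Sum>k\<le>K. real k * p K k)" for K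
  proof -
    have "(\<Sum>k\<le>K. real k * p K k) = (\<Sum>x\<in>UNIV \<times> boxes K. pmf l x * (if fst x = a \<and> snd x b \<in> {..K} then real (snd x b) else 0))"
      unfolding p_def S_def by (rule sum_slices[symmetric]) simp_all
    also have "\<dots> = (\<Sum>a'\<in>UNIV. \<Sum>\<sigma>\<in>boxes K. if a' = a then pmf l (a, \<sigma>) * real (\<sigma> b) else 0)"
      unfolding sum_pair_boxes by (intro sum.cong refl) (auto simp: boxes_iff)
    also have "\<dots> = (\<Sum>a'\<in>UNIV. if a' = a then \<Sum>\<sigma>\<in>boxes K. pmf l (a, \<sigma>) * real (\<sigma> b) else 0)"
      by (intro sum.cong refl) simp
    also have "\<dots> = (\<Sum>\<sigma>\<in>boxes K. pmf l (a, \<sigma>) * real (\<sigma> b))" by simp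
    also have "\<dots> = (\<Sum>\<sigma>\<in>boxes K. truncated_profile K l a \<sigma> * real (\<sigma> b))"
      by (intro sum.cong) (auto simp: truncated_profile_def)
    finally show ?thesis ..
  qed
  have upper: "(\<Sum>k\<le>K. real k * p K k) \<le> \<omega> a b" for K
  proof -
    have "(\<Sum>k\<le>K. real k * p K k) \<le> trunc_mean K l a b"
      unfolding tm p_def by (intro sum_mono mult_left_mono measure_pmf.finite_measure_mono) auto
    also have "\<dots> \<le> \<omega> b a" by (rule trunc_mean_le[OF \<omega>_nonneg c])
    finally show ?thesis by (simp add: \<omega>_commute)
  qed
  show ?thesis unfolding m
  proof (rule order_tendstoI)
    fix y assume "y < \<omega> a b"
    moreover have "(\<lambda>K. trunc_mean K l a b) \<longlonglongrightarrow> \<omega> a b"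
      using c consistent_iff[OF \<omega>_nonneg, where l = l] \<omega>_commute[of a b] by simp
    ultimately have "\<forall>\<^sub>F K in sequentially. y < trunc_mean K l a b" by (rule order_tendstoD(1)[rotated])
    then obtain K1 where "y < trunc_mean K1 l a b" using eventually_happens'[OF sequentially_bot] by blast
    moreover have "(\<lambda>K. \<Sum>k\<le>K1. real k * p K k) \<longlonglongrightarrow> trunc_mean K1 l a b"
      unfolding tm p_def by (intro tendsto_intros prob_boxes_tendsto)
    ultimately have "\<forall>\<^sub>F K in sequentially. y < (\<Sum>k\<le>K1. real k * p K k)" by (rule order_tendstoD(1)[rotated])
    then show "\<forall>\<^sub>F K in sequentially. y < (\<Sum>k\<le>K. real k * p K k)" using eventually_ge_at_top[of K1]
    proof eventually_elim
      case (elim K)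
      have "(\<Sum>k\<le>K1. real k * p K k) \<le> (\<Sum>k\<le>K. real k * p K k)"
        by (rule sum_mono2) (use elim in \<open>auto simp: p_def\<close>)
      then show ?case using elim by simp
    qed
  next
    fix y assume "\<omega> a b < y"
    then show "\<forall>\<^sub>F K in sequentially. (\<Sum>k\<le>K. real k * p K k) < y"
      using upper by (intro always_eventually allI) (rule le_less_trans)
  qed
qed

text \<open>Only the entry at the empty neighbourhood differs from \<open>l\<close>; it converges,
  and its reference weight is positive, so its term converges too. The others are partial sums of an
  unconditionally convergent series.\<close>

lemma truncated_profile_entropy_tendsto:
  assumes H1: "H1 l = \<rho>"
    and v: "((\<lambda>x. kl_term (pmf l x) (pmf (poisson_locality \<omega> \<rho>) x)) has_sum v) UNIV"
  shows "(\<lambda>K. \<Sum>a\<in>UNIV. \<Sum>\<sigma>\<in>boxes K. truncated_profile K l a \<sigma> *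
    ln (truncated_profile K l a \<sigma> / (pmf \<rho> a * poisson_profile a \<sigma>))) \<longlonglongrightarrow> v"
proof -
  let ?q = "poisson_locality \<omega> \<rho>"
  define h where "h a \<sigma> y = y * ln (y / (pmf \<rho> a * poisson_profile a \<sigma>))" for a \<sigma> and y :: real
  have q: "pmf ?q (a, \<sigma>) = pmf \<rho> a * poisson_profile a \<sigma>" for a \<sigma>
    by (simp add: pmf_poisson_locality[OF \<omega>_nonneg] poisson_profile_def)
  have "((\<lambda>x. kl_term (pmf l x) (pmf ?q x) + pmf l x + - pmf ?q x) has_sum v + 1 + - 1) UNIV"
    by (intro has_sum_add v pmf_has_sum has_sum_uminusI)
  then have "((\<lambda>x. h (fst x) (snd x) (pmf l x)) has_sum v) UNIV"
    by (simp add: kl_term_eq h_def q[symmetric])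
  then have "(\<lambda>K. \<Sum>x\<in>UNIV \<times> boxes K. h (fst x) (snd x) (pmf l x)) \<longlonglongrightarrow> v"
    unfolding has_sum_def by (rule filterlim_compose) (rule filterlim_boxes)
  then have main: "(\<lambda>K. \<Sum>a\<in>UNIV. \<Sum>\<sigma>\<in>boxes K. h a \<sigma> (pmf l (a, \<sigma>))) \<longlonglongrightarrow> v"
    by (simp only: sum_pair_boxes fst_conv snd_conv)
  have corr: "(\<lambda>K. \<Sum>a\<in>UNIV. h a (\<lambda>_. 0) (truncated_profile K l a (\<lambda>_. 0)) - h a (\<lambda>_. 0) (pmf l (a, \<lambda>_. 0))) \<longlonglongrightarrow>
      (\<Sum>a\<in>(UNIV :: 'b set). 0)"
  proof (rule tendsto_sum)
    fix a
    have "(\<lambda>K. h a (\<lambda>_. 0) (truncated_profile K l a (\<lambda>_. 0))) \<longlonglongrightarrow> h a (\<lambda>_. 0) (pmf l (a, \<lambda>_. 0))"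
    proof (rule continuous_on_tendsto_compose[where s = "{0..}" and f = "h a (\<lambda>_. 0)"])
      show "continuous_on {0..} (h a (\<lambda>_. 0))"
        unfolding h_def by (intro continuous_on_mult_ln mult_pos_pos pmf_pos poisson_profile_0)
      show "\<forall>\<^sub>F K in sequentially. truncated_profile K l a (\<lambda>_. 0) \<in> {0..}"
        using order_trans[OF pmf_nonneg pmf_le_truncated_profile[OF H1]] by (intro always_eventually) simp
    qed (simp_all add: truncated_profile_tendsto[OF H1])
    then show "(\<lambda>K. h a (\<lambda>_. 0) (truncated_profile K l a (\<lambda>_. 0)) - h a (\<lambda>_. 0) (pmf l (a, \<lambda>_. 0))) \<longlonglongrightarrow> 0"
      by (rule LIM_zero)
  qed
  have "(\<Sum>\<sigma>\<in>boxes K. h a \<sigma> (truncated_profile K l a \<sigma>)) = (\<Sum>\<sigma>\<in>boxes K. h a \<sigma> (pmf l (a, \<sigma>))) +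
      (h a (\<lambda>_. 0) (truncated_profile K l a (\<lambda>_. 0)) - h a (\<lambda>_. 0) (pmf l (a, \<lambda>_. 0)))" for a K
  proof -
    have "(\<Sum>\<sigma>\<in>boxes K - {\<lambda>_. 0}. h a \<sigma> (truncated_profile K l a \<sigma>)) = (\<Sum>\<sigma>\<in>boxes K - {\<lambda>_. 0}. h a \<sigma> (pmf l (a, \<sigma>)))"
      by (intro sum.cong) (auto simp: truncated_profile_def)
    then show ?thesis
      using sum.remove[OF finite_boxes zero_in_boxes, where g = "\<lambda>\<sigma>. h a \<sigma> (truncated_profile K l a \<sigma>)"]
        sum.remove[OF finite_boxes zero_in_boxes, where g = "\<lambda>\<sigma>. h a \<sigma> (pmf l (a, \<sigma>))"] by simp
  qed
  then have "(\<Sum>a\<in>UNIV. \<Sum>\<sigma>\<in>boxes K. h a \<sigma> (truncated_profile K l a \<sigma>)) =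
      (\<Sum>a\<in>UNIV. \<Sum>\<sigma>\<in>boxes K. h a \<sigma> (pmf l (a, \<sigma>))) +
      (\<Sum>a\<in>UNIV. h a (\<lambda>_. 0) (truncated_profile K l a (\<lambda>_. 0)) - h a (\<lambda>_. 0) (pmf l (a, \<lambda>_. 0)))" for K
    by (simp only: sum.distrib)
  then show ?thesis using tendsto_add[OF main corr] by (simp add: h_def)
qed

text \<open>Each requirement holds for all large boxes and there are finitely many of them, so a
  single \<open>K\<close> serves.\<close>

lemma approximating_profile:
  assumes l: "rate_J \<rho> \<omega> l = ereal v" and \<eta>: "\<eta> > 0" and F: "finite F"
  shows "\<exists>K \<kappa>. F \<subseteq> UNIV \<times> boxes K \<and> (\<forall>a \<sigma>. 0 \<le> \<kappa> a \<sigma>) \<and> (\<forall>a. (\<Sum>\<sigma>\<in>boxes K. \<kappa> a \<sigma>) = pmf \<rho> a) \<and>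
    (\<forall>a \<sigma>. poisson_profile a \<sigma> = 0 \<longrightarrow> \<kappa> a \<sigma> = 0) \<and>
    (\<forall>a \<sigma>. (a, \<sigma>) \<in> F \<longrightarrow> \<bar>\<kappa> a \<sigma> - pmf l (a, \<sigma>)\<bar> < \<eta>) \<and>
    (\<forall>a b. \<bar>(\<Sum>\<sigma>\<in>boxes K. \<kappa> a \<sigma> * real (\<sigma> b)) - \<omega> a b\<bar> < \<eta>) \<and>
    (\<Sum>a\<in>UNIV. \<Sum>\<sigma>\<in>boxes K. \<kappa> a \<sigma> * ln (\<kappa> a \<sigma> / (pmf \<rho> a * poisson_profile a \<sigma>))) < v + \<eta>"
proof -
  let ?q = "poisson_locality \<omega> \<rho>"
  have c: "consistent \<omega> l" and H1: "H1 l = \<rho>" and re: "relative_entropy (measure_pmf l) (measure_pmf ?q) = ereal v"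
    using l unfolding rate_J_eq[OF \<omega>_nonneg] by (auto split: if_splits)
  have ac: "pmf ?q x = 0 \<Longrightarrow> pmf l x = 0" for x
    using re unfolding relative_entropy_pmf by (simp del: split_paired_All split: if_splits)
  have "(\<lambda>x. kl_term (pmf l x) (pmf ?q x)) summable_on UNIV" "infsum (\<lambda>x. kl_term (pmf l x) (pmf ?q x)) UNIV = v"
    using re unfolding relative_entropy_pmf by (auto split: if_splits)
  then have v: "((\<lambda>x. kl_term (pmf l x) (pmf ?q x)) has_sum v) UNIV" using has_sum_infsum by blast
  have "\<forall>\<^sub>F K in sequentially. \<forall>x\<in>F. \<bar>truncated_profile K l (fst x) (snd x) - pmf l x\<bar> < \<eta>"
    using truncated_profile_tendsto[OF H1] \<eta>
    by (subst eventually_ball_finite_distrib[OF F]) (auto simp: tendsto_iff dist_real_def)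
  moreover have "\<forall>\<^sub>F K in sequentially. \<forall>p\<in>UNIV. \<bar>(\<Sum>\<sigma>\<in>boxes K. truncated_profile K l (fst p) \<sigma> * real (\<sigma> (snd p))) - \<omega> (fst p) (snd p)\<bar> < \<eta>"
    using truncated_profile_mean_tendsto[OF c] \<eta>
    by (subst eventually_ball_finite_distrib) (auto simp: tendsto_iff dist_real_def)
  moreover have "\<forall>\<^sub>F K in sequentially. (\<Sum>a\<in>UNIV. \<Sum>\<sigma>\<in>boxes K. truncated_profile K l a \<sigma> *
    ln (truncated_profile K l a \<sigma> / (pmf \<rho> a * poisson_profile a \<sigma>))) < v + \<eta>"
    by (rule order_tendstoD(2)[OF truncated_profile_entropy_tendsto[OF H1 v]]) (use \<eta> in simp)
  ultimately have "\<forall>\<^sub>F K in sequentially. F \<subseteq> UNIV \<times> boxes K \<and>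
      (\<forall>x\<in>F. \<bar>truncated_profile K l (fst x) (snd x) - pmf l x\<bar> < \<eta>) \<and>
      (\<forall>p\<in>UNIV. \<bar>(\<Sum>\<sigma>\<in>boxes K. truncated_profile K l (fst p) \<sigma> * real (\<sigma> (snd p))) - \<omega> (fst p) (snd p)\<bar> < \<eta>) \<and>
      (\<Sum>a\<in>UNIV. \<Sum>\<sigma>\<in>boxes K. truncated_profile K l a \<sigma> *
        ln (truncated_profile K l a \<sigma> / (pmf \<rho> a * poisson_profile a \<sigma>))) < v + \<eta>"
    using eventually_subset_boxes[OF F] by (intro eventually_conj)
  then obtain K where K: "F \<subseteq> UNIV \<times> boxes K"
      "\<forall>x\<in>F. \<bar>truncated_profile K l (fst x) (snd x) - pmf l x\<bar> < \<eta>"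
      "\<forall>p\<in>UNIV. \<bar>(\<Sum>\<sigma>\<in>boxes K. truncated_profile K l (fst p) \<sigma> * real (\<sigma> (snd p))) - \<omega> (fst p) (snd p)\<bar> < \<eta>"
      "(\<Sum>a\<in>UNIV. \<Sum>\<sigma>\<in>boxes K. truncated_profile K l a \<sigma> *
        ln (truncated_profile K l a \<sigma> / (pmf \<rho> a * poisson_profile a \<sigma>))) < v + \<eta>"
    using eventually_happens'[OF sequentially_bot] by blast
  show ?thesis
  proof (intro exI[of _ K] exI[of _ "truncated_profile K l"] conjI allI impI)
    show "0 \<le> truncated_profile K l a \<sigma>" for a \<sigma>
      using order_trans[OF pmf_nonneg pmf_le_truncated_profile[OF H1]] .
    show "truncated_profile K l a \<sigma> = 0" if 0: "poisson_profile a \<sigma> = 0" for a \<sigma>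
    proof -
      have "\<sigma> \<noteq> (\<lambda>_. 0)" using poisson_profile_0[of a] 0 by auto
      moreover have "pmf ?q (a, \<sigma>) = 0"
        using 0 by (simp add: pmf_poisson_locality[OF \<omega>_nonneg] poisson_profile_def)
      ultimately show ?thesis using ac[of "(a, \<sigma>)"] by (simp add: truncated_profile_def)
    qed
    show "\<bar>truncated_profile K l a \<sigma> - pmf l (a, \<sigma>)\<bar> < \<eta>" if "(a, \<sigma>) \<in> F" for a \<sigma>
      using bspec[OF K(2) that] by simp
    show "\<bar>(\<Sum>\<sigma>\<in>boxes K. truncated_profile K l a \<sigma> * real (\<sigma> b)) - \<omega> a b\<bar> < \<eta>" for a b
      using bspec[OF K(3), of "(a, b)"] by simp
  qed (rule K sum_truncated_profile)+
qed

end

section \<open>Assembling the lower bound\<close>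

lemma overlap_rate_small:
  assumes "0 < \<epsilon>"
  obtains \<theta> :: real where "\<theta> > 0" "C * ln ((1 + exp (- \<theta>)) / (1 - exp (- \<theta>))) < \<epsilon>"
proof -
  have "((\<lambda>\<theta>. C * ln ((1 + exp (- \<theta>)) / (1 - exp (- \<theta>)))) \<longlongrightarrow> C * 0) at_top"
    by (intro tendsto_intros) real_asymp
  then have "\<forall>\<^sub>F \<theta> in at_top. C * ln ((1 + exp (- \<theta>)) / (1 - exp (- \<theta>))) < \<epsilon>"
    by (rule order_tendstoD) (use assms in simp)
  then have "\<forall>\<^sub>F \<theta> in at_top. 0 < \<theta> \<and> C * ln ((1 + exp (- \<theta>)) / (1 - exp (- \<theta>))) < \<epsilon>"
    by (intro eventually_conj eventually_gt_at_top)
  then show ?thesis using that eventually_happens'[OF trivial_limit_at_top_linorder] by blast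
qed

text \<open>The counts of a type add up to its class size, so the Stirling bound for the factorial
  of the class size splits into one factor for each neighbourhood, to be estimated by
  \<open>R\<close>.\<close>

lemma typed_degrees_weight_ge:
  fixes t :: "nat \<Rightarrow> 'b::finite" and q :: "'b \<Rightarrow> ('b \<Rightarrow> nat) \<Rightarrow> real"
  assumes S: "finite S" and k: "\<And>a. (\<Sum>\<sigma>\<in>S. k a \<sigma>) = card (nodes_of n t a)" and q: "\<And>a \<sigma>. 0 \<le> q a \<sigma>"
    and R: "\<And>a \<sigma>. \<sigma> \<in> S \<Longrightarrow> exp (- real n * (R a \<sigma> + \<epsilon>)) * fact (k a \<sigma>) \<le> (real (card (nodes_of n t a)) / exp 1) ^ k a \<sigma> * q a \<sigma> ^ k a \<sigma>"
  shows "exp (- real n * (\<Sum>a\<in>UNIV. \<Sum>\<sigma>\<in>S. R a \<sigma> + \<epsilon>)) \<le>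
    real (card (typed_degrees n t S k)) * (\<Prod>a\<in>UNIV. \<Prod>\<sigma>\<in>S. q a \<sigma> ^ k a \<sigma>)"
proof -
  let ?N = "\<lambda>a. card (nodes_of n t a)"
  let ?f = "(\<Prod>a\<in>UNIV. \<Prod>\<sigma>\<in>S. fact (k a \<sigma>)) :: real"
  let ?Q = "\<Prod>a\<in>UNIV. \<Prod>\<sigma>\<in>S. q a \<sigma> ^ k a \<sigma>"
  have Q: "0 \<le> ?Q" by (intro prod_nonneg zero_le_power q)
  have f: "0 < ?f" by (intro prod_pos) simp
  have "exp (- real n * (\<Sum>a\<in>UNIV. \<Sum>\<sigma>\<in>S. R a \<sigma> + \<epsilon>)) * ?f =
      (\<Prod>a\<in>UNIV. \<Prod>\<sigma>\<in>S. exp (- real n * (R a \<sigma> + \<epsilon>)) * fact (k a \<sigma>))"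
    using S by (simp only: prod.distrib sum_distrib_left exp_sum finite)
  also have "\<dots> \<le> (\<Prod>a\<in>UNIV. \<Prod>\<sigma>\<in>S. (real (?N a) / exp 1) ^ k a \<sigma> * q a \<sigma> ^ k a \<sigma>)"
    by (intro prod_mono conjI R prod_nonneg mult_nonneg_nonneg) auto
  also have "\<dots> = (\<Prod>a\<in>UNIV. \<Prod>\<sigma>\<in>S. (real (?N a) / exp 1) ^ k a \<sigma>) * ?Q"
    by (simp only: prod.distrib)
  also have "(\<Prod>a\<in>UNIV. \<Prod>\<sigma>\<in>S. (real (?N a) / exp 1) ^ k a \<sigma>) = (\<Prod>a\<in>UNIV. (real (?N a) / exp 1) ^ ?N a)"
    by (simp only: power_sum[symmetric] k)
  also have "\<dots> * ?Q \<le> (\<Prod>a\<in>UNIV. fact (?N a)) * ?Q"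
    by (intro mult_right_mono Q prod_mono conjI power_le_fact_exp) simp
  also have "\<dots> \<le> (real (card (typed_degrees n t S k)) * ?f) * ?Q"
  proof (intro mult_right_mono Q)
    have "real (\<Prod>a\<in>UNIV. fact (?N a)) \<le> real (card (typed_degrees n t S k) * (\<Prod>a\<in>UNIV. \<Prod>\<sigma>\<in>S. fact (k a \<sigma>)))"
      unfolding of_nat_le_iff by (rule card_typed_degrees[OF S k])
    then show "(\<Prod>a\<in>UNIV. fact (?N a)) \<le> real (card (typed_degrees n t S k)) * ?f" by simp
  qed
  finally have "exp (- real n * (\<Sum>a\<in>UNIV. \<Sum>\<sigma>\<in>S. R a \<sigma> + \<epsilon>)) * ?f \<le> (real (card (typed_degrees n t S k)) * ?Q) * ?f"
    by (simp only: ac_simps)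
  then show ?thesis using f by (simp only: mult_le_cancel_right_pos)
qed

context type_sequence
begin

text \<open>Every neighbourhood has at least the weight of its centre, and no edge set is close to
  more centres than the overlap bound allows; summing over the centres loses only that
  factor.\<close>

lemma near_union_probability:
  assumes near: "\<And>d. d \<in> typed_degrees n t (boxes K) k \<Longrightarrow>
      exp (- \<epsilon> * real n) * (\<Prod>j<n. \<Prod>b\<in>UNIV. limit_weight t d (j, b)) \<le>
      measure_pmf.prob p {E. (\<Sum>j<n. \<Sum>b\<in>UNIV. \<bar>real (degree_vector n t E j b) - real (d j b)\<bar>) \<le> \<epsilon> * real n}"
    and \<theta>: "\<theta> > 0"
  shows "real (card (typed_degrees n t (boxes K) k)) * (\<Prod>a\<in>UNIV. \<Prod>\<sigma>\<in>boxes K. poisson_profile a \<sigma> ^ k a \<sigma>) \<le>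
    exp (real n * (\<epsilon> + \<theta> * \<epsilon> + real CARD('b) * ln ((1 + exp (- \<theta>)) / (1 - exp (- \<theta>))))) *
    measure_pmf.prob p (\<Union>d\<in>typed_degrees n t (boxes K) k.
      {E. (\<Sum>j<n. \<Sum>b\<in>UNIV. \<bar>real (degree_vector n t E j b) - real (d j b)\<bar>) \<le> \<epsilon> * real n})"
proof -
  let ?D = "typed_degrees n t (boxes K) k"
  let ?X = "\<lambda>d. {E. (\<Sum>j<n. \<Sum>b\<in>UNIV. \<bar>real (degree_vector n t E j b) - real (d j b)\<bar>) \<le> \<epsilon> * real n}"
  let ?W = "\<Prod>a\<in>UNIV. \<Prod>\<sigma>\<in>boxes K. poisson_profile a \<sigma> ^ k a \<sigma>"
  let ?A = "(1 + exp (- \<theta>)) / (1 - exp (- \<theta>))"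
  have finD: "finite ?D" by (rule finite_typed_degrees) simp
  have "exp (- \<theta>) < 1" using \<theta> by simp
  then have A: "?A > 0" by (intro divide_pos_pos add_pos_pos) auto
  have W: "(\<Prod>j<n. \<Prod>b\<in>UNIV. limit_weight t d (j, b)) = ?W" if "d \<in> ?D" for d
    using prod_typed_degrees[OF finite_boxes that, of poisson_profile] by (simp add: poisson_profile_def)
  have "exp (- \<epsilon> * real n) * (real (card ?D) * ?W) = (\<Sum>d\<in>?D. exp (- \<epsilon> * real n) * ?W)" by simp
  also have "\<dots> \<le> (\<Sum>d\<in>?D. measure_pmf.prob p (?X d))"
  proof (rule sum_mono)
    fix d assume d: "d \<in> ?D"
    show "exp (- \<epsilon> * real n) * ?W \<le> measure_pmf.prob p (?X d)" using near[OF d] unfolding W[OF d] .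
  qed
  also have "\<dots> \<le> (exp (\<theta> * (\<epsilon> * real n)) * ?A ^ (n * CARD('b))) * measure_pmf.prob p (\<Union>d\<in>?D. ?X d)"
    by (rule sum_prob_le_overlap[OF finD]) (simp only: mem_Collect_eq card_typed_degrees_close_le[OF \<theta>])
  also have "?A ^ (n * CARD('b)) = exp (real n * (real CARD('b) * ln ?A))"
  proof -
    have "exp (real (n * CARD('b)) * ln ?A) = ?A ^ (n * CARD('b))" using A by (simp only: exp_of_nat_mult exp_ln)
    then show ?thesis by (simp only: of_nat_mult mult.assoc)
  qed
  finally have "exp (\<epsilon> * real n) * (exp (- \<epsilon> * real n) * (real (card ?D) * ?W)) \<le>
      exp (\<epsilon> * real n) * ((exp (\<theta> * (\<epsilon> * real n)) * exp (real n * (real CARD('b) * ln ?A))) * measure_pmf.prob p (\<Union>d\<in>?D. ?X d))"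
    by (intro mult_left_mono) auto
  moreover have "exp (\<epsilon> * real n) * (exp (- \<epsilon> * real n) * x) = x" for x
    by (simp add: mult.assoc[symmetric] exp_add[symmetric])
  moreover have "exp (\<epsilon> * real n) * ((exp (\<theta> * (\<epsilon> * real n)) * exp (real n * (real CARD('b) * ln ?A))) * x) =
      exp (real n * (\<epsilon> + \<theta> * \<epsilon> + real CARD('b) * ln ?A)) * x" for x
    by (simp only: exp_add distrib_left mult.assoc mult.commute[of "real n"])
  ultimately show ?thesis by (simp only:)
qed

lemma lower_local:
  assumes G: "openin weak_topology G" "l \<in> G" and l: "rate_J \<rho> \<omega> l = ereal v" and \<epsilon>: "\<epsilon> > 0"
  shows "\<forall>\<^sub>F n in sequentially. exp (- real n * (v + \<epsilon>)) \<le>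
    measure (conditional_locality_law TYPE('d::finite) n (\<rho>n n) (\<omega>n n)) G"
proof -
  obtain F \<delta>0 where F: "finite F" "\<delta>0 > 0" and GF: "\<And>p. (\<forall>x\<in>F. \<bar>pmf p x - pmf l x\<bar> < \<delta>0) \<Longrightarrow> p \<in> G"
    using weak_neighbourhood[OF G] by blast
  \<comment> \<open>The choice of \<open>\<theta>\<close> precedes that of the radius
    \<open>\<epsilon>1\<close>, because the overlap involves the product
    \<open>\<theta> * \<epsilon>1\<close>.\<close>
  obtain \<theta> where \<theta>: "\<theta> > 0" "real CARD('b) * ln ((1 + exp (- \<theta>)) / (1 - exp (- \<theta>))) < \<epsilon> / 8"
    using overlap_rate_small[of "\<epsilon> / 8" "real CARD('b)"] \<epsilon> by auto
  define \<epsilon>1 where "\<epsilon>1 = min (\<epsilon> / 8) (min (\<delta>0 / 4) (\<epsilon> / (8 * \<theta>)))"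
  have \<epsilon>1: "\<epsilon>1 > 0" "\<epsilon>1 \<le> \<epsilon> / 8" "\<epsilon>1 \<le> \<delta>0 / 4" "\<theta> * \<epsilon>1 \<le> \<epsilon> / 8"
  proof -
    have "\<theta> * \<epsilon>1 \<le> \<theta> * (\<epsilon> / (8 * \<theta>))" using \<theta>(1) by (intro mult_left_mono) (auto simp: \<epsilon>1_def)
    then show "\<theta> * \<epsilon>1 \<le> \<epsilon> / 8" using \<theta>(1) by simp
  qed (use \<epsilon> F(2) \<theta>(1) in \<open>auto simp: \<epsilon>1_def\<close>)
  obtain \<delta> where \<delta>: "\<delta> > 0" and near: "\<And>\<Delta>. \<forall>\<^sub>F n in sequentially. \<forall>t\<in>arrangements n (\<rho>n n). \<forall>d.
    nearly_balanced \<delta> n t d \<longrightarrow> (\<forall>j b. d j b \<le> \<Delta>) \<longrightarrow>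
    exp (- \<epsilon>1 * real n) * (\<Prod>j<n. \<Prod>b\<in>UNIV. limit_weight t d (j, b)) \<le>
    measure_pmf.prob (edge_law n (\<omega>n n) t)
      {E. (\<Sum>j<n. \<Sum>b\<in>UNIV. \<bar>real (degree_vector n t E j b) - real (d j b)\<bar>) \<le> \<epsilon>1 * real n}"
    using eventually_happens'[OF trivial_limit_at_right_real
      eventually_conj[OF eventually_at_right_less near_probability[OF \<epsilon>1(1)]]] by blast
  \<comment> \<open>The profile has to be accurate to less than \<open>\<delta>\<close>, so that its
    degree vectors are still nearly balanced after rounding.\<close>
  define \<eta> where "\<eta> = min (\<epsilon> / 8) (min (\<delta>0 / 4) (\<delta> / 2))"
  have \<eta>: "\<eta> > 0" "\<eta> \<le> \<epsilon> / 8" "\<eta> \<le> \<delta>0 / 4" "\<eta> < \<delta>" using \<epsilon> F(2) \<delta> by (auto simp: \<eta>_def)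
  from approximating_profile[OF l \<eta>(1) F(1)]
  obtain K \<kappa> where FK: "F \<subseteq> UNIV \<times> boxes K" and "\<forall>a \<sigma>. 0 \<le> \<kappa> a \<sigma>"
    and "\<forall>a. (\<Sum>\<sigma>\<in>boxes K. \<kappa> a \<sigma>) = pmf \<rho> a"
    and "\<forall>a \<sigma>. poisson_profile a \<sigma> = 0 \<longrightarrow> \<kappa> a \<sigma> = 0"
    and "\<forall>a \<sigma>. (a, \<sigma>) \<in> F \<longrightarrow> \<bar>\<kappa> a \<sigma> - pmf l (a, \<sigma>)\<bar> < \<eta>"
    and "\<forall>a b. \<bar>(\<Sum>\<sigma>\<in>boxes K. \<kappa> a \<sigma> * real (\<sigma> b)) - \<omega> a b\<bar> < \<eta>"
    and \<kappa>R: "(\<Sum>a\<in>UNIV. \<Sum>\<sigma>\<in>boxes K. \<kappa> a \<sigma> * ln (\<kappa> a \<sigma> / (pmf \<rho> a * poisson_profile a \<sigma>))) < v + \<eta>"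
    by (elim exE conjE) (rule that; assumption)
  note \<kappa>0 = this(2)[rule_format] and \<kappa>S = this(3)[rule_format] and \<kappa>ac = this(4)[rule_format]
    and \<kappa>l = this(5)[rule_format] and \<kappa>m = this(6)[rule_format]
  let ?R = "\<lambda>a \<sigma>. \<kappa> a \<sigma> * ln (\<kappa> a \<sigma> / (pmf \<rho> a * poisson_profile a \<sigma>))"
  define N where "N a n = nat \<lfloor>real n * pmf (\<rho>n n) a\<rfloor>" for a n
  have N: "real (N a n) = real n * pmf (\<rho>n n) a" if "1 \<le> n" for a n
  proof -
    have "real n * pmf (\<rho>n n) a \<in> \<nat>" using lattice_\<rho>[OF that] by (simp add: lattice_types_def)
    then obtain m where "real n * pmf (\<rho>n n) a = real m" by (auto elim: Nats_cases)
    then show ?thesis by (simp add: N_def)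
  qed
  have limN: "(\<lambda>n. real (N a n) / real n) \<longlonglongrightarrow> pmf \<rho> a" for a
  proof (rule Lim_transform_eventually[OF tendsto_\<rho>])
    show "\<forall>\<^sub>F n in sequentially. pmf (\<rho>n n) a = real (N a n) / real n"
      using eventually_ge_at_top[of 1] by eventually_elim (simp add: N)
  qed
  have "\<forall>a. \<exists>k. (\<forall>n. (\<Sum>s\<in>boxes K. k n s) = N a n) \<and> (\<forall>s\<in>boxes K. (\<lambda>n. real (k n s) / real n) \<longlonglongrightarrow> \<kappa> a s) \<and>
      (\<forall>n. \<forall>s\<in>boxes K - {\<lambda>_. 0}. \<kappa> a s = 0 \<longrightarrow> k n s = 0)"
    by (intro allI rounding[OF _ _ _ _ pmf_pos limN] \<kappa>0 \<kappa>S zero_in_boxes) simp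
  then obtain k where "\<forall>a. (\<forall>n. (\<Sum>s\<in>boxes K. k a n s) = N a n) \<and> (\<forall>s\<in>boxes K. (\<lambda>n. real (k a n s) / real n) \<longlonglongrightarrow> \<kappa> a s) \<and>
      (\<forall>n. \<forall>s\<in>boxes K - {\<lambda>_. 0}. \<kappa> a s = 0 \<longrightarrow> k a n s = 0)"
    unfolding choice_iff by blast
  then have kS: "\<And>a n. (\<Sum>\<sigma>\<in>boxes K. k a n \<sigma>) = N a n"
    and klim: "\<And>a \<sigma>. \<sigma> \<in> boxes K \<Longrightarrow> (\<lambda>n. real (k a n \<sigma>) / real n) \<longlonglongrightarrow> \<kappa> a \<sigma>"
    and k0: "\<And>a n \<sigma>. \<sigma> \<in> boxes K \<Longrightarrow> \<sigma> \<noteq> (\<lambda>_. 0) \<Longrightarrow> \<kappa> a \<sigma> = 0 \<Longrightarrow> k a n \<sigma> = 0"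
    by (simp_all)
  have kac: "k a n \<sigma> = 0" if "\<sigma> \<in> boxes K" "poisson_profile a \<sigma> = 0" for a n \<sigma>
  proof (rule k0[OF that(1)])
    show "\<sigma> \<noteq> (\<lambda>_. 0)" using poisson_profile_0[of a] that(2) by auto
  qed (rule \<kappa>ac[OF that(2)])
  \<comment> \<open>The number of multinomial factors, among which an error of
    \<open>\<epsilon> / 8\<close> is divided.\<close>
  define M where "M = real (CARD('b) * card (boxes K :: ('b \<Rightarrow> nat) set))"
  have M: "M > 0" by (simp add: M_def card_PiE)
  have E1: "\<forall>\<^sub>F n in sequentially. \<forall>x\<in>UNIV \<times> boxes K. exp (- real n * (?R (fst x) (snd x) + \<epsilon> / (8 * M))) * fact (k (fst x) n (snd x)) \<le>
      (real (N (fst x) n) / exp 1) ^ k (fst x) n (snd x) * poisson_profile (fst x) (snd x) ^ k (fst x) n (snd x)"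
  proof (subst eventually_ball_finite_distrib, simp, rule ballI)
    fix x :: "'b \<times> ('b \<Rightarrow> nat)" assume x: "x \<in> UNIV \<times> boxes K"
    then have xK: "snd x \<in> boxes K" by auto
    show "\<forall>\<^sub>F n in sequentially. exp (- real n * (?R (fst x) (snd x) + \<epsilon> / (8 * M))) * fact (k (fst x) n (snd x)) \<le>
      (real (N (fst x) n) / exp 1) ^ k (fst x) n (snd x) * poisson_profile (fst x) (snd x) ^ k (fst x) n (snd x)"
    proof (rule multinomial_factor_ge[OF klim[OF xK] limN pmf_pos poisson_profile_nonneg])
      show "k (fst x) n (snd x) \<le> N (fst x) n" for n
        unfolding kS[symmetric] by (rule member_le_sum) (use xK in simp_all)
      show "\<kappa> (fst x) (snd x) = 0 \<and> (\<forall>n. k (fst x) n (snd x) = 0)" if "poisson_profile (fst x) (snd x) = 0"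
        using \<kappa>ac[OF that] kac[OF xK that] by simp
    qed (use \<epsilon> M \<kappa>0 in simp_all)
  qed
  have E2: "\<forall>\<^sub>F n in sequentially. \<forall>p\<in>UNIV. \<bar>(\<Sum>\<sigma>\<in>boxes K. real (k (fst p) n \<sigma>) / real n * real (\<sigma> (snd p))) - \<omega> (fst p) (snd p)\<bar> < \<delta>"
  proof (subst eventually_ball_finite_distrib, simp, rule ballI)
    fix p :: "'b \<times> 'b"
    have "(\<lambda>n. \<bar>(\<Sum>\<sigma>\<in>boxes K. real (k (fst p) n \<sigma>) / real n * real (\<sigma> (snd p))) - \<omega> (fst p) (snd p)\<bar>) \<longlonglongrightarrow>
        \<bar>(\<Sum>\<sigma>\<in>boxes K. \<kappa> (fst p) \<sigma> * real (\<sigma> (snd p))) - \<omega> (fst p) (snd p)\<bar>"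
      by (intro tendsto_intros klim)
    then show "\<forall>\<^sub>F n in sequentially. \<bar>(\<Sum>\<sigma>\<in>boxes K. real (k (fst p) n \<sigma>) / real n * real (\<sigma> (snd p))) - \<omega> (fst p) (snd p)\<bar> < \<delta>"
      by (rule order_tendstoD(2)) (rule less_trans[OF \<kappa>m \<eta>(4)])
  qed
  have E3: "\<forall>\<^sub>F n in sequentially. \<forall>x\<in>F. \<bar>real (k (fst x) n (snd x)) / real n - pmf l x\<bar> < \<delta>0 / 4"
  proof (subst eventually_ball_finite_distrib, rule F(1), rule ballI)
    fix x assume x: "x \<in> F"
    have xK: "snd x \<in> boxes K" using subsetD[OF FK x] by (simp only: mem_Times_iff)
    have "(\<lambda>n. \<bar>real (k (fst x) n (snd x)) / real n - pmf l x\<bar>) \<longlonglongrightarrow> \<bar>\<kappa> (fst x) (snd x) - pmf l x\<bar>"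
      by (intro tendsto_intros klim xK)
    moreover have "\<bar>\<kappa> (fst x) (snd x) - pmf l x\<bar> < \<delta>0 / 4"
      using \<kappa>l[of "fst x" "snd x"] x \<eta>(3) by simp
    ultimately show "\<forall>\<^sub>F n in sequentially. \<bar>real (k (fst x) n (snd x)) / real n - pmf l x\<bar> < \<delta>0 / 4"
      by (rule order_tendstoD(2))
  qed
  show ?thesis using E1 E2 E3 near[of K] eventually_ge_at_top[of 1]
  proof eventually_elim
    case (elim n)
    have Gs: "G \<in> sets (borel_of_topology weak_topology)"
      using G(1) openin_subset by (auto simp: borel_of_topology_def)
    show ?case
    proof (rule measure_law_bounds(2)[OF elim(5) Gs])
      fix t assume t: "t \<in> arrangements n (\<rho>n n)"
      let ?P = "measure_pmf.prob (edge_law n (\<omega>n n) t)"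
      let ?D = "typed_degrees n t (boxes K) (\<lambda>a. k a n)"
      let ?X = "\<lambda>d. {E. (\<Sum>j<n. \<Sum>b\<in>UNIV. \<bar>real (degree_vector n t E j b) - real (d j b)\<bar>) \<le> \<epsilon>1 * real n}"
      let ?W = "\<Prod>a\<in>UNIV. \<Prod>\<sigma>\<in>boxes K. poisson_profile a \<sigma> ^ k a n \<sigma>"
      have card_nodes: "card (nodes_of n t a) = N a n" for a
      proof -
        have "real (card (nodes_of n t a)) = real (N a n)" using arrangement_card[OF t, of a] N[OF elim(5), of a] by simp
        then show ?thesis by simp
      qed
      have bal: "nearly_balanced \<delta> n t d" and le: "\<forall>j b. d j b \<le> K" if d: "d \<in> ?D" for d
      proof -
        have s: "(\<Sum>j\<in>nodes_of n t a. d j b) = (\<Sum>\<sigma>\<in>boxes K. k a n \<sigma> * \<sigma> b)" for a b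
          using sum_typed_degrees[OF finite_boxes d, of "\<lambda>\<sigma>. \<sigma> b" a] by simp
        have "\<bar>real (\<Sum>j\<in>nodes_of n t a. d j b) - real n * \<omega> a b\<bar> \<le> \<delta> * real n" for a b
        proof -
          have "real (\<Sum>j\<in>nodes_of n t a. d j b) = real n * (\<Sum>\<sigma>\<in>boxes K. real (k a n \<sigma>) / real n * real (\<sigma> b))"
            unfolding s using elim(5) by (simp add: sum_distrib_left)
          then have "\<bar>real (\<Sum>j\<in>nodes_of n t a. d j b) - real n * \<omega> a b\<bar> =
              real n * \<bar>(\<Sum>\<sigma>\<in>boxes K. real (k a n \<sigma>) / real n * real (\<sigma> b)) - \<omega> a b\<bar>"
            by (simp only: right_diff_distrib[symmetric] abs_mult abs_of_nat)
          also have "\<dots> \<le> real n * \<delta>"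
            using bspec[OF elim(2), of "(a, b)"] by (intro mult_left_mono) simp_all
          finally show ?thesis by (simp only: mult.commute)
        qed
        moreover have "(\<Sum>j\<in>nodes_of n t a. d j b) = 0" if "\<omega> a b = 0" for a b
          unfolding s
        proof (rule sum.neutral, rule ballI)
          fix \<sigma> :: "'b \<Rightarrow> nat" assume \<sigma>: "\<sigma> \<in> boxes K"
          show "k a n \<sigma> * \<sigma> b = 0"
          proof (cases "\<sigma> b = 0")
            case False
            then show ?thesis using kac[OF \<sigma> poisson_profile_eq_0[OF \<open>\<omega> a b = 0\<close>]] by simp
          qed simp
        qed
        ultimately show "nearly_balanced \<delta> n t d" unfolding nearly_balanced_def by blast
        show "\<forall>j b. d j b \<le> K"
        proof (intro allI)
          fix j b
          show "d j b \<le> K" using d by (cases "j < n") (simp_all add: typed_degrees_def boxes_iff)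
        qed
      qed
      have "exp (- real n * (\<Sum>a\<in>UNIV. \<Sum>\<sigma>\<in>boxes K. ?R a \<sigma> + \<epsilon> / (8 * M))) \<le> real (card ?D) * ?W"
      proof (rule typed_degrees_weight_ge)
        fix a and \<sigma> :: "'b \<Rightarrow> nat" assume "\<sigma> \<in> boxes K"
        then show "exp (- real n * (?R a \<sigma> + \<epsilon> / (8 * M))) * fact (k a n \<sigma>) \<le>
            (real (card (nodes_of n t a)) / exp 1) ^ k a n \<sigma> * poisson_profile a \<sigma> ^ k a n \<sigma>"
          using bspec[OF elim(1), of "(a, \<sigma>)"] by (simp only: card_nodes fst_conv snd_conv mem_Times_iff UNIV_I simp_thms)
      qed (simp_all only: kS card_nodes poisson_profile_nonneg finite_boxes)
      also have "\<dots> \<le> exp (real n * (\<epsilon>1 + \<theta> * \<epsilon>1 + real CARD('b) * ln ((1 + exp (- \<theta>)) / (1 - exp (- \<theta>))))) * ?P (\<Union>d\<in>?D. ?X d)"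
      proof (rule near_union_probability[OF _ \<theta>(1)])
        fix d assume d: "d \<in> ?D"
        show "exp (- \<epsilon>1 * real n) * (\<Prod>j<n. \<Prod>b\<in>UNIV. limit_weight t d (j, b)) \<le> ?P (?X d)"
          by (rule elim(4)[rule_format, OF t bal[OF d] le[OF d, rule_format]])
      qed
      \<comment> \<open>An eighth of \<open>\<epsilon>\<close> each for the radius, for its product
        with \<open>\<theta>\<close>, and for the base of the overlap bound.\<close>
      also have "\<dots> \<le> exp (real n * (3 * \<epsilon> / 8)) * ?P (\<Union>d\<in>?D. ?X d)"
        using \<epsilon>1 \<theta>(2) by (intro mult_right_mono iffD2[OF exp_le_cancel_iff] mult_left_mono) auto
      finally have A: "exp (- real n * (\<Sum>a\<in>UNIV. \<Sum>\<sigma>\<in>boxes K. ?R a \<sigma> + \<epsilon> / (8 * M))) \<le>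
          exp (real n * (3 * \<epsilon> / 8)) * ?P (\<Union>d\<in>?D. ?X d)" .
      have "(\<Sum>a\<in>(UNIV :: 'b set). \<Sum>\<sigma>\<in>(boxes K :: ('b \<Rightarrow> nat) set). \<epsilon> / (8 * M)) = M * (\<epsilon> / (8 * M))"
        by (simp add: M_def)
      also have "\<dots> = \<epsilon> / 8" using M by simp
      finally have "(\<Sum>a\<in>UNIV. \<Sum>\<sigma>\<in>boxes K. ?R a \<sigma> + \<epsilon> / (8 * M)) = (\<Sum>a\<in>UNIV. \<Sum>\<sigma>\<in>boxes K. ?R a \<sigma>) + \<epsilon> / 8"
        by (simp only: sum.distrib)
      also have "\<dots> \<le> v + \<epsilon> / 4" using \<kappa>R \<eta>(2) by linarith
      finally have R: "(\<Sum>a\<in>UNIV. \<Sum>\<sigma>\<in>boxes K. ?R a \<sigma> + \<epsilon> / (8 * M)) \<le> v + \<epsilon> / 4" .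
      have "exp (- real n * (v + \<epsilon>)) \<le> exp (- (real n * (3 * \<epsilon> / 8)) + - real n * (\<Sum>a\<in>UNIV. \<Sum>\<sigma>\<in>boxes K. ?R a \<sigma> + \<epsilon> / (8 * M)))"
      proof -
        have "real n * (\<Sum>a\<in>UNIV. \<Sum>\<sigma>\<in>boxes K. ?R a \<sigma> + \<epsilon> / (8 * M)) \<le> real n * (v + \<epsilon> / 4)"
          by (intro mult_left_mono R) simp
        moreover have "real n * (v + \<epsilon> / 4) + real n * (3 * \<epsilon> / 8) \<le> real n * (v + \<epsilon>)"
          unfolding distrib_left[symmetric] using \<epsilon> by (intro mult_left_mono) auto
        ultimately show ?thesis by (simp only: exp_le_cancel_iff mult_minus_left)
      qed
      also have "\<dots> = exp (- (real n * (3 * \<epsilon> / 8))) * exp (- real n * (\<Sum>a\<in>UNIV. \<Sum>\<sigma>\<in>boxes K. ?R a \<sigma> + \<epsilon> / (8 * M)))"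
        by (rule exp_add)
      also have "\<dots> \<le> exp (- (real n * (3 * \<epsilon> / 8))) * (exp (real n * (3 * \<epsilon> / 8)) * ?P (\<Union>d\<in>?D. ?X d))"
        by (intro mult_left_mono A) simp
      also have "\<dots> = ?P (\<Union>d\<in>?D. ?X d)"
        by (simp only: mult.assoc[symmetric] exp_add[symmetric]) simp
      also have "\<dots> \<le> ?P {E. empirical_locality n t (degree_vector n t E) \<in> G}"
      proof (rule measure_pmf.finite_measure_mono)
        show "(\<Union>d\<in>?D. ?X d) \<subseteq> {E. empirical_locality n t (degree_vector n t E) \<in> G}"
        proof (rule UN_least, rule subsetI, rule CollectI, rule GF, rule ballI)
          fix d E x assume d: "d \<in> ?D" and E: "E \<in> ?X d" and x: "x \<in> F"
          let ?e = "empirical_locality n t"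
          obtain a \<sigma> where x': "x = (a, \<sigma>)" by (cases x)
          have \<sigma>: "\<sigma> \<in> boxes K" using subsetD[OF FK x] by (simp only: x' mem_Times_iff snd_conv)
          have "{j \<in> {..<n}. (t j, d j) = x} = {j \<in> nodes_of n t a. d j = \<sigma>}" by (auto simp: nodes_of_def x')
          then have "pmf (?e d) x = real (k a n \<sigma>) / real n"
            using d \<sigma> by (simp only: pmf_empirical[OF elim(5)]) (simp add: typed_degrees_def)
          then have "\<bar>pmf (?e d) x - pmf l x\<bar> < \<delta>0 / 4" using bspec[OF elim(3) x] by (simp add: x')
          moreover have "real n * \<bar>pmf (?e (degree_vector n t E)) x - pmf (?e d) x\<bar> \<le> real n * \<epsilon>1"
            using pmf_empirical_diff_le[OF elim(5), of t "degree_vector n t E" x d] E by (simp add: mult.commute)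
          then have "\<bar>pmf (?e (degree_vector n t E)) x - pmf (?e d) x\<bar> \<le> \<epsilon>1" using elim(5) by simp
          \<comment> \<open>At most \<open>\<delta>0 / 4\<close> comes from the counts and
            \<open>\<delta>0 / 4\<close> from moving the degrees.\<close>
          ultimately show "\<bar>pmf (?e (degree_vector n t E)) x - pmf l x\<bar> < \<delta>0" using \<epsilon>1(3) F(2) by linarith
        qed
      qed simp
      finally show "exp (- real n * (v + \<epsilon>)) \<le> ?P {E. empirical_locality n t (degree_vector n t E) \<in> G}" .
    qed
  qed
qed

end

section \<open>The large deviation principle\<close>

theorem theorem2p1:
  fixes \<nu> :: "'b::finite \<Rightarrow> real"
    and r :: "nat \<Rightarrow> 'b \<Rightarrow> 'b \<Rightarrow> real"
    and \<Lambda> :: "'b \<Rightarrow> 'b \<Rightarrow> real"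
    and \<rho> :: "'b pmf" and \<rho>n :: "nat \<Rightarrow> 'b pmf"
    and \<omega> :: "'b \<Rightarrow> 'b \<Rightarrow> real" and \<omega>n :: "nat \<Rightarrow> 'b \<Rightarrow> 'b \<Rightarrow> real"
  assumes "\<And>a. 0 \<le> \<nu> a" and "(\<Sum>a\<in>UNIV. \<nu> a) = 1"
    and "\<And>n a b. 0 < r n a b \<and> r n a b \<le> 1" and "\<And>n a b. r n a b = r n b a"
    and "\<And>a b. (\<lambda>n. real n * r n a b ^ CARD('d::finite)) \<longlonglongrightarrow> \<Lambda> a b"
    and "\<And>a b. 0 \<le> \<Lambda> a b" and "\<And>a b. \<Lambda> a b = \<Lambda> b a" and "\<exists>a b. \<Lambda> a b \<noteq> 0"
    and "\<And>a. 0 < pmf \<rho> a" and "\<omega> \<in> sym_measures"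
    and "\<And>n. 1 \<le> n \<Longrightarrow> \<rho>n n \<in> lattice_types n"
    and "\<And>n. 1 \<le> n \<Longrightarrow> \<omega>n n \<in> lattice_pairs n"
    and "limitin weak_topology \<rho>n \<rho> sequentially"
    and "\<And>a b. (\<lambda>n. \<omega>n n a b) \<longlonglongrightarrow> \<omega> a b"
  shows "satisfies_LDP weak_topology
           (\<lambda>n. conditional_locality_law TYPE('d) n (\<rho>n n) (\<omega>n n)) (\<lambda>n. real n) (rate_J \<rho> \<omega>) \<and>
         good_rate_function weak_topology (rate_J \<rho> \<omega>)"
proof -
  \<comment> \<open>Evaluation at a type is weakly continuous, which yields the pointwise
    convergence that the locale asks for.\<close>
  have "(\<lambda>n. pmf (\<rho>n n) a) \<longlonglongrightarrow> pmf \<rho> a" for a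
    using continuous_map_limit[OF continuous_map_pmf assms(13), of a] by (simp add: o_def)
  then interpret type_sequence \<rho> \<rho>n \<omega> \<omega>n
    by unfold_locales (use assms in auto)
  have good: "good_rate_function weak_topology (rate_J \<rho> \<omega>)"
    by (rule good_rate_function_rate_J[OF \<omega>_nonneg])
  obtain C where C: "\<forall>\<^sub>F n in sequentially. AE l in conditional_locality_law TYPE('d) n (\<rho>n n) (\<omega>n n).
      l \<in> {l. \<forall>a b K. trunc_mean K l a b \<le> C}" using eventually_bounded_mean by blast
  have "satisfies_LDP weak_topology
      (\<lambda>n. conditional_locality_law TYPE('d) n (\<rho>n n) (\<omega>n n)) real (rate_J \<rho> \<omega>)"
  proof (rule satisfies_LDP_compactI)
    show "0 \<le> rate_J \<rho> \<omega> l" if "l \<in> topspace weak_topology" for l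
      using good that by (simp add: good_rate_function_def)
    show "\<exists>U. openin weak_topology U \<and> l \<in> U \<and>
        (\<forall>\<^sub>F n in sequentially. measure (conditional_locality_law TYPE('d) n (\<rho>n n) (\<omega>n n)) U \<le> exp (- real n * c))"
      if "ereal c < rate_J \<rho> \<omega> l" for l c
      using that by (rule upper_local)
    show "\<forall>\<^sub>F n in sequentially. exp (- real n * (v + \<epsilon>)) \<le>
        measure (conditional_locality_law TYPE('d) n (\<rho>n n) (\<omega>n n)) G"
      if "openin weak_topology G" "l \<in> G" "rate_J \<rho> \<omega> l = ereal v" "\<epsilon> > 0" for G l v \<epsilon>
      using that by (rule lower_local)
  qed (rule prob_space_conditional_locality_law sets_space_conditional_locality_law compactin_bounded_mean C)+
  then show ?thesis using good by simp
qed

end
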